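(* Let $T$ be the operator \[ Tu(x)=\int_{\mathbb{R}^n}\int_{\mathbb{R}^n} e^{i(x\cdot\xi+\varphi(y,\xi))}a(x,y,\xi)u(y)\,dy\,d\xi\qquad(x\in\mathbb{R}^n), \] where $\varphi(y,\xi)\in C^\infty(\mathbb{R}^n_y\times\mathbb{R}^n_\xi)$ is a real-valued function and $a(x,y,\xi)\in C^\infty(\mathbb{R}^n_x\times\mathbb{R}^n_y\times\mathbb{R}^n_\xi)$. Assume that there is a constant $C$ such that \[ |\det\partial_y\partial_\xi\varphi(y,\xi)|\geq C>0\quad\text{for all }(y,\xi)\in\mathbb{R}^n\times\mathbb{R}^n, \] and that all the derivatives (of all orders, including order zero) of the entries of the matrix $\partial_y\partial_\xi\varphi$ are bounded on $\mathbb{R}^n\times\mathbb{R}^n$. Also assume that, for constants $C_\alpha$, $C_{\alpha\beta\gamma}$, \[ |\partial_\xi^\alpha\varphi(y,\xi)|\leq C_\alpha\langle y\rangle\quad\text{for all multi-indices }|\alpha|\geq 1, \] \[ |\partial_x^\alpha\partial_y^\beta\partial_\xi^\gamma a(x,y,\xi)|\leq C_{\alpha\beta\gamma}\langle x\rangle^{-|\alpha|}\quad\text{for all multi-indices }\alpha,\beta,\gamma, \] for all $x,y,\xi\in\mathbb{R}^n$. Then $T$ is bounded on $L^2_m(\mathbb{R}^n)$ for any $m\in\mathbb{R}$.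
   Context: Notation: $\langle x\rangle^m=(1+|x|^2)^{m/2}$. For $m\in\mathbb{R}$, $L^2_m(\mathbb{R}^n)$ is the set of functions $f$ for which the norm $\|f\|_{L^2_m(\mathbb{R}^n)}=\left(\int_{\mathbb{R}^n}|\langle x\rangle^m f(x)|^2\,dx\right)^{1/2}$ is finite. $\partial_y\partial_\xi\varphi$ is the $n\times n$ matrix of mixed second derivatives $\partial_{y_i}\partial_{\xi_j}\varphi$. As usual, the integral defining $T$ is understood as an oscillatory integral, first for $u$ in a dense class of test functions; boundedness means that $T$ extends to a bounded operator. *)

theory Defs
  imports "HOL-Analysis.Analysis"
begin

primrec C_order :: "nat \<Rightarrow> ('a::euclidean_space \<Rightarrow> 'b::real_normed_vector) \<Rightarrow> bool" where
  "C_order 0 f \<longleftrightarrow> continuous_on UNIV f"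
| "C_order (Suc k) f \<longleftrightarrow> (\<forall>x. f differentiable (at x)) \<and>
     (\<forall>b\<in>Basis. C_order k (\<lambda>x. frechet_derivative f (at x) b))"

definition smooth :: "('a::euclidean_space \<Rightarrow> 'b::real_normed_vector) \<Rightarrow> bool" where
  "smooth f \<longleftrightarrow> (\<forall>k. C_order k f)"

definition test_function :: "('a::euclidean_space \<Rightarrow> complex) \<Rightarrow> bool" where
  "test_function u \<longleftrightarrow> smooth u \<and> compact (closure {x. u x \<noteq> 0})"

definition partial :: "'n::finite \<Rightarrow> (real^'n \<Rightarrow> 'b::real_normed_vector) \<Rightarrow> real^'n \<Rightarrow> 'b" where
  "partial i f x = frechet_derivative f (at x) (axis i 1)"

definition index_list :: "'n::finite list" where
  "index_list = (SOME is. distinct is \<and> set is = UNIV)"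

text \<open>Multi-indices are functions \<open>\<alpha> :: 'n \<Rightarrow> nat\<close>. The partial derivatives are applied in the
  arbitrary but fixed order given by \<open>index_list\<close>; for smooth functions the order is irrelevant.\<close>

definition mderiv :: "('n::finite \<Rightarrow> nat) \<Rightarrow> (real^'n \<Rightarrow> 'b::real_normed_vector) \<Rightarrow> real^'n \<Rightarrow> 'b" where
  "mderiv \<alpha> f = foldr (\<lambda>i. partial i ^^ \<alpha> i) index_list f"

definition mi_order :: "('n::finite \<Rightarrow> nat) \<Rightarrow> nat" where
  "mi_order \<alpha> = (\<Sum>i\<in>UNIV. \<alpha> i)"

definition mixed_hessian :: "(real^'n \<Rightarrow> real^'n \<Rightarrow> real) \<Rightarrow> real^'n \<Rightarrow> real^'n \<Rightarrow> real^'n^'n" where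
  "mixed_hessian \<phi> y \<xi> = (\<chi> i j. partial i (\<lambda>y'. partial j (\<lambda>\<xi>'. \<phi> y' \<xi>') \<xi>) y)"

definition bracket :: "real \<Rightarrow> 'a::real_normed_vector \<Rightarrow> real" where
  "bracket m x = (1 + (norm x)\<^sup>2) powr (m / 2)"

definition L2w :: "real \<Rightarrow> ('a::euclidean_space \<Rightarrow> complex) set" where
  "L2w m = {f. f \<in> borel_measurable lebesgue \<and>
     integrable lebesgue (\<lambda>x. (cmod (of_real (bracket m x) * f x))\<^sup>2)}"

definition L2w_norm :: "real \<Rightarrow> ('a::euclidean_space \<Rightarrow> complex) \<Rightarrow> real" where
  "L2w_norm m f = sqrt (LINT x|lebesgue. (cmod (of_real (bracket m x) * f x))\<^sup>2)"

text \<open>Elements of \<open>L2w m\<close> are functions rather than classes modulo null sets, so linearity of the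
  extension \<open>S\<close> and its agreement with \<open>T\<close> on test functions are almost-everywhere statements. Linearity and
  the norm bound together imply that \<open>S\<close> respects almost-everywhere equality.\<close>

definition extends_to_bounded_operator_on_L2w ::
    "real \<Rightarrow> (('a::euclidean_space \<Rightarrow> complex) \<Rightarrow> 'a \<Rightarrow> complex) \<Rightarrow> bool" where
  "extends_to_bounded_operator_on_L2w m T \<longleftrightarrow>
     (\<exists>S. (\<forall>u\<in>L2w m. S u \<in> L2w m) \<and>
          (\<forall>u\<in>L2w m. \<forall>v\<in>L2w m. \<forall>c d. AE x in lebesgue.
             S (\<lambda>z. c * u z + d * v z) x = c * S u x + d * S v x) \<and>
          (\<exists>K. \<forall>u\<in>L2w m. L2w_norm m (S u) \<le> K * L2w_norm m u) \<and>
          (\<forall>u. test_function u \<longrightarrow> (AE x in lebesgue. S u x = T u x)))"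

text \<open>Oscillatory integral over \<open>(y, \<xi>)\<close> of an integrand \<open>F\<close> that is compactly supported in \<open>y\<close>:
  regularise by a cutoff \<open>\<rho> (\<epsilon> \<xi>)\<close> with \<open>\<rho> 0 = 1\<close> and let \<open>\<epsilon>\<close> tend to \<open>0\<close>; the limit must
  exist and be the same for every cutoff.\<close>

definition has_osc_integral ::
    "('a::euclidean_space \<Rightarrow> 'b::euclidean_space \<Rightarrow> complex) \<Rightarrow> complex \<Rightarrow> bool" where
  "has_osc_integral F L \<longleftrightarrow>
     (\<forall>\<rho>. test_function \<rho> \<and> \<rho> 0 = 1 \<longrightarrow>
        (\<forall>\<epsilon>>0. integrable lborel (\<lambda>(y, \<xi>). \<rho> (\<epsilon> *\<^sub>R \<xi>) * F y \<xi>)) \<and>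
        ((\<lambda>\<epsilon>. LINT (y, \<xi>)|lborel. \<rho> (\<epsilon> *\<^sub>R \<xi>) * F y \<xi>) \<longlongrightarrow> L) (at_right 0))"

definition fio_integrand ::
    "(real^'n \<Rightarrow> real^'n \<Rightarrow> real) \<Rightarrow> (real^'n \<Rightarrow> real^'n \<Rightarrow> real^'n \<Rightarrow> complex) \<Rightarrow>
     (real^'n \<Rightarrow> complex) \<Rightarrow> real^'n \<Rightarrow> real^'n \<Rightarrow> real^'n \<Rightarrow> complex" where
  "fio_integrand \<phi> a u x y \<xi> = exp (\<i> * of_real (x \<bullet> \<xi> + \<phi> y \<xi>)) * a x y \<xi> * u y"

definition fio ::
    "(real^'n \<Rightarrow> real^'n \<Rightarrow> real) \<Rightarrow> (real^'n \<Rightarrow> real^'n \<Rightarrow> real^'n \<Rightarrow> complex) \<Rightarrow>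
     (real^'n \<Rightarrow> complex) \<Rightarrow> real^'n \<Rightarrow> complex" where
  "fio \<phi> a u x = (THE L. has_osc_integral (fio_integrand \<phi> a u x) L)"

end

theory Submission
  imports Defs
begin

text \<open>
The operator is studied through the bilinear form that pairs it with a second function. The frequency
is first cut off smoothly, so that all integrals converge absolutely, and every bound is uniform in
the cutoff.

The phase enters through one consequence of the determinant condition: the gradient in one variable,
as a function of the other, is globally expanding. This is Hadamard's argument, based on
\<open>matrix_lower_bound\<close> and \<open>hadamard_expanding\<close>. Expansion makes oscillating kernels
almost orthogonal, and the Schur test turns this into square-integral bounds on unit windows that are
uniform in the centre of the window (\<open>local_L2_bound\<close>).

An amplitude that is bounded with all derivatives and has bounded support in the rescaled output
variable is treated by windows of unit size in position and frequency. On such a cell the phase is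
a sum of functions of one variable up to a residual with bounded derivatives. The residual is absorbed
into the amplitude, the amplitude is expanded into characters, and the form becomes a superposition of
products of wave packets, which the window bounds control. This is \<open>block_estimate\<close>.

For the weights both variables are decomposed into dyadic shells. The decay of the amplitude
in the output variable keeps the rescaled amplitudes in one bounded family. When the scales of the two
shells are far apart the total phase is nonstationary in frequency: the frequency gradient of the phase
has the size of the input variable, by growth above and expansion below. Repeated integration by parts
then gives any power of the ratio of the scales (\<open>shell_decay\<close>). A power larger than the exponent
of the weight leaves a summable matrix, and all weights are handled at once (\<open>weighted_bound\<close>).

On test functions the oscillatory integral converges because the input integral decays rapidly in
frequency (\<open>osc_integral\<close>), and Fatou's lemma transfers the uniform bound to the limit
(\<open>osc_weighted_bound\<close>). Test functions are dense in the weighted space, and a bounded linear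
operator given on them extends (\<open>bounded_extension\<close>).
\<close>

abbreviation nn_sq :: "('a::euclidean_space => complex) => ennreal" where
 "nn_sq f \<equiv> (\<integral>\<^sup>+x. ennreal ((cmod (f x))\<^sup>2) \<partial>lborel)"

section \<open>Directional derivatives and uniformly bounded families\<close>

definition dd :: "'a::real_normed_vector => ('a => 'b::real_normed_vector) => 'a => 'b" where
 "dd b f x = frechet_derivative f (at x) b"

lemma dd_eq: "(f has_derivative f') (at x) ==> dd b f x = f' b"
 unfolding dd_def by (metis frechet_derivative_at)

lemma dd_has_derivative: "f differentiable (at x) ==> (f has_derivative (%b. dd b f x)) (at x)"
 unfolding dd_def using frechet_derivative_works by (metis (no_types, lifting) eta_contract_eq)

lemma dd_expand:
 fixes f :: "'a::euclidean_space => 'b::real_normed_vector"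
 assumes "f differentiable (at x)"
 shows "dd v f x = (\<Sum>c\<in>Basis. (v \<bullet> c) *\<^sub>R dd c f x)"
proof -
 interpret bounded_linear "%b. dd b f x"
  using dd_has_derivative[OF assms] has_derivative_bounded_linear by blast
 show ?thesis
  by (subst euclidean_representation[of v, symmetric]) (simp add: sum scaleR)
qed

lemma dd_add:
 "f differentiable (at x) ==> g differentiable (at x) ==> dd b (%x. f x + g x) x = dd b f x + dd b g x"
 by (rule dd_eq) (auto intro!: derivative_eq_intros dd_has_derivative)

lemma (in bounded_bilinear) dd_prod:
 assumes "f differentiable (at x)" "g differentiable (at x)"
 shows "dd b (%x. prod (f x) (g x)) x = prod (dd b f x) (g x) + prod (f x) (dd b g x)"
proof -
 have "((%x. prod (f x) (g x)) has_derivative (%h. prod (f x) (dd h g x) + prod (dd h f x) (g x))) (at x)"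
  by (rule FDERIV[OF dd_has_derivative dd_has_derivative, OF assms])
 from dd_eq[OF this] show ?thesis by simp
qed

lemma (in bounded_bilinear) differentiable_prod:
 assumes "f differentiable (at x)" "g differentiable (at x)"
 shows "(%x. prod (f x) (g x)) differentiable (at x)"
 using FDERIV[OF dd_has_derivative dd_has_derivative, OF assms] differentiable_def by blast


lemma dd_linear:
 assumes "bounded_linear T" "f differentiable (at x)"
 shows "dd b (%x. T (f x)) x = T (dd b f x)"
 by (rule dd_eq[where f'="%h. T (dd h f x)"]) (rule bounded_linear.has_derivative[OF assms(1) dd_has_derivative[OF assms(2)]])

lemma differentiable_linear:
 assumes "bounded_linear T" "f differentiable (at x)"
 shows "(%x. T (f x)) differentiable (at x)"
 using bounded_linear.has_derivative[OF assms(1) dd_has_derivative[OF assms(2)]] differentiable_def by blast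

lemma dd_chain:
 fixes g :: "'c::real_normed_vector => 'a::euclidean_space"
 assumes "g differentiable (at x)" "f differentiable (at (g x))"
 shows "dd b (%x. f (g x)) x = (\<Sum>c\<in>Basis. (dd b g x \<bullet> c) *\<^sub>R dd c f (g x))"
proof -
 have "((%x. f (g x)) has_derivative (%h. dd (dd h g x) f (g x))) (at x)"
  using has_derivative_compose[OF dd_has_derivative[OF assms(1)] dd_has_derivative[OF assms(2)]] .
 from dd_eq[OF this, of b] show ?thesis using dd_expand[OF assms(2), of "dd b g x"] by (rule trans)
qed

lemma differentiable_chain:
 assumes "g differentiable (at x)" "f differentiable (at (g x))"
 shows "(%x. f (g x)) differentiable (at x)"
 using has_derivative_compose[OF dd_has_derivative[OF assms(1)] dd_has_derivative[OF assms(2)]]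
  differentiable_def by blast

lemma dd_const [simp]: "dd b (%x. c) = (%x. 0)"
 by (rule ext, rule dd_eq) auto

primrec symb_k :: "nat => ('p \<times> 'a::euclidean_space) set => ('p => 'a => 'b::real_normed_vector) => bool" where
 "symb_k 0 \<Omega> F \<longleftrightarrow> (\<exists>C. \<forall>p x. (p, x) \<in> \<Omega> --> norm (F p x) <= C)"
| "symb_k (Suc k) \<Omega> F \<longleftrightarrow> (\<exists>C. \<forall>p x. (p, x) \<in> \<Omega> --> norm (F p x) <= C) \<and>
   (\<forall>p x. F p differentiable (at x)) \<and> (\<forall>b\<in>Basis. symb_k k \<Omega> (%p. dd b (F p)))"

definition symb :: "('p \<times> 'a::euclidean_space) set => ('p => 'a => 'b::real_normed_vector) => bool" where
 "symb \<Omega> F \<longleftrightarrow> (\<forall>k. symb_k k \<Omega> F)"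

lemma symb_k_bound: "symb_k k \<Omega> F ==> \<exists>C. \<forall>p x. (p, x) \<in> \<Omega> --> norm (F p x) <= C"
 by (cases k) auto

lemma symb_k_down: "symb_k (Suc k) \<Omega> F ==> symb_k k \<Omega> F"
 by (induction k arbitrary: F) auto

text \<open>Families are controlled by all derivatives at once, so every closure property of bounded families
is proved for finitely many derivatives by induction and then read off from this recursive
description.\<close>

lemma symb_iff:
 "symb \<Omega> F \<longleftrightarrow> (\<exists>C. \<forall>p x. (p, x) \<in> \<Omega> --> norm (F p x) <= C) \<and>
   (\<forall>p x. F p differentiable (at x)) \<and> (\<forall>b\<in>Basis. symb \<Omega> (%p. dd b (F p)))" (is "_ \<longleftrightarrow> ?R")
proof
 assume "symb \<Omega> F"
 then have "\<And>k. symb_k (Suc k) \<Omega> F" unfolding symb_def by blast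
 then show ?R unfolding symb_def by (metis symb_k.simps(2))
next
 assume R: ?R
 have "symb_k k \<Omega> F" for k using R by (cases k) (auto simp: symb_def)
 then show "symb \<Omega> F" unfolding symb_def by blast
qed

lemma symb_bound:
 assumes "symb \<Omega> F" obtains C where "C > 0" "\<And>p x. (p, x) \<in> \<Omega> ==> norm (F p x) <= C"
proof -
 obtain C where C: "\<forall>p x. (p, x) \<in> \<Omega> --> norm (F p x) <= C" using assms symb_iff[of \<Omega> F] by blast
 have "norm (F p x) <= \<bar>C\<bar> + 1" if "(p, x) \<in> \<Omega>" for p x
  using C that by (smt (verit))
 then show thesis by (rule that[of "\<bar>C\<bar> + 1", rotated]) (assumption, simp)
qed

lemma symb_differentiable: "symb \<Omega> F ==> F p differentiable (at x)"
 using symb_iff[of \<Omega> F] by blast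

lemma symb_continuous: "symb \<Omega> F ==> continuous_on A (F p)"
 by (meson continuous_at_imp_continuous_on differentiable_imp_continuous_within symb_differentiable)

lemma symb_dd: "symb \<Omega> F ==> b \<in> Basis ==> symb \<Omega> (%p. dd b (F p))"
 using symb_iff[of \<Omega> F] by blast

lemma symb_k_add:
 assumes "symb_k k \<Omega> F" "symb_k k \<Omega> G" shows "symb_k k \<Omega> (%p x. F p x + G p x)"
 using assms
proof (induction k arbitrary: F G)
 case 0
 then obtain C D where "\<forall>p x. (p, x) \<in> \<Omega> --> norm (F p x) <= C" "\<forall>p x. (p, x) \<in> \<Omega> --> norm (G p x) <= D" by auto
 then show ?case by (auto intro!: exI[of _ "C + D"] norm_triangle_mono)
next
 case (Suc k)
 from symb_k_bound[OF Suc.prems(1)] symb_k_bound[OF Suc.prems(2)]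
 obtain C D where "\<forall>p x. (p, x) \<in> \<Omega> --> norm (F p x) <= C" "\<forall>p x. (p, x) \<in> \<Omega> --> norm (G p x) <= D" by auto
 then have B: "\<exists>C. \<forall>p x. (p, x) \<in> \<Omega> --> norm (F p x + G p x) <= C"
  by (auto intro!: exI[of _ "C + D"] norm_triangle_mono)
 have "dd b (%x. F p x + G p x) = (%x. dd b (F p) x + dd b (G p) x)" for b p
  using Suc.prems by (auto intro!: ext dd_add)
 then show ?case using Suc B by (auto intro!: differentiable_add)
qed

lemma symb_add: "symb \<Omega> F ==> symb \<Omega> G ==> symb \<Omega> (%p x. F p x + G p x)"
 unfolding symb_def using symb_k_add by blast

lemma symb_k_const:
 assumes "\<And>p x. (p, x) \<in> \<Omega> ==> norm (c p) <= C"
 shows "symb_k k \<Omega> (%p x. c p)"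
proof -
 have 0: "symb_k k \<Omega> (%p x. 0)" for k :: nat
  by (induction k) auto
 show ?thesis by (cases k) (use assms 0 in auto)
qed

lemma symb_const: "(\<And>p x. (p, x) \<in> \<Omega> ==> norm (c p) <= C) ==> symb \<Omega> (%p x. c p)"
 unfolding symb_def using symb_k_const by blast

lemma symb_const0: "symb \<Omega> (%p x. c)"
 by (rule symb_const[of _ _ "norm c"]) simp

lemma symb_sum:
 assumes "finite I" "\<And>i. i \<in> I ==> symb \<Omega> (F i)"
 shows "symb \<Omega> (%p x. \<Sum>i\<in>I. F i p x)"
 using assms by (induction I rule: finite_induct) (auto intro: symb_add symb_const0)

lemma symb_k_sum:
 assumes "finite I" "\<And>i. i \<in> I ==> symb_k k \<Omega> (F i)"
 shows "symb_k k \<Omega> (%p x. \<Sum>i\<in>I. F i p x)"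
 using assms by (induction I rule: finite_induct) (auto intro: symb_k_add symb_k_const[of _ _ 0])

lemma (in bounded_bilinear) symb_k_prod:
 assumes "symb_k k \<Omega> F" "symb_k k \<Omega> G"
 shows "symb_k k \<Omega> (%p x. prod (F p x) (G p x))"
 using assms
proof (induction k arbitrary: F G)
 case 0
 then obtain C D where *: "\<forall>p x. (p, x) \<in> \<Omega> --> norm (F p x) <= C" "\<forall>p x. (p, x) \<in> \<Omega> --> norm (G p x) <= D" by auto
 obtain K where K: "0 < K" "\<forall>a b. norm (prod a b) <= norm a * norm b * K" using pos_bounded by blast
 show ?case
  unfolding symb_k.simps
 proof (intro exI[of _ "\<bar>C\<bar> * \<bar>D\<bar> * K"] allI impI)
  fix p x assume "(p, x) \<in> \<Omega>"
  then have "norm (F p x) * norm (G p x) * K <= \<bar>C\<bar> * \<bar>D\<bar> * K"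
   using * K(1) by (intro mult_mono) (auto intro: order_trans[OF _ abs_ge_self])
  then show "norm (prod (F p x) (G p x)) <= \<bar>C\<bar> * \<bar>D\<bar> * K" using K(2) order_trans by blast
 qed
next
 case (Suc k)
 have d: "\<And>p x. F p differentiable (at x)" "\<And>p x. G p differentiable (at x)" using Suc.prems by auto
 have e: "dd b (%x. prod (F p x) (G p x)) = (%x. prod (dd b (F p) x) (G p x) + prod (F p x) (dd b (G p) x))" for b p
  using d by (auto intro!: ext dd_prod)
 have 1: "symb_k k \<Omega> (%p x. prod (F p x) (G p x))"
  by (rule Suc.IH[OF symb_k_down[OF Suc.prems(1)] symb_k_down[OF Suc.prems(2)]])
 have 2: "symb_k k \<Omega> (%p. dd b (%x. prod (F p x) (G p x)))" if "b \<in> Basis" for b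
  unfolding e using that Suc.prems symb_k_down[OF Suc.prems(1)] symb_k_down[OF Suc.prems(2)]
  by (intro symb_k_add Suc.IH) auto
 show ?case using 2 symb_k_bound[OF 1] differentiable_prod[OF d] by simp
qed

lemma (in bounded_bilinear) symb_prod:
 "symb \<Omega> F ==> symb \<Omega> G ==> symb \<Omega> (%p x. prod (F p x) (G p x))"
 unfolding symb_def using symb_k_prod by blast

lemmas symb_mult = bounded_bilinear.symb_prod[OF bounded_bilinear_mult]
lemmas symb_scaleR = bounded_bilinear.symb_prod[OF bounded_bilinear_scaleR]
lemmas symb_k_mult = bounded_bilinear.symb_k_prod[OF bounded_bilinear_mult]
lemmas symb_k_scaleR = bounded_bilinear.symb_k_prod[OF bounded_bilinear_scaleR]

lemma symb_k_linear:
 assumes "bounded_linear T" "symb_k k \<Omega> F"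
 shows "symb_k k \<Omega> (%p x. T (F p x))"
 using assms(2)
proof (induction k arbitrary: F)
 case 0
 then obtain C where *: "\<forall>p x. (p, x) \<in> \<Omega> --> norm (F p x) <= C" by auto
 obtain K where K: "0 < K" "\<forall>a. norm (T a) <= norm a * K" using bounded_linear.pos_bounded[OF assms(1)] by blast
 then show ?case using * by (auto intro!: exI[of _ "C * K"] intro: order_trans[OF K(2)[rule_format]] mult_right_mono)
next
 case (Suc k)
 have d: "\<And>p x. F p differentiable (at x)" using Suc.prems by auto
 have e: "dd b (%x. T (F p x)) = (%x. T (dd b (F p) x))" for b p
  using d by (auto intro!: ext dd_linear assms)
 have 1: "symb_k k \<Omega> (%p x. T (F p x))"
  by (rule Suc.IH[OF symb_k_down[OF Suc.prems(1)]])
 show ?case using symb_k_bound[OF 1] differentiable_linear[OF assms(1) d] Suc by (simp add: e)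
qed

lemma symb_linear: "bounded_linear T ==> symb \<Omega> F ==> symb \<Omega> (%p x. T (F p x))"
 unfolding symb_def using symb_k_linear by blast

lemmas symb_of_real = symb_linear[OF bounded_linear_of_real]
lemmas symb_cnj = symb_linear[OF bounded_linear_cnj]

lemma symb_uminus:
 assumes "symb \<Omega> F" shows "symb \<Omega> (%p x. - F p x)"
 using symb_linear[OF bounded_linear_minus[OF bounded_linear_ident] assms] .

lemma symb_diff:
 assumes "symb \<Omega> F" "symb \<Omega> G" shows "symb \<Omega> (%p x. F p x - G p x)"
 using symb_add[OF assms(1) symb_uminus[OF assms(2)]] by simp

lemma symb_mono:
 fixes F :: "'p => 'a::euclidean_space => 'b::real_normed_vector"
 assumes "symb \<Omega> F" "\<Omega>' \<subseteq> \<Omega>" shows "symb \<Omega>' F"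
proof -
 have "symb_k k \<Omega> F ==> symb_k k \<Omega>' F" for k and F :: "'p => 'a => 'b"
 proof (induction k arbitrary: F)
  case 0 then show ?case using assms(2) by fastforce
 next
  case (Suc k)
  then obtain C where "\<forall>p x. (p, x) \<in> \<Omega> --> norm (F p x) <= C" using symb_k_bound by blast
  then have "\<forall>p x. (p, x) \<in> \<Omega>' --> norm (F p x) <= C" using assms(2) by blast
  then show ?case using Suc by auto
 qed
 then show ?thesis using assms by (simp add: symb_def)
qed

lemma symb_reparam:
 fixes F :: "'p => 'a::euclidean_space => 'b::real_normed_vector"
 assumes "symb \<Omega> F" shows "symb {(q, x). (f q, x) \<in> \<Omega>} (%q. F (f q))"
proof -
 have "symb_k k \<Omega> F ==> symb_k k {(q, x). (f q, x) \<in> \<Omega>} (%q. F (f q))" for k and F :: "'p => 'a => 'b"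
 proof (induction k arbitrary: F)
  case 0 then show ?case by auto
 next
  case (Suc k)
  then obtain C where "\<forall>p x. (p, x) \<in> \<Omega> --> norm (F p x) <= C" using symb_k_bound by blast
  moreover have "symb_k k {(q, x). (f q, x) \<in> \<Omega>} (%q. dd b (F (f q)))" if "b \<in> Basis" for b
   using Suc.IH[of "%p. dd b (F p)"] Suc.prems that by simp
  ultimately show ?case using Suc.prems by auto
 qed
 then show ?thesis using assms by (simp add: symb_def)
qed

lemma symb_k_compose:
 fixes h :: "'p => 'c::euclidean_space => 'a::euclidean_space"
 assumes "symb_k k \<Omega>' F"
  and "\<And>p x. (p, x) \<in> \<Omega> ==> (p, h p x) \<in> \<Omega>'"
  and "\<And>p x. h p differentiable (at x)"
  and "\<And>b. b \<in> Basis ==> symb_k k \<Omega> (%p. dd b (h p))"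
 shows "symb_k k \<Omega> (%p x. F p (h p x))"
 using assms(1,4)
proof (induction k arbitrary: F)
 case 0
 then show ?case using assms(2) by auto blast
next
 case (Suc k)
 have d: "\<And>p x. F p differentiable (at x)" using Suc.prems by auto
 have e: "dd b (%x. F p (h p x)) = (%x. \<Sum>c\<in>Basis. (dd b (h p) x \<bullet> c) *\<^sub>R dd c (F p) (h p x))" for b p
  using d by (auto intro!: ext dd_chain assms)
 from symb_k_bound[OF Suc.prems(1)] have 1: "\<exists>C. \<forall>p x. (p, x) \<in> \<Omega> --> norm (F p (h p x)) <= C"
  using assms(2) by blast
 have h: "symb_k k \<Omega> (%p. dd b (h p))" if "b \<in> Basis" for b by (rule symb_k_down[OF Suc.prems(2)[OF that]])
 have "symb_k k \<Omega> (%p. dd b (%x. F p (h p x)))" if b: "b \<in> Basis" for b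
  unfolding e
 proof (intro symb_k_sum finite_Basis symb_k_scaleR)
  fix c :: 'a assume c: "c \<in> Basis"
  show "symb_k k \<Omega> (%p x. dd b (h p) x \<bullet> c)"
   by (rule symb_k_linear[OF bounded_linear_inner_left h[OF b]])
  show "symb_k k \<Omega> (%p x. dd c (F p) (h p x))"
   by (rule Suc.IH) (use Suc.prems c h in auto)
 qed
 moreover have "(%x. F p (h p x)) differentiable (at x)" for p x by (rule differentiable_chain[OF assms(3) d])
 ultimately show ?case using 1 by simp
qed

lemma symb_compose:
 fixes h :: "'p => 'c::euclidean_space => 'a::euclidean_space"
 assumes "symb \<Omega>' F"
  and "\<And>p x. (p, x) \<in> \<Omega> ==> (p, h p x) \<in> \<Omega>'"
  and "\<And>p x. h p differentiable (at x)"
  and "\<And>b. b \<in> Basis ==> symb \<Omega> (%p. dd b (h p))"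
 shows "symb \<Omega> (%p x. F p (h p x))"
 unfolding symb_def
proof
 fix k
 show "symb_k k \<Omega> (%p x. F p (h p x))"
  by (rule symb_k_compose[OF _ assms(2,3)]) (use assms(1,4) in \<open>simp_all add: symb_def\<close>)
qed

lemma symb_inverse:
 fixes q :: "'p => 'a::euclidean_space => real"
 assumes "symb \<Omega> q" "\<And>p x. q p x \<noteq> 0" "c > 0" "\<And>p x. (p, x) \<in> \<Omega> ==> \<bar>q p x\<bar> >= c"
 shows "symb \<Omega> (%p x. 1 / q p x)"
proof -
 have B: "\<exists>C. \<forall>p x. (p, x) \<in> \<Omega> --> norm (1 / q p x) <= C"
  using assms(3,4) by (intro exI[of _ "1/c"]) (auto simp: divide_simps)
 have D: "((%x. 1 / q p x) has_derivative (%h. - (1 / q p x) * (1 / q p x) * dd h (q p) x)) (at x)" for p x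
  using assms(2) by (auto intro!: derivative_eq_intros dd_has_derivative symb_differentiable[OF assms(1)] simp: divide_simps)
 have e: "dd b (%x. 1 / q p x) = (%x. - ((1 / q p x) * (1 / q p x) * dd b (q p) x))" for p b
  by (rule ext, rule dd_eq[THEN trans, OF D]) simp
 have "symb_k k \<Omega> (%p x. 1 / q p x)" for k
 proof (induction k)
  case 0 then show ?case using B by simp
 next
  case (Suc k)
  have "symb_k k \<Omega> (%p. dd b (%x. 1 / q p x))" if "b \<in> Basis" for b
   unfolding e using symb_dd[OF assms(1) that]
   by (intro symb_k_linear[OF bounded_linear_minus[OF bounded_linear_ident]] symb_k_mult Suc) (auto simp: symb_def)
  then show ?case using B D by (auto simp: differentiable_def)
 qed
 then show ?thesis unfolding symb_def by blast
qed

text \<open>A family that vanishes off a closed set has vanishing derivatives on the open complement, so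
bounds on the closed set are bounds everywhere.\<close>

lemma symb_extend:
 fixes F :: "'p => 'a::euclidean_space => 'b::real_normed_vector"
 assumes "symb \<Omega> F" "\<And>p. closed {x. (p, x) \<in> \<Omega>}" "\<And>p x. p \<in> P ==> (p, x) \<notin> \<Omega> ==> F p x = 0"
 shows "symb (P \<times> UNIV) F"
proof -
 have "symb_k k (P \<times> UNIV) F" if "symb_k k \<Omega> F" "\<And>p x. p \<in> P ==> (p, x) \<notin> \<Omega> ==> F p x = 0" for k and F :: "'p => 'a => 'b"
  using that
 proof (induction k arbitrary: F)
  case 0
  then obtain C where C: "\<forall>p x. (p, x) \<in> \<Omega> --> norm (F p x) <= C" by auto
  have "norm (F p x) <= max C 0" if "p \<in> P" for p x using C 0(2)[OF that] by (cases "(p,x) \<in> \<Omega>") (auto simp: le_max_iff_disj)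
  then show ?case by auto
 next
  case (Suc k)
  obtain C where C: "\<forall>p x. (p, x) \<in> \<Omega> --> norm (F p x) <= C" using symb_k_bound[OF Suc.prems(1)] by blast
  have 1: "norm (F p x) <= max C 0" if "p \<in> P" for p x using C Suc.prems(2)[OF that] by (cases "(p,x) \<in> \<Omega>") (auto simp: le_max_iff_disj)
  have 2: "dd b (F p) x = 0" if "p \<in> P" "(p, x) \<notin> \<Omega>" for b p x
  proof -
   have "open (- {x. (p, x) \<in> \<Omega>})" using assms(2) by auto
   then have "((F p) has_derivative (%_. 0)) (at x)"
    by (rule has_derivative_transform_within_open[of "%_. 0", OF _ , rotated]) (use that Suc.prems(2) in auto)
   then show ?thesis by (rule dd_eq)
  qed
  have "symb_k k (P \<times> UNIV) (%p. dd b (F p))" if "b \<in> Basis" for b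
   by (rule Suc.IH) (use Suc.prems that 2 in auto)
  moreover have "\<exists>C. \<forall>p x. (p, x) \<in> P \<times> UNIV --> norm (F p x) <= C" using 1 by (intro exI[of _ "max C 0"]) auto
  ultimately show ?case using Suc.prems by auto
 qed
 then show ?thesis using assms by (simp add: symb_def)
qed

lemma symb_smooth:
 fixes F :: "'p => 'a::euclidean_space => 'b::real_normed_vector"
 assumes "symb \<Omega> F" shows "smooth (F p)"
proof -
 have "C_order k (F p)" if "symb \<Omega> F" for k and F :: "'p => 'a => 'b"
  using that
 proof (induction k arbitrary: F)
  case 0 then show ?case by (simp add: symb_continuous)
 next
  case (Suc k)
  then show ?case using symb_dd[OF Suc.prems] symb_differentiable[OF Suc.prems]
   by (auto simp: dd_def[symmetric])
 qed
 then show ?thesis using assms by (simp add: smooth_def)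
qed

lemma smooth_differentiable: "smooth f ==> f differentiable (at x)"
 unfolding smooth_def by (metis C_order.simps(2))

lemma smooth_dd: "smooth f ==> b \<in> Basis ==> smooth (dd b f)"
proof -
 assume *: "smooth f" "b \<in> Basis"
 have "C_order (Suc k) f" for k using * smooth_def by blast
 then show ?thesis unfolding smooth_def using * by (auto simp: dd_def[abs_def] fun_eq_iff)
qed

lemma smooth_symb:
 fixes F :: "'p => 'a::euclidean_space => 'b::real_normed_vector"
 assumes "\<And>p. smooth (F p)" shows "symb {} F"
proof -
 have "symb_k k {} F" if "\<And>p. smooth (F p)" for k and F :: "'p => 'a => 'b"
  using that by (induction k arbitrary: F) (auto simp: smooth_differentiable smooth_dd)
 then show ?thesis using assms by (simp add: symb_def)
qed

lemma smooth_iff_symb: "smooth f \<longleftrightarrow> symb {} (%_::unit. f)"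
 using symb_smooth[of "{}" "%_::unit. f"] smooth_symb[of "%_::unit. f"] by auto

lemma smooth_continuous: "smooth f ==> continuous_on A f"
 by (meson continuous_at_imp_continuous_on differentiable_imp_continuous_within smooth_differentiable)

lemma symb_smooth_compact:
 fixes f :: "'a::euclidean_space => 'b::real_normed_vector" and s :: "'p => real"
 assumes "smooth f" "compact K" "\<And>p. p \<in> P ==> \<bar>s p\<bar> <= 1"
 shows "symb (P \<times> K) (%p x. s p *\<^sub>R f x)"
proof -
 have "symb_k k (P \<times> K) (%p x. s p *\<^sub>R f x)" if "smooth f" for k and f :: "'a => 'b"
  using that
 proof (induction k arbitrary: f)
  case 0
  then obtain C where C: "\<forall>x\<in>K. norm (f x) <= C"
   using compact_imp_bounded[OF compact_continuous_image[OF smooth_continuous[OF 0] assms(2)]] unfolding bounded_iff by auto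
  have "norm (s p *\<^sub>R f x) <= C" if "p \<in> P" "x \<in> K" for p x
  proof -
   have "\<bar>s p\<bar> * norm (f x) <= 1 * norm (f x)" by (intro mult_right_mono assms(3) that) auto
   then show ?thesis using C that by force
  qed
  then show ?case by auto
 next
  case (Suc k)
  obtain C where C: "\<forall>x\<in>K. norm (f x) <= C"
   using compact_imp_bounded[OF compact_continuous_image[OF smooth_continuous[OF Suc.prems] assms(2)]] unfolding bounded_iff by auto
  have 1: "norm (s p *\<^sub>R f x) <= C" if "p \<in> P" "x \<in> K" for p x
  proof -
   have "\<bar>s p\<bar> * norm (f x) <= 1 * norm (f x)" by (intro mult_right_mono assms(3) that) auto
   then show ?thesis using C that by force
  qed
  have e: "dd b (%x. s p *\<^sub>R f x) = (%x. s p *\<^sub>R dd b f x)" for p b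
   by (rule ext, rule dd_linear[OF bounded_linear_scaleR_right smooth_differentiable[OF Suc.prems]])
  have "symb_k k (P \<times> K) (%p. dd b (%x. s p *\<^sub>R f x))" if "b \<in> Basis" for b
   unfolding e using Suc.IH smooth_dd[OF Suc.prems that] by blast
  then show ?case using 1 smooth_differentiable[OF Suc.prems] by (auto intro!: exI[of _ C] differentiable_scaleR)
 qed
 from this[OF assms(1)] show ?thesis by (simp add: symb_def)
qed

section \<open>Iterated derivatives of smooth functions\<close>

lemma clairaut_real:
 fixes f :: "'a::euclidean_space => real"
 assumes f: "smooth f" and bc: "b \<in> Basis" "c \<in> Basis"
 shows "dd b (dd c f) x = dd c (dd b f) x"
proof -
 have line: "((%s. g (z + s *\<^sub>R v)) has_real_derivative dd v g (z + t *\<^sub>R v)) (at t)"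
  if "smooth g" for g :: "'a => real" and z v t
 proof -
  have "((%s. z + s *\<^sub>R v) has_derivative (%s. s *\<^sub>R v)) (at t)" by (auto intro!: derivative_eq_intros)
  from has_derivative_compose[OF this dd_has_derivative[OF smooth_differentiable[OF that]]]
  have "((%s. g (z + s *\<^sub>R v)) has_derivative (%s. dd (s *\<^sub>R v) g (z + t *\<^sub>R v))) (at t)" .
  moreover have "dd (s *\<^sub>R v) g (z + t *\<^sub>R v) = dd v g (z + t *\<^sub>R v) * s" for s
   using linear_cmul[OF bounded_linear.linear[OF has_derivative_bounded_linear[OF dd_has_derivative[OF smooth_differentiable[OF that]]]], of s v "z + t *\<^sub>R v"]
   by (simp add: mult.commute)
  ultimately show ?thesis by (simp add: has_field_derivative_def)
 qed
 \<comment> \<open>the second difference over a small square is a mixed derivative at an intermediate point,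
   with the derivatives taken in either order\<close>
 have key: "\<exists>s t. 0 < s \<and> s < h \<and> 0 < t \<and> t < h \<and>
   f (x + h *\<^sub>R b + h *\<^sub>R c) - f (x + h *\<^sub>R b) - f (x + h *\<^sub>R c) + f x = h * h * dd c (dd b f) (x + s *\<^sub>R b + t *\<^sub>R c)"
  if hb: "h > 0" "b \<in> Basis" "c \<in> Basis" for h b c
 proof -
  let ?g = "%s. f (x + h *\<^sub>R c + s *\<^sub>R b) - f (x + s *\<^sub>R b)"
  obtain s where s: "0 < s" "s < h" "?g h - ?g 0 = (h - 0) * (dd b f (x + h *\<^sub>R c + s *\<^sub>R b) - dd b f (x + s *\<^sub>R b))"
   using MVT2[OF hb(1), of ?g "%s. dd b f (x + h *\<^sub>R c + s *\<^sub>R b) - dd b f (x + s *\<^sub>R b)"]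
    DERIV_diff[OF line[OF f] line[OF f]] by blast
  let ?k = "%t. dd b f ((x + s *\<^sub>R b) + t *\<^sub>R c)"
  obtain t where t: "0 < t" "t < h" "?k h - ?k 0 = (h - 0) * dd c (dd b f) ((x + s *\<^sub>R b) + t *\<^sub>R c)"
   using MVT2[OF hb(1), of ?k "%t. dd c (dd b f) ((x + s *\<^sub>R b) + t *\<^sub>R c)"] line[OF smooth_dd[OF f hb(2)]] by blast
  show ?thesis
   by (rule exI[of _ s], rule exI[of _ t]) (use s t in \<open>simp add: algebra_simps\<close>)
 qed
 have lim: "((%n. dd c (dd b f) (x + s n *\<^sub>R b + t n *\<^sub>R c)) \<longlonglongrightarrow> dd c (dd b f) x)"
  if "b \<in> Basis" "c \<in> Basis" "\<And>n::nat. 0 < s n \<and> s n < 1 / Suc n" "\<And>n. 0 < t n \<and> t n < 1 / Suc n" for b c s t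
 proof -
  have "s \<longlonglongrightarrow> 0" "t \<longlonglongrightarrow> 0"
   by (rule tendsto_sandwich[OF _ _ tendsto_const LIMSEQ_inverse_real_of_nat];
     use that(3,4) in \<open>auto intro!: always_eventually less_imp_le simp: inverse_eq_divide\<close>)+
  then have "(%n. x + s n *\<^sub>R b + t n *\<^sub>R c) \<longlonglongrightarrow> x + 0 *\<^sub>R b + 0 *\<^sub>R c" by (intro tendsto_intros)
  moreover have "isCont (dd c (dd b f)) x"
   by (meson smooth_dd that smooth_differentiable f differentiable_imp_continuous_within)
  ultimately show ?thesis using isCont_tendsto_compose by fastforce
 qed
 obtain s t where st: "\<And>n. 0 < s n \<and> s n < 1 / Suc n \<and> 0 < t n \<and> t n < 1 / Suc n \<and>
   f (x + (1 / Suc n) *\<^sub>R b + (1 / Suc n) *\<^sub>R c) - f (x + (1 / Suc n) *\<^sub>R b) - f (x + (1 / Suc n) *\<^sub>R c) + f x = (1 / Suc n) * (1 / Suc n) * dd c (dd b f) (x + s n *\<^sub>R b + t n *\<^sub>R c)"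
  using key[OF _ bc, of "1 / Suc n" for n] by (simp only: divide_pos_pos zero_less_one of_nat_0_less_iff zero_less_Suc True_implies_equals) metis
 obtain s' t' where st': "\<And>n. 0 < s' n \<and> s' n < 1 / Suc n \<and> 0 < t' n \<and> t' n < 1 / Suc n \<and>
   f (x + (1 / Suc n) *\<^sub>R c + (1 / Suc n) *\<^sub>R b) - f (x + (1 / Suc n) *\<^sub>R c) - f (x + (1 / Suc n) *\<^sub>R b) + f x = (1 / Suc n) * (1 / Suc n) * dd b (dd c f) (x + s' n *\<^sub>R c + t' n *\<^sub>R b)"
  using key[OF _ bc(2,1), of "1 / Suc n" for n] by (simp only: divide_pos_pos zero_less_one of_nat_0_less_iff zero_less_Suc True_implies_equals) metis
 have "dd b (dd c f) (x + s' n *\<^sub>R c + t' n *\<^sub>R b) = dd c (dd b f) (x + s n *\<^sub>R b + t n *\<^sub>R c)" for n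
 proof -
  have "(1 / real (Suc n)) * (1 / real (Suc n)) * dd b (dd c f) (x + s' n *\<^sub>R c + t' n *\<^sub>R b)
    = (1 / real (Suc n)) * (1 / real (Suc n)) * dd c (dd b f) (x + s n *\<^sub>R b + t n *\<^sub>R c)"
   using conjunct2[OF conjunct2[OF conjunct2[OF conjunct2[OF st[of n]]]]]
    conjunct2[OF conjunct2[OF conjunct2[OF conjunct2[OF st'[of n]]]]]
   unfolding add.assoc[of x "_ *\<^sub>R c" "_ *\<^sub>R b"] add.commute[of "(1 / real (Suc n)) *\<^sub>R c" "(1 / real (Suc n)) *\<^sub>R b"]
    add.assoc[of x "_ *\<^sub>R b" "_ *\<^sub>R c"] by linarith
  then show ?thesis by simp
 qed
 then have "(%n. dd b (dd c f) (x + s' n *\<^sub>R c + t' n *\<^sub>R b)) = (%n. dd c (dd b f) (x + s n *\<^sub>R b + t n *\<^sub>R c))" by blast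
 moreover have "(%n. dd c (dd b f) (x + s n *\<^sub>R b + t n *\<^sub>R c)) \<longlonglongrightarrow> dd c (dd b f) x"
  by (rule lim) (use st bc in auto)
 moreover have "(%n. dd b (dd c f) (x + s' n *\<^sub>R c + t' n *\<^sub>R b)) \<longlonglongrightarrow> dd b (dd c f) x"
  by (rule lim) (use st' bc in auto)
 ultimately show ?thesis using LIMSEQ_unique by metis
qed

lemma smooth_linear: "bounded_linear T ==> smooth f ==> smooth (%x. T (f x))"
 using symb_linear[of T "{}" "%_. f"] by (simp add: smooth_iff_symb)

text \<open>Commuting derivatives make the arbitrary order of differentiation in multi-indices harmless.\<close>

lemma clairaut:
 fixes f :: "'a::euclidean_space => 'b::euclidean_space"
 assumes f: "smooth f" and bc: "b \<in> Basis" "c \<in> Basis"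
 shows "dd b (dd c f) = dd c (dd b f)"
proof
 fix x
 have 1: "dd b (dd c (%x. f x \<bullet> e)) x = dd b (dd c f) x \<bullet> e" if "b \<in> Basis" "c \<in> Basis" for b c e
 proof -
  have "dd c (%x. f x \<bullet> e) = (%x. dd c f x \<bullet> e)"
   by (rule ext, rule dd_linear[OF bounded_linear_inner_left smooth_differentiable[OF f]])
  then show ?thesis
   by (simp add: dd_linear[OF bounded_linear_inner_left smooth_differentiable[OF smooth_dd[OF f that(2)]]])
 qed
 show "dd b (dd c f) x = dd c (dd b f) x"
  by (rule euclidean_eqI)
   (use clairaut_real[OF smooth_linear[OF bounded_linear_inner_left f] bc, of _ x] 1[OF bc] 1[OF bc(2,1)] in simp)
qed

definition ddl :: "'a::real_normed_vector list => ('a => 'b::real_normed_vector) => 'a => 'b" where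
 "ddl bs f = foldr dd bs f"

lemma ddl_simps [simp]: "ddl [] f = f" "ddl (b # bs) f = dd b (ddl bs f)" "ddl (bs @ cs) f = ddl bs (ddl cs f)"
 by (auto simp: ddl_def)

lemma smooth_ddl: "smooth f ==> set bs \<subseteq> Basis ==> smooth (ddl bs f)"
 by (induction bs) (auto simp: smooth_dd)

lemma ddl_dd:
 fixes f :: "'a::euclidean_space => 'b::euclidean_space"
 shows "smooth f ==> set bs \<subseteq> Basis ==> b \<in> Basis ==> ddl bs (dd b f) = dd b (ddl bs f)"
 by (induction bs) (auto simp: clairaut smooth_ddl)

lemma ddl_perm:
 fixes f :: "'a::euclidean_space => 'b::euclidean_space"
 assumes "smooth f" "set bs \<subseteq> Basis" "mset bs = mset cs"
 shows "ddl bs f = ddl cs f"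
 using assms(2,3)
proof (induction bs arbitrary: cs)
 case Nil then show ?case by simp
next
 case (Cons b bs)
 then have "b \<in> set cs" by (metis list.set_intros(1) mset_eq_setD)
 then obtain xs ys where cs: "cs = xs @ b # ys" by (meson split_list)
 have B: "set (xs @ ys) \<subseteq> Basis" "b \<in> Basis" using Cons.prems mset_eq_setD[OF Cons.prems(2)] by (auto simp: cs)
 have "ddl bs f = ddl (xs @ ys) f" using Cons by (intro Cons.IH) (auto simp: cs)
 moreover have "ddl cs f = dd b (ddl (xs @ ys) f)"
  using B assms(1) by (auto simp: cs ddl_dd smooth_ddl)
 ultimately show ?case by simp
qed

lemma symb_ddlI:
 assumes "\<And>p. smooth (F p)"
  and "\<And>bs. set bs \<subseteq> Basis ==> \<exists>C. \<forall>p x. (p, x) \<in> \<Omega> --> norm (ddl bs (F p) x) <= C"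
 shows "symb \<Omega> F"
proof -
 have "symb_k k \<Omega> (%p. ddl cs (F p))" if "set cs \<subseteq> Basis" for k cs
  using that
 proof (induction k arbitrary: cs)
  case 0 then show ?case using assms(2) by simp
 next
  case (Suc k)
  have "symb_k k \<Omega> (%p. dd b (ddl cs (F p)))" if "b \<in> Basis" for b
   using Suc.IH[of "b # cs"] Suc.prems that by simp
  then show ?case using assms(2)[OF Suc.prems] smooth_differentiable[OF smooth_ddl[OF assms(1) Suc.prems]] by simp
 qed
 from this[of "[]"] show ?thesis by (simp add: symb_def)
qed

lemma smooth_compose:
 fixes h :: "'c::euclidean_space => 'a::euclidean_space"
 assumes "smooth f" "smooth h" shows "smooth (%x. f (h x))"
proof -
 have h: "symb {} (%_::unit. h)" using assms(2) smooth_iff_symb by blast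
 have "symb {} (%(_::unit) x. f (h x))"
  by (rule symb_compose[where \<Omega>'="{}" and F="%_. f" and h="%_. h"])
   (use assms symb_dd[OF h] in \<open>auto simp: smooth_iff_symb[symmetric] smooth_differentiable\<close>)
 then show ?thesis by (simp add: smooth_iff_symb)
qed

lemma smooth_const [simp]: "smooth (%x. c)"
 using symb_smooth[OF symb_const0[of "{}" c]] .

lemma smooth_bounded_linear: assumes "bounded_linear T" shows "smooth (T :: 'a::euclidean_space => 'b::real_normed_vector)"
proof -
 have d: "(T has_derivative T) (at x)" for x by (rule bounded_linear_imp_has_derivative[OF assms])
 have "dd b T = (%x. T b)" for b by (rule ext, rule dd_eq[OF d])
 then have "symb {} (%_::unit. T)"
  by (subst symb_iff) (use d in \<open>auto simp: differentiable_def symb_const0\<close>)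
 then show ?thesis using smooth_iff_symb by blast
qed

lemma smooth_id [simp]: "smooth (%x. x)"
 by (rule smooth_bounded_linear[OF bounded_linear_ident])

lemma smooth_add: "smooth f ==> smooth g ==> smooth (%x. f x + g x)"
 using symb_add[of "{}" "%_. f" "%_. g"] by (simp add: smooth_iff_symb)
lemma smooth_diff: "smooth f ==> smooth g ==> smooth (%x. f x - g x)"
 using symb_diff[of "{}" "%_. f" "%_. g"] by (simp add: smooth_iff_symb)
lemma smooth_mult: "smooth f ==> smooth g ==> smooth (%x. f x * (g x :: 'b::real_normed_algebra))"
 using symb_mult[of "{}" "%_. f" "%_. g"] by (simp add: smooth_iff_symb)
lemma smooth_scaleR: "smooth f ==> smooth g ==> smooth (%x. f x *\<^sub>R g x)"
 using symb_scaleR[of "{}" "%_. f" "%_. g"] by (simp add: smooth_iff_symb)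
lemma smooth_inner: "smooth f ==> smooth g ==> smooth (%x. f x \<bullet> g x)"
 using bounded_bilinear.symb_prod[OF bounded_bilinear_inner, of "{}" "%_. f" "%_. g"] by (simp add: smooth_iff_symb)
lemma smooth_Pair:
 fixes f :: "'a::euclidean_space => 'b::euclidean_space" and g :: "'a => 'c::euclidean_space"
 assumes "smooth f" "smooth g" shows "smooth (%x. (f x, g x))"
proof -
 have "smooth (%x. (f x, 0) + (0, g x))"
  by (intro smooth_add smooth_linear[of "%x. (x, 0)", OF _ assms(1)] smooth_linear[of "%x. (0, x)", OF _ assms(2)])
   (auto intro!: bounded_linear_Pair bounded_linear_ident bounded_linear_zero)
 then show ?thesis by simp
qed
lemma smooth_fst: "smooth f ==> smooth (%x. fst (f x))" by (rule smooth_linear[OF bounded_linear_fst])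
lemma smooth_snd: "smooth f ==> smooth (%x. snd (f x))" by (rule smooth_linear[OF bounded_linear_snd])

lemmas smooth_intros = smooth_const smooth_id smooth_add smooth_diff smooth_mult smooth_scaleR smooth_inner
 smooth_Pair smooth_fst smooth_snd

section \<open>Multi-indices and slices of product spaces\<close>

definition mlist :: "('n::finite => nat) => (real^'n) list" where
 "mlist \<alpha> = concat (map (%i. replicate (\<alpha> i) (axis i 1)) index_list)"

lemma index_list: "distinct (index_list :: 'n::finite list)" "set (index_list :: 'n list) = UNIV"
proof -
 have "\<exists>is :: 'n list. distinct is \<and> set is = UNIV" using finite_distinct_list[of "UNIV :: 'n set"] by auto
 from someI_ex[OF this] show "distinct (index_list :: 'n::finite list)" "set (index_list :: 'n list) = UNIV"
  unfolding index_list_def by auto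
qed

lemma partial_eq_dd: "partial i = dd (axis i 1)"
 by (intro ext) (simp add: partial_def dd_def)

lemma mderiv_eq_ddl: "mderiv \<alpha> f = ddl (mlist \<alpha>) f"
proof -
 have 1: "(dd b ^^ k) g = ddl (replicate k b) g" for b :: "real^'n" and k and g :: "real^'n => 'b"
  by (induction k) auto
 have "foldr (%i. partial i ^^ \<alpha> i) is f = ddl (concat (map (%i. replicate (\<alpha> i) (axis i 1)) is)) f" for "is"
  by (induction "is") (auto simp: partial_eq_dd 1)
 then show ?thesis by (simp add: mderiv_def mlist_def)
qed

lemma set_mlist: "set (mlist \<alpha>) \<subseteq> Basis"
 by (auto simp: mlist_def set_replicate_conv_if Basis_vec_def)

lemma length_mlist: "length (mlist \<alpha>) = mi_order \<alpha>"
proof -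
 have "length (mlist \<alpha>) = sum_list (map \<alpha> index_list)"
  by (simp add: mlist_def length_concat comp_def)
 also have "\<dots> = mi_order \<alpha>"
  using sum_list_distinct_conv_sum_set[OF index_list(1), of \<alpha>] by (simp add: index_list(2) mi_order_def)
 finally show ?thesis .
qed

lemma mlist_exists:
 assumes "set bs \<subseteq> (Basis :: (real^'n) set)"
 obtains \<alpha> where "mset (mlist \<alpha>) = mset bs"
proof
 let ?\<alpha> = "%i. count (mset bs) (axis i 1)"
 have inj: "axis i (1::real) = axis j 1 \<longleftrightarrow> i = j" for i j :: 'n by (simp add: axis_eq_axis)
 have c: "count (mset (concat (map (%i. replicate (?\<alpha> i) (axis i 1 :: real^'n)) is))) (axis j 1) = (if j \<in> set is then ?\<alpha> j else 0)"
  if "distinct is" for "is" and j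
  using that by (induction "is") (auto simp: inj count_replicate_mset)
 show "mset (mlist ?\<alpha>) = mset bs"
 proof (rule multiset_eqI)
  fix v :: "real^'n"
  show "count (mset (mlist ?\<alpha>)) v = count (mset bs) v"
  proof (cases "v \<in> Basis")
   case True
   then obtain j where "v = axis j 1" by (auto simp: Basis_vec_def)
   then show ?thesis using c[OF index_list(1), of j] by (simp add: mlist_def index_list(2))
  next
   case False
   then have "v \<notin> set bs" "v \<notin> set (mlist ?\<alpha>)" using assms set_mlist by blast+
   then show ?thesis by (metis count_mset_0_iff)
  qed
 qed
qed

lemma ddl_affine:
 fixes T :: "'a::euclidean_space => 'c::euclidean_space"
 assumes "bounded_linear T" "\<And>b. b \<in> Basis ==> T b \<in> Basis" "smooth f" "set bs \<subseteq> Basis"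
 shows "ddl bs (%x. f (z + T x)) = (%x. ddl (map T bs) f (z + T x))"
 using assms(4)
proof (induction bs)
 case Nil then show ?case by simp
next
 case (Cons b bs)
 have s: "smooth (ddl (map T bs) f)" using Cons assms by (intro smooth_ddl) auto
 have "((%x. z + T x) has_derivative T) (at x)" for x
  using bounded_linear_imp_has_derivative[OF assms(1)] by (auto intro!: derivative_eq_intros)
 from has_derivative_compose[OF this dd_has_derivative[OF smooth_differentiable[OF s]]]
 have "dd b (%x. ddl (map T bs) f (z + T x)) x = dd (T b) (ddl (map T bs) f) (z + T x)" for x
  by (rule dd_eq)
 moreover have "ddl bs (%x. f (z + T x)) = (%x. ddl (map T bs) f (z + T x))" using Cons by simp
 ultimately show ?case unfolding list.map ddl_simps by presburger
qed

abbreviation inc1 :: "'a::real_vector => 'a \<times> 'b::real_vector" where "inc1 b \<equiv> (b, 0)"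
abbreviation inc2 :: "'b::real_vector => 'a::real_vector \<times> 'b" where "inc2 b \<equiv> (0, b)"

lemma ddl_slice1:
 fixes f :: "'a::euclidean_space \<times> 'c::euclidean_space => 'b::real_normed_vector"
 assumes "smooth f" "set bs \<subseteq> Basis"
 shows "ddl bs (%x. f (x, y)) x = ddl (map inc1 bs) f (x, y)"
 using ddl_affine[of inc1 f bs "(0, y)", OF bounded_linear_Pair[OF bounded_linear_ident bounded_linear_zero] _ assms]
 by (auto simp: fun_eq_iff Basis_prod_def)

lemma ddl_slice2:
 fixes f :: "'a::euclidean_space \<times> 'c::euclidean_space => 'b::real_normed_vector"
 assumes "smooth f" "set bs \<subseteq> Basis"
 shows "ddl bs (%y. f (x, y)) y = ddl (map inc2 bs) f (x, y)"
 using ddl_affine[of inc2 f bs "(x, 0)", OF bounded_linear_Pair[OF bounded_linear_zero bounded_linear_ident] _ assms]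
 by (auto simp: fun_eq_iff Basis_prod_def)

lemma Basis_list_prod:
 assumes "set bs \<subseteq> (Basis :: ('a::euclidean_space \<times> 'b::euclidean_space) set)"
 obtains xs ys where "set xs \<subseteq> Basis" "set ys \<subseteq> Basis" "mset bs = mset (map inc1 xs @ map inc2 ys)"
 using assms
proof (induction bs arbitrary: thesis)
 case Nil then show ?case by (metis empty_subsetI list.map_disc_iff list.set(1) self_append_conv)
next
 case (Cons b bs)
 obtain xs ys where *: "set xs \<subseteq> Basis" "set ys \<subseteq> Basis" "mset bs = mset (map inc1 xs @ map inc2 ys)"
  using Cons.IH Cons.prems(2) by (metis insert_subset list.simps(15))
 from Cons.prems(2) consider u where "u \<in> Basis" "b = inc1 u" | v where "v \<in> Basis" "b = inc2 v"
  by (auto simp: Basis_prod_def)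
 then show ?case
 proof cases
  case 1 then show ?thesis using Cons.prems(1)[of "u # xs" ys] * by auto
 next
  case 2 then show ?thesis using Cons.prems(1)[of xs "v # ys"] * by auto
 qed
qed

lemma mderiv_perm:
 fixes f :: "real^'n => 'b::euclidean_space"
 assumes "smooth f" "set bs \<subseteq> Basis" "mset (mlist \<alpha>) = mset bs"
 shows "mderiv \<alpha> f = ddl bs f"
 unfolding mderiv_eq_ddl by (rule ddl_perm[OF assms(1) set_mlist assms(3)])

lemma smooth_slice1: "smooth f ==> smooth (%x. f (x, y))" for f :: "'a::euclidean_space \<times> 'c::euclidean_space => 'b::real_normed_vector"
 by (rule smooth_compose[of f "%x. (x, y)"]) (auto intro!: smooth_intros)
lemma smooth_slice2: "smooth f ==> smooth (%y. f (x, y))" for f :: "'a::euclidean_space \<times> 'c::euclidean_space => 'b::real_normed_vector"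
 by (rule smooth_compose[of f "%y. (x, y)"]) (auto intro!: smooth_intros)

lemma Basis_inc: "b \<in> Basis ==> inc1 b \<in> Basis" "b \<in> Basis ==> inc2 b \<in> Basis"
 by (auto simp: Basis_prod_def)

lemma mderiv2_eq_ddl:
 fixes f :: "(real^'n) \<times> (real^'m) => 'b::euclidean_space"
 assumes f: "smooth f" and bs: "set bs \<subseteq> Basis" "mset (mlist \<beta>) = mset bs" and cs: "set cs \<subseteq> Basis" "mset (mlist \<gamma>) = mset cs"
 shows "mderiv \<beta> (%y. mderiv \<gamma> (%\<xi>. f (y, \<xi>)) \<xi>) y = ddl (map inc1 bs @ map inc2 cs) f (y, \<xi>)"
proof -
 have s: "smooth (ddl (map inc2 cs) f)" using cs(1) by (intro smooth_ddl f) (auto intro: Basis_inc)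
 have "(%y. mderiv \<gamma> (%\<xi>. f (y, \<xi>)) \<xi>) = (%y. ddl (map inc2 cs) f (y, \<xi>))"
  by (simp add: mderiv_perm[OF smooth_slice2[OF f] cs] ddl_slice2[OF f cs(1)])
 then show ?thesis
  by (simp add: mderiv_perm[OF smooth_slice1[OF s] bs] ddl_slice1[OF s bs(1)])
qed

lemma mderiv3_eq_ddl:
 fixes f :: "(real^'l) \<times> (real^'n) \<times> (real^'m) => 'b::euclidean_space"
 assumes f: "smooth f" and as: "set as \<subseteq> Basis" "mset (mlist \<alpha>) = mset as"
  and bs: "set bs \<subseteq> Basis" "mset (mlist \<beta>) = mset bs" and cs: "set cs \<subseteq> Basis" "mset (mlist \<gamma>) = mset cs"
 shows "mderiv \<alpha> (%x. mderiv \<beta> (%y. mderiv \<gamma> (%\<xi>. f (x, y, \<xi>)) \<xi>) y) x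
  = ddl (map inc1 as @ map inc2 (map inc1 bs @ map inc2 cs)) f (x, y, \<xi>)"
proof -
 let ?ds = "map inc1 bs @ map inc2 cs :: ((real^'n) \<times> (real^'m)) list"
 have ds: "set ?ds \<subseteq> Basis" using bs cs by (auto intro: Basis_inc)
 have s: "smooth (ddl (map inc2 ?ds) f)" by (intro smooth_ddl f) (use ds in \<open>auto intro: Basis_inc\<close>)
 have "(%x. mderiv \<beta> (%y. mderiv \<gamma> (%\<xi>. f (x, y, \<xi>)) \<xi>) y) = (%x. ddl ?ds (%z. f (x, z)) (y, \<xi>))"
  by (rule ext) (rule mderiv2_eq_ddl[OF smooth_slice2[OF f] bs cs])
 also have "\<dots> = (%x. ddl (map inc2 ?ds) f (x, y, \<xi>))"
  by (simp only: ddl_slice2[OF f ds])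
 finally show ?thesis
  by (simp only: mderiv_perm[OF smooth_slice1[OF s] as] ddl_slice1[OF s as(1)] ddl_simps)
qed

section \<open>Cutoff functions\<close>

definition flat_exp :: "nat => real => real" where
 "flat_exp n t = (if t <= 0 then 0 else inverse t ^ n * exp (- inverse t))"

lemma power_le_fact_exp: "0 <= s ==> s ^ k <= fact k * exp (s::real)"
proof -
 assume s: "0 <= s"
 have "s ^ k / fact k <= exp s"
  using sum_le_suminf[OF summable_exp[of s], of "{k}"] s by (simp add: exp_def divide_inverse mult.commute)
 then show ?thesis by (simp add: field_simps)
qed

lemma flat_exp_le: "\<bar>flat_exp n t\<bar> <= fact (n + 1) * \<bar>t\<bar>"
proof (cases "t <= 0")
 case False
 then have t: "t > 0" by simp
 have "inverse t ^ (n + 1) <= fact (n + 1) * exp (inverse t)" by (rule power_le_fact_exp) (use t in simp)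
 then have "inverse t ^ n * exp (- inverse t) <= fact (n + 1) * t"
  using t by (simp add: exp_minus field_simps)
 then show ?thesis using t by (simp add: flat_exp_def)
next
 case True
 then show ?thesis unfolding flat_exp_def by (simp add: mult_nonneg_nonpos del: fact_Suc)
qed

lemma flat_exp_deriv:
 "(flat_exp n has_real_derivative (- real n * flat_exp (n + 1) t + flat_exp (n + 2) t)) (at t)"
proof -
 consider "t < 0" | "t = 0" | "t > 0" by linarith
 then show ?thesis
 proof cases
  case 1
  have "((%_. 0) has_real_derivative 0) (at t)" by simp
  then have "(flat_exp n has_real_derivative 0) (at t)"
   by (rule has_field_derivative_transform_within_open[of _ _ _ "{..<0}"]) (use 1 in \<open>auto simp: flat_exp_def\<close>)
  then show ?thesis using 1 by (simp add: flat_exp_def)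
 next
  case 2
  have b: "\<bar>flat_exp n h / h\<bar> <= fact (n + 2) * \<bar>h\<bar>" for h
  proof (cases "h <= 0")
   case False
   then have "flat_exp n h / h = flat_exp (n + 1) h" by (simp add: flat_exp_def field_simps)
   then show ?thesis using flat_exp_le[of "n + 1" h] by simp
  next
   case True
   then show ?thesis unfolding flat_exp_def by (simp add: mult_nonneg_nonpos del: fact_Suc)
  qed
  have "(%h. flat_exp n h / h) \<midarrow>0\<rightarrow> 0"
   by (rule Lim_null_comparison[of _ "%h. fact (n + 2) * \<bar>h\<bar>"])
    (use b in \<open>auto intro!: always_eventually tendsto_eq_intros simp del: fact_Suc\<close>)
  then show ?thesis using 2 by (simp add: DERIV_def flat_exp_def)
 next
  case 3
  have i: "(inverse has_real_derivative (- (inverse t * inverse t))) (at t)"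
   using 3 by (auto intro!: derivative_eq_intros)
  have e: "((%t. exp (- inverse t)) has_real_derivative (inverse t * inverse t * exp (- inverse t))) (at t)"
   by (rule DERIV_cong[OF DERIV_fun_exp[OF DERIV_minus[OF i]]]) simp
  have "((%t. inverse t ^ n * exp (- inverse t)) has_real_derivative
    (- real n * (inverse t ^ (n + 1) * exp (- inverse t)) + inverse t ^ (n + 2) * exp (- inverse t))) (at t)"
   by (rule DERIV_cong[OF DERIV_mult[OF DERIV_power[OF i, of n] e]], cases n) (simp_all add: algebra_simps)
  then have "(flat_exp n has_real_derivative
    (- real n * (inverse t ^ (n + 1) * exp (- inverse t)) + inverse t ^ (n + 2) * exp (- inverse t))) (at t)"
   by (rule has_field_derivative_transform_within_open[of _ _ _ "{0<..}"]) (use 3 in \<open>auto simp: flat_exp_def\<close>)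
  then show ?thesis using 3 by (simp add: flat_exp_def)
 qed
qed

lemma smooth_flat_exp: "smooth (flat_exp n)"
proof -
 have d: "dd 1 (flat_exp n) = (%t. - real n * flat_exp (n + 1) t + flat_exp (n + 2) t)" for n
  by (rule ext, rule dd_eq[THEN trans, OF flat_exp_deriv[unfolded has_field_derivative_def]]) simp
 have "symb_k k {} (%p::nat. flat_exp (m p))" for k and m :: "nat => nat"
 proof (induction k arbitrary: m)
  case (Suc k)
  have "symb_k k {} (%p. dd 1 (flat_exp (m p)))"
   unfolding d
  proof (intro symb_k_add)
   show "symb_k k {} (%p t. - real (m p) * flat_exp (m p + 1) t)"
    by (rule symb_k_mult[OF symb_k_const Suc.IH]) auto
  qed (rule Suc.IH)
  moreover have "flat_exp n differentiable (at t)" for n t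
   using flat_exp_deriv[of n t] real_differentiable_def by blast
  ultimately show ?case by simp
 qed simp
 from this[of _ "%p. p"] show ?thesis using symb_smooth[of "{}" flat_exp n] by (simp add: symb_def)
qed

definition bump :: "'a::euclidean_space => real" where
 "bump x = flat_exp 0 (1 - x \<bullet> x)"

lemma smooth_bump: "smooth bump"
 unfolding bump_def[abs_def]
 by (rule smooth_compose[OF smooth_flat_exp, of "%x. 1 - x \<bullet> x"]) (intro smooth_intros)

lemma bump_ge_0: "bump x >= 0" by (simp add: bump_def flat_exp_def)
lemma bump_le_1: "bump x <= 1" by (simp add: bump_def flat_exp_def)
lemma bump_0: "bump x = 0 \<longleftrightarrow> norm x >= 1"
 by (simp add: bump_def flat_exp_def norm_eq_sqrt_inner)
lemma bump_outside: "norm x > 1 ==> bump x = 0" by (simp add: bump_0)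

definition plateau_step :: "real => real" where
 "plateau_step t = flat_exp 0 t * (1 / (flat_exp 0 t + flat_exp 0 (1 - t)))"

lemma plateau_step: "t <= 0 ==> plateau_step t = 0" "t >= 1 ==> plateau_step t = 1"
 by (auto simp: plateau_step_def flat_exp_def)

lemma smooth_plateau_step: "smooth plateau_step"
proof -
 have p: "flat_exp 0 t + flat_exp 0 (1 - t) \<noteq> 0" for t
  using add_pos_pos[OF exp_gt_zero[of "- inverse t"] exp_gt_zero[of "- inverse (1 - t)"]]
  by (auto simp: flat_exp_def)
 have "smooth (%t. flat_exp 0 (1 - t))"
  by (rule smooth_compose[OF smooth_flat_exp, of "%t. 1 - t"]) (intro smooth_intros)
 then have s: "symb {} (%_::unit. %t. flat_exp 0 t + flat_exp 0 (1 - t))"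
  by (intro smooth_iff_symb[THEN iffD1] smooth_add smooth_flat_exp)
 have "smooth (%t. 1 / (flat_exp 0 t + flat_exp 0 (1 - t)))"
  using symb_inverse[OF s p, of 1] by (simp add: smooth_iff_symb)
 then show ?thesis unfolding plateau_step_def[abs_def] by (intro smooth_mult smooth_flat_exp)
qed

definition plateau :: "real => real" where
 "plateau t = plateau_step (2 * t - 1) * plateau_step ((8 - t) * (1 / 4))"

lemma smooth_plateau: "smooth plateau"
 unfolding plateau_def[abs_def]
 by (intro smooth_mult smooth_compose[OF smooth_plateau_step, of "%t. 2 * t - 1"]
   smooth_compose[OF smooth_plateau_step, of "%t. (8 - t) * (1 / 4)"] smooth_diff smooth_const smooth_id)

lemma plateau_eq_1: "1 <= t ==> t <= 4 ==> plateau t = 1" by (simp add: plateau_def plateau_step)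
lemma plateau_eq_0: "t <= 1/2 \<or> t >= 8 ==> plateau t = 0" by (auto simp: plateau_def plateau_step)

lemma symb_compact_support:
 assumes "smooth f" "\<And>x. norm x > R ==> f x = 0"
 shows "symb UNIV (%_::'p. f)"
proof -
 have "symb (UNIV \<times> cball 0 R) (%_::'p. f)" using symb_smooth_compact[OF assms(1) compact_cball, of UNIV "%_. 1" 0 R] by simp
 then have "symb (UNIV \<times> UNIV) (%_::'p. f)"
  by (rule symb_extend) (use assms(2) in \<open>auto simp: not_le closed_Collect_le continuous_on_norm continuous_on_id\<close>)
 then show ?thesis by simp
qed

lemma symb_bump: "symb UNIV (%_. bump)"
 by (rule symb_compact_support[OF smooth_bump, of 1]) (rule bump_outside)

lemma symb_plateau: "symb UNIV (%_. plateau)"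
 by (rule symb_compact_support[OF smooth_plateau, of 8]) (rule plateau_eq_0, auto)

lemma test_function_iff:
 "test_function u \<longleftrightarrow> smooth u \<and> (\<exists>R. \<forall>x. norm x > R --> u x = 0)"
proof -
 have "compact (closure {x. u x \<noteq> 0}) \<longleftrightarrow> (\<exists>R. \<forall>x. norm x > R --> u x = 0)" (is "?L \<longleftrightarrow> ?R")
 proof
  assume ?L
  then have "bounded {x. u x \<noteq> 0}" by (meson bounded_subset closure_subset compact_imp_bounded)
  then show ?R unfolding bounded_iff by (metis mem_Collect_eq not_less)
 next
  assume ?R
  then have "bounded {x. u x \<noteq> 0}" unfolding bounded_iff by (metis mem_Collect_eq not_less)
  then show ?L by (simp add: compact_eq_bounded_closed bounded_closure)
 qed
 then show ?thesis unfolding test_function_def by simp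
qed

lemma test_function_bump: "test_function (%x. of_real (bump (x::'a::euclidean_space) / bump (0::'a)) :: complex)"
 unfolding test_function_iff
proof
 have "smooth (%x. complex_of_real (inverse (bump (0::'a)) * bump (x::'a)))"
  by (intro smooth_linear[OF bounded_linear_of_real] smooth_mult smooth_const smooth_bump)
 then show "smooth (%x. of_real (bump (x::'a) / bump (0::'a)) :: complex)" by (simp add: divide_inverse mult.commute)
qed (auto intro!: exI[of _ 1] simp: bump_outside)

section \<open>Globally expanding maps\<close>

lemma mvt_dd:
 fixes f :: "'a::euclidean_space => 'b::euclidean_space"
 assumes "\<And>z. f differentiable (at z)"
 obtains t where "0 < t" "t < 1" "norm (f (x + v) - f x) <= norm (dd v f (x + t *\<^sub>R v))"
proof -
 have d: "((%s. f (x + s *\<^sub>R v)) has_derivative (%s. dd (s *\<^sub>R v) f (x + t *\<^sub>R v))) (at t)" for t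
  by (rule has_derivative_compose[OF _ dd_has_derivative[OF assms], of "%s. x + s *\<^sub>R v" "%s. s *\<^sub>R v" t UNIV])
   (auto intro!: derivative_eq_intros)
 obtain t where "t \<in> {0<..<1}" "norm (f (x + 1 *\<^sub>R v) - f (x + 0 *\<^sub>R v)) <= norm (dd ((1 - 0) *\<^sub>R v) f (x + t *\<^sub>R v))"
  using mvt_general[of 0 1 "%s. f (x + s *\<^sub>R v)" "%t s. dd (s *\<^sub>R v) f (x + t *\<^sub>R v)"] d
  by (metis (no_types, lifting) continuous_at_imp_continuous_on has_derivative_continuous zero_less_one)
 then show thesis by (intro that[of t]) auto
qed

text \<open>By itself the lower bound on the derivative gives expansion only between points closer than a
scale fixed by the Lipschitz constant; expansion between distant points is the content of
Hadamard's global inversion theorem.\<close>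

lemma hadamard_expanding:
 fixes F :: "'a::euclidean_space => 'a"
 assumes D: "\<And>x. (F has_derivative F' x) (at x)"
  and c: "c > 0" "\<And>x v. norm (F' x v) >= c * norm v"
  and L: "L > 0" "\<And>x y v. norm (F' x v - F' y v) <= L * norm (x - y) * norm v"
 shows "norm (F x - F y) >= c * norm (x - y)"
proof -
 define \<delta> where "\<delta> = c / (2 * L)"
 define \<kappa> where "\<kappa> = c * \<delta> / 16"
 have pos: "\<delta> > 0" "\<kappa> > 0" using c L by (auto simp: \<delta>_def \<kappa>_def)
 have lin: "linear (F' x)" for x using D has_derivative_linear by blast
 have contF: "continuous_on A F" for A
  using D by (meson continuous_at_imp_continuous_on has_derivative_continuous)
 have loc: "norm (F q - F p) >= c / 2 * norm (q - p)" if pq: "norm (q - p) <= \<delta>" for p q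
 proof -
  have d: "((%z. F z - F' p z) has_derivative (%v. F' z v - F' p v)) (at z)" for z
   by (intro has_derivative_diff D linear_imp_has_derivative lin)
  obtain t where t: "0 < t" "t < 1"
   "norm ((F (p + (q - p)) - F' p (p + (q - p))) - (F p - F' p p)) <= norm (dd (q - p) (%z. F z - F' p z) (p + t *\<^sub>R (q - p)))"
   by (rule mvt_dd[of "%z. F z - F' p z" p "q - p"]) (use d differentiable_def in blast)
  have "norm (dd (q - p) (%z. F z - F' p z) (p + t *\<^sub>R (q - p))) <= L * norm (t *\<^sub>R (q - p)) * norm (q - p)"
   unfolding dd_eq[OF d] using L(2)[where x="p + t *\<^sub>R (q - p)" and y=p and v="q - p"] by simp
  also have "\<dots> <= L * \<delta> * norm (q - p)"
  proof (intro mult_right_mono mult_left_mono)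
   have "norm (t *\<^sub>R (q - p)) <= 1 * norm (q - p)" using t by (simp add: mult_left_le_one_le)
   then show "norm (t *\<^sub>R (q - p)) <= \<delta>" using pq by linarith
  qed (use L in auto)
  also have "L * \<delta> = c / 2" using L by (simp add: \<delta>_def)
  finally have "norm ((F q - F p) - F' p (q - p)) <= c / 2 * norm (q - p)"
   using t(3) by (simp add: linear_diff[OF lin] algebra_simps)
  moreover have "c * norm (q - p) <= norm (F' p (q - p))" using c by blast
  moreover have "norm (F' p (q - p)) <= norm (F q - F p) + norm ((F q - F p) - F' p (q - p))"
   using norm_triangle_ineq4[of "F q - F p" "(F q - F p) - F' p (q - p)"] by simp
  ultimately show ?thesis by linarith
 qed
 have surj: "surj (F' x)" for x
 proof (rule linear_inj_imp_surj[OF lin])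
  have "v = 0" if "F' x v = 0" for v using c(2)[where x=x and v=v] that c(1) by (simp add: mult_le_0_iff)
  then show "inj (F' x)" using linear_injective_0[OF lin] by blast
 qed
 have solve: "\<exists>q. norm (q - \<xi>) < \<delta> / 4 \<and> F q = t" if t: "norm (F \<xi> - t) < \<kappa>" for \<xi> t
 proof -
  let ?g = "%q. (F q - t) \<bullet> (F q - t)"
  have "continuous_on (cball \<xi> (\<delta>/4)) ?g" by (intro continuous_intros contF)
  then obtain q where q: "q \<in> cball \<xi> (\<delta>/4)" "\<And>z. z \<in> cball \<xi> (\<delta>/4) ==> ?g q <= ?g z"
   using continuous_attains_inf[of "cball \<xi> (\<delta>/4)" ?g] pos by auto
  have "?g q <= ?g \<xi>" using q(2)[of \<xi>] pos by simp
  then have le: "norm (F q - t) < \<kappa>" using t by (simp add: norm_le[symmetric] power2_norm_eq_inner[symmetric])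
  have inn: "norm (q - \<xi>) < \<delta> / 4"
  proof (rule ccontr)
   assume "\<not> ?thesis"
   then have e: "norm (q - \<xi>) = \<delta> / 4" using q(1) by (simp add: dist_norm norm_minus_commute)
   have "c / 2 * (\<delta> / 4) <= norm (F q - F \<xi>)" using loc[of q \<xi>] e pos by simp
   also have "\<dots> <= norm (F q - t) + norm (F \<xi> - t)" using norm_triangle_ineq4[of "F q - t" "F \<xi> - t"] by simp
   also have "\<dots> < 2 * \<kappa>" using le t by simp
   finally show False by (simp add: \<kappa>_def)
  qed
  have "(?g has_derivative (%v. 2 * ((F q - t) \<bullet> F' q v))) (at q)"
   by (auto intro!: derivative_eq_intros D simp: inner_commute)
  moreover have "ball q (\<delta>/4 - norm (q - \<xi>)) \<subseteq> cball \<xi> (\<delta>/4)"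
  proof
   fix z assume "z \<in> ball q (\<delta>/4 - norm (q - \<xi>))"
   then show "z \<in> cball \<xi> (\<delta>/4)" using dist_triangle[of \<xi> z q] by (simp add: dist_norm norm_minus_commute)
  qed
  ultimately have "(%v. 2 * ((F q - t) \<bullet> F' q v)) = (%v. 0)"
   by (intro differential_zero_maxmin[of q "ball q (\<delta>/4 - norm (q - \<xi>))" ?g]) (use q(2) inn in auto)
  moreover obtain v where "F' q v = F q - t" using surj[of q] by (metis surjD)
  ultimately have "(F q - t) \<bullet> (F q - t) = 0" by (metis mult_eq_0_iff zero_neq_numeral)
  then show ?thesis using inn by auto
 qed
 have surjF: "\<exists>q. F q = b" for b
 proof -
  have "closed (range F)"
  proof (unfold closed_sequential_limits, intro allI impI, elim conjE)
   fix s l assume s: "\<forall>n. s n \<in> range F" "s \<longlonglongrightarrow> l"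
   then obtain n where n: "norm (s n - l) < \<kappa>" using pos LIMSEQ_D by (metis le_refl)
   from s obtain \<xi> where "s n = F \<xi>" by blast
   with n solve[of \<xi> l] show "l \<in> range F" by (metis rangeI)
  qed
  moreover have "open (range F)"
   unfolding open_dist
  proof (intro ballI exI conjI allI impI)
   fix x y assume "x \<in> range F" "dist y x < \<kappa>"
   then show "y \<in> range F" using solve by (metis dist_norm norm_minus_commute rangeE rangeI)
  qed (rule pos)
  ultimately have "range F = UNIV" using connected_UNIV by (metis clopen empty_is_image UNIV_not_empty)
  then show ?thesis by (metis surjD)
 qed
 have cov: "covering_space UNIV F UNIV"
  unfolding covering_space_def
 proof (intro conjI ballI)
  show "continuous_on UNIV F" by (rule contF)
  show "range F = UNIV" using surjF by (metis surjI)
  fix b :: 'a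
  let ?T = "ball b \<kappa>"
  let ?v = "{ball q (\<delta>/4) \<inter> F -` ?T | q. F q = b}"
  have op: "open (F -` ?T)" using contF by (metis open_ball open_vimage)
  have "\<Union>?v = UNIV \<inter> F -` ?T"
  proof (rule set_eqI, rule iffI)
   fix x assume x: "x \<in> UNIV \<inter> F -` ?T"
   then have "norm (F x - b) < \<kappa>" by (simp add: dist_norm norm_minus_commute)
   from solve[OF this] obtain q where q: "norm (q - x) < \<delta>/4" "F q = b" by blast
   have "x \<in> ball q (\<delta>/4) \<inter> F -` ?T" using x q by (simp add: dist_norm)
   then show "x \<in> \<Union>?v" using q(2) by blast
  qed auto
  moreover have "\<forall>u\<in>?v. openin (top_of_set UNIV) u" using op by auto
  moreover have "pairwise disjnt ?v"
  proof (rule pairwiseI)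
   fix u u' assume u: "u \<in> ?v" "u' \<in> ?v" "u \<noteq> u'"
   then obtain q q' where q: "u = ball q (\<delta>/4) \<inter> F -` ?T" "F q = b" "u' = ball q' (\<delta>/4) \<inter> F -` ?T" "F q' = b" by blast
   show "disjnt u u'"
   proof (rule ccontr)
    assume "\<not> ?thesis"
    then obtain x where "dist q x < \<delta>/4" "dist q' x < \<delta>/4" by (auto simp: disjnt_def q)
    then have "dist q q' < \<delta>" using dist_triangle2[of q q' x] pos by simp
    then have "c / 2 * norm (q - q') <= 0" using loc[of q q'] q by (simp add: dist_norm)
    then have "q = q'" using c(1) by (simp add: mult_le_0_iff)
    then show False using u q by simp
   qed
  qed
  moreover have "\<forall>u\<in>?v. \<exists>g. homeomorphism u ?T F g"
  proof
   fix u assume "u \<in> ?v"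
   then obtain q where q: "u = ball q (\<delta>/4) \<inter> F -` ?T" "F q = b" by blast
   have "inj_on F u"
   proof (rule inj_onI)
    fix x y assume *: "x \<in> u" "y \<in> u" "F x = F y"
    then have "dist x y < \<delta>" using dist_triangle[of x y q] pos by (simp add: dist_commute q)
    then have "c / 2 * norm (x - y) <= 0" using loc[of x y] *(3) by (simp add: dist_norm)
    then show "x = y" using c(1) by (simp add: mult_le_0_iff)
   qed
   moreover have "F ` u = ?T"
   proof (rule set_eqI, rule iffI)
    fix t assume t: "t \<in> ?T"
    then have "norm (F q - t) < \<kappa>" by (simp add: dist_norm q)
    from solve[OF this] obtain x where x: "norm (x - q) < \<delta>/4" "F x = t" by blast
    then have "x \<in> u" using t by (simp add: dist_norm norm_minus_commute q)
    then show "t \<in> F ` u" using x by blast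
   qed (auto simp: q)
   moreover have "open u" using op by (simp add: q open_Int)
   ultimately show "\<exists>g. homeomorphism u ?T F g"
    using invariance_of_domain_homeomorphism[of u F] contF by (metis order_refl)
  qed
  ultimately show "\<exists>T. b \<in> T \<and> openin (top_of_set UNIV) T \<and>
    (\<exists>v. \<Union>v = UNIV \<inter> F -` T \<and> (\<forall>u\<in>v. openin (top_of_set UNIV) u) \<and> pairwise disjnt v \<and>
      (\<forall>u\<in>v. \<exists>q. homeomorphism u T F q))"
   using pos by (intro exI[of _ ?T] conjI exI[of _ ?v]) auto
 qed
 \<comment> \<open>\<open>UNIV\<close> is simply connected, so the identity lifts to a section \<open>g\<close>, and by uniqueness of lifts \<open>g \<circ> F\<close> is the identity\<close>
 obtain g where g: "continuous_on UNIV g" "g (F y) = y" "\<And>z. F (g z) = z"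
  using covering_space_lift_strong[OF cov, of y "F y" UNIV "%z. z"]
  by (auto simp: convex_imp_simply_connected convex_imp_locally_path_connected continuous_on_id)
 have gF: "g (F z) = z" for z
  by (rule covering_space_lift_unique[OF cov, where f=F and ?g1.0="%z. g (F z)" and ?g2.0="%z. z" and T=UNIV and a=y])
   (use g contF in \<open>auto intro: continuous_on_compose2 continuous_on_id\<close>)
 define G' where "G' z = inv (F' (g z))" for z
 have inv: "F' (g z) (G' z v) = v" "G' z (F' (g z) v) = v" for z v
 proof -
  have "inj (F' (g z))"
   using linear_surj_imp_inj[OF lin surj] by blast
  then show "G' z (F' (g z) v) = v" by (simp add: G'_def)
  show "F' (g z) (G' z v) = v" by (simp add: G'_def surj_f_inv_f[OF surj])
 qed
 have linG: "linear (G' z)" for z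
 proof (rule linearI)
  fix a b :: 'a and s :: real
  have "G' z (a + b) = G' z (F' (g z) (G' z a + G' z b))" by (simp only: linear_add[OF lin] inv)
  then show "G' z (a + b) = G' z a + G' z b" by (simp only: inv)
  have "G' z (s *\<^sub>R a) = G' z (F' (g z) (s *\<^sub>R G' z a))" by (simp only: linear_cmul[OF lin] inv)
  then show "G' z (s *\<^sub>R a) = s *\<^sub>R G' z a" by (simp only: inv)
 qed
 have dg: "(g has_derivative G' z) (at z)" for z
  by (rule has_derivative_inverse_basic[where f=F and f'="F' (g z)" and T=UNIV])
   (use D g linG inv in \<open>auto simp: linear_conv_bounded_linear continuous_on_eq_continuous_at fun_eq_iff\<close>)
 obtain t where "norm (g (F y + (F x - F y)) - g (F y)) <= norm (dd (F x - F y) g (F y + t *\<^sub>R (F x - F y)))"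
  by (rule mvt_dd[of g]) (use dg differentiable_def in blast)+
 then have "norm (x - y) <= norm (G' (F y + t *\<^sub>R (F x - F y)) (F x - F y))"
  by (simp add: dd_eq[OF dg] gF)
 moreover have "c * norm (G' z v) <= norm v" for z v using c(2)[where x="g z" and v="G' z v"] inv by simp
 ultimately show ?thesis using c(1) by (meson mult_le_cancel_left_pos order_trans)
qed

section \<open>Nonstationary phase\<close>

lemma integrable_bounded_support:
 fixes f :: "'a::euclidean_space => 'b::{banach, second_countable_topology}"
 assumes "f \<in> borel_measurable borel" "\<And>x. norm (f x) <= C" "\<And>x. norm x > R ==> f x = 0"
 shows "integrable lborel f"
proof (rule Bochner_Integration.integrable_bound[where f="%x. C * indicator (cball 0 R) x"])
 show "integrable lborel (%x::'a. C * indicator (cball 0 R) x)"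
  using emeasure_lborel_cball_finite[of 0 R] by (intro integrable_mult_right integrable_real_indicator) auto
 show "AE x in lborel. norm (f x) <= norm (C * indicator (cball 0 R) x)"
  using assms(2,3) by (auto intro!: AE_I2 simp: indicator_def not_le) (smt (verit) norm_ge_zero)
qed (use assms in simp)

lemma integrable_compact_support:
 fixes f :: "'a::euclidean_space => 'b::{banach, second_countable_topology}"
 assumes "continuous_on UNIV f" "\<And>x. norm x > R ==> f x = 0"
 shows "integrable lborel f"
proof -
 have "integrable lborel (%x. indicator (cball 0 R) x *\<^sub>R f x)"
  by (rule borel_integrable_compact[OF compact_cball continuous_on_subset[OF assms(1)]]) simp
 moreover have "(%x. indicator (cball 0 R) x *\<^sub>R f x) = f"
  using assms(2) by (auto simp: indicator_def fun_eq_iff not_le)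
 ultimately show ?thesis by simp
qed

lemma lborel_integral_translate:
 fixes f :: "'a::euclidean_space => 'b::{banach, second_countable_topology}"
 assumes "f \<in> borel_measurable borel"
 shows "(LINT x|lborel. f (c + x)) = (LINT x|lborel. f x)"
 using integral_distr[of "(+) c" lborel borel f] assms by (simp add: lborel_distr_plus)

lemma lborel_integrable_translate:
 fixes f :: "'a::euclidean_space => 'b::{banach, second_countable_topology}"
 assumes "integrable lborel f"
 shows "integrable lborel (%x. f (c + x))"
 by (rule integrable_distr[of "(+) c" lborel lborel f]) (use assms in \<open>simp_all add: lborel_distr_plus cong: distr_cong\<close>)

lemma nn_integral_translate:
 fixes f :: "'a::euclidean_space => ennreal"
 assumes "f \<in> borel_measurable borel"
 shows "(\<integral>\<^sup>+x. f (c + x) \<partial>lborel) = (\<integral>\<^sup>+x. f x \<partial>lborel)"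
 using nn_integral_distr[of "(+) c" lborel borel f] assms by (simp add: lborel_distr_plus)

lemma smooth_compact_support_bounded:
 fixes f :: "'a::euclidean_space => 'b::real_normed_vector"
 assumes "smooth f" "\<And>x. norm x > R ==> f x = 0"
 obtains C where "C > 0" "\<And>x. norm (f x) <= C"
 by (rule symb_bound[OF symb_compact_support[OF assms, where 'p=unit]]) auto

lemma dd_zero_open:
 assumes "open S" "\<And>x. x \<in> S ==> f x = 0" "x \<in> S"
 shows "dd b f x = 0"
proof -
 have "((%_. 0) has_derivative (%_. 0)) (at x)" by simp
 then have "(f has_derivative (%_. 0)) (at x)"
  by (rule has_derivative_transform_within_open[OF _ assms(1,3)]) (simp add: assms(2))
 then show ?thesis by (rule dd_eq)
qed

lemma integral_dd_zero:
 fixes h :: "'a::euclidean_space => complex"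
 assumes h: "smooth h" and R: "\<And>x. norm x > R ==> h x = 0" and b: "b \<in> Basis"
 shows "(LINT x|lborel. dd b h x) = 0"
proof -
 have o: "open {x::'a. norm x > R}" by (intro open_Collect_less continuous_intros)
 have Rd: "dd b h x = 0" if "norm x > R" for x
  by (rule dd_zero_open[OF o]) (use R that in auto)
 obtain C where C: "C > 0" "\<And>x. norm (dd b h x) <= C"
  using smooth_compact_support_bounded[OF smooth_dd[OF h b] Rd] by blast
 define g where "g n x = of_nat (Suc n) * (h (inverse (real (Suc n)) *\<^sub>R b + x) - h x)" for n x
 have m: "h \<in> borel_measurable borel" by (intro borel_measurable_continuous_onI smooth_continuous h)
 have ih: "integrable lborel h" by (rule integrable_compact_support[OF smooth_continuous[OF h] R])
 have g0: "(LINT x|lborel. g n x) = 0" for n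
  unfolding g_def
  by (simp add: Bochner_Integration.integral_diff[OF lborel_integrable_translate[OF ih] ih] lborel_integral_translate[OF m] del: of_nat_Suc)
 have lim: "(%n. g n x) \<longlonglongrightarrow> dd b h x" for x
 proof -
  have "((%s. x + s *\<^sub>R b) has_derivative (%s. s *\<^sub>R b)) (at 0)" by (auto intro!: derivative_eq_intros)
  from has_derivative_compose[OF this, of h "%v. dd v h x"] dd_has_derivative[OF smooth_differentiable[OF h], of x]
  have "((%s. h (x + s *\<^sub>R b)) has_derivative (%s. dd (s *\<^sub>R b) h x)) (at 0)" by simp
  moreover have "dd (s *\<^sub>R b) h x = s *\<^sub>R dd b h x" for s
   using linear_cmul[OF bounded_linear.linear[OF has_derivative_bounded_linear[OF dd_has_derivative[OF smooth_differentiable[OF h]]]]] by blast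
  ultimately have "((%s. h (x + s *\<^sub>R b)) has_derivative (%s. s *\<^sub>R dd b h x)) (at 0)" by simp
  then have 1: "((%s. norm (h (x + s *\<^sub>R b) - h x - s *\<^sub>R dd b h x) / norm s) \<longlongrightarrow> 0) (at 0)"
   by (simp add: has_derivative_iff_norm)
  have 2: "filterlim (%n. inverse (real (Suc n))) (at 0) sequentially"
   by (rule filterlim_atI[OF LIMSEQ_inverse_real_of_nat]) (simp del: of_nat_Suc)
  have "norm (h (x + inverse (real (Suc n)) *\<^sub>R b) - h x - inverse (real (Suc n)) *\<^sub>R dd b h x) / norm (inverse (real (Suc n)))
    = norm (g n x - dd b h x)" for n
  proof -
   have "g n x - dd b h x = real (Suc n) *\<^sub>R (h (x + inverse (real (Suc n)) *\<^sub>R b) - h x - inverse (real (Suc n)) *\<^sub>R dd b h x)"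
    by (simp add: g_def scaleR_conv_of_real algebra_simps add.commute del: of_nat_Suc)
   then show ?thesis by (simp add: divide_inverse mult.commute del: of_nat_Suc)
  qed
  then have "(%n. norm (g n x - dd b h x)) \<longlonglongrightarrow> 0" using filterlim_compose[OF 1 2] by simp
  then show ?thesis by (rule LIM_zero_cancel[OF tendsto_norm_zero_cancel])
 qed
 have bd: "norm (g n x) <= C * indicator (cball 0 (R + 1)) x" for n x
 proof -
  let ?v = "inverse (real (Suc n)) *\<^sub>R b"
  have nv: "norm ?v <= 1" using b by (simp add: inverse_le_1_iff)
  show ?thesis
  proof (cases "norm x <= R + 1")
   case True
   obtain t where "norm (h (x + ?v) - h x) <= norm (dd ?v h (x + t *\<^sub>R ?v))"
    using mvt_dd[of h x ?v] smooth_differentiable[OF h] by metis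
   also have "dd ?v h (x + t *\<^sub>R ?v) = inverse (real (Suc n)) *\<^sub>R dd b h (x + t *\<^sub>R ?v)"
    using linear_cmul[OF bounded_linear.linear[OF has_derivative_bounded_linear[OF dd_has_derivative[OF smooth_differentiable[OF h]]]]] by blast
   also have "norm \<dots> <= inverse (real (Suc n)) * C" using C by (simp del: of_nat_Suc)
   finally have "real (Suc n) * norm (h (x + ?v) - h x) <= C" by (simp add: field_simps del: of_nat_Suc)
   then show ?thesis using True by (simp add: g_def norm_mult add.commute del: of_nat_Suc)
  next
   case False
   have "norm x <= norm (?v + x) + norm ?v" using norm_triangle_ineq4[of "?v + x" ?v] by simp
   then have "norm (?v + x) > R" using False nv by linarith
   then show ?thesis using False R[of x] R[of "?v + x"] C by (simp add: g_def del: of_nat_Suc)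
  qed
 qed
 have "(%n. LINT x|lborel. g n x) \<longlonglongrightarrow> (LINT x|lborel. dd b h x)"
 proof (rule integral_dominated_convergence[where w="%x. C * indicator (cball 0 (R + 1)) x"])
  show "dd b h \<in> borel_measurable lborel"
   using borel_measurable_continuous_onI[OF smooth_continuous[OF smooth_dd[OF h b]]] by simp
  show "g n \<in> borel_measurable lborel" for n unfolding g_def using m by measurable
  show "integrable lborel (%x::'a. C * indicator (cball 0 (R + 1)) x)"
   using emeasure_lborel_cball_finite[of 0 "R + 1"] by (intro integrable_mult_right integrable_real_indicator) auto
 qed (use lim bd in auto)
 then show ?thesis by (simp add: g0 LIMSEQ_const_iff)
qed

lemma cis_has_derivative:
 assumes "h differentiable (at x)"
 shows "((%x. cis (h x)) has_derivative (%v. \<i> * of_real (dd v h x) * cis (h x))) (at x)"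
 using has_derivative_cis[OF dd_has_derivative[OF assms]] by (simp add: scaleR_conv_of_real mult_ac)

lemma dd_cis: "h differentiable (at x) ==> dd b (%x. cis (h x)) x = \<i> * of_real (dd b h x) * cis (h x)"
 by (rule dd_eq[OF cis_has_derivative])

lemma symb_cis:
 assumes "\<And>p x. h p differentiable (at x)" "\<And>b. b \<in> Basis ==> symb \<Omega> (%p. dd b (h p))"
 shows "symb \<Omega> (%p x. cis (h p x))"
proof -
 have e: "dd b (%x. cis (h p x)) = (%x. \<i> * of_real (dd b (h p) x) * cis (h p x))" for p b
  by (rule ext, rule dd_cis[OF assms(1)])
 have "symb_k k \<Omega> (%p x. cis (h p x))" for k
 proof (induction k)
  case 0 then show ?case by (auto intro!: exI[of _ 1])
 next
  case (Suc k)
  have "symb_k k \<Omega> (%p. dd b (%x. cis (h p x)))" if "b \<in> Basis" for b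
  proof -
   have "symb \<Omega> (%p x. \<i> * complex_of_real (dd b (h p) x))"
    by (intro symb_mult symb_const0 symb_of_real assms(2) that)
   then have "symb_k k \<Omega> (%p x. \<i> * complex_of_real (dd b (h p) x))" by (simp add: symb_def)
   then show ?thesis unfolding e by (rule symb_k_mult[OF _ Suc])
  qed
  moreover have "(%x. cis (h p x)) differentiable (at x)" for p x
   using cis_has_derivative[OF assms(1)] differentiable_def by blast
  ultimately show ?case by (auto intro!: exI[of _ 1])
 qed
 then show ?thesis by (simp add: symb_def)
qed

lemma smooth_cis: "smooth h ==> smooth (%x. cis (h x))"
proof -
 assume h: "smooth h"
 then have s: "symb {} (%_::unit. h)" by (rule smooth_iff_symb[THEN iffD1])
 have "symb {} (%(_::unit) x. cis (h x))"
  by (rule symb_cis[OF smooth_differentiable[OF h] symb_dd[OF s]])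
 then show ?thesis by (rule smooth_iff_symb[THEN iffD2])
qed

locale nonstationary =
 fixes B :: "'a::euclidean_space set" and \<Omega> :: "('p \<times> 'a) set" and t :: "'p => 'a => real" and r :: "'p => real" and c :: real
 assumes B: "B \<subseteq> Basis" and t: "\<And>p. smooth (t p)" and r: "\<And>p. r p >= 1"
  and sym: "\<And>b. b \<in> B ==> symb \<Omega> (%p x. dd b (t p) x / r p)"
  and c: "c > 0" and low: "\<And>p x. (p, x) \<in> \<Omega> ==> c * (r p)\<^sup>2 <= (\<Sum>b\<in>B. (dd b (t p) x)\<^sup>2)"
begin

definition "d b p x = dd b (t p) x / r p"
definition "q p x = (1 / r p)\<^sup>2 + (\<Sum>b\<in>B. (d b p x)\<^sup>2)"
definition flow :: "'a => ('p => 'a => complex) => 'p => 'a => complex" where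
 "flow b f p x = of_real (d b p x * (1 / q p x)) * f p x"
definition step :: "('p => 'a => complex) => 'p => 'a => complex" where
 "step f p x = of_real (1 / r p * (1 / q p x)) * f p x + \<i> * (\<Sum>b\<in>B. dd b (flow b f p) x)"

lemma finB: "finite B" using B finite_subset finite_Basis by blast

lemma symb_rinv: "symb \<Omega>' (%p x. 1 / r p)"
 by (rule symb_const[of _ _ 1]) (use r in \<open>auto simp: divide_le_eq\<close>, smt (verit) r)

lemma symb_q: "symb \<Omega> q"
 unfolding q_def[abs_def] power2_eq_square d_def
 by (intro symb_add symb_sum finB symb_mult sym symb_rinv)

lemma q_pos: "q p x > 0"
 unfolding q_def using r[of p] by (intro add_pos_nonneg sum_nonneg) auto

lemma symb_qinv: "symb \<Omega> (%p x. 1 / q p x)"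
proof (rule symb_inverse[OF symb_q _ c])
 show "q p x \<noteq> 0" for p x using q_pos[of p x] by simp
 show "c <= \<bar>q p x\<bar>" if "(p, x) \<in> \<Omega>" for p x
 proof -
  have "c <= (\<Sum>b\<in>B. (dd b (t p) x)\<^sup>2) / (r p)\<^sup>2" using low[OF that] r[of p] by (simp add: le_divide_eq)
  also have "\<dots> = (\<Sum>b\<in>B. (d b p x)\<^sup>2)" by (simp add: d_def power_divide sum_divide_distrib)
  finally show ?thesis unfolding q_def by (smt (verit) zero_le_power2)
 qed
qed

lemma symb_flow: "b \<in> B ==> symb \<Omega> f ==> symb \<Omega> (flow b f)"
 unfolding flow_def[abs_def] d_def by (intro symb_mult symb_of_real sym symb_qinv)

lemma symb_step: "symb \<Omega> f ==> symb \<Omega> (step f)"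
 unfolding step_def[abs_def]
 by (intro symb_add symb_mult symb_of_real symb_rinv symb_qinv symb_sum finB symb_const0 symb_dd symb_flow) (use B in auto)

lemma step_zero:
 assumes "open S" "\<And>x. x \<in> S ==> f p x = 0" "x \<in> S" shows "step f p x = 0"
proof -
 have "dd b (flow b f p) x = 0" for b
  by (rule dd_zero_open[OF assms(1) _ assms(3)]) (simp add: flow_def assms(2))
 then show ?thesis by (simp add: step_def assms)
qed

lemma step_identity:
 assumes f: "symb \<Omega> f"
 shows "cis (t p x) * f p x = of_real (1 / r p) * (cis (t p x) * step f p x)
  - of_real (1 / r p) * \<i> * (\<Sum>b\<in>B. dd b (%x. cis (t p x) * flow b f p x) x)"
proof -
 have 1: "dd b (%x. cis (t p x) * flow b f p x) x = \<i> * of_real (dd b (t p) x) * cis (t p x) * flow b f p x + cis (t p x) * dd b (flow b f p) x"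
  if "b \<in> B" for b
 proof -
  have "(%x. cis (t p x)) differentiable (at x)"
   using cis_has_derivative[OF smooth_differentiable[OF t]] differentiable_def by blast
  from bounded_bilinear.dd_prod[OF bounded_bilinear_mult this symb_differentiable[OF symb_flow[OF that f]]]
  show ?thesis by (simp add: dd_cis[OF smooth_differentiable[OF t]])
 qed
 have rp: "r p > 0" using r[of p] by linarith
 have 2: "\<i> * of_real (dd b (t p) x) * cis (t p x) * flow b f p x = \<i> * of_real (r p) * (cis (t p x) * f p x) * of_real (1 / q p x) * of_real ((d b p x)\<^sup>2)" for b
  using rp by (simp add: flow_def d_def power2_eq_square field_simps)
 have "(\<Sum>b\<in>B. dd b (%x. cis (t p x) * flow b f p x) x)
   = \<i> * of_real (r p) * (cis (t p x) * f p x) * of_real (1 / q p x) * of_real (\<Sum>b\<in>B. (d b p x)\<^sup>2) + cis (t p x) * (\<Sum>b\<in>B. dd b (flow b f p) x)"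
  using 1 by (simp add: 2 sum.distrib sum_distrib_left)
 moreover have "(\<Sum>b\<in>B. (d b p x)\<^sup>2) = q p x - (1 / r p)\<^sup>2" by (simp add: q_def)
 ultimately have S: "(\<Sum>b\<in>B. dd b (%x. cis (t p x) * flow b f p x) x)
   = \<i> * of_real (r p) * (cis (t p x) * f p x) * of_real (1 / q p x * (q p x - (1 / r p)\<^sup>2)) + cis (t p x) * (\<Sum>b\<in>B. dd b (flow b f p) x)"
  by simp
 have W: "of_real (1 / q p x * (q p x - (1 / r p)\<^sup>2)) = (1 - of_real (1 / r p) * of_real (1 / r p * (1 / q p x)) :: complex)"
  using q_pos[of p x] rp by (simp add: field_simps power2_eq_square)
 have gen: "C * F = X * (C * (Y * F + \<i> * G)) - X * \<i> * (\<i> * R * (C * F) * W + C * G)"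
  if "X * R = 1" "W = 1 - X * Y" for C F X Y G R W :: complex
 proof -
  have "X * \<i> * (\<i> * R * (C * F) * W + C * G) = - ((X * R) * (C * F) * W) + X * \<i> * C * G"
   by (simp add: algebra_simps)
  then show ?thesis unfolding that by (simp add: algebra_simps)
 qed
 show ?thesis unfolding S step_def by (rule gen[OF _ W]) (use rp in simp)
qed

lemma symb_stepN: "symb \<Omega> f ==> symb \<Omega> ((step ^^ N) f)"
 by (induction N) (auto intro: symb_step)

lemma stepN_zero:
 assumes "open S" "\<And>x. x \<in> S ==> f p x = 0" "x \<in> S" shows "(step ^^ N) f p x = 0"
 using assms(3)
proof (induction N arbitrary: x)
 case (Suc N)
 show ?case unfolding funpow.simps comp_def by (rule step_zero[where S=S]) (use assms Suc in auto)
qed (use assms in simp)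

lemma smooth_flow: "b \<in> B ==> symb \<Omega> f ==> smooth (%x. cis (t p x) * flow b f p x)"
 by (intro smooth_mult smooth_cis t symb_smooth[OF symb_flow])

lemma step_integral:
 assumes f: "symb \<Omega> f" and R: "\<And>x. norm x > R ==> f p x = 0"
 shows "(LINT x|lborel. cis (t p x) * f p x) = of_real (1 / r p) * (LINT x|lborel. cis (t p x) * step f p x)"
proof -
 have o: "open {x::'a. norm x > R}" by (intro open_Collect_less continuous_intros)
 have sR: "step f p x = 0" if "norm x > R" for x by (rule step_zero[OF o]) (use R that in auto)
 have fl: "flow b f p x = 0" if "norm x > R" for b x by (simp add: flow_def R that)
 have z: "(LINT x|lborel. dd b (%x. cis (t p x) * flow b f p x) x) = 0" if "b \<in> B" for b
  by (rule integral_dd_zero[OF smooth_flow[OF that f], of R]) (use fl that B in auto)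
 have i1: "integrable lborel (%x. cis (t p x) * step f p x)"
  by (rule integrable_compact_support[of _ R])
   (use sR in \<open>auto intro!: smooth_continuous smooth_mult smooth_cis t symb_smooth[OF symb_step[OF f]]\<close>)
 have i2: "integrable lborel (dd b (%x. cis (t p x) * flow b f p x))" if "b \<in> B" for b
 proof (rule integrable_compact_support[of _ R])
  show "continuous_on UNIV (dd b (%x. cis (t p x) * flow b f p x))"
   using that B by (intro smooth_continuous smooth_dd smooth_flow f) auto
  show "dd b (%x. cis (t p x) * flow b f p x) x = 0" if "norm x > R" for x
   by (rule dd_zero_open[OF o]) (use fl that in auto)
 qed
 have "(LINT x|lborel. cis (t p x) * f p x) = (LINT x|lborel. of_real (1 / r p) * (cis (t p x) * step f p x)
  - of_real (1 / r p) * \<i> * (\<Sum>b\<in>B. dd b (%x. cis (t p x) * flow b f p x) x))"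
  by (subst step_identity[OF f]) simp
 also have "\<dots> = (LINT x|lborel. of_real (1 / r p) * (cis (t p x) * step f p x))
  - (LINT x|lborel. of_real (1 / r p) * \<i> * (\<Sum>b\<in>B. dd b (%x. cis (t p x) * flow b f p x) x))"
  using i1 i2 by (intro Bochner_Integration.integral_diff integrable_mult_right Bochner_Integration.integrable_sum) auto
 also have "(LINT x|lborel. of_real (1 / r p) * \<i> * (\<Sum>b\<in>B. dd b (%x. cis (t p x) * flow b f p x) x)) = 0"
  using i2 z by (simp add: Bochner_Integration.integral_sum)
 finally show ?thesis by simp
qed

lemma stepN_integral:
 assumes f: "symb \<Omega> f" and R: "\<And>x. norm x > R ==> f p x = 0"
 shows "(LINT x|lborel. cis (t p x) * f p x) = of_real (1 / r p) ^ N * (LINT x|lborel. cis (t p x) * (step ^^ N) f p x)"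
proof (induction N)
 case (Suc N)
 have o: "open {x::'a. norm x > R}" by (intro open_Collect_less continuous_intros)
 have "(step ^^ N) f p x = 0" if "norm x > R" for x by (rule stepN_zero[OF o]) (use R that in auto)
 from step_integral[OF symb_stepN[OF f] this] Suc show ?case by simp
qed simp

text \<open>Integrating by parts along the normalized gradient of the phase gains one power of the large
parameter and keeps the amplitude in the same uniformly bounded class, so the step can be
repeated.\<close>

theorem nonstationary_decay:
 assumes f: "symb \<Omega> f" and cl: "\<And>p. closed {x. (p, x) \<in> \<Omega>}"
  and z: "\<And>p x. p \<in> P ==> (p, x) \<notin> \<Omega> ==> f p x = 0" and R: "\<And>p x. p \<in> P ==> norm x > R ==> f p x = 0"
 obtains C where "C >= 0" "\<And>p. p \<in> P ==> norm (LINT x|lborel. cis (t p x) * f p x) <= C / (r p) ^ N"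
proof -
 have zN: "(step ^^ N) f p x = 0" if "p \<in> P" "(p, x) \<notin> \<Omega>" for p x
  by (rule stepN_zero[of "- {x. (p, x) \<in> \<Omega>}"]) (use cl z that in auto)
 have o: "open {x::'a. norm x > R}" by (intro open_Collect_less continuous_intros)
 have RN: "(step ^^ N) f p x = 0" if "p \<in> P" "norm x > R" for p x by (rule stepN_zero[OF o]) (use R that in auto)
 obtain K where K: "K > 0" "\<And>p x. (p, x) \<in> P \<times> UNIV ==> norm ((step ^^ N) f p x) <= K"
  using symb_bound[OF symb_extend[OF symb_stepN[OF f, of N] cl zN]] by blast
 have bd: "norm (LINT x|lborel. cis (t p x) * (step ^^ N) f p x) <= K * measure lborel (cball 0 R :: 'a set)" if p: "p \<in> P" for p
 proof -
  have i: "integrable lborel (%x. cis (t p x) * (step ^^ N) f p x)"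
   by (rule integrable_compact_support[of _ R])
    (use RN[OF p] in \<open>auto intro!: smooth_continuous smooth_mult smooth_cis t symb_smooth[OF symb_stepN[OF f]]\<close>)
  have "norm (LINT x|lborel. cis (t p x) * (step ^^ N) f p x) <= integral\<^sup>L lborel (%x::'a. K * indicator (cball 0 R) x)"
  proof (rule Bochner_Integration.integral_norm_bound[THEN order_trans], rule integral_mono)
   show "integrable lborel (%x. norm (cis (t p x) * (step ^^ N) f p x))" using i by (rule integrable_norm)
   show "integrable lborel (%x::'a. K * indicator (cball 0 R) x)"
    using emeasure_lborel_cball_finite[of 0 R] by (intro integrable_mult_right integrable_real_indicator) auto
   show "norm (cis (t p x) * (step ^^ N) f p x) <= K * indicator (cball 0 R) x" for x
    using K(2)[of p x] RN[OF p, of x] p by (auto simp: norm_mult indicator_def not_le)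
  qed
  then show ?thesis by simp
 qed
 show thesis
 proof (rule that[of "K * measure lborel (cball 0 R :: 'a set)"])
  fix p assume p: "p \<in> P"
  have "norm (LINT x|lborel. cis (t p x) * f p x) = (1 / r p) ^ N * norm (LINT x|lborel. cis (t p x) * (step ^^ N) f p x)"
   using stepN_integral[OF f, where R=R and p=p and N=N] R[OF p] r[of p] by (simp add: norm_mult norm_power norm_divide power_divide)
  also have "\<dots> <= (1 / r p) ^ N * (K * measure lborel (cball 0 R :: 'a set))"
   using bd[OF p] r[of p] by (intro mult_left_mono) auto
  finally show "norm (LINT x|lborel. cis (t p x) * f p x) <= K * measure lborel (cball 0 R :: 'a set) / r p ^ N"
   by (simp add: power_divide mult.commute)
 qed (use K in simp)
qed

end

section \<open>Integration and the Schur test\<close>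

lemma cis_measurable [measurable]: "cis \<in> borel_measurable borel"
 by (intro borel_measurable_continuous_onI continuous_intros)

lemma smooth_measurable: "smooth f ==> f \<in> borel_measurable borel"
 by (intro borel_measurable_continuous_onI smooth_continuous)

lemma bump_measurable [measurable]: "bump \<in> borel_measurable borel"
 by (rule smooth_measurable[OF smooth_bump])

lemma nn_integral_decay:
 "(\<integral>\<^sup>+x. ennreal (1 / (1 + norm (x::'a::euclidean_space)) ^ (DIM('a) + 1)) \<partial>lborel) < \<infinity>"
proof -
 let ?n = "DIM('a)"
 let ?V = "unit_ball_vol (real ?n)"
 have term_le: "f k <= (\<Sum>k. f k)" for f :: "nat => ennreal" and k
  using sum_le_suminf[of f "{k}"] by simp
 have pw: "ennreal (1 / (1 + norm x) ^ (?n + 1)) <= (\<Sum>k. ennreal ((1/2) ^ (k * (?n + 1))) * indicator (cball 0 (2 ^ (k + 1))) x)" for x :: 'a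
 proof -
  define k where "k = nat \<lfloor>log 2 (1 + norm x)\<rfloor>"
  have pos: "log 2 (1 + norm x) >= 0" using zero_le_log_cancel_iff[of 2 "1 + norm x"] by (simp add: add_pos_nonneg)
  have k: "real k <= log 2 (1 + norm x)" "log 2 (1 + norm x) < real k + 1"
   using pos by (simp_all add: k_def)
  have "2 ^ k <= 1 + norm x" using k(1) by (simp add: le_log_iff powr_realpow add_pos_nonneg)
  moreover have "1 + norm x < 2 ^ (k + 1)"
   using k(2) by (simp add: log_less_iff powr_add powr_realpow add_pos_nonneg)
  ultimately have x: "2 ^ k <= 1 + norm x" "x \<in> cball 0 (2 ^ (k + 1))" by auto
  have "(2 ^ k) ^ (?n + 1) <= (1 + norm x) ^ (?n + 1)" using x(1) by (intro power_mono) auto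
  then have "1 / (1 + norm x) ^ (?n + 1) <= 1 / (2 ^ k) ^ (?n + 1)"
   by (intro divide_left_mono mult_pos_pos zero_less_power) (auto simp: add_pos_nonneg)
  also have "\<dots> = (1/2) ^ (k * (?n + 1))" by (simp only: power_mult power_one_over power_divide power_one)
  finally have "ennreal (1 / (1 + norm x) ^ (?n + 1)) <= ennreal ((1/2) ^ (k * (?n + 1))) * indicator (cball 0 (2 ^ (k + 1))) x"
   using x(2) by (simp add: ennreal_leI)
  also have "\<dots> <= (\<Sum>k. ennreal ((1/2) ^ (k * (?n + 1))) * indicator (cball 0 (2 ^ (k + 1))) x)"
   by (rule term_le)
  finally show ?thesis .
 qed
 have "(\<integral>\<^sup>+x. ennreal (1 / (1 + norm (x::'a)) ^ (?n + 1)) \<partial>lborel)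
   <= (\<integral>\<^sup>+x. (\<Sum>k. ennreal ((1/2) ^ (k * (?n + 1))) * indicator (cball 0 (2 ^ (k + 1))) (x::'a)) \<partial>lborel)"
  by (intro nn_integral_mono pw)
 also have "\<dots> = (\<Sum>k. \<integral>\<^sup>+x. ennreal ((1/2) ^ (k * (?n + 1))) * indicator (cball 0 (2 ^ (k + 1))) (x::'a) \<partial>lborel)"
  by (intro nn_integral_suminf borel_measurable_times_ennreal borel_measurable_const borel_measurable_indicator) simp
 also have "\<dots> = (\<Sum>k. ennreal (?V * 2 ^ ?n * (1/2) ^ k))"
 proof (intro suminf_cong)
  fix k :: nat
  have "(\<integral>\<^sup>+x. ennreal ((1/2) ^ (k * (?n + 1))) * indicator (cball 0 (2 ^ (k + 1))) (x::'a) \<partial>lborel)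
    = ennreal ((1/2) ^ (k * (?n + 1))) * ennreal (?V * (2 ^ (k + 1)) ^ ?n)"
   by (subst nn_integral_cmult_indicator) (simp_all add: emeasure_cball)
  also have "\<dots> = ennreal ((1/2) ^ (k * (?n + 1)) * (?V * (2 ^ (k + 1)) ^ ?n))"
   by (rule ennreal_mult[symmetric]) auto
  also have "(1/2::real) ^ (k * (?n + 1)) * (?V * (2 ^ (k + 1)) ^ ?n) = ?V * 2 ^ ?n * (1/2) ^ k"
  proof -
   have "(1/2::real) ^ (k * (?n + 1)) = (1/2) ^ (k * ?n) * (1/2) ^ k" by (simp add: power_add algebra_simps)
   moreover have "((2::real) ^ (k + 1)) ^ ?n = 2 ^ ?n * 2 ^ (k * ?n)" by (simp add: power_mult_distrib power_mult)
   moreover have "(1/2::real) ^ (k * ?n) * 2 ^ (k * ?n) = 1" by (simp add: power_mult_distrib[symmetric])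
   ultimately show ?thesis by (simp add: algebra_simps)
  qed
  finally show "(\<integral>\<^sup>+x. ennreal ((1/2) ^ (k * (?n + 1))) * indicator (cball 0 (2 ^ (k + 1))) (x::'a) \<partial>lborel)
    = ennreal (?V * 2 ^ ?n * (1/2) ^ k)" .
 qed
 also have "\<dots> < \<infinity>"
 proof -
  have "summable (%k. ?V * 2 ^ ?n * (1/2) ^ k)" by (intro summable_mult summable_geometric) simp
  then have "(\<Sum>k. ennreal (?V * 2 ^ ?n * (1/2) ^ k)) \<noteq> top"
   by (intro ennreal_suminf_neq_top) auto
  then show ?thesis by (simp add: top.not_eq_extremum)
 qed
 finally show ?thesis .
qed

definition decay :: "'a::euclidean_space => real" where
 "decay x = 1 / (1 + norm x) ^ (DIM('a) + 1)"

lemma decay_measurable [measurable]: "decay \<in> borel_measurable borel" unfolding decay_def[abs_def] by measurable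
lemma decay_pos: "decay x > 0" by (simp add: decay_def add_pos_nonneg)
lemma decay_minus: "decay (- x) = decay x" by (simp add: decay_def)
lemma integrable_decay: "integrable lborel decay"
 by (rule integrableI_nonneg) (use nn_integral_decay in \<open>auto simp: decay_def add_nonneg_nonneg\<close>)

definition decay_mass :: "'a::euclidean_space itself => real" where
 "decay_mass _ = (LINT x|lborel. decay (x::'a))"

lemma decay_mass: "(\<integral>\<^sup>+x. ennreal (decay (x::'a::euclidean_space)) \<partial>lborel) = ennreal (decay_mass TYPE('a))"
 unfolding decay_mass_def by (rule nn_integral_eq_integral[OF integrable_decay]) (simp add: less_imp_le decay_pos)

lemma decay_mass_nonneg: "decay_mass TYPE('a::euclidean_space) >= 0"
 unfolding decay_mass_def by (intro integral_nonneg_AE) (simp add: less_imp_le decay_pos)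

lemma nn_decay_shift: "(\<integral>\<^sup>+y. ennreal (decay (x - y)) \<partial>lborel) = ennreal (decay_mass TYPE('a))" for x :: "'a::euclidean_space"
proof -
 have "(\<integral>\<^sup>+y. ennreal (decay (x - y)) \<partial>lborel) = (\<integral>\<^sup>+y. ennreal (decay (- x + y)) \<partial>lborel)"
  by (intro nn_integral_cong) (metis decay_minus minus_diff_eq uminus_add_conv_diff)
 also have "\<dots> = (\<integral>\<^sup>+y. ennreal (decay (y::'a)) \<partial>lborel)"
  by (rule nn_integral_translate[of "%y. ennreal (decay y)"]) measurable
 finally show ?thesis by (simp add: decay_mass)
qed

text \<open>A kernel dominated by an integrable convolution kernel is bounded on square-integrable functions,
by the Cauchy-Schwarz inequality with the kernel as weight.\<close>

lemma schur:
 fixes g :: "'a::euclidean_space => complex"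
 assumes [measurable]: "g \<in> borel_measurable borel"
 shows "(\<integral>\<^sup>+x. \<integral>\<^sup>+y. ennreal (cmod (g x) * cmod (g y) * decay (x - y)) \<partial>lborel \<partial>lborel)
  <= ennreal (decay_mass TYPE('a)) * (nn_sq (%x. g x))"
proof -
 have pw: "ennreal (cmod (g x) * cmod (g y) * decay (x - y))
  <= ennreal (1/2) * (ennreal ((cmod (g x))\<^sup>2) * ennreal (decay (x - y)) + ennreal ((cmod (g y))\<^sup>2) * ennreal (decay (y - x)))" for x y
 proof -
  have "2 * (cmod (g x) * cmod (g y)) <= (cmod (g x))\<^sup>2 + (cmod (g y))\<^sup>2"
   using sum_squares_bound[of "cmod (g x)" "cmod (g y)"] by simp
  then have "cmod (g x) * cmod (g y) * decay (x - y) <= (1/2) * ((cmod (g x))\<^sup>2 + (cmod (g y))\<^sup>2) * decay (x - y)"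
   by (intro mult_right_mono) (auto simp: less_imp_le decay_pos)
  also have "\<dots> = (1/2) * ((cmod (g x))\<^sup>2 * decay (x - y) + (cmod (g y))\<^sup>2 * decay (y - x))"
   using decay_minus[of "x - y"] by (simp add: algebra_simps)
  finally have "ennreal (cmod (g x) * cmod (g y) * decay (x - y)) <= ennreal ((1/2) * ((cmod (g x))\<^sup>2 * decay (x - y) + (cmod (g y))\<^sup>2 * decay (y - x)))"
   by (rule ennreal_leI)
  moreover have "ennreal ((1/2) * (p + q)) = ennreal (1/2) * (ennreal p + ennreal q)" if "p >= 0" "q >= 0" for p q :: real
   by (subst ennreal_plus[OF that, symmetric], rule ennreal_mult) (use that in auto)
  ultimately show ?thesis by (simp only: ennreal_mult zero_le_power2 less_imp_le[OF decay_pos] mult_nonneg_nonneg)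
 qed
 let ?X = "ennreal (decay_mass TYPE('a)) * (nn_sq (%x. g x))"
 have A: "(\<integral>\<^sup>+x. \<integral>\<^sup>+y. ennreal ((cmod (g x))\<^sup>2) * ennreal (decay (x - y)) \<partial>lborel \<partial>lborel) = ?X"
  by (simp add: nn_integral_cmult nn_decay_shift nn_integral_multc mult.commute)
 have B: "(\<integral>\<^sup>+x. \<integral>\<^sup>+y. ennreal ((cmod (g y))\<^sup>2) * ennreal (decay (y - x)) \<partial>lborel \<partial>lborel) = ?X"
  unfolding A[symmetric] by (rule lborel_pair.Fubini') measurable
 have "(\<integral>\<^sup>+x. \<integral>\<^sup>+y. ennreal (cmod (g x) * cmod (g y) * decay (x - y)) \<partial>lborel \<partial>lborel)
  <= (\<integral>\<^sup>+x. \<integral>\<^sup>+y. ennreal (1/2) * (ennreal ((cmod (g x))\<^sup>2) * ennreal (decay (x - y)) + ennreal ((cmod (g y))\<^sup>2) * ennreal (decay (y - x))) \<partial>lborel \<partial>lborel)"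
  by (intro nn_integral_mono pw)
 also have "\<dots> = ennreal (1/2) * ((\<integral>\<^sup>+x. \<integral>\<^sup>+y. ennreal ((cmod (g x))\<^sup>2) * ennreal (decay (x - y)) \<partial>lborel \<partial>lborel)
   + (\<integral>\<^sup>+x. \<integral>\<^sup>+y. ennreal ((cmod (g y))\<^sup>2) * ennreal (decay (y - x)) \<partial>lborel \<partial>lborel))"
  by (simp add: nn_integral_cmult nn_integral_add)
 also have "\<dots> = ennreal (1/2) * (?X + ?X)" unfolding A B ..
 also have "\<dots> = (ennreal (1/2) + ennreal (1/2)) * ?X" by (simp only: distrib_left distrib_right)
 also have "ennreal (1/2) + ennreal (1/2) = ennreal (1/2 + 1/2)" by (rule ennreal_plus[symmetric]) auto
 finally show ?thesis by simp
qed

lemma nn_integral_truncate: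
 fixes f :: "'a::euclidean_space => ennreal"
 assumes [measurable]: "f \<in> borel_measurable borel"
  and "\<And>n::nat. (\<integral>\<^sup>+x. f x * indicator (cball 0 (real n)) x \<partial>lborel) <= B"
 shows "(\<integral>\<^sup>+x. f x \<partial>lborel) <= B"
proof -
 have "(\<integral>\<^sup>+x. f x \<partial>lborel) = (\<integral>\<^sup>+x. (SUP n::nat. f x * indicator (cball 0 (real n)) x) \<partial>lborel)"
 proof (intro nn_integral_cong antisym)
  fix x :: 'a
  obtain n :: nat where "norm x <= real n" using real_arch_simple by blast
  then show "f x <= (SUP n::nat. f x * indicator (cball 0 (real n)) x)" by (intro SUP_upper2[of n]) auto
  show "(SUP n::nat. f x * indicator (cball 0 (real n)) x) <= f x" by (intro SUP_least) (auto simp: indicator_def)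
 qed
 also have "\<dots> = (SUP n::nat. \<integral>\<^sup>+x. f x * indicator (cball 0 (real n)) x \<partial>lborel)"
  by (intro nn_integral_monotone_convergence_SUP) (auto simp: incseq_def le_fun_def indicator_def)
 also have "\<dots> <= B" by (intro SUP_least assms)
 finally show ?thesis .
qed

lemma nn_integral_scale:
 fixes f :: "'a::euclidean_space => ennreal"
 assumes [measurable]: "f \<in> borel_measurable borel" and c: "c > 0"
 shows "(\<integral>\<^sup>+x. f x \<partial>lborel) = ennreal (c ^ DIM('a)) * (\<integral>\<^sup>+x. f (c *\<^sub>R x) \<partial>lborel)"
proof -
 have "(\<integral>\<^sup>+x. f x \<partial>lborel) = (\<integral>\<^sup>+x. f x \<partial>density (distr lborel borel (%x. 0 + c *\<^sub>R x)) (%_. \<bar>c\<bar> ^ DIM('a)))"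
  using lborel_affine[of c "0::'a"] c by simp
 also have "\<dots> = ennreal (c ^ DIM('a)) * (\<integral>\<^sup>+x. f (c *\<^sub>R x) \<partial>lborel)"
  using c by (simp add: nn_integral_density nn_integral_distr nn_integral_cmult)
 finally show ?thesis .
qed

lemma integral_scale:
 fixes f :: "'a::euclidean_space => complex"
 assumes [measurable]: "f \<in> borel_measurable borel" and c: "c > 0"
 shows "(LINT x|lborel. f x) = of_real (c ^ DIM('a)) * (LINT x|lborel. f (c *\<^sub>R x))"
proof -
 have "(LINT x|lborel. f x) = (LINT x|density (distr lborel borel (%x. 0 + c *\<^sub>R x)) (%_. \<bar>c\<bar> ^ DIM('a)). f x)"
  using lborel_affine[of c "0::'a"] c by simp
 also have "\<dots> = of_real (c ^ DIM('a)) * (LINT x|lborel. f (c *\<^sub>R x))"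
  using c by (simp add: integral_density integral_distr scaleR_conv_of_real)
 finally show ?thesis .
qed

text \<open>Bounded Borel functions of bounded support: every integral over such functions converges
absolutely, so Fubini and integration by parts apply to them without further conditions.\<close>

definition bbs :: "('a::euclidean_space => complex) => bool" where
 "bbs g \<longleftrightarrow> g \<in> borel_measurable borel \<and> (\<exists>C. \<forall>x. cmod (g x) <= C) \<and> (\<exists>R. \<forall>x. norm x > R --> g x = 0)"

lemma bbs_measurable: "bbs g ==> g \<in> borel_measurable borel" by (simp add: bbs_def)

lemma bbs_integrable: "bbs g ==> integrable lborel g"
 unfolding bbs_def using integrable_bounded_support by blast

lemma bbs_mult:
 assumes "bbs g" and m: "f \<in> borel_measurable borel" and C: "\<And>x. cmod (f x) <= C"
 shows "bbs (%x. f x * g x)"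
proof -
 obtain D R where g: "g \<in> borel_measurable borel" "\<And>x. cmod (g x) <= D" "\<And>x. norm x > R ==> g x = 0"
  using assms(1) unfolding bbs_def by blast
 have "cmod (f x * g x) <= C * D" for x
  unfolding norm_mult by (intro mult_mono C g) (auto intro: order_trans[OF norm_ge_zero C])
 then show ?thesis unfolding bbs_def using g m by (intro conjI exI[of _ "C * D"] exI[of _ R]) auto
qed

lemma bbs_pair:
 fixes g :: "'a::euclidean_space => complex" and h :: "'b::euclidean_space => complex"
 assumes "bbs g" "bbs h" shows "bbs (%(x, y). g x * h y)"
proof -
 obtain C R where g: "g \<in> borel_measurable borel" "\<And>x. cmod (g x) <= C" "\<And>x. norm x > R ==> g x = 0"
  using assms(1) unfolding bbs_def by blast
 obtain D S where h: "h \<in> borel_measurable borel" "\<And>x. cmod (h x) <= D" "\<And>x. norm x > S ==> h x = 0"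
  using assms(2) unfolding bbs_def by blast
 note [measurable] = g(1) h(1)
 have "(%(x, y). g x * h y) \<in> borel_measurable (borel \<Otimes>\<^sub>M borel)" by measurable
 moreover have "cmod (g x * h y) <= C * D" for x y
  unfolding norm_mult by (intro mult_mono g h) (auto intro: order_trans[OF norm_ge_zero g(2)])
 moreover have "g x * h y = 0" if "norm (x, y) > \<bar>R\<bar> + \<bar>S\<bar>" for x y
 proof -
  have "norm x + norm y >= norm (x, y)" by (simp add: norm_Pair_le)
  then have "norm x > R \<or> norm y > S" using that by linarith
  then show ?thesis using g(3) h(3) by auto
 qed
 ultimately show ?thesis unfolding bbs_def borel_prod by (intro conjI exI[of _ "C * D"] exI[of _ "\<bar>R\<bar> + \<bar>S\<bar>"]) auto
qed

lemma bbs_const_smooth: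
 assumes "smooth f" "\<And>x. norm x > R ==> f x = 0" shows "bbs f"
 unfolding bbs_def using smooth_measurable[OF assms(1)] smooth_compact_support_bounded[OF assms] assms(2) by blast

lemma bbs_bump: "bbs (%x. of_real (bump x))"
 by (rule bbs_const_smooth[of _ 1]) (auto intro!: smooth_linear[OF bounded_linear_of_real smooth_bump] simp: bump_outside)

section \<open>Almost orthogonality of oscillating kernels\<close>

lemma cnj_measurable [measurable]: "cnj \<in> borel_measurable borel"
 by (intro borel_measurable_continuous_onI continuous_intros)

lemma bbs_cnj: "bbs g ==> bbs (%x. cnj (g x))"
 unfolding bbs_def using measurable_compose[OF _ cnj_measurable, of g] by auto

lemma lipschitz_snd:
 fixes f :: "'a::euclidean_space \<times> 'b::euclidean_space => real"
 assumes f: "smooth f" and b: "\<And>c. c \<in> Basis ==> \<exists>C. \<forall>z. \<bar>dd (inc2 c) f z\<bar> <= C"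
 obtains C where "C >= 0" "\<And>y \<zeta> \<eta>. \<bar>f (y, \<zeta>) - f (y, \<eta>)\<bar> <= C * norm (\<zeta> - \<eta>)"
proof -
 obtain C where C: "\<And>c z. c \<in> Basis ==> \<bar>dd (inc2 c) f z\<bar> <= C c" using b by metis
 let ?K = "\<Sum>c\<in>Basis. C c"
 have C0: "C c >= 0" if "c \<in> Basis" for c using C[OF that, of undefined] by linarith
 have "\<bar>f (y, \<zeta>) - f (y, \<eta>)\<bar> <= ?K * norm (\<zeta> - \<eta>)" for y \<zeta> \<eta>
 proof -
  have d: "(%\<zeta>. f (y, \<zeta>)) differentiable (at z)" for z by (rule smooth_differentiable[OF smooth_slice2[OF f]])
  obtain t where "0 < t" "t < 1"
   and t: "norm (f (y, \<eta> + (\<zeta> - \<eta>)) - f (y, \<eta>)) <= norm (dd (\<zeta> - \<eta>) (%\<zeta>. f (y, \<zeta>)) (\<eta> + t *\<^sub>R (\<zeta> - \<eta>)))"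
   by (rule mvt_dd[where x=\<eta> and v="\<zeta> - \<eta>", OF d])
  note t
  also have "dd (\<zeta> - \<eta>) (%\<zeta>. f (y, \<zeta>)) (\<eta> + t *\<^sub>R (\<zeta> - \<eta>)) = (\<Sum>c\<in>Basis. ((\<zeta> - \<eta>) \<bullet> c) *\<^sub>R dd (inc2 c) f (y, \<eta> + t *\<^sub>R (\<zeta> - \<eta>)))"
   by (rule trans[OF dd_expand[OF d]], rule sum.cong) (use ddl_slice2[OF f, of "[_]"] in auto)
  also have "norm \<dots> <= (\<Sum>c\<in>Basis. norm (\<zeta> - \<eta>) * C c)"
   by (intro sum_norm_le) (auto simp: abs_mult intro!: mult_mono Basis_le_norm C C0)
  also have "\<dots> = ?K * norm (\<zeta> - \<eta>)" by (simp add: sum_distrib_right mult.commute)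
  finally show ?thesis by simp
 qed
 then show thesis using that[of ?K] C0 by (simp add: sum_nonneg)
qed

lemma symb_unit_bound: "symb UNIV (%_::unit. f) ==> \<exists>C. \<forall>z. norm (f z) <= C"
 using symb_iff[of UNIV "%_::unit. f"] by auto

lemma dd_comm_inc:
 fixes f :: "'a::euclidean_space \<times> 'b::euclidean_space => real"
 assumes "smooth f" "b \<in> Basis" "c \<in> Basis"
 shows "dd (inc1 b) (dd (inc2 c) f) = dd (inc2 c) (dd (inc1 b) f)"
 by (rule clairaut) (use assms in \<open>auto intro: Basis_inc\<close>)

text \<open>The difference in the second variable is controlled by mixed derivatives alone. Dividing by one
plus the distance gives a phase gradient that is uniformly bounded with all derivatives although
the phase itself may grow.\<close>

lemma symb_difference_quotient:
 fixes f :: "'a::euclidean_space \<times> 'b::euclidean_space => real"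
 assumes "smooth f" "\<And>c. c \<in> Basis ==> symb UNIV (%_::unit. dd (inc2 c) f)"
 shows "symb UNIV (%p y. (f (fst p + y, fst (snd p)) - f (fst p + y, snd (snd p))) / (1 + norm (fst (snd p) - snd (snd p))))"
proof -
 have "symb_k k UNIV (%p y. (f (fst p + y, fst (snd p)) - f (fst p + y, snd (snd p))) / (1 + norm (fst (snd p) - snd (snd p))))"
  if "smooth f" "\<And>c. c \<in> Basis ==> symb UNIV (%_::unit. dd (inc2 c) f)" for k and f :: "'a \<times> 'b => real"
  using that
 proof (induction k arbitrary: f)
  case 0
  obtain C where C: "C >= 0" "\<And>y \<zeta> \<eta>. \<bar>f (y, \<zeta>) - f (y, \<eta>)\<bar> <= C * norm (\<zeta> - \<eta>)"
   using lipschitz_snd[OF 0(1)] symb_unit_bound[OF 0(2)] by (metis real_norm_def)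
  have "norm ((f (y, \<zeta>) - f (y, \<eta>)) / (1 + norm (\<zeta> - \<eta>))) <= C" for y \<zeta> \<eta>
   using C(2)[of y \<zeta> \<eta>] C(1) by (simp add: divide_le_eq add_pos_nonneg abs_of_pos) (smt (verit) mult_left_mono mult_cancel_left2 norm_ge_zero distrib_left mult.commute)
  then show ?case by auto
 next
  case (Suc k)
  let ?F = "%f p y. (f (fst p + y, fst (snd p)) - f (fst p + y, snd (snd p))) / (1 + norm (fst (snd p) - snd (snd p)))"
  obtain C where C: "C >= 0" "\<And>y \<zeta> \<eta>. \<bar>f (y, \<zeta>) - f (y, \<eta>)\<bar> <= C * norm (\<zeta> - \<eta>)"
   using lipschitz_snd[OF Suc.prems(1)] symb_unit_bound[OF Suc.prems(2)] by (metis real_norm_def)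
  have 1: "norm ((f (y, \<zeta>) - f (y, \<eta>)) / (1 + norm (\<zeta> - \<eta>))) <= C" for y \<zeta> \<eta>
   using C(2)[of y \<zeta> \<eta>] C(1) by (simp add: divide_le_eq add_pos_nonneg abs_of_pos) (smt (verit) mult_left_mono mult_cancel_left2 norm_ge_zero distrib_left mult.commute)
  have d: "((%y. f (w + y, \<zeta>)) has_derivative (%v. dd (inc1 v) f (w + y, \<zeta>))) (at y)" for w y \<zeta>
   by (rule has_derivative_compose[OF _ dd_has_derivative[OF smooth_differentiable[OF Suc.prems(1)]], of "%y. (w + y, \<zeta>)" inc1 y UNIV])
    (auto intro!: derivative_eq_intros)
  have D: "(?F f p has_derivative (%v. ?F (dd (inc1 v) f) p y)) (at y)" for p :: "'a \<times> 'b \<times> 'b" and y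
   by (auto intro!: derivative_eq_intros d simp: divide_inverse)
  have e: "dd b (?F f p) = ?F (dd (inc1 b) f) p" for b and p :: "'a \<times> 'b \<times> 'b"
   by (rule ext, rule dd_eq[OF D])
  have 2: "symb_k k UNIV (%p. dd b (?F f p))" if b: "b \<in> Basis" for b
   unfolding e
  proof (rule Suc.IH)
   show "smooth (dd (inc1 b) f)" by (rule smooth_dd[OF Suc.prems(1) Basis_inc(1)[OF b]])
   show "symb UNIV (%_::unit. dd (inc2 c) (dd (inc1 b) f))" if "c \<in> Basis" for c
    using symb_dd[OF Suc.prems(2)[OF that] Basis_inc(1)[OF b]] by (simp add: dd_comm_inc[OF Suc.prems(1) b that])
  qed
  have 3: "?F f p differentiable (at y)" for p y using D differentiable_def by blast
  show ?case unfolding symb_k.simps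
   by (intro conjI allI ballI 2 3 exI[of _ C] impI 1)
 qed
 then show ?thesis using assms by (simp add: symb_def)
qed

locale phase =
 fixes \<Phi> :: "'a::euclidean_space \<times> 'b::euclidean_space => real"
 assumes smooth: "smooth \<Phi>"
  and mixed: "\<And>b c. b \<in> Basis ==> c \<in> Basis ==> symb UNIV (%_::unit. dd (inc1 b) (dd (inc2 c) \<Phi>))"
  and expanding: "\<exists>\<kappa>>0. \<forall>y \<zeta> \<eta>. \<kappa> * (norm (\<zeta> - \<eta>))\<^sup>2 <= (\<Sum>b\<in>Basis. (dd (inc1 b) \<Phi> (y, \<zeta>) - dd (inc1 b) \<Phi> (y, \<eta>))\<^sup>2)"
begin

lemma meas [measurable]: "\<Phi> \<in> borel_measurable borel" by (rule smooth_measurable[OF smooth])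

lemma smooth_shift: "smooth (%y. \<Phi> (w + y, \<zeta>))"
 by (rule smooth_compose[OF smooth, of "%y. (w + y, \<zeta>)"]) (intro smooth_intros)

lemma dd_shift: "dd b (%y. \<Phi> (w + y, \<zeta>)) y = dd (inc1 b) \<Phi> (w + y, \<zeta>)"
 by (rule dd_eq[where f'="%v. dd (inc1 v) \<Phi> (w + y, \<zeta>)"],
   rule has_derivative_compose[OF _ dd_has_derivative[OF smooth_differentiable[OF smooth]], of "%y. (w + y, \<zeta>)" inc1 y UNIV])
  (auto intro!: derivative_eq_intros)

text \<open>Expansion of the gradient difference makes the phase nonstationary in the window as soon as the
two frequencies are apart.\<close>

lemma kernel_decay:
 obtains C where "C >= 0" "\<And>w \<zeta> \<eta>. cmod (LINT y|lborel. cis (\<Phi> (w + y, \<zeta>) - \<Phi> (w + y, \<eta>)) * of_real ((bump y)\<^sup>2)) <= C * decay (\<zeta> - \<eta>)"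
proof -
 let ?N = "DIM('b) + 1"
 define t where "t p y = \<Phi> (fst p + y, fst (snd p)) - \<Phi> (fst p + y, snd (snd p))" for p :: "'a \<times> 'b \<times> 'b" and y
 define r where "r p = 1 + norm (fst (snd p) - snd (snd p))" for p :: "'a \<times> 'b \<times> 'b"
 define P where "P = {p :: 'a \<times> 'b \<times> 'b. norm (fst (snd p) - snd (snd p)) >= 1}"
 obtain \<kappa> where \<kappa>: "\<kappa> > 0" "\<And>y \<zeta> \<eta>. \<kappa> * (norm (\<zeta> - \<eta>))\<^sup>2 <= (\<Sum>b\<in>Basis. (dd (inc1 b) \<Phi> (y, \<zeta>) - dd (inc1 b) \<Phi> (y, \<eta>))\<^sup>2)"
  using expanding by blast
 have ddt: "dd b (t p) = (%y. dd (inc1 b) \<Phi> (fst p + y, fst (snd p)) - dd (inc1 b) \<Phi> (fst p + y, snd (snd p)))" for b p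
 proof
  fix y
  have "((%y. \<Phi> (fst p + y, fst (snd p)) - \<Phi> (fst p + y, snd (snd p))) has_derivative
   (%v. dd v (%y. \<Phi> (fst p + y, fst (snd p))) y - dd v (%y. \<Phi> (fst p + y, snd (snd p))) y)) (at y)"
   by (intro has_derivative_diff dd_has_derivative smooth_differentiable smooth_shift)
  from dd_eq[OF this, of b] show "dd b (t p) y = dd (inc1 b) \<Phi> (fst p + y, fst (snd p)) - dd (inc1 b) \<Phi> (fst p + y, snd (snd p))"
   by (simp add: dd_shift t_def[abs_def])
 qed
 interpret nonstationary Basis "P \<times> UNIV" t r "\<kappa> / 4"
 proof
  show "smooth (t p)" for p unfolding t_def by (intro smooth_diff smooth_shift)
  show "symb (P \<times> UNIV) (%p y. dd b (t p) y / r p)" if b: "b \<in> Basis" for b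
   unfolding ddt r_def
   by (rule symb_mono[OF symb_difference_quotient[OF smooth_dd[OF smooth Basis_inc(1)[OF b]]]])
    (use mixed[OF b] b in \<open>auto simp: dd_comm_inc[OF smooth]\<close>)
  show "\<kappa> / 4 * (r p)\<^sup>2 <= (\<Sum>b\<in>Basis. (dd b (t p) y)\<^sup>2)" if "(p, y) \<in> P \<times> UNIV" for p y
  proof -
   have "r p <= 2 * norm (fst (snd p) - snd (snd p))" using that by (simp add: P_def r_def)
   then have "(r p)\<^sup>2 <= (2 * norm (fst (snd p) - snd (snd p)))\<^sup>2" by (intro power_mono) (auto simp: r_def add_nonneg_nonneg)
   then have "\<kappa> / 4 * (r p)\<^sup>2 <= \<kappa> * (norm (fst (snd p) - snd (snd p)))\<^sup>2" using \<kappa>(1) by (simp add: power_mult_distrib)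
   also have "\<dots> <= (\<Sum>b\<in>Basis. (dd b (t p) y)\<^sup>2)" unfolding ddt by (rule \<kappa>(2))
   finally show ?thesis .
  qed
 qed (use \<kappa> in \<open>auto simp: r_def\<close>)
 have fs: "symb (P \<times> UNIV) (%p y. complex_of_real ((bump y)\<^sup>2))"
  unfolding power2_eq_square by (intro symb_of_real symb_mult symb_mono[OF symb_bump]) auto
 obtain C where C: "C >= 0" "\<And>p. p \<in> P ==> norm (LINT y|lborel. cis (t p y) * of_real ((bump y)\<^sup>2)) <= C / r p ^ ?N"
  by (rule nonstationary_decay[OF fs, of P 1 ?N]) (auto simp: bump_outside)
 define D where "D = (LINT y|lborel. (bump (y::'a))\<^sup>2)"
 have bD: "norm (LINT y|lborel. cis (t p y) * of_real ((bump y)\<^sup>2)) <= D" for p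
  unfolding D_def by (rule order_trans[OF integral_norm_bound]) (simp add: norm_mult norm_power)
 have D0: "D >= 0" unfolding D_def by simp
 show thesis
 proof (rule that[of "C + D * 2 ^ ?N"])
  fix w :: 'a and \<zeta> \<eta> :: 'b
  let ?p = "(w, \<zeta>, \<eta>)"
  have dec: "decay (\<zeta> - \<eta>) = 1 / r ?p ^ ?N" by (simp add: decay_def r_def)
  have "norm (LINT y|lborel. cis (t ?p y) * of_real ((bump y)\<^sup>2)) <= (C + D * 2 ^ ?N) * decay (\<zeta> - \<eta>)"
  proof (cases "?p \<in> P")
   case True
   have "C / r ?p ^ ?N <= (C + D * 2 ^ ?N) * decay (\<zeta> - \<eta>)"
    unfolding dec using D0 r[of ?p] by (simp add: divide_right_mono)
   then show ?thesis using C(2)[OF True] by linarith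
  next
   case False
   then have "r ?p <= 2" by (simp add: P_def r_def)
   then have "r ?p ^ ?N <= 2 ^ ?N" using r[of ?p] by (intro power_mono) auto
   then have "1 <= 2 ^ ?N * decay (\<zeta> - \<eta>)" unfolding dec using r[of ?p] by (simp add: le_divide_eq)
   then have "D * 1 <= D * (2 ^ ?N * decay (\<zeta> - \<eta>))" using D0 by (rule mult_left_mono)
   moreover have "0 <= C * decay (\<zeta> - \<eta>)" using C(1) decay_pos[of "\<zeta> - \<eta>"] by simp
   ultimately show ?thesis using bD[of ?p] by (simp add: algebra_simps)
  qed
  then show "cmod (LINT y|lborel. cis (\<Phi> (w + y, \<zeta>) - \<Phi> (w + y, \<eta>)) * of_real ((bump y)\<^sup>2)) <= (C + D * 2 ^ ?N) * decay (\<zeta> - \<eta>)"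
   by (simp add: t_def)
 qed (use C D0 in simp)
qed

text \<open>Squaring out the integral produces the kernel that decays in the difference of the two
frequencies, to which the Schur test applies.\<close>

lemma adjoint_L2_bound:
 obtains C where "C > 0" "\<And>w g. bbs g ==>
   (\<integral>\<^sup>+y. ennreal ((bump y)\<^sup>2 * (cmod (LINT \<zeta>|lborel. cis (\<Phi> (w + y, \<zeta>)) * g \<zeta>))\<^sup>2) \<partial>lborel)
    <= ennreal C * (nn_sq (%\<zeta>. g \<zeta>))"
proof -
 obtain C where C: "C >= 0" "\<And>w \<zeta> \<eta>. cmod (LINT y|lborel. cis (\<Phi> (w + y, \<zeta>) - \<Phi> (w + y, \<eta>)) * of_real ((bump y)\<^sup>2)) <= C * decay (\<zeta> - \<eta>)"
  using kernel_decay by blast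
 let ?K = "C * decay_mass TYPE('b) + 1"
 have "(\<integral>\<^sup>+y. ennreal ((bump y)\<^sup>2 * (cmod (LINT \<zeta>|lborel. cis (\<Phi> (w + y, \<zeta>)) * g \<zeta>))\<^sup>2) \<partial>lborel)
    <= ennreal ?K * (nn_sq (%\<zeta>. g \<zeta>))" if g: "bbs g" for w g
 proof -
  have [measurable]: "g \<in> borel_measurable borel" using g by (rule bbs_measurable)
  define G where "G y = (LINT \<zeta>|lborel. cis (\<Phi> (w + y, \<zeta>)) * g \<zeta>)" for y
  define f where "f y z = cis (\<Phi> (w + y, fst z) - \<Phi> (w + y, snd z)) * (of_real ((bump y)\<^sup>2) * (g (fst z) * cnj (g (snd z))))" for y z
  have cg: "bbs (%\<zeta>. cnj (g \<zeta>))" by (rule bbs_cnj[OF g])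
  have b2: "bbs (%y. of_real ((bump (y::'a))\<^sup>2) :: complex)"
   using bbs_mult[OF bbs_bump, where f="%y. of_real (bump y)" and C=1] by (simp add: power2_eq_square bump_le_1 bump_ge_0)
  have bf: "bbs (%(y, z). f y z)"
  proof -
   have "bbs (%x::'a \<times> 'b \<times> 'b. cis (\<Phi> (w + fst x, fst (snd x)) - \<Phi> (w + fst x, snd (snd x))) * (case x of (y, z) => of_real ((bump y)\<^sup>2) * (case z of (\<zeta>, \<eta>) => g \<zeta> * cnj (g \<eta>))))"
   proof (rule bbs_mult[OF bbs_pair[OF b2 bbs_pair[OF g cg]], where C=1])
    have "(%x::'a \<times> 'b \<times> 'b. cis (\<Phi> (w + fst x, fst (snd x)) - \<Phi> (w + fst x, snd (snd x)))) \<in> borel_measurable (borel \<Otimes>\<^sub>M borel \<Otimes>\<^sub>M borel)"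
     by measurable
    then show "(%x::'a \<times> 'b \<times> 'b. cis (\<Phi> (w + fst x, fst (snd x)) - \<Phi> (w + fst x, snd (snd x)))) \<in> borel_measurable borel"
     by (simp add: borel_prod)
   qed simp
   then show ?thesis by (simp add: f_def case_prod_unfold)
  qed
  have int: "integrable (lborel \<Otimes>\<^sub>M lborel) (%(y, z). f y z)"
   using bbs_integrable[OF bf] by (simp add: lborel_prod)
  have bz: "bbs (%(\<zeta>, \<eta>). (cis (\<Phi> (w + y, \<zeta>)) * g \<zeta>) * cnj (cis (\<Phi> (w + y, \<eta>)) * g \<eta>))" for y
   by (rule bbs_pair[of "%\<zeta>. cis (\<Phi> (w + y, \<zeta>)) * g \<zeta>" "%\<eta>. cnj (cis (\<Phi> (w + y, \<eta>)) * g \<eta>)"])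
    (use bbs_mult[OF g, where f="%\<zeta>. cis (\<Phi> (w + y, \<zeta>))" and C=1] bbs_mult[OF cg, where f="%\<zeta>. cnj (cis (\<Phi> (w + y, \<zeta>)))" and C=1] in \<open>auto\<close>)
  have GG: "(LINT z|lborel. f y z) = of_real ((bump y)\<^sup>2 * (cmod (G y))\<^sup>2)" for y
  proof -
   have "(LINT z|lborel. f y z) = of_real ((bump y)\<^sup>2) * (LINT z|(lborel \<Otimes>\<^sub>M lborel). (case z of (\<zeta>, \<eta>) => (cis (\<Phi> (w + y, \<zeta>)) * g \<zeta>) * cnj (cis (\<Phi> (w + y, \<eta>)) * g \<eta>)))"
    unfolding lborel_prod integral_mult_right_zero[symmetric]
    by (intro Bochner_Integration.integral_cong refl) (auto simp: f_def cis_cnj cis_mult algebra_simps split: prod.splits)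
   also have "(LINT z|(lborel \<Otimes>\<^sub>M lborel). (case z of (\<zeta>, \<eta>) => (cis (\<Phi> (w + y, \<zeta>)) * g \<zeta>) * cnj (cis (\<Phi> (w + y, \<eta>)) * g \<eta>)))
    = (LINT \<zeta>|lborel. LINT \<eta>|lborel. (cis (\<Phi> (w + y, \<zeta>)) * g \<zeta>) * cnj (cis (\<Phi> (w + y, \<eta>)) * g \<eta>))"
    using bbs_integrable[OF bz] by (subst lborel_pair.integral_fst'[symmetric]) (simp_all add: lborel_prod)
   also have "\<dots> = G y * (LINT \<eta>|lborel. cnj (cis (\<Phi> (w + y, \<eta>)) * g \<eta>))"
    by (simp add: G_def del: complex_cnj_mult)
   also have "(LINT \<eta>|lborel. cnj (cis (\<Phi> (w + y, \<eta>)) * g \<eta>)) = cnj (G y)"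
    unfolding G_def by (rule Bochner_Integration.integral_cnj)
   finally show ?thesis using complex_norm_square[of "G y"] by simp
  qed
  have iG: "integrable lborel (%y. complex_of_real ((bump y)\<^sup>2 * (cmod (G y))\<^sup>2))"
   using lborel_pair.integrable_fst'[OF int] by (simp add: GG)
  then have iG': "integrable lborel (%y. (bump y)\<^sup>2 * (cmod (G y))\<^sup>2)" by (simp only: complex_of_real_integrable_eq)
  have e: "complex_of_real (LINT y|lborel. (bump y)\<^sup>2 * (cmod (G y))\<^sup>2) = (LINT z|lborel. LINT y|lborel. f y z)"
   unfolding lborel_pair.Fubini_integral[OF int] GG by (rule integral_complex_of_real[symmetric])
  have "(\<integral>\<^sup>+y. ennreal ((bump y)\<^sup>2 * (cmod (G y))\<^sup>2) \<partial>lborel) = ennreal (LINT y|lborel. (bump y)\<^sup>2 * (cmod (G y))\<^sup>2)"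
   by (rule nn_integral_eq_integral[OF iG']) auto
  also have "(LINT y|lborel. (bump y)\<^sup>2 * (cmod (G y))\<^sup>2) = cmod (LINT z|lborel. LINT y|lborel. f y z)"
   unfolding e[symmetric] norm_of_real by (rule abs_of_nonneg[symmetric]) simp
  also have "ennreal \<dots> <= (\<integral>\<^sup>+z. norm (LINT y|lborel. f y z) \<partial>lborel)"
   by (rule integral_norm_bound_ennreal[OF lborel_pair.integrable_snd[OF int]])
  also have "\<dots> <= (\<integral>\<^sup>+z. ennreal C * ennreal (cmod (g (fst z)) * cmod (g (snd z)) * decay (fst z - snd z)) \<partial>lborel)"
  proof (intro nn_integral_mono)
   fix z :: "'b \<times> 'b"
   have "(LINT y|lborel. f y z) = (LINT y|lborel. cis (\<Phi> (w + y, fst z) - \<Phi> (w + y, snd z)) * of_real ((bump y)\<^sup>2)) * (g (fst z) * cnj (g (snd z)))"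
    by (simp add: f_def mult.assoc[symmetric])
   then have "norm (LINT y|lborel. f y z) <= C * decay (fst z - snd z) * (cmod (g (fst z)) * cmod (g (snd z)))"
    using C(2)[of w "fst z" "snd z"] by (simp add: norm_mult mult_right_mono)
   also have "\<dots> = C * (cmod (g (fst z)) * cmod (g (snd z)) * decay (fst z - snd z))" by simp
   finally show "ennreal (norm (LINT y|lborel. f y z)) <= ennreal C * ennreal (cmod (g (fst z)) * cmod (g (snd z)) * decay (fst z - snd z))"
    by (subst ennreal_mult[symmetric]) (auto intro!: ennreal_leI simp: C less_imp_le decay_pos)
  qed
  also have "\<dots> = ennreal C * (\<integral>\<^sup>+\<zeta>. \<integral>\<^sup>+\<eta>. ennreal (cmod (g \<zeta>) * cmod (g \<eta>) * decay (\<zeta> - \<eta>)) \<partial>lborel \<partial>lborel)"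
  proof -
   have m: "(%z. ennreal (cmod (g (fst z)) * cmod (g (snd z)) * decay (fst z - snd z))) \<in> borel_measurable (lborel \<Otimes>\<^sub>M lborel)"
    by measurable
   show ?thesis using lborel.nn_integral_fst[OF m] m by (simp add: lborel_prod nn_integral_cmult)
  qed
  also have "\<dots> <= ennreal C * (ennreal (decay_mass TYPE('b)) * (nn_sq (%\<zeta>. g \<zeta>)))"
   by (intro mult_left_mono schur) auto
  also have "\<dots> = ennreal (C * decay_mass TYPE('b)) * (nn_sq (%\<zeta>. g \<zeta>))"
   by (simp add: mult.assoc ennreal_mult C decay_mass_nonneg)
  also have "\<dots> <= ennreal ?K * (nn_sq (%\<zeta>. g \<zeta>))"
   by (intro mult_right_mono ennreal_leI) auto
  finally show ?thesis unfolding G_def .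
 qed
 moreover have "?K > 0" using C(1) decay_mass_nonneg[where 'a='b] by (simp add: add_nonneg_pos)
 ultimately show thesis using that by blast
qed

end

section \<open>Local square-integral bounds and Plancherel's inequality\<close>

lemma bbs_sq_finite:
 assumes "bbs g" obtains a where "a >= 0" "(nn_sq (%x. g x)) = ennreal a"
proof -
 obtain C R where g: "g \<in> borel_measurable borel" "\<And>x. cmod (g x) <= C" "\<And>x. norm x > R ==> g x = 0"
  using assms unfolding bbs_def by blast
 have "integrable lborel (%x. (cmod (g x))\<^sup>2)"
  by (rule integrable_bounded_support[of _ "C\<^sup>2" R]) (use g in \<open>auto intro!: power_mono\<close>)
 from nn_integral_eq_integral[OF this] show thesis by (intro that[of "LINT x|lborel. (cmod (g x))\<^sup>2"]) auto
qed

lemma bbs_indicator: "bbs g ==> A \<in> sets borel ==> bbs (%x. g x * indicator A x)"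
 using bbs_mult[of g "indicator A" 1] by (auto simp: indicator_def mult.commute)

lemma bbs_bounded_indicator:
 assumes "f \<in> borel_measurable borel" "\<And>x. cmod (f x) <= C"
 shows "bbs (%x. f x * indicator (cball 0 R) x)"
 unfolding bbs_def
proof (intro conjI exI allI impI)
 show "(%x. f x * indicator (cball 0 R) x) \<in> borel_measurable borel" by (intro borel_measurable_times assms(1) borel_measurable_indicator) simp
 show "cmod (f x * indicator (cball 0 R) x) <= max C 0" for x using assms(2)[of x] by (auto simp: indicator_def le_max_iff_disj)
 show "f x * indicator (cball 0 R) x = 0" if "norm x > R" for x using that by (auto simp: indicator_def)
qed

context phase
begin

text \<open>Duality with the previous bound. The constant is independent of the centre of the window, which is
what allows summation over all windows.\<close>

lemma local_L2_bound:
 obtains C where "C > 0" "\<And>w h. bbs h ==>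
   (nn_sq (%\<zeta>. LINT y|lborel. cis (\<Phi> (w + y, \<zeta>)) * (of_real (bump y) * h y)))
    <= ennreal C * (\<integral>\<^sup>+y. ennreal ((cmod (h y))\<^sup>2) * indicator (cball 0 1) y \<partial>lborel)"
proof -
 obtain C where C: "C > 0" "\<And>w g. bbs g ==>
   (\<integral>\<^sup>+y. ennreal ((bump y)\<^sup>2 * (cmod (LINT \<zeta>|lborel. cis (\<Phi> (w + y, \<zeta>)) * g \<zeta>))\<^sup>2) \<partial>lborel)
    <= ennreal C * (nn_sq (%\<zeta>. g \<zeta>))"
  using adjoint_L2_bound by blast
 have base: "(nn_sq (%\<zeta>. LINT y|lborel. cis (\<Phi> (w + y, \<zeta>)) * (of_real (bump y) * h y)))
    <= ennreal C * (nn_sq (%y. h y))" if h: "bbs h" for w h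
 proof -
  have [measurable]: "h \<in> borel_measurable borel" using h by (rule bbs_measurable)
  define U where "U \<zeta> = (LINT y|lborel. cis (\<Phi> (w + y, \<zeta>)) * (of_real (bump y) * h y))" for \<zeta>
  have Um [measurable]: "U \<in> borel_measurable borel"
   unfolding U_def[abs_def] by (intro lborel.borel_measurable_lebesgue_integral) measurable
  have bh: "bbs (%y. of_real (bump y) * h y)"
   by (rule bbs_mult[OF h, of _ 1]) (auto simp: bump_le_1 bump_ge_0)
  have Ub: "cmod (U \<zeta>) <= (LINT y|lborel. cmod (of_real (bump y) * h y))" for \<zeta>
   unfolding U_def by (rule order_trans[OF integral_norm_bound]) (simp add: norm_mult)
  obtain H where H: "H >= 0" "(nn_sq (%x. h x)) = ennreal H"
   using bbs_sq_finite[OF h] by blast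
  show ?thesis
   unfolding U_def[symmetric]
  proof (rule nn_integral_truncate)
   fix n :: nat
   define g where "g \<zeta> = cnj (U \<zeta>) * indicator (cball 0 (real n)) \<zeta>" for \<zeta>
   have bg: "bbs g" unfolding g_def[abs_def]
    by (rule bbs_bounded_indicator[of _ "LINT y|lborel. cmod (of_real (bump y) * h y)"]) (use Ub in auto)
   have [measurable]: "g \<in> borel_measurable borel" using bg by (rule bbs_measurable)
   define G where "G y = (LINT \<zeta>|lborel. cis (\<Phi> (w + y, \<zeta>)) * g \<zeta>)" for y
   have Gm [measurable]: "G \<in> borel_measurable borel"
    unfolding G_def[abs_def] by (intro lborel.borel_measurable_lebesgue_integral) measurable
   define f where "f y \<zeta> = cis (\<Phi> (w + y, \<zeta>)) * ((of_real (bump y) * h y) * g \<zeta>)" for y \<zeta>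
   have "bbs (%x. cis (\<Phi> (w + fst x, snd x)) * (case x of (y, \<zeta>) => (of_real (bump y) * h y) * g \<zeta>))"
   proof (rule bbs_mult[OF bbs_pair[OF bh bg], where C=1])
    have "(%x. cis (\<Phi> (w + fst x, snd x))) \<in> borel_measurable (borel \<Otimes>\<^sub>M borel)" by measurable
    then show "(%x. cis (\<Phi> (w + fst x, snd x))) \<in> borel_measurable borel" by (simp add: borel_prod)
   qed simp
   from bbs_integrable[OF this] have int: "integrable (lborel \<Otimes>\<^sub>M lborel) (%(y, \<zeta>). f y \<zeta>)"
    by (simp add: lborel_prod f_def case_prod_unfold)
   have gU: "U \<zeta> * g \<zeta> = of_real ((cmod (g \<zeta>))\<^sup>2)" for \<zeta>
    using complex_norm_square[of "U \<zeta>"] by (auto simp: g_def indicator_def)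
   have e1: "(LINT y|lborel. f y \<zeta>) = U \<zeta> * g \<zeta>" for \<zeta>
    unfolding f_def U_def by (simp add: mult.assoc[symmetric])
   have e2: "(LINT \<zeta>|lborel. f y \<zeta>) = (of_real (bump y) * h y) * G y" for y
    unfolding f_def G_def by (simp only: mult.left_commute[of "cis _"] integral_mult_right_zero)
   obtain a where a: "a >= 0" "(nn_sq (%\<zeta>. g \<zeta>)) = ennreal a"
    using bbs_sq_finite[OF bg] by blast
   have ig: "integrable lborel (%\<zeta>. (cmod (g \<zeta>))\<^sup>2)"
    using lborel_pair.integrable_snd[OF int] unfolding e1 gU by (simp only: complex_of_real_integrable_eq)
   have "ennreal a = ennreal (LINT \<zeta>|lborel. (cmod (g \<zeta>))\<^sup>2)"
    unfolding a(2)[symmetric] by (rule nn_integral_eq_integral[OF ig]) auto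
   also have "(LINT \<zeta>|lborel. (cmod (g \<zeta>))\<^sup>2) = cmod (LINT \<zeta>|lborel. LINT y|lborel. f y \<zeta>)"
    unfolding e1 gU integral_complex_of_real norm_of_real by (rule abs_of_nonneg[symmetric]) simp
   also have "(LINT \<zeta>|lborel. LINT y|lborel. f y \<zeta>) = (LINT y|lborel. (of_real (bump y) * h y) * G y)"
    using lborel_pair.Fubini_integral[OF int] by (simp add: e2)
   also have "ennreal (cmod \<dots>) <= (\<integral>\<^sup>+y. norm ((of_real (bump y) * h y) * G y) \<partial>lborel)"
    using lborel_pair.integrable_fst'[OF int] by (intro integral_norm_bound_ennreal) (simp add: e2)
   also have "\<dots> <= (\<integral>\<^sup>+y. ennreal (C / 2) * ennreal ((cmod (h y))\<^sup>2) + ennreal (1 / (2 * C)) * ennreal ((bump y)\<^sup>2 * (cmod (G y))\<^sup>2) \<partial>lborel)"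
   proof (intro nn_integral_mono)
    fix y :: 'a
    let ?p = "cmod (h y)" and ?q = "bump y * cmod (G y)"
    have "0 <= (C * ?p - ?q)\<^sup>2" by simp
    then have "2 * C * (?p * ?q) <= C\<^sup>2 * ?p\<^sup>2 + ?q\<^sup>2" by (simp add: power2_eq_square algebra_simps)
    then have "?p * ?q <= (C\<^sup>2 * ?p\<^sup>2 + ?q\<^sup>2) / (2 * C)" using C(1) by (simp add: field_simps)
    also have "\<dots> = C / 2 * ?p\<^sup>2 + 1 / (2 * C) * ?q\<^sup>2" using C(1) by (simp add: field_simps power2_eq_square)
    finally have "norm ((of_real (bump y) * h y) * G y) <= C / 2 * (cmod (h y))\<^sup>2 + 1 / (2 * C) * ((bump y)\<^sup>2 * (cmod (G y))\<^sup>2)"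
     by (simp add: norm_mult bump_ge_0 power_mult_distrib algebra_simps)
    then have "ennreal (norm ((of_real (bump y) * h y) * G y)) <= ennreal (C / 2 * (cmod (h y))\<^sup>2 + 1 / (2 * C) * ((bump y)\<^sup>2 * (cmod (G y))\<^sup>2))"
     by (rule ennreal_leI)
    also have "\<dots> = ennreal (C / 2 * (cmod (h y))\<^sup>2) + ennreal (1 / (2 * C) * ((bump y)\<^sup>2 * (cmod (G y))\<^sup>2))"
     using C(1) by (intro ennreal_plus) auto
    also have "ennreal (C / 2 * (cmod (h y))\<^sup>2) = ennreal (C / 2) * ennreal ((cmod (h y))\<^sup>2)"
     using C(1) by (intro ennreal_mult) auto
    also have "ennreal (1 / (2 * C) * ((bump y)\<^sup>2 * (cmod (G y))\<^sup>2)) = ennreal (1 / (2 * C)) * ennreal ((bump y)\<^sup>2 * (cmod (G y))\<^sup>2)"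
     using C(1) by (intro ennreal_mult) auto
    finally show "ennreal (norm ((of_real (bump y) * h y) * G y)) <= ennreal (C / 2) * ennreal ((cmod (h y))\<^sup>2) + ennreal (1 / (2 * C)) * ennreal ((bump y)\<^sup>2 * (cmod (G y))\<^sup>2)" .
   qed
   also have "\<dots> = ennreal (C / 2) * ennreal H + ennreal (1 / (2 * C)) * (\<integral>\<^sup>+y. ennreal ((bump y)\<^sup>2 * (cmod (G y))\<^sup>2) \<partial>lborel)"
    by (simp add: nn_integral_add nn_integral_cmult H(2))
   also have "\<dots> <= ennreal (C / 2) * ennreal H + ennreal (1 / (2 * C)) * (ennreal C * ennreal a)"
    unfolding a(2)[symmetric] G_def by (intro add_left_mono mult_left_mono C(2) bg) auto
   also have "\<dots> = ennreal (C / 2 * H + a / 2)"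
    using C(1) H(1) a(1) by (simp add: ennreal_mult[symmetric] ennreal_plus[symmetric] del: ennreal_plus)
   finally have "a <= C / 2 * H + a / 2" using C(1) H(1) a(1) by (subst (asm) ennreal_le_iff) auto
   then have aC: "a <= C * H" by simp
   have "(\<integral>\<^sup>+\<zeta>. ennreal ((cmod (U \<zeta>))\<^sup>2) * indicator (cball 0 (real n)) \<zeta> \<partial>lborel) = ennreal a"
    unfolding a(2)[symmetric] by (intro nn_integral_cong) (auto simp: g_def indicator_def)
   then show "(\<integral>\<^sup>+\<zeta>. ennreal ((cmod (U \<zeta>))\<^sup>2) * indicator (cball 0 (real n)) \<zeta> \<partial>lborel) <= ennreal C * (nn_sq (%y. h y))"
    unfolding H(2) using aC C(1) H(1) by (simp add: ennreal_mult[symmetric] ennreal_leI)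
  qed measurable
 qed
 show thesis
 proof (rule that[OF C(1)])
  fix w :: 'a and h :: "'a => complex" assume h: "bbs h"
  have i: "bbs (%y. h y * indicator (cball 0 1) y)" by (rule bbs_indicator[OF h]) simp
  have e1: "of_real (bump y) * (h y * indicator (cball 0 1) y) = of_real (bump y) * h y" for y
   by (auto simp: indicator_def bump_outside)
  have e2: "ennreal ((cmod (h y * indicator (cball 0 1) y))\<^sup>2) = ennreal ((cmod (h y))\<^sup>2) * indicator (cball 0 1) y" for y
   by (auto simp: indicator_def)
  show "(nn_sq (%\<zeta>. LINT y|lborel. cis (\<Phi> (w + y, \<zeta>)) * (of_real (bump y) * h y)))
    <= ennreal C * (\<integral>\<^sup>+y. ennreal ((cmod (h y))\<^sup>2) * indicator (cball 0 1) y \<partial>lborel)"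
   using base[OF i, of w] unfolding e1 e2 .
 qed
qed

end

lemma phase_inner: "phase (%z. fst z \<bullet> (snd z :: 'a::euclidean_space))"
proof
 show "smooth (%z. fst z \<bullet> (snd z :: 'a))" by (intro smooth_intros)
 have D: "((%z. fst z \<bullet> (snd z :: 'a)) has_derivative (%h. fst z \<bullet> snd h + fst h \<bullet> snd z)) (at z)" for z
  by (auto intro!: derivative_eq_intros)
 have d: "dd v (%z. fst z \<bullet> (snd z :: 'a)) = (%z. fst z \<bullet> snd v + fst v \<bullet> snd z)" for v
  by (rule ext, rule dd_eq[OF D])
 have D2: "((%z. fst z \<bullet> snd v + fst v \<bullet> snd z) has_derivative (%h. fst h \<bullet> snd v + fst v \<bullet> snd h)) (at z)" for v :: "'a \<times> 'a" and z
  by (auto intro!: derivative_eq_intros)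
 have d2: "dd u (%z. fst z \<bullet> snd v + fst v \<bullet> snd z) = (%z. fst u \<bullet> snd v + fst v \<bullet> snd u)" for u v :: "'a \<times> 'a"
  by (rule ext, rule dd_eq[OF D2])
 show "symb UNIV (%_::unit. dd (inc1 b) (dd (inc2 c) (%z. fst z \<bullet> (snd z :: 'a))))" for b c :: 'a
  unfolding d d2 by (rule symb_const0)
 show "\<exists>\<kappa>>0. \<forall>y \<zeta> \<eta>. \<kappa> * (norm (\<zeta> - \<eta>))\<^sup>2 <= (\<Sum>b\<in>Basis. (dd (inc1 b) (%z. fst z \<bullet> (snd z :: 'a)) (y, \<zeta>) - dd (inc1 b) (%z. fst z \<bullet> snd z) (y, \<eta>))\<^sup>2)"
 proof (intro exI[of _ 1] conjI allI)
  fix y \<zeta> \<eta> :: 'a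
  have "(norm (\<zeta> - \<eta>))\<^sup>2 = (\<Sum>b\<in>Basis. (b \<bullet> \<zeta> - b \<bullet> \<eta>)\<^sup>2)"
   unfolding power2_norm_eq_inner euclidean_inner[of "\<zeta> - \<eta>" "\<zeta> - \<eta>"]
   by (simp add: power2_eq_square inner_diff_left inner_diff_right inner_commute)
  then show "1 * (norm (\<zeta> - \<eta>))\<^sup>2 <= (\<Sum>b\<in>Basis. (dd (inc1 b) (%z. fst z \<bullet> (snd z :: 'a)) (y, \<zeta>) - dd (inc1 b) (%z. fst z \<bullet> snd z) (y, \<eta>))\<^sup>2)"
   by (simp add: d)
 qed simp
qed

text \<open>The inner product is itself an expanding phase. Its local bound is scale invariant under dilation,
so letting the window exhaust the space gives the global inequality; only an inequality up to a
constant is required below.\<close>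

lemma plancherel_le:
 obtains C where "C > 0" "\<And>v :: 'a::euclidean_space => complex. bbs v ==>
  (nn_sq (%\<xi>. LINT x|lborel. cis (x \<bullet> \<xi>) * v x)) <= ennreal C * (nn_sq (%x. v x))"
proof -
 let ?d = "DIM('a)"
 note * = phase.adjoint_L2_bound[OF phase_inner[where 'a='a], unfolded fst_conv snd_conv]
 obtain C where C0: "C > 0" and C1: "\<And>w g :: 'a => complex. bbs g ==>
   (\<integral>\<^sup>+y. ennreal ((bump y)\<^sup>2 * (cmod (LINT \<zeta>|lborel. cis ((w + y) \<bullet> \<zeta>) * g \<zeta>))\<^sup>2) \<partial>lborel)
    <= ennreal C * (nn_sq (%\<zeta>. g \<zeta>))"
  using * by blast
 have C: "C > 0" "\<And>g :: 'a => complex. bbs g ==>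
   (\<integral>\<^sup>+y. ennreal ((bump y)\<^sup>2 * (cmod (LINT \<zeta>|lborel. cis (y \<bullet> \<zeta>) * g \<zeta>))\<^sup>2) \<partial>lborel)
    <= ennreal C * (nn_sq (%\<zeta>. g \<zeta>))"
  using C0 C1[of _ 0] by simp_all
 define \<beta> where "\<beta> = (exp (- (4/3)) :: real)\<^sup>2"
 have \<beta>: "\<beta> > 0" by (simp add: \<beta>_def)
 have b\<beta>: "\<beta> <= (bump x)\<^sup>2" if "norm x <= 1/2" for x :: 'a
 proof -
  have "(norm x)\<^sup>2 <= (1/2)\<^sup>2" using that by (intro power_mono) auto
  then have "3/4 <= 1 - x \<bullet> x" unfolding power2_norm_eq_inner by (simp add: power2_eq_square)
  moreover from this have "inverse (1 - x \<bullet> x) <= inverse (3/4)" by (intro le_imp_inverse_le) auto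
  ultimately have "exp (- (4/3)) <= bump x" by (simp add: bump_def flat_exp_def)
  then show ?thesis unfolding \<beta>_def by (intro power_mono) auto
 qed
 show thesis
 proof (rule that[of "C / \<beta>"])
  fix v :: "'a => complex" assume v: "bbs v"
  have [measurable]: "v \<in> borel_measurable borel" using v by (rule bbs_measurable)
  define V where "V \<xi> = (LINT x|lborel. cis (x \<bullet> \<xi>) * v x)" for \<xi>
  have [measurable]: "V \<in> borel_measurable borel"
   unfolding V_def[abs_def] by (intro lborel.borel_measurable_lebesgue_integral) measurable
  show "(nn_sq (%\<xi>. V \<xi>)) <= ennreal (C / \<beta>) * (nn_sq (%x. v x))" (is "_ <= _ * ?H")
  proof (rule nn_integral_truncate)
   fix n :: nat
   define \<epsilon> where "\<epsilon> = 1 / (2 * (real n + 1))"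
   have \<epsilon>: "\<epsilon> > 0" by (simp add: \<epsilon>_def)
   define G where "G y = (LINT \<zeta>|lborel. cis (y \<bullet> \<zeta>) * v (\<epsilon> *\<^sub>R \<zeta>))" for y
   have [measurable]: "G \<in> borel_measurable borel"
    unfolding G_def[abs_def] by (intro lborel.borel_measurable_lebesgue_integral) measurable
   have VG: "V \<xi> = of_real (\<epsilon> ^ ?d) * G (\<epsilon> *\<^sub>R \<xi>)" for \<xi>
    unfolding V_def G_def by (subst integral_scale[OF _ \<epsilon>]) (simp_all add: inner_commute)
   have bv: "bbs (%\<zeta>. v (\<epsilon> *\<^sub>R \<zeta>))"
   proof -
    obtain D R where "\<And>x. cmod (v x) <= D" "\<And>x. norm x > R ==> v x = 0" using v unfolding bbs_def by blast
    then show ?thesis unfolding bbs_def using \<epsilon>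
     by (intro conjI exI[of _ D] exI[of _ "R / \<epsilon>"]) (auto simp: field_simps)
   qed
   let ?f = "%y. ennreal ((bump y)\<^sup>2 * (cmod (G y))\<^sup>2)"
   have "(\<integral>\<^sup>+\<xi>. ennreal ((cmod (V \<xi>))\<^sup>2) * indicator (cball 0 (real n)) \<xi> \<partial>lborel)
    <= (\<integral>\<^sup>+\<xi>. ennreal (1 / \<beta>) * (ennreal (\<epsilon> ^ ?d * \<epsilon> ^ ?d) * ?f (\<epsilon> *\<^sub>R \<xi>)) \<partial>lborel)"
   proof (intro nn_integral_mono)
    fix \<xi> :: 'a
    have "(cmod (V \<xi>))\<^sup>2 <= 1 / \<beta> * (\<epsilon> ^ ?d * \<epsilon> ^ ?d * ((bump (\<epsilon> *\<^sub>R \<xi>))\<^sup>2 * (cmod (G (\<epsilon> *\<^sub>R \<xi>)))\<^sup>2))" if "norm \<xi> <= real n"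
    proof -
     have "norm (\<epsilon> *\<^sub>R \<xi>) <= 1/2" using that \<epsilon> by (simp add: \<epsilon>_def field_simps)
     from b\<beta>[OF this] have "1 <= 1 / \<beta> * (bump (\<epsilon> *\<^sub>R \<xi>))\<^sup>2" using \<beta> by (simp add: field_simps)
     then have "(cmod (V \<xi>))\<^sup>2 * 1 <= (cmod (V \<xi>))\<^sup>2 * (1 / \<beta> * (bump (\<epsilon> *\<^sub>R \<xi>))\<^sup>2)" by (intro mult_left_mono) auto
     then show ?thesis unfolding VG by (simp add: norm_mult norm_power power_mult_distrib power2_eq_square \<epsilon> less_imp_le algebra_simps)
    qed
    then have "ennreal ((cmod (V \<xi>))\<^sup>2) * indicator (cball 0 (real n)) \<xi> <= ennreal (1 / \<beta> * (\<epsilon> ^ ?d * \<epsilon> ^ ?d * ((bump (\<epsilon> *\<^sub>R \<xi>))\<^sup>2 * (cmod (G (\<epsilon> *\<^sub>R \<xi>)))\<^sup>2)))"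
     by (auto simp: indicator_def intro!: ennreal_leI)
    also have "\<dots> = ennreal (1 / \<beta>) * (ennreal (\<epsilon> ^ ?d * \<epsilon> ^ ?d) * ?f (\<epsilon> *\<^sub>R \<xi>))"
     using \<beta> \<epsilon> by (subst ennreal_mult, simp, simp, subst ennreal_mult) auto
    finally show "ennreal ((cmod (V \<xi>))\<^sup>2) * indicator (cball 0 (real n)) \<xi> <= ennreal (1 / \<beta>) * (ennreal (\<epsilon> ^ ?d * \<epsilon> ^ ?d) * ?f (\<epsilon> *\<^sub>R \<xi>))" .
   qed
   also have "\<dots> = ennreal (1 / \<beta>) * (ennreal (\<epsilon> ^ ?d) * (ennreal (\<epsilon> ^ ?d) * (\<integral>\<^sup>+\<xi>. ?f (\<epsilon> *\<^sub>R \<xi>) \<partial>lborel)))"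
    using \<epsilon> by (simp add: nn_integral_cmult ennreal_mult mult.assoc)
   also have "ennreal (\<epsilon> ^ ?d) * (\<integral>\<^sup>+\<xi>. ?f (\<epsilon> *\<^sub>R \<xi>) \<partial>lborel) = (\<integral>\<^sup>+y. ?f y \<partial>lborel)"
    by (rule nn_integral_scale[OF _ \<epsilon>, symmetric]) measurable
   also have "ennreal (1 / \<beta>) * (ennreal (\<epsilon> ^ ?d) * (\<integral>\<^sup>+y. ?f y \<partial>lborel))
    <= ennreal (1 / \<beta>) * (ennreal (\<epsilon> ^ ?d) * (ennreal C * (nn_sq (%\<zeta>. v (\<epsilon> *\<^sub>R \<zeta>)))))"
    unfolding G_def by (intro mult_left_mono C(2) bv) auto
   also have "\<dots> = ennreal (1 / \<beta>) * (ennreal C * (ennreal (\<epsilon> ^ ?d) * (nn_sq (%\<zeta>. v (\<epsilon> *\<^sub>R \<zeta>)))))"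
    by (simp only: mult.left_commute)
   also have "ennreal (\<epsilon> ^ ?d) * (nn_sq (%\<zeta>. v (\<epsilon> *\<^sub>R \<zeta>))) = ?H"
    by (rule nn_integral_scale[OF _ \<epsilon>, symmetric]) measurable
   also have "ennreal (1 / \<beta>) * (ennreal C * ?H) = ennreal (C / \<beta>) * ?H"
    using \<beta> C(1) by (simp add: mult.assoc[symmetric] ennreal_mult[symmetric])
   finally show "(\<integral>\<^sup>+\<xi>. ennreal ((cmod (V \<xi>))\<^sup>2) * indicator (cball 0 (real n)) \<xi> \<partial>lborel) <= ennreal (C / \<beta>) * ?H" .
  qed measurable
 qed (use C \<beta> in simp)
qed

section \<open>Fourier expansion of amplitudes\<close>

lemma fourier_decay:
 fixes G :: "'p => 'e::euclidean_space => complex"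
 assumes G: "symb (P \<times> UNIV) G" and R: "\<And>p s. p \<in> P ==> norm s > R ==> G p s = 0"
 obtains C where "C > 0" "\<And>p k. p \<in> P ==> cmod (LINT s|lborel. cis (- (k \<bullet> s)) * G p s) <= C * decay k"
proof -
 let ?N = "DIM('e) + 1"
 define t where "t q s = - (snd q \<bullet> s)" for q :: "'p \<times> 'e" and s
 define r where "r q = 1 + norm (snd q)" for q :: "'p \<times> 'e"
 define Q where "Q = {q :: 'p \<times> 'e. fst q \<in> P \<and> norm (snd q) >= 1}"
 have D: "(t q has_derivative (%v. - (snd q \<bullet> v))) (at s)" for q s
  unfolding t_def by (auto intro!: derivative_eq_intros)
 have ddt: "dd b (t q) = (%s. - (snd q \<bullet> b))" for b q by (rule ext, rule dd_eq[OF D])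
 interpret nonstationary Basis "Q \<times> UNIV" t r "1 / 4"
 proof
  show "smooth (t q)" for q
   using smooth_inner[OF smooth_const smooth_id, of "- snd q"] by (simp add: t_def[abs_def])
  show "symb (Q \<times> UNIV) (%q s. dd b (t q) s / r q)" if "b \<in> Basis" for b
   unfolding ddt
  proof (rule symb_const[of _ _ 1])
   fix q :: "'p \<times> 'e"
   have "\<bar>snd q \<bullet> b\<bar> <= norm (snd q)" using that by (simp add: Basis_le_norm)
   then show "norm (- (snd q \<bullet> b) / r q) <= 1" by (simp add: r_def divide_le_eq add_pos_nonneg abs_of_pos)
  qed
  show "1 / 4 * (r q)\<^sup>2 <= (\<Sum>b\<in>Basis. (dd b (t q) s)\<^sup>2)" if "(q, s) \<in> Q \<times> UNIV" for q s
  proof -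
   have "r q <= 2 * norm (snd q)" using that by (simp add: Q_def r_def)
   then have "(r q)\<^sup>2 <= (2 * norm (snd q))\<^sup>2" by (intro power_mono) (auto simp: r_def add_nonneg_nonneg)
   moreover have "(norm (snd q))\<^sup>2 = (\<Sum>b\<in>Basis. (snd q \<bullet> b)\<^sup>2)"
    unfolding power2_norm_eq_inner euclidean_inner[of "snd q" "snd q"] by (simp add: power2_eq_square)
   ultimately show ?thesis by (simp add: ddt power_mult_distrib)
  qed
 qed (auto simp: r_def)
 have Gs: "symb (Q \<times> UNIV) (%q. G (fst q))"
  by (rule symb_mono[OF symb_reparam[OF G]]) (auto simp: Q_def)
 obtain C where C: "C >= 0" "\<And>q. q \<in> Q ==> norm (LINT s|lborel. cis (t q s) * G (fst q) s) <= C / r q ^ ?N"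
  by (rule nonstationary_decay[OF Gs, of Q R ?N]) (use R in \<open>auto simp: Q_def\<close>)
 obtain K where K: "K > 0" "\<And>p s. (p, s) \<in> P \<times> UNIV ==> norm (G p s) <= K" using symb_bound[OF G] by blast
 define D where "D = K * measure lborel (cball 0 R :: 'e set)"
 have D0: "D >= 0" using K(1) by (simp add: D_def)
 have bD: "norm (LINT s|lborel. cis (- (k \<bullet> s)) * G p s) <= D" if p: "p \<in> P" for p k
 proof -
  have "norm (LINT s|lborel. cis (- (k \<bullet> s)) * G p s) <= (LINT s|lborel. norm (cis (- (k \<bullet> s)) * G p s))"
   by (rule integral_norm_bound)
  also have "\<dots> <= integral\<^sup>L lborel (%s::'e. K * indicator (cball 0 R) s)"
  proof (rule integral_mono)
   have "integrable lborel (G p)" by (rule integrable_compact_support[OF symb_continuous[OF G] R[OF p]])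
   then show "integrable lborel (%s. norm (cis (- (k \<bullet> s)) * G p s))" by (simp add: norm_mult)
   show "integrable lborel (%s::'e. K * indicator (cball 0 R) s)"
    using emeasure_lborel_cball_finite[of 0 R] by (intro integrable_mult_right integrable_real_indicator) auto
   show "norm (cis (- (k \<bullet> s)) * G p s) <= K * indicator (cball 0 R) s" for s
    using K(2)[of p s] R[OF p, of s] p by (auto simp: norm_mult indicator_def not_le)
  qed
  finally show ?thesis by (simp add: D_def)
 qed
 show thesis
 proof (rule that[of "C + D * 2 ^ ?N + 1"])
  fix p k assume p: "p \<in> P"
  have dec: "decay k = 1 / r (p, k) ^ ?N" by (simp add: decay_def r_def)
  have d0: "0 <= decay k" using decay_pos[of k] by simp
  show "cmod (LINT s|lborel. cis (- (k \<bullet> s)) * G p s) <= (C + D * 2 ^ ?N + 1) * decay k"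
  proof (cases "norm k >= 1")
   case True
   have "cmod (LINT s|lborel. cis (- (k \<bullet> s)) * G p s) <= C * decay k"
    using C(2)[of "(p, k)"] True p unfolding dec by (simp add: Q_def t_def)
   also have "\<dots> <= (C + D * 2 ^ ?N + 1) * decay k" using D0 d0 by (intro mult_right_mono) auto
   finally show ?thesis .
  next
   case False
   then have "r (p, k) ^ ?N <= 2 ^ ?N" using r[of "(p, k)"] by (intro power_mono) (auto simp: r_def)
   then have "1 <= 2 ^ ?N * decay k" unfolding dec using r[of "(p, k)"] by (simp add: le_divide_eq)
   then have "D * 1 <= D * (2 ^ ?N * decay k)" using D0 by (rule mult_left_mono)
   moreover have "0 <= (C + 1) * decay k" using C(1) d0 by simp
   ultimately show ?thesis using bD[OF p, of k] by (simp add: algebra_simps)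
  qed
 qed (use C(1) D0 in \<open>simp add: add_nonneg_pos\<close>)
qed

lemma integrable_product_bound:
 fixes F :: "'a::euclidean_space => 'b::euclidean_space => complex"
 assumes F: "case_prod F \<in> borel_measurable (lborel \<Otimes>\<^sub>M lborel)"
  and a: "integrable lborel a" and b: "integrable lborel b"
  and le: "\<And>x y. cmod (F x y) <= a x * b y"
 shows "integrable (lborel \<Otimes>\<^sub>M lborel) (case_prod F)"
proof (rule lborel_pair.Fubini_integrable[OF F])
 have i: "integrable lborel (F x)" for x
  by (rule Bochner_Integration.integrable_bound[where f="%y. a x * b y"])
   (use b F le in \<open>auto intro!: AE_I2 intro: order_trans[OF le abs_ge_self]\<close>)
 then show "AE x in lborel. integrable lborel (%y. case (x, y) of (x, y) => F x y)" by simp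
 show "integrable lborel (%x. LINT y|lborel. norm (case (x, y) of (x, y) => F x y))"
 proof (rule Bochner_Integration.integrable_bound[where f="%x. a x * (LINT y|lborel. b y)"])
  show "integrable lborel (%x. a x * (LINT y|lborel. b y))" using a by simp
  have "(LINT y|lborel. norm (F x y)) <= a x * (LINT y|lborel. b y)" for x
   unfolding integral_mult_right_zero[symmetric] by (rule integral_mono) (use i b le in auto)
  then show "AE x in lborel. norm (LINT y|lborel. norm (case (x, y) of (x, y) => F x y)) <= norm (a x * (LINT y|lborel. b y))"
   by (auto intro!: AE_I2 intro: order_trans[OF _ abs_ge_self])
  show "(%x. LINT y|lborel. norm (case (x, y) of (x, y) => F x y)) \<in> borel_measurable lborel"
   using F by (intro lborel.borel_measurable_lebesgue_integral) simp
 qed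
qed

definition fourier :: "('e::euclidean_space => complex) => 'e => complex" where
 "fourier G k = (LINT s|lborel. cis (- (k \<bullet> s)) * G s)"

lemma fourier_measurable [measurable (raw)]:
 assumes [measurable]: "G \<in> borel_measurable borel" shows "fourier G \<in> borel_measurable borel"
 unfolding fourier_def[abs_def] by (intro lborel.borel_measurable_lebesgue_integral) measurable

lemma fourier_integrable:
 assumes "smooth G" "\<And>s. norm s > R ==> G s = 0"
 shows "integrable lborel (fourier G)" and "\<exists>C>0. \<forall>k. cmod (fourier G k) <= C * decay k"
proof -
 have "symb ((UNIV::unit set) \<times> UNIV) (%_. G)" using symb_compact_support[OF assms] by simp
 from fourier_decay[OF this, of R] assms(2) obtain C where C: "C > 0" "\<And>k. cmod (fourier G k) <= C * decay k"
  by (metis UNIV_I fourier_def)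
 then show "\<exists>C>0. \<forall>k. cmod (fourier G k) <= C * decay k" by blast
 have [measurable]: "G \<in> borel_measurable borel" by (rule smooth_measurable[OF assms(1)])
 show "integrable lborel (fourier G)"
  by (rule Bochner_Integration.integrable_bound[OF integrable_mult_right[OF integrable_decay, of C]])
   (auto intro!: AE_I2 intro: order_trans[OF C(2) abs_ge_self])
qed

lemma smooth_bump_complex: "smooth (%x. complex_of_real (bump x))"
 by (rule smooth_linear[OF bounded_linear_of_real smooth_bump])

lemma fourier_bump_lower:
 obtains \<delta> where "\<delta> > 0" "\<And>k. norm k <= 1 ==> cmod (fourier (%x. complex_of_real (bump (x::'e::euclidean_space))) k) >= \<delta>"
proof -
 have ib: "integrable lborel (bump :: 'e => real)"
  by (rule integrable_compact_support[OF smooth_continuous[OF smooth_bump], of 1]) (rule bump_outside)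
 have pos: "(LINT x|lborel. bump (x::'e)) > 0"
 proof -
  have "bump x > 0" if "x \<in> ball 0 1" for x :: 'e using that bump_0[of x] bump_ge_0[of x] by (simp add: less_le)
  have "(LINT x|lborel. bump (x::'e)) \<noteq> 0"
  proof
   assume "(LINT x|lborel. bump (x::'e)) = 0"
   then have "AE x in lborel. bump (x::'e) = 0" using integral_nonneg_eq_0_iff_AE[OF ib] bump_ge_0 by auto
   then have "AE x in lborel. (x::'e) \<notin> ball 0 1" by eventually_elim (auto simp: bump_0)
   then have "emeasure lborel (ball 0 1 :: 'e set) = 0" using AE_iff_null_sets[of "ball 0 1 :: 'e set" lborel] by (simp add: null_sets_def del: mem_ball mem_ball_0)
   then have "unit_ball_vol (real DIM('e)) <= 0" by (simp add: emeasure_ball ennreal_eq_0_iff)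
  then show False using unit_ball_vol_pos[of "real DIM('e)"] of_nat_0_le_iff by (metis not_le)
  qed
  moreover have "(LINT x|lborel. bump (x::'e)) >= 0" by (simp add: bump_ge_0)
  ultimately show ?thesis by simp
 qed
 show thesis
 proof (rule that[of "(LINT x|lborel. bump (x::'e)) * cos 1"])
  show "(LINT x|lborel. bump (x::'e)) * cos 1 > 0" using pos cos_gt_zero_pi[of 1] pi_gt3 by simp
  fix k :: 'e assume k: "norm k <= 1"
  have ic: "integrable lborel (%s. cis (- (k \<bullet> s)) * complex_of_real (bump s))"
   by (rule bbs_integrable[OF bbs_mult[OF bbs_bump, of _ 1]]) auto
  have "(LINT x|lborel. bump (x::'e)) * cos 1 <= (LINT s|lborel. Re (cis (- (k \<bullet> s)) * complex_of_real (bump s)))"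
   unfolding integral_mult_left_zero[symmetric]
  proof (rule integral_mono)
   show "integrable lborel (%s. Re (cis (- (k \<bullet> s)) * complex_of_real (bump s)))" by (rule integrable_Re[OF ic])
   show "bump s * cos 1 <= Re (cis (- (k \<bullet> s)) * complex_of_real (bump s))" for s
   proof (cases "norm s < 1")
    case True
    have "\<bar>k \<bullet> s\<bar> <= norm k * norm s" by (rule Cauchy_Schwarz_ineq2)
    also have "\<dots> <= 1" using k True by (intro mult_le_one) auto
    finally have "cos 1 <= cos \<bar>k \<bullet> s\<bar>" using pi_gt3 by (intro cos_monotone_0_pi_le) auto
    then show ?thesis using bump_ge_0[of s] by (simp add: mult.commute mult_left_mono)
   next
    case False
    then have "bump s = 0" by (simp add: bump_0)
    then show ?thesis by simp
   qed
  qed (use ib in simp)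
  also have "\<dots> = Re (fourier (%x. complex_of_real (bump x)) k)" unfolding fourier_def by (rule integral_Re[OF ic])
  also have "\<dots> <= cmod (fourier (%x. complex_of_real (bump x)) k)" by (rule complex_Re_le_cmod)
  finally show "(LINT x|lborel. bump (x::'e)) * cos 1 <= cmod (fourier (%x. complex_of_real (bump x)) k)" .
 qed
qed

lemma fourier_inversion:
 obtains c where "c \<noteq> 0" "\<And>G R z. smooth G ==> (\<And>s. norm s > R ==> G s = 0) ==>
  (LINT k|lborel. fourier G k * cis (k \<bullet> z)) = c * G (z::'e::euclidean_space)"
proof -
 let ?d = "DIM('e)"
 let ?b = "%x::'e. complex_of_real (bump x)"
 define c1 where "c1 = (LINT x|lborel. fourier ?b x)"
 have smb: "smooth ?b" by (rule smooth_bump_complex)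
 have b0: "bump (0::'e) \<noteq> 0" by (simp add: bump_0)
 have inv: "of_real (bump (0::'e)) * (LINT k|lborel. fourier G k * cis (k \<bullet> z)) = c1 * G z"
  if G: "smooth G" and R: "\<And>s. norm s > R ==> G s = 0" for G R and z :: 'e
 proof -
  have [measurable]: "G \<in> borel_measurable borel" by (rule smooth_measurable[OF G])
  obtain M where M: "M > 0" "\<And>s. cmod (G s) <= M" using smooth_compact_support_bounded[OF G R] by blast
  define \<epsilon> where "\<epsilon> n = inverse (real (Suc n))" for n
  have \<epsilon>: "\<epsilon> n > 0" for n by (simp add: \<epsilon>_def)
  have \<epsilon>0: "\<epsilon> \<longlonglongrightarrow> 0" unfolding \<epsilon>_def by (rule LIMSEQ_inverse_real_of_nat)
  have bG: "bbs G" by (rule bbs_const_smooth[OF G R])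
  have bbe: "bbs (%k. ?b (\<epsilon> n *\<^sub>R k))" for n
   unfolding bbs_def using \<epsilon>[of n]
   by (intro conjI exI[of _ 1] exI[of _ "1 / \<epsilon> n"] allI impI bump_outside)
    (auto simp: bump_le_1 bump_ge_0 bump_0 field_simps intro!: less_imp_le)
  have eq: "(LINT k|lborel. ?b (\<epsilon> n *\<^sub>R k) * (fourier G k * cis (k \<bullet> z))) = (LINT s|lborel. G (z + \<epsilon> n *\<^sub>R s) * fourier ?b s)" for n
  proof -
   define f where "f k s = cis (k \<bullet> (z - s)) * (?b (\<epsilon> n *\<^sub>R k) * G s)" for k s
   have "bbs (%x. cis (fst x \<bullet> (z - snd x)) * (case x of (k, s) => ?b (\<epsilon> n *\<^sub>R k) * G s))"
    by (rule bbs_mult[OF bbs_pair[OF bbe bG], where C=1]) (auto intro!: borel_measurable_continuous_onI continuous_intros)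
   from bbs_integrable[OF this] have int: "integrable (lborel \<Otimes>\<^sub>M lborel) (%(k, s). f k s)"
    by (simp add: lborel_prod f_def case_prod_unfold)
   have e1: "(LINT s|lborel. f k s) = ?b (\<epsilon> n *\<^sub>R k) * (fourier G k * cis (k \<bullet> z))" for k
   proof -
    have "f k s = (?b (\<epsilon> n *\<^sub>R k) * cis (k \<bullet> z)) * (cis (- (k \<bullet> s)) * G s)" for s
    proof -
     have "cis (k \<bullet> (z - s)) = cis (k \<bullet> z) * cis (- (k \<bullet> s))" by (simp add: cis_mult inner_diff_right)
     then show ?thesis by (simp only: f_def mult_ac)
    qed
    then show ?thesis by (simp add: fourier_def)
   qed
   have e2: "(LINT k|lborel. f k s) = G s * (LINT k|lborel. ?b (\<epsilon> n *\<^sub>R k) * cis (k \<bullet> (z - s)))" for s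
    unfolding f_def integral_mult_right_zero[symmetric] by (intro Bochner_Integration.integral_cong) auto
   define h where "h s = (LINT k|lborel. ?b (\<epsilon> n *\<^sub>R k) * cis (k \<bullet> s))" for s
   have hF: "of_real (\<epsilon> n ^ ?d) * h (- \<epsilon> n *\<^sub>R s) = fourier ?b s" for s
   proof -
    have "fourier ?b s = of_real (\<epsilon> n ^ ?d) * (LINT k|lborel. cis (- (s \<bullet> (\<epsilon> n *\<^sub>R k))) * ?b (\<epsilon> n *\<^sub>R k))"
     unfolding fourier_def by (rule integral_scale[OF _ \<epsilon>]) measurable
    then show ?thesis unfolding h_def by (simp add: inner_commute mult.commute)
   qed
   have [measurable]: "h \<in> borel_measurable borel"
    unfolding h_def[abs_def] by (intro lborel.borel_measurable_lebesgue_integral) measurable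
   have "(LINT k|lborel. ?b (\<epsilon> n *\<^sub>R k) * (fourier G k * cis (k \<bullet> z))) = (LINT s|lborel. LINT k|lborel. f k s)"
    using lborel_pair.Fubini_integral[OF int] by (simp add: e1)
   also have "\<dots> = (LINT s|lborel. G s * h (z - s))" by (simp add: e2 h_def)
   also have "\<dots> = (LINT s|lborel. G (z + s) * h (z - (z + s)))"
    by (rule lborel_integral_translate[symmetric]) measurable
   also have "\<dots> = of_real (\<epsilon> n ^ ?d) * (LINT s|lborel. G (z + \<epsilon> n *\<^sub>R s) * h (- \<epsilon> n *\<^sub>R s))"
    by (subst integral_scale[OF _ \<epsilon>[of n]]) simp_all
   also have "\<dots> = (LINT s|lborel. G (z + \<epsilon> n *\<^sub>R s) * fourier ?b s)"
    unfolding integral_mult_right_zero[symmetric] hF[symmetric] by (intro Bochner_Integration.integral_cong) auto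
   finally show ?thesis .
  qed
  obtain C where C: "C > 0" "\<And>k. cmod (fourier G k) <= C * decay k" using fourier_integrable(2)[OF G R] by blast
  have L1: "(%n. LINT k|lborel. ?b (\<epsilon> n *\<^sub>R k) * (fourier G k * cis (k \<bullet> z))) \<longlonglongrightarrow> (LINT k|lborel. ?b 0 * (fourier G k * cis (k \<bullet> z)))"
  proof (rule integral_dominated_convergence[where w="%k. norm (fourier G k)"])
   show "integrable lborel (%k. norm (fourier G k))" using fourier_integrable(1)[OF G R] by simp
   show "AE k in lborel. (%n. ?b (\<epsilon> n *\<^sub>R k) * (fourier G k * cis (k \<bullet> z))) \<longlonglongrightarrow> ?b 0 * (fourier G k * cis (k \<bullet> z))"
   proof (intro AE_I2 tendsto_mult tendsto_const)
    fix k :: 'e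
    have "(%n. \<epsilon> n *\<^sub>R k) \<longlonglongrightarrow> 0 *\<^sub>R k" by (intro tendsto_scaleR \<epsilon>0 tendsto_const)
    then have "(%n. \<epsilon> n *\<^sub>R k) \<longlonglongrightarrow> 0" by simp
    moreover have "isCont ?b 0" using smooth_continuous[OF smb, of UNIV] by (simp add: continuous_on_eq_continuous_at)
    ultimately show "(%n. ?b (\<epsilon> n *\<^sub>R k)) \<longlonglongrightarrow> ?b 0" by (rule isCont_tendsto_compose[rotated])
   qed
   show "AE k in lborel. norm (?b (\<epsilon> n *\<^sub>R k) * (fourier G k * cis (k \<bullet> z))) <= norm (fourier G k)" for n
    by (rule AE_I2) (simp add: norm_mult bump_ge_0 bump_le_1 mult_left_le_one_le)
  qed measurable
  have L2: "(%n. LINT s|lborel. G (z + \<epsilon> n *\<^sub>R s) * fourier ?b s) \<longlonglongrightarrow> (LINT s|lborel. G z * fourier ?b s)"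
  proof (rule integral_dominated_convergence[where w="%k. M * norm (fourier ?b k)"])
   show "integrable lborel (%k. M * norm (fourier ?b k))"
    using fourier_integrable(1)[OF smb, of 1] by (auto simp: bump_outside)
   show "AE s in lborel. (%n. G (z + \<epsilon> n *\<^sub>R s) * fourier ?b s) \<longlonglongrightarrow> G z * fourier ?b s"
   proof (intro AE_I2 tendsto_mult tendsto_const)
    fix s :: 'e
    have "(%n. z + \<epsilon> n *\<^sub>R s) \<longlonglongrightarrow> z + 0 *\<^sub>R s" by (intro tendsto_intros \<epsilon>0)
    then have "(%n. z + \<epsilon> n *\<^sub>R s) \<longlonglongrightarrow> z" by simp
    moreover have "isCont G z" using smooth_continuous[OF G, of UNIV] by (simp add: continuous_on_eq_continuous_at)
    ultimately show "(%n. G (z + \<epsilon> n *\<^sub>R s)) \<longlonglongrightarrow> G z" by (rule isCont_tendsto_compose[rotated])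
   qed
   show "AE s in lborel. norm (G (z + \<epsilon> n *\<^sub>R s) * fourier ?b s) <= M * norm (fourier ?b s)" for n
    by (rule AE_I2) (simp add: norm_mult M mult_right_mono)
  qed measurable
  show ?thesis using LIMSEQ_unique[OF L1[unfolded eq] L2] by (simp add: c1_def mult.commute)
 qed
 have "c1 \<noteq> 0"
 proof
  assume c1: "c1 = 0"
  let ?B = "fourier ?b"
  have [measurable]: "?B \<in> borel_measurable borel" by measurable
  have z0: "(LINT k|lborel. ?B k * cis (k \<bullet> z)) = 0" for z
   using inv[OF smb, of 1 z] b0 by (simp add: c1 bump_outside)
  obtain C where C: "C > 0" "\<And>k. cmod (?B k) <= C * decay k" using fourier_integrable(2)[OF smb, of 1] by (auto simp: bump_outside)
  define f where "f k z = ?B k * cis (k \<bullet> z) * ?b z" for k z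
  have int: "integrable (lborel \<Otimes>\<^sub>M lborel) (%(k, z). f k z)"
  proof (rule integrable_product_bound[where a="%k. C * decay k" and b="%z. norm (?b z)"])
   show "(%(k, z). f k z) \<in> borel_measurable (lborel \<Otimes>\<^sub>M lborel)" unfolding f_def by measurable
   show "integrable lborel (%k::'e. C * decay k)" by (intro integrable_mult_right integrable_decay)
   show "integrable lborel (%z. norm (?b z))" using bbs_integrable[OF bbs_bump] by (rule integrable_norm)
  qed (simp add: f_def norm_mult C mult_right_mono)
  have cB: "(LINT z|lborel. f k z) = of_real ((cmod (?B k))\<^sup>2)" for k
  proof -
   have "cnj (?B k) = (LINT z|lborel. cis (k \<bullet> z) * ?b z)"
    unfolding fourier_def Bochner_Integration.integral_cnj[symmetric] by (simp add: cis_cnj)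
   then show ?thesis using complex_norm_square[of "?B k"] by (simp add: f_def mult.assoc)
  qed
  have i2: "integrable lborel (%k. (cmod (?B k))\<^sup>2)"
   using lborel_pair.integrable_fst'[OF int] unfolding prod.case cB by (simp only: complex_of_real_integrable_eq)
  have "complex_of_real (LINT k|lborel. (cmod (?B k))\<^sup>2) = (LINT k|lborel. LINT z|lborel. f k z)"
   unfolding cB by (rule integral_complex_of_real[symmetric])
  also have "\<dots> = (LINT z|lborel. LINT k|lborel. f k z)" by (rule lborel_pair.Fubini_integral[OF int, symmetric])
  also have "\<dots> = 0" unfolding f_def by (simp add: z0)
  finally have I0: "(LINT k|lborel. (cmod (?B k))\<^sup>2) = 0" by simp
  obtain \<delta> where \<delta>: "\<delta> > 0" "\<And>k. norm k <= 1 ==> cmod (?B k) >= \<delta>" using fourier_bump_lower[where 'e='e] by blast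
  have "AE k in lborel. (cmod (?B k))\<^sup>2 = 0" using integral_nonneg_eq_0_iff_AE[OF i2] I0 by simp
  then have "AE k in lborel. k \<notin> (ball 0 1 :: 'e set)"
  proof eventually_elim
   case (elim k) then show ?case using \<delta>(1) \<delta>(2)[of k] by auto
  qed
  then have "emeasure lborel (ball 0 1 :: 'e set) = 0" using AE_iff_null_sets[of "ball 0 1 :: 'e set" lborel] by (simp add: null_sets_def del: mem_ball mem_ball_0)
  then have "unit_ball_vol (real DIM('e)) <= 0" by (simp add: emeasure_ball ennreal_eq_0_iff)
  then show False using unit_ball_vol_pos[of "real DIM('e)"] of_nat_0_le_iff by (metis not_le)
 qed
 then have nz: "c1 / of_real (bump (0::'e)) \<noteq> 0" using b0 by simp
 show thesis
 proof (rule that[OF nz])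
  fix G :: "'e => complex" and R :: real and z :: 'e assume "smooth G" "\<And>s. norm s > R ==> G s = 0"
  from inv[OF this] show "(LINT k|lborel. fourier G k * cis (k \<bullet> z)) = c1 / of_real (bump (0::'e)) * G z"
   using b0 by (simp add: field_simps)
 qed
qed

text \<open>An amplitude from a bounded family of compactly supported functions is a superposition of
characters with integrable coefficients. The family is thereby removed at the price of a
modulation, and every bound below has to be uniform in the modulation.\<close>

lemma fourier_pairing:
 fixes G :: "'p => 'e::euclidean_space => complex"
 assumes G: "symb (P \<times> UNIV) G" and R: "\<And>p s. p \<in> P ==> norm s > R ==> G p s = 0"
 obtains C where "C > 0" "\<And>p (f :: 's::euclidean_space => complex) h. p \<in> P ==> bbs f ==> h \<in> borel_measurable borel ==>
   ennreal (cmod (LINT s|lborel. G p (h s) * f s)) <= (\<integral>\<^sup>+k. ennreal (C * decay k * cmod (LINT s|lborel. cis (k \<bullet> h s) * f s)) \<partial>lborel)"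
proof -
 obtain c where c: "c \<noteq> 0" "\<And>G R z. smooth G ==> (\<And>s. norm s > R ==> G s = 0) ==>
  (LINT k|lborel. fourier G k * cis (k \<bullet> z)) = c * G (z::'e)"
  using fourier_inversion[where 'e='e] by blast
 obtain C where C: "C > 0" "\<And>p k. p \<in> P ==> cmod (fourier (G p) k) <= C * decay k"
  using fourier_decay[OF G R] unfolding fourier_def by metis
 have "ennreal (cmod (LINT s|lborel. G p (h s) * f s)) <= (\<integral>\<^sup>+k. ennreal (C / cmod c * decay k * cmod (LINT s|lborel. cis (k \<bullet> h s) * f s)) \<partial>lborel)"
  if p: "p \<in> P" and f: "bbs f" and h [measurable]: "h \<in> borel_measurable borel" for p and f :: "'s => complex" and h
 proof -
  have sG: "smooth (G p)" by (rule symb_smooth[OF G])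
  have [measurable]: "G p \<in> borel_measurable borel" "f \<in> borel_measurable borel"
   using smooth_measurable[OF sG] bbs_measurable[OF f] by auto
  have [measurable]: "fourier (G p) \<in> borel_measurable borel" by measurable
  define F where "F k z = inverse c * (fourier (G p) k * (cis (k \<bullet> h z) * f z))" for k z
  have int: "integrable (lborel \<Otimes>\<^sub>M lborel) (%(k, z). F k z)"
  proof (rule integrable_product_bound[where a="%k. C / cmod c * decay k" and b="%z. norm (f z)"])
   show "(%(k, z). F k z) \<in> borel_measurable (lborel \<Otimes>\<^sub>M lborel)" unfolding F_def by measurable
   show "integrable lborel (%k::'e. C / cmod c * decay k)" by (intro integrable_mult_right integrable_decay)
   show "integrable lborel (%z. norm (f z))" using bbs_integrable[OF f] by (rule integrable_norm)
   show "cmod (F k z) <= C / cmod c * decay k * norm (f z)" for k z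
   proof -
    have "cmod (F k z) = inverse (cmod c) * (cmod (fourier (G p) k) * cmod (f z))" by (simp add: F_def norm_mult norm_inverse)
    also have "\<dots> <= inverse (cmod c) * (C * decay k * cmod (f z))" by (intro mult_left_mono mult_right_mono C(2) p) auto
    finally show ?thesis by (simp add: divide_inverse mult_ac)
   qed
  qed
  have 1: "(LINT k|lborel. F k z) = G p (h z) * f z" for z
  proof -
   have "(LINT k|lborel. F k z) = inverse c * ((LINT k|lborel. fourier (G p) k * cis (k \<bullet> h z)) * f z)"
   proof -
    have "F k z = inverse c * ((fourier (G p) k * cis (k \<bullet> h z)) * f z)" for k by (simp only: F_def mult.assoc)
    then show ?thesis by (simp only: integral_mult_right_zero integral_mult_left_zero)
   qed
   then show ?thesis using c(2)[OF sG R[OF p]] c(1) by simp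
  qed
  have 2: "(LINT z|lborel. F k z) = inverse c * (fourier (G p) k * (LINT z|lborel. cis (k \<bullet> h z) * f z))" for k
   by (simp add: F_def)
  have "(LINT s|lborel. G p (h s) * f s) = (LINT k|lborel. LINT z|lborel. F k z)"
   using lborel_pair.Fubini_integral[OF int] by (simp add: 1)
  also have "ennreal (cmod \<dots>) <= (\<integral>\<^sup>+k. norm (LINT z|lborel. F k z) \<partial>lborel)"
   using lborel_pair.integrable_fst'[OF int] by (intro integral_norm_bound_ennreal) simp
  also have "\<dots> <= (\<integral>\<^sup>+k. ennreal (C / cmod c * decay k * cmod (LINT s|lborel. cis (k \<bullet> h s) * f s)) \<partial>lborel)"
  proof (intro nn_integral_mono ennreal_leI)
   fix k
   have "cmod (LINT z|lborel. F k z) = inverse (cmod c) * (cmod (fourier (G p) k) * cmod (LINT s|lborel. cis (k \<bullet> h s) * f s))"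
    by (simp add: 2 norm_mult norm_inverse)
   also have "\<dots> <= inverse (cmod c) * (C * decay k * cmod (LINT s|lborel. cis (k \<bullet> h s) * f s))"
    by (intro mult_left_mono mult_right_mono C(2) p) auto
   finally show "cmod (LINT z|lborel. F k z) <= C / cmod c * decay k * cmod (LINT s|lborel. cis (k \<bullet> h s) * f s)"
    by (simp add: divide_inverse mult_ac)
  qed
  finally show ?thesis .
 qed
 then show thesis using that[of "C / cmod c"] C(1) c(1) by simp
qed

section \<open>Freezing the phase on a cell\<close>

abbreviation swp :: "'a \<times> 'b => 'b \<times> 'a" where "swp z \<equiv> (snd z, fst z)"

lemma symb_compose_affine:
 fixes F :: "'p => 'a::euclidean_space => 'b::real_normed_vector" and T :: "'c::euclidean_space => 'a"
 assumes F: "symb \<Omega>' F" and T: "bounded_linear T" and \<Omega>: "\<And>q x. (q, x) \<in> \<Omega> ==> (f q, a q + T x) \<in> \<Omega>'"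
 shows "symb \<Omega> (%q x. F (f q) (a q + T x))"
proof (rule symb_compose[where F="%q. F (f q)" and h="%q x. a q + T x", OF symb_reparam[OF F]])
 have D: "((%x. a q + T x) has_derivative T) (at x)" for q x
  using bounded_linear_imp_has_derivative[OF T] by (auto intro!: derivative_eq_intros)
 show "(%x. a q + T x) differentiable (at x)" for q x using D differentiable_def by blast
 have "dd b (%x. a q + T x) = (%x. T b)" for b q by (rule ext, rule dd_eq[OF D])
 then show "symb \<Omega> (%q. dd b (%x. a q + T x))" for b by (simp add: symb_const0)
qed (use \<Omega> in auto)

lemma symb_compose_linear:
 fixes F :: "'p => 'a::euclidean_space => 'b::real_normed_vector" and T :: "'c::euclidean_space => 'a"
 assumes F: "symb \<Omega>' F" and T: "bounded_linear T" and \<Omega>: "\<And>q x. (q, x) \<in> \<Omega> ==> (f q, T x) \<in> \<Omega>'"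
 shows "symb \<Omega> (%q x. F (f q) (T x))"
 using symb_compose_affine[OF F T, of \<Omega> f "%_. 0"] \<Omega> by simp

lemma dd_compose_affine:
 assumes T: "bounded_linear T" and f: "smooth f"
 shows "dd b (%x. f (a + T x)) = (%x. dd (T b) f (a + T x))"
proof
 fix x
 have "((%x. a + T x) has_derivative T) (at x)"
  using bounded_linear_imp_has_derivative[OF T] by (auto intro!: derivative_eq_intros)
 from has_derivative_compose[OF this dd_has_derivative[OF smooth_differentiable[OF f]]]
 show "dd b (%x. f (a + T x)) x = dd (T b) f (a + T x)" by (rule dd_eq)
qed

text \<open>A mixed second difference loses the growth of the phase: only mixed derivatives enter.\<close>

lemma symb_second_difference:
 fixes f :: "'a::euclidean_space \<times> 'b::euclidean_space => real"
 assumes "smooth f" "\<And>c. c \<in> Basis ==> symb UNIV (%_::unit. dd (inc2 c) f)"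
 shows "symb {(q, z). norm (snd z) <= 1} (%q z. f (q + z) - f (fst q + fst z, snd q))"
proof -
 let ?O = "{(q::'a \<times> 'b, z::'a \<times> 'b). norm (snd z) <= 1}"
 let ?F = "%f (q::'a \<times> 'b) (z::'a \<times> 'b). f (q + z) - f (fst q + fst z, snd q) :: real"
 have bl: "bounded_linear (%z::'a \<times> 'b. (fst z, 0::'b))"
  by (intro bounded_linear_Pair bounded_linear_fst bounded_linear_zero)
 have "symb_k k ?O (?F f)" if "smooth f" "\<And>c. c \<in> Basis ==> symb UNIV (%_::unit. dd (inc2 c) f)" for k and f :: "'a \<times> 'b => real"
  using that
 proof (induction k arbitrary: f)
  case (0 f)
  obtain C where C: "C >= 0" "\<And>y \<zeta> \<eta>. \<bar>f (y, \<zeta>) - f (y, \<eta>)\<bar> <= C * norm (\<zeta> - \<eta>)"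
   using lipschitz_snd[OF 0(1)] symb_unit_bound[OF 0(2)] by (metis real_norm_def)
  have "norm (?F f q z) <= C" if "norm (snd z) <= 1" for q z
  proof -
   have "norm (?F f q z) <= C * norm (snd z)" using C(2)[of "fst q + fst z" "snd q + snd z" "snd q"] by (simp add: plus_prod_def)
   also have "\<dots> <= C * 1" using that C(1) by (intro mult_left_mono) auto
   finally show ?thesis by simp
  qed
  then have "\<exists>C. \<forall>q z. (q, z) \<in> ?O --> norm (?F f q z) <= C" by (intro exI[of _ C]) auto
  then show ?case unfolding symb_k.simps .
 next
  case (Suc k f)
  obtain C where C: "C >= 0" "\<And>y \<zeta> \<eta>. \<bar>f (y, \<zeta>) - f (y, \<eta>)\<bar> <= C * norm (\<zeta> - \<eta>)"
   using lipschitz_snd[OF Suc.prems(1)] symb_unit_bound[OF Suc.prems(2)] by (metis real_norm_def)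
  have 1: "norm (?F f q z) <= C" if "norm (snd z) <= 1" for q z
  proof -
   have "norm (?F f q z) <= C * norm (snd z)" using C(2)[of "fst q + fst z" "snd q + snd z" "snd q"] by (simp add: plus_prod_def)
   also have "\<dots> <= C * 1" using that C(1) by (intro mult_left_mono) auto
   finally show ?thesis by simp
  qed
  have s1: "smooth (%z. f (q + z))" for q by (rule smooth_compose[OF Suc.prems(1)]) (intro smooth_intros)
  have s2: "smooth (%z. f (fst q + fst z, snd q))" for q :: "'a \<times> 'b"
   by (rule smooth_compose[OF Suc.prems(1), of "%z. (fst q + fst z, snd q)"]) (intro smooth_intros)
  have e: "dd b (?F f q) = (%z. dd b f (q + z) - dd (fst b, 0) f (fst q + fst z, snd q))" for b q
  proof
   fix z
   have "(?F f q has_derivative (%v. dd v (%z. f (q + z)) z - dd v (%z. f (fst q + fst z, snd q)) z)) (at z)"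
    by (intro has_derivative_diff dd_has_derivative smooth_differentiable s1 s2)
   from dd_eq[OF this, of b] show "dd b (?F f q) z = dd b f (q + z) - dd (fst b, 0) f (fst q + fst z, snd q)"
    using dd_compose_affine[OF bounded_linear_ident Suc.prems(1), of b q]
     dd_compose_affine[OF bl Suc.prems(1), of b "(fst q, snd q)", unfolded plus_prod_def fst_conv snd_conv add_0_right]
    by (simp only:)
  qed
  have 2: "symb_k k ?O (%q. dd b (?F f q))" if b: "b \<in> Basis" for b
  proof -
   from b consider u where "u \<in> Basis" "b = inc1 u" | v where "v \<in> Basis" "b = inc2 v" by (auto simp: Basis_prod_def)
   then show ?thesis
   proof cases
    case 1
    have "symb_k k ?O (?F (dd (inc1 u) f))"
    proof (rule Suc.IH)
     show "smooth (dd (inc1 u) f)" by (rule smooth_dd[OF Suc.prems(1) Basis_inc(1)[OF 1(1)]])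
     show "symb UNIV (%_::unit. dd (inc2 c) (dd (inc1 u) f))" if "c \<in> Basis" for c
      using symb_dd[OF Suc.prems(2)[OF that] Basis_inc(1)[OF 1(1)]] by (simp add: dd_comm_inc[OF Suc.prems(1) 1(1) that])
    qed
    then show ?thesis unfolding e by (simp add: 1(2))
   next
    case 2
    have z: "dd (0, 0) f x = 0" for x
     using linear_0[OF bounded_linear.linear[OF has_derivative_bounded_linear[OF dd_has_derivative[OF smooth_differentiable[OF Suc.prems(1)]]]]]
     by (simp add: zero_prod_def)
    have "symb ?O (%q z. dd (inc2 v) f (q + z))"
     by (rule symb_compose_affine[OF Suc.prems(2)[OF 2(1)] bounded_linear_ident, where f="%_. ()" and a="%q. q"]) auto
    then show ?thesis unfolding e by (simp add: 2(2) z symb_def)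
   qed
  qed
  have 3: "?F f q differentiable (at z)" for q z
   by (intro differentiable_diff smooth_differentiable s1 s2)
  have 0: "\<exists>C. \<forall>q z. (q, z) \<in> ?O --> norm (?F f q z) <= C" using 1 by (intro exI[of _ C]) auto
  show ?case unfolding symb_k.simps using 0 2 3 by blast
 qed
 then show ?thesis using assms by (simp add: symb_def)
qed

locale fio_phase = fw: phase \<Phi> + bw: phase "%z. \<Phi> (swp z)"
 for \<Phi> :: "'a::euclidean_space \<times> 'a => real"
begin

lemma bounded_linear_swp: "bounded_linear (%z. swp z)"
 by (intro bounded_linear_Pair bounded_linear_fst bounded_linear_snd)

lemma dd_swp: "dd b (%z. \<Phi> (swp z)) = (%z. dd (swp b) \<Phi> (swp z))"
 using dd_compose_affine[OF bounded_linear_swp fw.smooth, of b 0] by simp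

text \<open>What is left of the phase after freezing either variable at the centre of a cell. The frozen terms
depend on one variable each and are absorbed into the two packets.\<close>

definition residual :: "'a \<times> 'a => 'a \<times> 'a => real" where
 "residual q z = \<Phi> (q + z) - \<Phi> (fst q, snd q + snd z) - \<Phi> (fst q + fst z, snd q) + \<Phi> q"

lemma smooth_residual: "smooth (residual q)"
 unfolding residual_def
 by (intro smooth_add smooth_diff smooth_const smooth_compose[OF fw.smooth] smooth_intros)

lemma symb_cis_residual: "symb {(q, z). norm (fst z) <= 1 \<and> norm (snd z) <= 1} (%q z. cis (residual q z))"
proof (rule symb_cis)
 let ?O = "{(q::'a \<times> 'a, z::'a \<times> 'a). norm (fst z) <= 1 \<and> norm (snd z) <= 1}"
 show "residual q differentiable (at z)" for q z by (rule smooth_differentiable[OF smooth_residual])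
 fix b :: "'a \<times> 'a" assume b: "b \<in> Basis"
 have bl1: "bounded_linear (%z::'a \<times> 'a. (fst z, 0::'a))" and bl2: "bounded_linear (%z::'a \<times> 'a. (0::'a, snd z))"
  by (intro bounded_linear_Pair bounded_linear_fst bounded_linear_snd bounded_linear_zero)+
 have e: "dd b (residual q) = (%z. dd b \<Phi> (q + z) - dd (0, snd b) \<Phi> (fst q, snd q + snd z) - dd (fst b, 0) \<Phi> (fst q + fst z, snd q))" for b q
 proof
  fix z
  have s1: "smooth (%z. \<Phi> (q + z))" by (intro smooth_compose[OF fw.smooth] smooth_intros)
  have s2: "smooth (%z::'a \<times> 'a. \<Phi> (fst q, snd q + snd z))" by (intro smooth_compose[OF fw.smooth] smooth_intros)
  have s3: "smooth (%z::'a \<times> 'a. \<Phi> (fst q + fst z, snd q))" by (intro smooth_compose[OF fw.smooth] smooth_intros)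
  have "(residual q has_derivative (%v. dd v (%z. \<Phi> (q + z)) z - dd v (%z. \<Phi> (fst q, snd q + snd z)) z - dd v (%z. \<Phi> (fst q + fst z, snd q)) z + 0)) (at z)"
   unfolding residual_def[abs_def]
   by (intro has_derivative_add has_derivative_diff has_derivative_const dd_has_derivative smooth_differentiable s1 s2 s3)
  from dd_eq[OF this, of b] show "dd b (residual q) z = dd b \<Phi> (q + z) - dd (0, snd b) \<Phi> (fst q, snd q + snd z) - dd (fst b, 0) \<Phi> (fst q + fst z, snd q)"
   using dd_compose_affine[OF bounded_linear_ident fw.smooth, of b q]
    dd_compose_affine[OF bl1 fw.smooth, of b "(fst q, snd q)", unfolded plus_prod_def fst_conv snd_conv add_0_right]
    dd_compose_affine[OF bl2 fw.smooth, of b "(fst q, snd q)", unfolded plus_prod_def fst_conv snd_conv add_0_right]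
   by (simp only: add_0_right)
 qed
 have z: "dd (0, 0) \<Phi> x = 0" for x
  using linear_0[OF bounded_linear.linear[OF has_derivative_bounded_linear[OF dd_has_derivative[OF smooth_differentiable[OF fw.smooth]]]]]
  by (simp add: zero_prod_def)
 from b consider u where "u \<in> Basis" "b = inc1 u" | v where "v \<in> Basis" "b = inc2 v" by (auto simp: Basis_prod_def)
 then show "symb ?O (%q. dd b (residual q))"
 proof cases
  case 1
  have "symb {(q, z). norm (snd z) <= 1} (%q z. dd (inc1 u) \<Phi> (q + z) - dd (inc1 u) \<Phi> (fst q + fst z, snd q))"
   by (rule symb_second_difference[OF smooth_dd[OF fw.smooth Basis_inc(1)[OF 1(1)]]])
    (use fw.mixed[OF 1(1)] in \<open>simp add: dd_comm_inc[OF fw.smooth 1(1)]\<close>)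
  then have "symb ?O (%q z. dd (inc1 u) \<Phi> (q + z) - dd (inc1 u) \<Phi> (fst q + fst z, snd q))"
   by (rule symb_mono) auto
  then show ?thesis unfolding e by (simp add: 1(2) z)
 next
  case 2
  let ?f = "dd (inc1 v) (%z. \<Phi> (swp z))"
  have "symb {(q, z). norm (snd z) <= 1} (%q z. ?f (q + z) - ?f (fst q + fst z, snd q))"
   by (rule symb_second_difference[OF smooth_dd[OF bw.smooth Basis_inc(1)[OF 2(1)]]])
    (use bw.mixed[OF 2(1)] in \<open>simp add: dd_comm_inc[OF bw.smooth 2(1)]\<close>)
  from symb_compose_linear[OF this bounded_linear_swp, of ?O "%q. swp q"]
  have "symb ?O (%q z. ?f (swp q + swp z) - ?f (fst (swp q) + fst (swp z), snd (swp q)))" by auto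
  then show ?thesis unfolding e by (simp add: 2(2) z dd_swp plus_prod_def)
 qed
qed

definition cell_amp :: "('p => 'a \<times> 'a \<times> 'a => complex) => 'p \<times> 'a \<times> 'a => 'a \<times> 'a \<times> 'a => complex" where
 "cell_amp F q z = F (fst q) ((0, snd q) + z) * of_real (bump (fst (snd z)) * bump (snd (snd z))) * cis (residual (snd q) (snd z))"

lemma symb_cell_amp:
 fixes F :: "'p => 'a \<times> 'a \<times> 'a => complex"
 assumes F: "symb (P \<times> UNIV) F"
 shows "symb ((P \<times> UNIV) \<times> UNIV) (cell_amp F)"
proof (rule symb_extend)
 let ?O = "{(q::'p \<times> 'a \<times> 'a, z::'a \<times> 'a \<times> 'a). fst q \<in> P \<and> norm (fst (snd z)) <= 1 \<and> norm (snd (snd z)) <= 1}"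
 show "symb ?O (cell_amp F)"
  unfolding cell_amp_def[abs_def]
 proof (intro symb_mult symb_of_real)
  show "symb ?O (%q z. F (fst q) ((0, snd q) + z))"
   by (rule symb_compose_affine[OF F bounded_linear_ident, where f=fst and a="%q. (0, snd q)"]) auto
  show "symb ?O (%q z. bump (fst (snd z)))"
   by (rule symb_compose_linear[OF symb_bump, where T="%z. fst (snd z)" and f="%_. ()"])
    (auto intro: bounded_linear_compose[OF bounded_linear_fst bounded_linear_snd])
  show "symb ?O (%q z. bump (snd (snd z)))"
   by (rule symb_compose_linear[OF symb_bump, where T="%z. snd (snd z)" and f="%_. ()"])
    (auto intro: bounded_linear_compose[OF bounded_linear_snd bounded_linear_snd])
  show "symb ?O (%q z. cis (residual (snd q) (snd z)))"
   by (rule symb_compose_linear[OF symb_cis_residual bounded_linear_snd, where f=snd]) auto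
 qed
 show "closed {z. (q, z) \<in> ?O}" for q
 proof -
  have "closed {z::'a \<times> 'a \<times> 'a. norm (fst (snd z)) <= 1 \<and> norm (snd (snd z)) <= 1}"
   by (intro closed_Collect_conj closed_Collect_le continuous_intros)
  then show ?thesis by (cases "fst q \<in> P") auto
 qed
 show "cell_amp F q z = 0" if "q \<in> P \<times> UNIV" "(q, z) \<notin> ?O" for q z
  using that by (auto simp: cell_amp_def bump_outside)
qed

lemma cell_amp_support:
 assumes "\<And>z. norm (fst z) > R ==> F (fst q) z = 0" "norm z > \<bar>R\<bar> + 2"
 shows "cell_amp F q z = 0"
proof (rule ccontr)
 assume nz: "cell_amp F q z \<noteq> 0"
 then have "norm (fst z) <= R" using assms(1)[of "(0, snd q) + z"] by (force simp: cell_amp_def)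
 moreover have "norm (fst (snd z)) <= 1" "norm (snd (snd z)) <= 1"
  using nz by (auto simp: cell_amp_def bump_0)
 moreover have "norm z <= norm (fst z) + (norm (fst (snd z)) + norm (snd (snd z)))"
  using norm_Pair_le[of "fst z" "snd z"] norm_Pair_le[of "fst (snd z)" "snd (snd z)"] by simp
 ultimately show False using assms(2) by linarith
qed

end

section \<open>Wave packets\<close>

definition l2 :: "('a::euclidean_space => complex) => real" where
 "l2 g = sqrt (LINT x|lborel. (cmod (g x))\<^sup>2)"

lemma l2_nonneg: "l2 g >= 0" by (simp add: l2_def)

lemma nn_l2:
 assumes "bbs g" shows "(nn_sq (%x. g x)) = ennreal ((l2 g)\<^sup>2)"
proof -
 obtain C R where g: "g \<in> borel_measurable borel" "\<And>x. cmod (g x) <= C" "\<And>x. norm x > R ==> g x = 0"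
  using assms unfolding bbs_def by blast
 have "integrable lborel (%x. (cmod (g x))\<^sup>2)"
  by (rule integrable_bounded_support[of _ "C\<^sup>2" R]) (use g in \<open>auto intro!: power_mono\<close>)
 from nn_integral_eq_integral[OF this] show ?thesis by (simp add: l2_def)
qed

definition ball_vol :: "'a::euclidean_space itself => real" where
 "ball_vol _ = measure lborel (cball 0 1 :: 'a set)"

lemma emeasure_unit_cball: "emeasure lborel (cball 0 1 :: 'a::euclidean_space set) = ennreal (ball_vol TYPE('a))"
 unfolding ball_vol_def by (rule emeasure_eq_ennreal_measure) (use emeasure_lborel_cball_finite[of 0 1] in \<open>simp add: less_top[symmetric]\<close>)

lemma nn_integral_smear:
 fixes f :: "'a::euclidean_space => ennreal"
 assumes [measurable]: "f \<in> borel_measurable borel"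
 shows "(\<integral>\<^sup>+w. \<integral>\<^sup>+y. f (w + y) * indicator (cball 0 1) y \<partial>lborel \<partial>lborel) = ennreal (ball_vol TYPE('a)) * (\<integral>\<^sup>+x. f x \<partial>lborel)"
proof -
 have [measurable]: "(indicator (cball 0 1) :: 'a => ennreal) \<in> borel_measurable borel" by (rule borel_measurable_indicator) simp
 have "(\<integral>\<^sup>+w. \<integral>\<^sup>+y. f (w + y) * indicator (cball 0 1) y \<partial>lborel \<partial>lborel)
   = (\<integral>\<^sup>+y. \<integral>\<^sup>+w. f (w + y) * indicator (cball 0 1) y \<partial>lborel \<partial>lborel)"
  by (rule lborel_pair.Fubini') measurable
 also have "\<dots> = (\<integral>\<^sup>+y. (\<integral>\<^sup>+x. f x \<partial>lborel) * indicator (cball 0 1) (y::'a) \<partial>lborel)"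
  using nn_integral_translate[of f] by (intro nn_integral_cong) (simp add: nn_integral_multc add.commute)
 also have "\<dots> = (\<integral>\<^sup>+x. f x \<partial>lborel) * emeasure lborel (cball 0 1 :: 'a set)"
  by (rule nn_integral_cmult_indicator) simp
 finally show ?thesis by (simp add: emeasure_unit_cball mult.commute)
qed

lemma (in phase) local_L2_bound_bounded:
 obtains C where "C > 0" "\<And>w h D. h \<in> borel_measurable borel ==> (\<And>y. cmod (h y) <= D) ==>
   (nn_sq (%\<zeta>. LINT y|lborel. cis (\<Phi> (w + y, \<zeta>)) * (of_real (bump y) * h y)))
    <= ennreal C * (\<integral>\<^sup>+y. ennreal ((cmod (h y))\<^sup>2) * indicator (cball 0 1) y \<partial>lborel)"
proof -
 obtain C where C: "C > 0" "\<And>w h. bbs h ==>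
   (nn_sq (%\<zeta>. LINT y|lborel. cis (\<Phi> (w + y, \<zeta>)) * (of_real (bump y) * h y)))
    <= ennreal C * (\<integral>\<^sup>+y. ennreal ((cmod (h y))\<^sup>2) * indicator (cball 0 1) y \<partial>lborel)"
  using local_L2_bound by blast
 show thesis
 proof (rule that[OF C(1)])
  fix w :: 'a and h :: "'a => complex" and D assume h: "h \<in> borel_measurable borel" "\<And>y. cmod (h y) <= D"
  have i: "bbs (%y. h y * indicator (cball 0 1) y)" by (rule bbs_bounded_indicator[OF h])
  have e1: "of_real (bump y) * (h y * indicator (cball 0 1) y) = of_real (bump y) * h y" for y
   by (auto simp: indicator_def bump_outside)
  have e2: "ennreal ((cmod (h y * indicator (cball 0 1) y))\<^sup>2) * indicator (cball 0 1) y = ennreal ((cmod (h y))\<^sup>2) * indicator (cball 0 1) y" for y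
   by (auto simp: indicator_def)
  show "(nn_sq (%\<zeta>. LINT y|lborel. cis (\<Phi> (w + y, \<zeta>)) * (of_real (bump y) * h y)))
    <= ennreal C * (\<integral>\<^sup>+y. ennreal ((cmod (h y))\<^sup>2) * indicator (cball 0 1) y \<partial>lborel)"
   using C(2)[OF i, of w] unfolding e1 e2 .
 qed
qed

lemma bbs_translate: assumes "bbs g" shows "bbs (%y. g (w + y))"
proof -
 obtain C R where g: "g \<in> borel_measurable borel" "\<And>x. cmod (g x) <= C" "\<And>x. norm x > R ==> g x = 0"
  using assms unfolding bbs_def by blast
 note [measurable] = g(1)
 have "g (w + y) = 0" if "norm y > R + norm w" for y
  using that norm_triangle_ineq4[of "w + y" w] by (intro g(3)) simp
 moreover have "(%y. g (w + y)) \<in> borel_measurable borel" by measurable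
 ultimately show ?thesis unfolding bbs_def using g(2) by blast
qed

lemma nn_integral_lborel_prod:
 fixes f :: "'a::euclidean_space \<times> 'b::euclidean_space => ennreal"
 assumes "f \<in> borel_measurable borel"
 shows "(\<integral>\<^sup>+z. f z \<partial>lborel) = (\<integral>\<^sup>+x. \<integral>\<^sup>+y. f (x, y) \<partial>lborel \<partial>lborel)"
  and "(\<integral>\<^sup>+z. f z \<partial>lborel) = (\<integral>\<^sup>+y. \<integral>\<^sup>+x. f (x, y) \<partial>lborel \<partial>lborel)"
proof -
 have m: "f \<in> borel_measurable (lborel \<Otimes>\<^sub>M lborel)" using assms by (simp add: lborel_prod)
 show 1: "(\<integral>\<^sup>+z. f z \<partial>lborel) = (\<integral>\<^sup>+x. \<integral>\<^sup>+y. f (x, y) \<partial>lborel \<partial>lborel)"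
  using lborel.nn_integral_fst[OF m] by (simp add: lborel_prod)
 show "(\<integral>\<^sup>+z. f z \<partial>lborel) = (\<integral>\<^sup>+y. \<integral>\<^sup>+x. f (x, y) \<partial>lborel \<partial>lborel)"
  unfolding 1 by (rule lborel_pair.Fubini') (use m in simp)
qed

context fio_phase
begin

definition kern :: "('a \<times> 'a \<times> 'a => complex) => real => ('a => complex) => ('a => complex) => 'a \<times> 'a \<times> 'a => complex" where
 "kern F \<rho> u v z = cis (fst z \<bullet> snd (snd z) + \<Phi> (snd z)) * F (fst z /\<^sub>R \<rho>, snd z) * (u (fst (snd z)) * v (fst z))"

definition vhat :: "real => ('a => complex) => 'a => 'a => complex" where
 "vhat \<rho> v k \<xi> = (LINT x|lborel. cis (x \<bullet> \<xi>) * (cis (k \<bullet> (x /\<^sub>R \<rho>)) * v x))"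
definition pack_u :: "('a => complex) => 'a \<times> 'a => 'a => complex" where
 "pack_u u q k = (LINT y|lborel. cis (\<Phi> (fst q + y, snd q)) * (of_real (bump y) * (cis (k \<bullet> y) * u (fst q + y))))"
definition pack_v :: "real => ('a => complex) => 'a \<times> 'a => 'a => 'a => complex" where
 "pack_v \<rho> v q k1 k3 = (LINT \<xi>|lborel. cis (\<Phi> (fst q, snd q + \<xi>)) * (of_real (bump \<xi>) * (cis (k3 \<bullet> \<xi>) * vhat \<rho> v k1 (snd q + \<xi>))))"

lemma vhat_measurable [measurable (raw)]:
 assumes [measurable]: "v \<in> borel_measurable borel" "f \<in> borel_measurable M" "g \<in> borel_measurable M"
 shows "(%x. vhat \<rho> v (f x) (g x)) \<in> borel_measurable M"
 unfolding vhat_def by (intro lborel.borel_measurable_lebesgue_integral) measurable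

lemma pack_u_measurable [measurable (raw)]:
 assumes [measurable]: "u \<in> borel_measurable borel" "f \<in> borel_measurable M" "g \<in> borel_measurable M" "k \<in> borel_measurable M"
 shows "(%x. pack_u u (f x, g x) (k x)) \<in> borel_measurable M"
 unfolding pack_u_def fst_conv snd_conv by (intro lborel.borel_measurable_lebesgue_integral) measurable

lemma pack_v_measurable [measurable (raw)]:
 assumes [measurable]: "v \<in> borel_measurable borel" "f \<in> borel_measurable M" "g \<in> borel_measurable M" "k1 \<in> borel_measurable M" "k3 \<in> borel_measurable M"
 shows "(%x. pack_v \<rho> v (f x, g x) (k1 x) (k3 x)) \<in> borel_measurable M"
 unfolding pack_v_def fst_conv snd_conv by (intro lborel.borel_measurable_lebesgue_integral) measurable

text \<open>Square integration over the frequency centre is the local bound; integration over the position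
centre merely smears the mass of the function over unit balls.\<close>

lemma pack_u_bound:
 obtains C where "C > 0" "\<And>u k. bbs u ==>
  (nn_sq (%q. pack_u u q k)) <= ennreal (C * (l2 u)\<^sup>2)"
proof -
 obtain C where C: "C > 0" "\<And>w h D. h \<in> borel_measurable borel ==> (\<And>y. cmod (h y) <= D) ==>
   (nn_sq (%\<zeta>. LINT y|lborel. cis (\<Phi> (w + y, \<zeta>)) * (of_real (bump y) * h y)))
    <= ennreal C * (\<integral>\<^sup>+y. ennreal ((cmod (h y))\<^sup>2) * indicator (cball 0 1) y \<partial>lborel)"
  using fw.local_L2_bound_bounded by blast
 have "(nn_sq (%q. pack_u u q k)) <= ennreal ((C * ball_vol TYPE('a) + 1) * (l2 u)\<^sup>2)" if u: "bbs u" for u k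
 proof -
  obtain D where D: "u \<in> borel_measurable borel" "\<And>x. cmod (u x) <= D" using u unfolding bbs_def by blast
  note [measurable] = D(1)
  have hb: "cmod (cis (k \<bullet> y) * u (w + y)) <= D" for w y using D(2) by (simp add: norm_mult)
  have "(%q. pack_u u (fst q, snd q) k) \<in> borel_measurable (borel \<Otimes>\<^sub>M borel)" by measurable
  then have m [measurable]: "(%q. pack_u u q k) \<in> borel_measurable borel" by (simp add: borel_prod)
  have "(nn_sq (%q. pack_u u q k)) = (\<integral>\<^sup>+w. \<integral>\<^sup>+\<zeta>. ennreal ((cmod (pack_u u (w, \<zeta>) k))\<^sup>2) \<partial>lborel \<partial>lborel)"
   by (rule nn_integral_lborel_prod(1)) measurable
  also have "\<dots> <= (\<integral>\<^sup>+w. ennreal C * (\<integral>\<^sup>+y. ennreal ((cmod (cis (k \<bullet> y) * u (w + y)))\<^sup>2) * indicator (cball 0 1) y \<partial>lborel) \<partial>lborel)"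
   unfolding pack_u_def fst_conv snd_conv
   by (intro nn_integral_mono C(2)[OF _ hb]) measurable
  also have "\<dots> = (\<integral>\<^sup>+w. ennreal C * (\<integral>\<^sup>+y. (%x. ennreal ((cmod (u x))\<^sup>2)) (w + y) * indicator (cball 0 1) y \<partial>lborel) \<partial>lborel)"
   by (simp add: norm_mult)
  also have "\<dots> = ennreal C * (\<integral>\<^sup>+w. (\<integral>\<^sup>+y. (%x. ennreal ((cmod (u x))\<^sup>2)) (w + y) * indicator (cball 0 1) y \<partial>lborel) \<partial>lborel)"
  proof (rule nn_integral_cmult)
   have [measurable]: "(indicator (cball 0 1) :: 'a => ennreal) \<in> borel_measurable borel" by (rule borel_measurable_indicator) simp
   show "(%w. \<integral>\<^sup>+y. (%x. ennreal ((cmod (u x))\<^sup>2)) (w + y) * indicator (cball 0 1) y \<partial>lborel) \<in> borel_measurable lborel" by measurable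
  qed
  also have "\<dots> = ennreal C * (ennreal (ball_vol TYPE('a)) * ennreal ((l2 u)\<^sup>2))"
   by (subst nn_integral_smear) (simp_all add: nn_l2[OF u])
  also have "\<dots> = ennreal (C * ball_vol TYPE('a) * (l2 u)\<^sup>2)"
   using C(1) by (simp add: ennreal_mult ball_vol_def mult.assoc)
  also have "\<dots> <= ennreal ((C * ball_vol TYPE('a) + 1) * (l2 u)\<^sup>2)" by (intro ennreal_leI mult_right_mono) auto
  finally show ?thesis .
 qed
 moreover have "C * ball_vol TYPE('a) + 1 > 0" using C(1) by (intro add_nonneg_pos mult_nonneg_nonneg) (auto simp: ball_vol_def)
 ultimately show thesis using that by blast
qed

text \<open>The roles of the variables are exchanged: the local bound is applied to the swapped phase, and
Plancherel's inequality returns from the transform to the function.\<close>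

lemma pack_v_bound:
 obtains C where "C > 0" "\<And>\<rho> v k1 k3. bbs v ==>
  (nn_sq (%q. pack_v \<rho> v q k1 k3)) <= ennreal (C * (l2 v)\<^sup>2)"
proof -
 obtain C where C: "C > 0" "\<And>w h D. h \<in> borel_measurable borel ==> (\<And>y. cmod (h y) <= D) ==>
   (nn_sq (%\<zeta>. LINT y|lborel. cis (\<Phi> (\<zeta>, w + y)) * (of_real (bump y) * h y)))
    <= ennreal C * (\<integral>\<^sup>+y. ennreal ((cmod (h y))\<^sup>2) * indicator (cball 0 1) y \<partial>lborel)"
  using bw.local_L2_bound_bounded unfolding fst_conv snd_conv by blast
 obtain C' where C': "C' > 0" "\<And>v :: 'a => complex. bbs v ==>
  (nn_sq (%\<xi>. LINT x|lborel. cis (x \<bullet> \<xi>) * v x)) <= ennreal C' * (nn_sq (%x. v x))"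
  using plancherel_le by blast
 have "(nn_sq (%q. pack_v \<rho> v q k1 k3)) <= ennreal ((C * ball_vol TYPE('a) * C' + 1) * (l2 v)\<^sup>2)"
  if v: "bbs v" for \<rho> v k1 k3
 proof -
  have vm [measurable]: "v \<in> borel_measurable borel" using v by (rule bbs_measurable)
  have kv: "bbs (%x. cis (k1 \<bullet> (x /\<^sub>R \<rho>)) * v x)" by (rule bbs_mult[OF v, of _ 1]) auto
  define D where "D = (LINT x|lborel. cmod (v x))"
  have vb: "cmod (vhat \<rho> v k1 \<xi>) <= D" for \<xi>
   unfolding vhat_def D_def by (rule order_trans[OF integral_norm_bound]) (simp add: norm_mult)
  have hb: "cmod (cis (k3 \<bullet> \<xi>) * vhat \<rho> v k1 (\<zeta> + \<xi>)) <= D" for \<zeta> \<xi> using vb by (simp add: norm_mult)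
  have gm [measurable]: "vhat \<rho> v k1 \<in> borel_measurable borel" by measurable
  have "(%q. pack_v \<rho> v (fst q, snd q) k1 k3) \<in> borel_measurable (borel \<Otimes>\<^sub>M borel)" by measurable
  then have m [measurable]: "(%q. pack_v \<rho> v q k1 k3) \<in> borel_measurable borel" by (simp add: borel_prod)
  have "(nn_sq (%q. pack_v \<rho> v q k1 k3)) = (\<integral>\<^sup>+\<zeta>. \<integral>\<^sup>+w. ennreal ((cmod (pack_v \<rho> v (w, \<zeta>) k1 k3))\<^sup>2) \<partial>lborel \<partial>lborel)"
   by (rule nn_integral_lborel_prod(2)) measurable
  also have "\<dots> <= (\<integral>\<^sup>+\<zeta>. ennreal C * (\<integral>\<^sup>+\<xi>. ennreal ((cmod (cis (k3 \<bullet> \<xi>) * vhat \<rho> v k1 (\<zeta> + \<xi>)))\<^sup>2) * indicator (cball 0 1) \<xi> \<partial>lborel) \<partial>lborel)"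
   unfolding pack_v_def fst_conv snd_conv
   by (intro nn_integral_mono C(2)[OF _ hb]) measurable
  also have "\<dots> = (\<integral>\<^sup>+\<zeta>. ennreal C * (\<integral>\<^sup>+\<xi>. (%x. ennreal ((cmod (vhat \<rho> v k1 x))\<^sup>2)) (\<zeta> + \<xi>) * indicator (cball 0 1) \<xi> \<partial>lborel) \<partial>lborel)"
   by (simp add: norm_mult)
  also have "\<dots> = ennreal C * (\<integral>\<^sup>+\<zeta>. (\<integral>\<^sup>+\<xi>. (%x. ennreal ((cmod (vhat \<rho> v k1 x))\<^sup>2)) (\<zeta> + \<xi>) * indicator (cball 0 1) \<xi> \<partial>lborel) \<partial>lborel)"
  proof (rule nn_integral_cmult)
   have [measurable]: "(indicator (cball 0 1) :: 'a => ennreal) \<in> borel_measurable borel" by (rule borel_measurable_indicator) simp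
   show "(%\<zeta>. \<integral>\<^sup>+\<xi>. (%x. ennreal ((cmod (vhat \<rho> v k1 x))\<^sup>2)) (\<zeta> + \<xi>) * indicator (cball 0 1) \<xi> \<partial>lborel) \<in> borel_measurable lborel" by measurable
  qed
  also have "\<dots> = ennreal C * (ennreal (ball_vol TYPE('a)) * (nn_sq (%x. vhat \<rho> v k1 x)))"
   by (subst nn_integral_smear) simp_all
  also have "\<dots> <= ennreal C * (ennreal (ball_vol TYPE('a)) * (ennreal C' * ennreal ((l2 v)\<^sup>2)))"
  proof (intro mult_left_mono)
   have "(nn_sq (%x. cis (k1 \<bullet> (x /\<^sub>R \<rho>)) * v x)) = ennreal ((l2 v)\<^sup>2)"
    unfolding nn_l2[OF v, symmetric] by (simp add: norm_mult)
   then show "(nn_sq (%x. vhat \<rho> v k1 x)) <= ennreal C' * ennreal ((l2 v)\<^sup>2)"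
    using C'(2)[OF kv] unfolding vhat_def by simp
  qed auto
  also have "\<dots> = ennreal (C * ball_vol TYPE('a) * C' * (l2 v)\<^sup>2)"
   using C(1) C'(1) by (simp add: ennreal_mult ball_vol_def mult.assoc)
  also have "\<dots> <= ennreal ((C * ball_vol TYPE('a) * C' + 1) * (l2 v)\<^sup>2)" by (intro ennreal_leI mult_right_mono) auto
  finally show ?thesis .
 qed
 moreover have "C * ball_vol TYPE('a) * C' + 1 > 0" using C(1) C'(1) by (intro add_nonneg_pos mult_nonneg_nonneg) (auto simp: ball_vol_def)
 ultimately show thesis using that by blast
qed

end

section \<open>Uniform bound for one block\<close>

context fio_phase
begin

lemma bbs_kern:
 assumes F: "F \<in> borel_measurable borel" "\<And>z. cmod (F z) <= D" "\<And>z. norm (snd (snd z)) > S ==> F z = 0"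
  and u: "bbs u" and v: "bbs v"
 shows "bbs (kern F \<rho> u v)"
proof -
 obtain C R where g: "u \<in> borel_measurable borel" "\<And>x. cmod (u x) <= C" "\<And>x. norm x > R ==> u x = 0"
  using u unfolding bbs_def by blast
 obtain C' R' where h: "v \<in> borel_measurable borel" "\<And>x. cmod (v x) <= C'" "\<And>x. norm x > R' ==> v x = 0"
  using v unfolding bbs_def by blast
 note [measurable] = F(1) g(1) h(1)
 have "(%z. cis (fst z \<bullet> snd (snd z) + \<Phi> (snd z)) * F (fst z /\<^sub>R \<rho>, snd z) * (u (fst (snd z)) * v (fst z))) \<in> borel_measurable (borel \<Otimes>\<^sub>M borel \<Otimes>\<^sub>M borel)"
 proof -
  have [measurable]: "(%z::'a \<times> 'a \<times> 'a. snd z) \<in> borel \<Otimes>\<^sub>M borel \<Otimes>\<^sub>M borel \<rightarrow>\<^sub>M borel"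
   using measurable_snd[of "borel :: 'a measure" "borel \<Otimes>\<^sub>M borel :: ('a \<times> 'a) measure"] by (simp add: borel_prod)
  show ?thesis by measurable
 qed
 then have m: "kern F \<rho> u v \<in> borel_measurable borel" unfolding kern_def[abs_def] by (simp add: borel_prod)
 have D0: "0 <= D" and C0: "0 <= C" and C'0: "0 <= C'"
  by (rule order_trans[OF norm_ge_zero F(2)], rule order_trans[OF norm_ge_zero g(2)], rule order_trans[OF norm_ge_zero h(2)])
 have b: "cmod (kern F \<rho> u v z) <= D * (C * C')" for z
  unfolding kern_def norm_mult norm_cis by (intro mult_mono) (use F(2) g(2) h(2) D0 C0 C'0 in auto)
 have s: "kern F \<rho> u v z = 0" if z: "norm z > \<bar>R\<bar> + \<bar>R'\<bar> + \<bar>S\<bar>" for z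
 proof (rule ccontr)
  assume nz: "kern F \<rho> u v z \<noteq> 0"
  then have "norm (fst z) <= R'" using h(3)[of "fst z"] by (force simp: kern_def)
  moreover have "norm (fst (snd z)) <= R" using nz g(3)[of "fst (snd z)"] by (force simp: kern_def)
  moreover have "norm (snd (snd z)) <= S" using nz F(3)[of "(fst z /\<^sub>R \<rho>, snd z)"] by (force simp: kern_def)
  moreover have "norm z <= norm (fst z) + (norm (fst (snd z)) + norm (snd (snd z)))"
   using norm_Pair_le[of "fst z" "snd z"] norm_Pair_le[of "fst (snd z)" "snd (snd z)"] by simp
  ultimately show False using z by linarith
 qed
 show ?thesis unfolding bbs_def using m b s by blast
qed

text \<open>On one cell and for one modulation the trilinear integral separates, because the frozen phase is a
sum of functions of one variable.\<close>

lemma packet_factorization: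
 assumes u: "bbs u" and v: "bbs v"
 defines "f \<equiv> %(q::'a \<times> 'a) z. cis (fst z \<bullet> (snd q + snd (snd z)) + \<Phi> (fst q, snd q + snd (snd z)) + \<Phi> (fst q + fst (snd z), snd q) - \<Phi> q)
   * (v (fst z) * ((of_real (bump (fst (snd z))) * u (fst q + fst (snd z))) * of_real (bump (snd (snd z)))))"
 shows "bbs (f q)"
  and "cmod (LINT z|lborel. cis (k \<bullet> (fst z /\<^sub>R \<rho>, snd z)) * f q z) = cmod (pack_u u q (fst (snd k))) * cmod (pack_v \<rho> v q (fst k) (snd (snd k)))"
proof -
 note [measurable] = bbs_measurable[OF u] bbs_measurable[OF v]
 have bu: "bbs (%y. of_real (bump y) * u (fst q + y))"
  by (rule bbs_mult[OF bbs_translate[OF u], of _ 1]) (auto simp: bump_le_1 bump_ge_0)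
 have ph: "(%z. cis (fst z \<bullet> (snd q + snd (snd z)) + \<Phi> (fst q, snd q + snd (snd z)) + \<Phi> (fst q + fst (snd z), snd q) - \<Phi> q)) \<in> borel_measurable (borel :: ('a \<times> 'a \<times> 'a) measure)"
 proof -
  have "(%z. cis (fst z \<bullet> (snd q + snd (snd z)) + \<Phi> (fst q, snd q + snd (snd z)) + \<Phi> (fst q + fst (snd z), snd q) - \<Phi> q)) \<in> borel_measurable (borel \<Otimes>\<^sub>M borel \<Otimes>\<^sub>M borel :: ('a \<times> 'a \<times> 'a) measure)"
   by measurable
  then show ?thesis by (simp add: borel_prod)
 qed
 have "bbs (%z. cis (fst z \<bullet> (snd q + snd (snd z)) + \<Phi> (fst q, snd q + snd (snd z)) + \<Phi> (fst q + fst (snd z), snd q) - \<Phi> q)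
   * (case z of (x, z') => v x * (case z' of (y, \<xi>) => (of_real (bump y) * u (fst q + y)) * of_real (bump \<xi>))))"
  by (rule bbs_mult[OF bbs_pair[OF v bbs_pair[OF bu bbs_bump]] ph, of 1]) simp
 then show b: "bbs (f q)" by (simp add: f_def case_prod_unfold)
 define T where "T x z = cis (k \<bullet> (x /\<^sub>R \<rho>, z)) * f q (x, z)" for x z
 have "(%z. cis (k \<bullet> (fst z /\<^sub>R \<rho>, snd z))) \<in> borel_measurable (borel :: ('a \<times> 'a \<times> 'a) measure)"
  by (intro borel_measurable_continuous_onI continuous_intros)
 then have "bbs (%z. cis (k \<bullet> (fst z /\<^sub>R \<rho>, snd z)) * f q z)" by (rule bbs_mult[OF b, of _ 1]) simp
 from bbs_integrable[OF this] have int: "integrable (lborel \<Otimes>\<^sub>M lborel) (%(x, z). T x z)"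
  by (simp add: lborel_prod T_def case_prod_unfold)
 define a where "a y = cis (\<Phi> (fst q + y, snd q)) * (of_real (bump y) * (cis (fst (snd k) \<bullet> y) * u (fst q + y)))" for y
 define b where "b \<xi> = cis (\<Phi> (fst q, snd q + \<xi>)) * (of_real (bump \<xi>) * (cis (snd (snd k) \<bullet> \<xi>) * vhat \<rho> v (fst k) (snd q + \<xi>)))" for \<xi>
 have Tx: "(LINT x|lborel. T x z) = cis (- \<Phi> q) * (a (fst z) * b (snd z))" for z
 proof -
  have "T x z = (cis (- \<Phi> q) * (a (fst z) * (cis (\<Phi> (fst q, snd q + snd z)) * (of_real (bump (snd z)) * cis (snd (snd k) \<bullet> snd z)))))
    * (cis (x \<bullet> (snd q + snd z)) * (cis (fst k \<bullet> (x /\<^sub>R \<rho>)) * v x))" for x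
  proof -
   have "cis (fst x' \<bullet> (snd q + snd (snd x')) + \<Phi> (fst q, snd q + snd (snd x')) + \<Phi> (fst q + fst (snd x'), snd q) - \<Phi> q)
    = cis (- \<Phi> q) * cis (\<Phi> (fst q + fst (snd x'), snd q)) * cis (\<Phi> (fst q, snd q + snd (snd x'))) * cis (fst x' \<bullet> (snd q + snd (snd x')))" for x'
    unfolding cis_mult by (rule arg_cong[where f=cis]) simp
   moreover have "cis (k \<bullet> (x /\<^sub>R \<rho>, z)) = cis (fst k \<bullet> (x /\<^sub>R \<rho>)) * cis (fst (snd k) \<bullet> fst z) * cis (snd (snd k) \<bullet> snd z)"
    unfolding cis_mult by (rule arg_cong[where f=cis]) (cases k, cases z, auto)
   ultimately show ?thesis by (simp only: T_def f_def a_def fst_conv snd_conv mult_ac)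
  qed
  then have "(LINT x|lborel. T x z) = (cis (- \<Phi> q) * (a (fst z) * (cis (\<Phi> (fst q, snd q + snd z)) * (of_real (bump (snd z)) * cis (snd (snd k) \<bullet> snd z)))))
    * vhat \<rho> v (fst k) (snd q + snd z)" unfolding vhat_def by (simp only: integral_mult_right_zero)
  then show ?thesis by (simp only: b_def mult_ac)
 qed
 have int2: "integrable (lborel \<Otimes>\<^sub>M lborel) (%(y, \<xi>). cis (- \<Phi> q) * (a y * b \<xi>))"
  using lborel_pair.integrable_snd[OF int] unfolding Tx by (simp add: lborel_prod case_prod_unfold)
 have "(LINT z|lborel. cis (k \<bullet> (fst z /\<^sub>R \<rho>, snd z)) * f q z) = (LINT z|(lborel \<Otimes>\<^sub>M lborel). (case z of (x, z) => T x z))"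
  by (simp add: lborel_prod T_def case_prod_unfold)
 also have "\<dots> = (LINT z|lborel. LINT x|lborel. T x z)" by (rule lborel_pair.integral_snd[OF int, symmetric])
 also have "\<dots> = (LINT z|(lborel \<Otimes>\<^sub>M lborel). (case z of (y, \<xi>) => cis (- \<Phi> q) * (a y * b \<xi>)))"
  unfolding Tx by (simp add: lborel_prod case_prod_unfold)
 also have "\<dots> = (LINT y|lborel. LINT \<xi>|lborel. cis (- \<Phi> q) * (a y * b \<xi>))"
  using lborel_pair.integral_fst'[OF int2] by simp
 also have "\<dots> = cis (- \<Phi> q) * (pack_u u q (fst (snd k)) * pack_v \<rho> v q (fst k) (snd (snd k)))"
  unfolding integral_mult_right_zero integral_mult_left_zero by (simp only: pack_u_def pack_v_def a_def[abs_def] b_def[abs_def])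
 finally show "cmod (LINT z|lborel. cis (k \<bullet> (fst z /\<^sub>R \<rho>, snd z)) * f q z) = cmod (pack_u u q (fst (snd k))) * cmod (pack_v \<rho> v q (fst k) (snd (snd k)))"
  by (simp add: norm_mult)
qed

lemma sum_of_packets:
 assumes A: "bbs (A :: 'a \<times> 'a \<times> 'a => complex)"
 defines "I \<equiv> %q::'a \<times> 'a. (LINT z|lborel. A z * of_real ((bump (fst (snd z) - fst q))\<^sup>2 * (bump (snd (snd z) - snd q))\<^sup>2))"
 shows "integrable lborel I" and "(LINT q|lborel. I q) = of_real ((LINT y|lborel. (bump (y::'a))\<^sup>2)\<^sup>2) * (LINT z|lborel. A z)"
proof -
 obtain D T where D: "A \<in> borel_measurable borel" "\<And>z. cmod (A z) <= D" "\<And>z. norm z > T ==> A z = 0"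
  using A unfolding bbs_def by blast
 note [measurable] = D(1)
 define H where "H q z = A z * of_real ((bump (fst (snd z) - fst q))\<^sup>2 * (bump (snd (snd z) - snd q))\<^sup>2)" for q :: "'a \<times> 'a" and z
 have b1: "(bump y)\<^sup>2 <= 1" "0 <= (bump y)\<^sup>2" for y :: 'a using bump_le_1 bump_ge_0 by (auto intro!: power_le_one)
 have int: "integrable (lborel \<Otimes>\<^sub>M lborel) (%(q, z). H q z)"
 proof (rule integrable_product_bound[where a="indicator (cball 0 (2 * \<bar>T\<bar> + 2))" and b="%z. cmod (A z)"])
  have "(%x. A (snd x) * of_real ((bump (fst (snd (snd x)) - fst (fst x)))\<^sup>2 * (bump (snd (snd (snd x)) - snd (fst x)))\<^sup>2)) \<in> borel_measurable (borel :: (('a \<times> 'a) \<times> ('a \<times> 'a \<times> 'a)) measure)"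
  proof (intro borel_measurable_times)
   show "(%x. A (snd x)) \<in> borel_measurable (borel :: (('a \<times> 'a) \<times> ('a \<times> 'a \<times> 'a)) measure)"
    by (rule measurable_compose[OF _ D(1)]) (intro borel_measurable_continuous_onI continuous_intros)
   show "(%x. complex_of_real ((bump (fst (snd (snd x)) - fst (fst x)))\<^sup>2 * (bump (snd (snd (snd x)) - snd (fst x)))\<^sup>2)) \<in> borel_measurable (borel :: (('a \<times> 'a) \<times> ('a \<times> 'a \<times> 'a)) measure)"
    by (intro borel_measurable_continuous_onI continuous_intros continuous_on_compose2[OF smooth_continuous[OF smooth_bump, of UNIV]]) auto
  qed
  then show "(%(q, z). H q z) \<in> borel_measurable (lborel \<Otimes>\<^sub>M lborel)"
   by (simp add: lborel_prod H_def case_prod_unfold)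
  show "integrable lborel (indicator (cball 0 (2 * \<bar>T\<bar> + 2)) :: 'a \<times> 'a => real)"
   using emeasure_lborel_cball_finite[of 0 "2 * \<bar>T\<bar> + 2"] by (intro integrable_real_indicator) auto
  show "integrable lborel (%z. cmod (A z))" using bbs_integrable[OF A] by (rule integrable_norm)
  show "cmod (H q z) <= indicator (cball 0 (2 * \<bar>T\<bar> + 2)) q * cmod (A z)" for q z
  proof (cases "H q z = 0")
   case False
   then have "norm z <= T" using D(3)[of z] by (force simp: H_def)
   moreover have "norm (fst (snd z) - fst q) <= 1" "norm (snd (snd z) - snd q) <= 1"
    using False by (auto simp: H_def bump_0)
   moreover have "norm (fst (snd z)) <= norm (snd z)" "norm (snd (snd z)) <= norm (snd z)" "norm (snd z) <= norm z"
    by (simp_all add: norm_prod_def real_le_rsqrt)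
   moreover have "norm (fst q) <= norm (fst (snd z)) + norm (fst (snd z) - fst q)" "norm (snd q) <= norm (snd (snd z)) + norm (snd (snd z) - snd q)"
    using norm_triangle_ineq4[of "fst (snd z)" "fst (snd z) - fst q"] norm_triangle_ineq4[of "snd (snd z)" "snd (snd z) - snd q"] by simp_all
   moreover have "norm q <= norm (fst q) + norm (snd q)" using norm_Pair_le[of "fst q" "snd q"] by simp
   ultimately have "q \<in> cball 0 (2 * \<bar>T\<bar> + 2)" by simp
   moreover have "cmod (H q z) <= cmod (A z)"
    unfolding H_def norm_mult norm_of_real using b1 by (intro mult_left_le) (auto simp: abs_mult intro!: mult_le_one)
   ultimately show ?thesis by simp
  qed simp
 qed
 show "integrable lborel I" using lborel_pair.integrable_fst'[OF int] by (simp add: I_def H_def)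
 let ?N = "LINT y|lborel. (bump (y::'a))\<^sup>2"
 have bs: "(LINT w|lborel. complex_of_real ((bump (y - w))\<^sup>2)) = of_real ?N" for y :: 'a
 proof -
  have "bump (- x) = bump x" for x :: 'a by (simp add: bump_def)
  from this[of "y - _"] have bm: "bump (y - w) = bump (- y + w)" for w :: 'a by simp
  have "(LINT w|lborel. complex_of_real ((bump (y - w))\<^sup>2)) = (LINT w|lborel. complex_of_real ((bump (- y + w))\<^sup>2))" unfolding bm ..
  also have "\<dots> = (LINT w|lborel. complex_of_real ((bump (w::'a))\<^sup>2))"
   by (rule lborel_integral_translate[of "%w. complex_of_real ((bump w)\<^sup>2)"]) measurable
  also have "\<dots> = of_real ?N" by (rule integral_complex_of_real)
  finally show ?thesis .
 qed
 have b2: "bbs (%w. complex_of_real ((bump (y - w))\<^sup>2))" for y :: 'a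
 proof -
  have "smooth (%w. bump (y - w))" by (intro smooth_compose[OF smooth_bump] smooth_intros)
  then have "smooth (%w. complex_of_real (bump (y - w) * bump (y - w)))" by (intro smooth_linear[OF bounded_linear_of_real] smooth_mult)
  moreover have "bump (y - w) = 0" if "norm w > norm y + 1" for w using that norm_triangle_ineq4[of y "y - w"] by (intro bump_outside) simp
  ultimately show ?thesis unfolding power2_eq_square by (intro bbs_const_smooth[of _ "norm y + 1"]) auto
 qed
 have Hq: "(LINT q|lborel. H q z) = A z * of_real (?N\<^sup>2)" for z
 proof -
  have "bbs (%(w, \<zeta>). complex_of_real ((bump (fst (snd z) - w))\<^sup>2) * complex_of_real ((bump (snd (snd z) - \<zeta>))\<^sup>2))"
   by (rule bbs_pair[OF b2 b2])
  from bbs_integrable[OF this]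
  have i: "integrable (lborel \<Otimes>\<^sub>M lborel) (%(w, \<zeta>). complex_of_real ((bump (fst (snd z) - w))\<^sup>2) * complex_of_real ((bump (snd (snd z) - \<zeta>))\<^sup>2))"
   by (simp add: lborel_prod)
  have "(LINT q|lborel. H q z) = A z * (LINT q|(lborel \<Otimes>\<^sub>M lborel). (case q of (w, \<zeta>) => complex_of_real ((bump (fst (snd z) - w))\<^sup>2) * complex_of_real ((bump (snd (snd z) - \<zeta>))\<^sup>2)))"
   unfolding H_def lborel_prod integral_mult_right_zero by (simp add: case_prod_unfold)
  also have "(LINT q|(lborel \<Otimes>\<^sub>M lborel). (case q of (w, \<zeta>) => complex_of_real ((bump (fst (snd z) - w))\<^sup>2) * complex_of_real ((bump (snd (snd z) - \<zeta>))\<^sup>2)))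
   = (LINT w|lborel. LINT \<zeta>|lborel. complex_of_real ((bump (fst (snd z) - w))\<^sup>2) * complex_of_real ((bump (snd (snd z) - \<zeta>))\<^sup>2))"
   using lborel_pair.integral_fst'[OF i] by simp
  also have "\<dots> = of_real ?N * of_real ?N" unfolding integral_mult_right_zero bs integral_mult_left_zero ..
  finally show ?thesis by (simp add: power2_eq_square)
 qed
 have "(LINT q|lborel. I q) = (LINT q|lborel. LINT z|lborel. H q z)" by (simp add: I_def H_def)
 also have "\<dots> = (LINT z|lborel. LINT q|lborel. H q z)" by (rule lborel_pair.Fubini_integral[OF int, symmetric])
 also have "\<dots> = of_real (?N\<^sup>2) * (LINT z|lborel. A z)" unfolding Hq by (simp add: mult.commute)
 finally show "(LINT q|lborel. I q) = of_real (?N\<^sup>2) * (LINT z|lborel. A z)" .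
qed

text \<open>Windows are averaged over all centres, so that the integral equals a normalized integral of cell
contributions. On each cell the amplitude, including the residual phase, is expanded into
characters; the Cauchy-Schwarz inequality in the centre then pairs the two families of packets.\<close>

theorem block_estimate:
 fixes F :: "'p => 'a \<times> 'a \<times> 'a => complex"
 assumes F: "symb (P \<times> UNIV) F" and R: "\<And>p z. p \<in> P ==> norm (fst z) > R ==> F p z = 0"
  and S: "\<And>p. p \<in> P ==> \<exists>S. \<forall>z. norm (snd (snd z)) > S --> F p z = 0"
 obtains K where "K > 0" "\<And>p \<rho> u v. p \<in> P ==> bbs u ==> bbs v ==> cmod (LINT z|lborel. kern (F p) \<rho> u v z) <= K * l2 u * l2 v"
proof -
 let ?N = "LINT y|lborel. (bump (y::'a))\<^sup>2"
 obtain C where C: "C > 0" "\<And>q (f :: 'a \<times> 'a \<times> 'a => complex) h. q \<in> P \<times> (UNIV :: ('a \<times> 'a) set) ==> bbs f ==> h \<in> borel_measurable borel ==>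
   ennreal (cmod (LINT s|lborel. cell_amp F q (h s) * f s)) <= (\<integral>\<^sup>+k. ennreal (C * decay k * cmod (LINT s|lborel. cis (k \<bullet> h s) * f s)) \<partial>lborel)"
 proof (rule fourier_pairing[OF symb_cell_amp[OF F], of "\<bar>R\<bar> + 2"])
  show "cell_amp F q s = 0" if "q \<in> P \<times> UNIV" "norm s > \<bar>R\<bar> + 2" for q s
   by (rule cell_amp_support[OF _ that(2)]) (use that(1) R in auto)
 qed (rule that)
 obtain C1 where C1: "C1 > 0" "\<And>u k. bbs u ==> (nn_sq (%q. pack_u u q k)) <= ennreal (C1 * (l2 u)\<^sup>2)"
  using pack_u_bound by blast
 obtain C2 where C2: "C2 > 0" "\<And>\<rho> v k1 k3. bbs v ==> (nn_sq (%q. pack_v \<rho> v q k1 k3)) <= ennreal (C2 * (l2 v)\<^sup>2)"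
  using pack_v_bound by blast
 obtain D where D: "D > 0" "\<And>p z. (p, z) \<in> P \<times> UNIV ==> norm (F p z) <= D" using symb_bound[OF F] by blast
 define M where "M = C * decay_mass TYPE('a \<times> 'a \<times> 'a)"
 have M0: "M >= 0" unfolding M_def using C(1) decay_mass_nonneg[where 'a="'a \<times> 'a \<times> 'a"] by simp
 have N0: "?N > 0"
 proof -
  have ib: "integrable lborel (%y::'a. (bump y)\<^sup>2)"
  proof -
   have "smooth (%y::'a. bump y * bump y)" by (intro smooth_mult smooth_bump)
   then show ?thesis unfolding power2_eq_square by (intro integrable_compact_support[of _ 1] smooth_continuous) (auto simp: bump_outside)
  qed
  have "?N \<noteq> 0"
  proof
   assume "?N = 0"
   then have "AE x in lborel. (bump (x::'a))\<^sup>2 = 0" using integral_nonneg_eq_0_iff_AE[OF ib] by auto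
   then have "AE x in lborel. (x::'a) \<notin> ball 0 1" by eventually_elim (auto simp: bump_0)
   then have "emeasure lborel (ball 0 1 :: 'a set) = 0" using AE_iff_null_sets[of "ball 0 1 :: 'a set" lborel] by (simp add: null_sets_def del: mem_ball mem_ball_0)
   then have "unit_ball_vol (real DIM('a)) <= 0" by (simp add: emeasure_ball ennreal_eq_0_iff)
   then show False using unit_ball_vol_pos[of "real DIM('a)"] of_nat_0_le_iff by (metis not_le)
  qed
  moreover have "?N >= 0" by simp
  ultimately show ?thesis by linarith
 qed
 have main: "cmod (LINT z|lborel. kern (F p) \<rho> u v z) <= (M * (sqrt C1 * sqrt C2) / ?N\<^sup>2 + 1) * l2 u * l2 v"
  if p: "p \<in> P" and u: "bbs u" and v: "bbs v" for p \<rho> u v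
 proof -
  note [measurable] = bbs_measurable[OF u] bbs_measurable[OF v]
  obtain S where S: "\<And>z. norm (snd (snd z)) > S ==> F p z = 0" using S[OF p] by blast
  define A where "A = kern (F p) \<rho> u v"
  have bA: "bbs A" unfolding A_def
   by (rule bbs_kern[OF smooth_measurable[OF symb_smooth[OF F]] _ S u v, of D]) (use D(2) p in auto)
  define I where "I q = (LINT z|lborel. A z * of_real ((bump (fst (snd z) - fst q))\<^sup>2 * (bump (snd (snd z) - snd q))\<^sup>2))" for q :: "'a \<times> 'a"
  have Im: "A \<in> borel_measurable borel" by (rule bbs_measurable[OF bA])
  define f where "f q z = cis (fst z \<bullet> (snd q + snd (snd z)) + \<Phi> (fst q, snd q + snd (snd z)) + \<Phi> (fst q + fst (snd z), snd q) - \<Phi> q)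
   * (v (fst z) * ((of_real (bump (fst (snd z))) * u (fst q + fst (snd z))) * of_real (bump (snd (snd z)))))" for q z
  have Iq: "I q = (LINT z|lborel. cell_amp F (p, q) (fst z /\<^sub>R \<rho>, snd z) * f q z)" for q
  proof -
   let ?G = "%z. A z * of_real ((bump (fst (snd z) - fst q))\<^sup>2 * (bump (snd (snd z) - snd q))\<^sup>2)"
   have "?G \<in> borel_measurable borel"
    by (intro borel_measurable_times Im borel_measurable_continuous_onI continuous_intros continuous_on_compose2[OF smooth_continuous[OF smooth_bump, of UNIV]]) auto
   from lborel_integral_translate[OF this, of "(0, q)"]
   have I: "I q = (LINT z|lborel. ?G ((0, q) + z))" by (simp only: I_def)
   have G: "?G ((0, q) + z) = cell_amp F (p, q) (fst z /\<^sub>R \<rho>, snd z) * f q z" for z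
   proof -
    have "cis (fst z \<bullet> (snd q + snd (snd z)) + \<Phi> (q + snd z))
     = cis (residual q (snd z)) * cis (fst z \<bullet> (snd q + snd (snd z)) + \<Phi> (fst q, snd q + snd (snd z)) + \<Phi> (fst q + fst (snd z), snd q) - \<Phi> q)"
     unfolding cis_mult residual_def by (rule arg_cong[where f=cis]) simp
    then show ?thesis
     by (simp add: A_def kern_def cell_amp_def f_def power2_eq_square algebra_simps)
   qed
   show ?thesis unfolding I by (intro Bochner_Integration.integral_cong refl G)
  qed
  have bf: "bbs (f q)" for q unfolding f_def using packet_factorization(1)[OF u v] .
  have hm: "(%z. (fst z /\<^sub>R \<rho>, snd z)) \<in> (borel :: ('a \<times> 'a \<times> 'a) measure) \<rightarrow>\<^sub>M borel"
   by (intro borel_measurable_continuous_onI continuous_intros)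
  let ?U = "%q k. pack_u u q (fst (snd k))" and ?V = "%q k. pack_v \<rho> v q (fst k) (snd (snd k))"
  have Ib: "ennreal (cmod (I q)) <= (\<integral>\<^sup>+k. ennreal (C * decay k) * (ennreal (cmod (?U q k)) * ennreal (cmod (?V q k))) \<partial>lborel)" for q
  proof -
   have "ennreal (cmod (I q)) <= (\<integral>\<^sup>+k. ennreal (C * decay k * cmod (LINT s|lborel. cis (k \<bullet> (fst s /\<^sub>R \<rho>, snd s)) * f q s)) \<partial>lborel)"
    unfolding Iq by (rule C(2)[OF _ bf hm]) (use p in simp)
   also have "\<dots> = (\<integral>\<^sup>+k. ennreal (C * decay k) * (ennreal (cmod (?U q k)) * ennreal (cmod (?V q k))) \<partial>lborel)"
    unfolding f_def packet_factorization(2)[OF u v] using C(1)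
    by (intro nn_integral_cong) (simp add: ennreal_mult less_imp_le decay_pos mult.assoc)
   finally show ?thesis .
  qed
  have Um: "(%x. pack_u u (fst x) (fst (snd (snd x)))) \<in> borel_measurable (borel :: (('a \<times> 'a) \<times> 'a \<times> 'a \<times> 'a) measure)"
  proof -
   have "(%x. pack_u u (fst (fst x), snd (fst x)) (fst (snd (snd x)))) \<in> borel_measurable (borel :: (('a \<times> 'a) \<times> 'a \<times> 'a \<times> 'a) measure)"
    by (rule pack_u_measurable) (auto intro!: borel_measurable_continuous_onI continuous_intros)
   then show ?thesis by simp
  qed
  have Vm: "(%x. pack_v \<rho> v (fst x) (fst (snd x)) (snd (snd (snd x)))) \<in> borel_measurable (borel :: (('a \<times> 'a) \<times> 'a \<times> 'a \<times> 'a) measure)"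
  proof -
   have "(%x. pack_v \<rho> v (fst (fst x), snd (fst x)) (fst (snd x)) (snd (snd (snd x)))) \<in> borel_measurable (borel :: (('a \<times> 'a) \<times> 'a \<times> 'a \<times> 'a) measure)"
    by (rule pack_v_measurable) (auto intro!: borel_measurable_continuous_onI continuous_intros)
   then show ?thesis by simp
  qed
  have dm: "(%x. ennreal (C * decay (snd x))) \<in> borel_measurable (borel :: (('a \<times> 'a) \<times> 'a \<times> 'a \<times> 'a) measure)"
   by (intro measurable_compose[OF _ measurable_ennreal] borel_measurable_times borel_measurable_const
     measurable_compose[OF _ decay_measurable] borel_measurable_continuous_onI continuous_intros)
  have jm: "(%(q, k). ennreal (C * decay k) * (ennreal (cmod (?U q k)) * ennreal (cmod (?V q k)))) \<in> borel_measurable (lborel \<Otimes>\<^sub>M lborel)"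
  proof -
   have "(%x. ennreal (C * decay (snd x)) * (ennreal (cmod (pack_u u (fst x) (fst (snd (snd x))))) * ennreal (cmod (pack_v \<rho> v (fst x) (fst (snd x)) (snd (snd (snd x))))))) \<in> borel_measurable (borel :: (('a \<times> 'a) \<times> 'a \<times> 'a \<times> 'a) measure)"
    by (intro borel_measurable_times_ennreal dm) (use Um Vm in simp_all)
   then show ?thesis by (simp add: lborel_prod case_prod_unfold)
  qed
  have um: "(%q. ?U q k) \<in> borel_measurable borel" and vm: "(%q. ?V q k) \<in> borel_measurable borel" for k
  proof -
   have c: "(%q. (q, k)) \<in> (borel :: ('a \<times> 'a) measure) \<rightarrow>\<^sub>M borel" by (intro borel_measurable_continuous_onI continuous_intros)
   show "(%q. ?U q k) \<in> borel_measurable borel" using measurable_compose[OF c Um] by simp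
   show "(%q. ?V q k) \<in> borel_measurable borel" using measurable_compose[OF c Vm] by simp
  qed
  have CS: "(\<integral>\<^sup>+q. ennreal (cmod (?U q k)) * ennreal (cmod (?V q k)) \<partial>lborel) <= ennreal (sqrt C1 * sqrt C2 * (l2 u * l2 v))" for k
  proof -
   let ?L = "\<integral>\<^sup>+q. ennreal (cmod (?U q k)) * ennreal (cmod (?V q k)) \<partial>lborel"
   have "?L\<^sup>2 <= (\<integral>\<^sup>+q. (ennreal (cmod (?U q k)))\<^sup>2 \<partial>lborel) * (\<integral>\<^sup>+q. (ennreal (cmod (?V q k)))\<^sup>2 \<partial>lborel)"
    by (rule Cauchy_Schwarz_nn_integral) (use um[of k] vm[of k] in \<open>simp_all\<close>)
   also have "\<dots> = (nn_sq (%q. ?U q k)) * (nn_sq (%q. ?V q k))"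
    by (simp add: ennreal_power)
   also have "\<dots> <= ennreal (C1 * (l2 u)\<^sup>2) * ennreal (C2 * (l2 v)\<^sup>2)"
    by (intro mult_mono C1(2)[OF u] C2(2)[OF v]) auto
   also have "\<dots> = ennreal ((sqrt C1 * sqrt C2 * (l2 u * l2 v))\<^sup>2)"
    using C1(1) C2(1) by (simp add: ennreal_mult[symmetric] power_mult_distrib algebra_simps)
   finally have sq: "?L\<^sup>2 <= ennreal ((sqrt C1 * sqrt C2 * (l2 u * l2 v))\<^sup>2)" .
   have r0: "sqrt C1 * sqrt C2 * (l2 u * l2 v) >= 0" using C1(1) C2(1) by (simp add: l2_nonneg)
   have "?L \<noteq> top" using sq by (auto simp: power2_eq_square top_unique)
   then obtain l where l: "?L = ennreal l" "l >= 0" by (cases ?L) auto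
   have "l\<^sup>2 <= (sqrt C1 * sqrt C2 * (l2 u * l2 v))\<^sup>2" using sq unfolding l(1) by (simp add: ennreal_power l(2))
   then have "l <= sqrt C1 * sqrt C2 * (l2 u * l2 v)" using power2_le_imp_le[OF _ r0] by blast
   then show ?thesis unfolding l(1) by (rule ennreal_leI)
  qed
  have "ennreal (cmod (LINT q|lborel. I q)) <= (\<integral>\<^sup>+q. norm (I q) \<partial>lborel)"
   using sum_of_packets(1)[OF bA] unfolding I_def[symmetric] by (rule integral_norm_bound_ennreal)
  also have "\<dots> <= (\<integral>\<^sup>+q. \<integral>\<^sup>+k. ennreal (C * decay k) * (ennreal (cmod (?U q k)) * ennreal (cmod (?V q k))) \<partial>lborel \<partial>lborel)"
   by (intro nn_integral_mono Ib)
  also have "\<dots> = (\<integral>\<^sup>+k. \<integral>\<^sup>+q. ennreal (C * decay k) * (ennreal (cmod (?U q k)) * ennreal (cmod (?V q k))) \<partial>lborel \<partial>lborel)"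
   by (rule lborel_pair.Fubini'[OF jm, symmetric])
  also have "\<dots> = (\<integral>\<^sup>+k. ennreal (C * decay k) * (\<integral>\<^sup>+q. ennreal (cmod (?U q k)) * ennreal (cmod (?V q k)) \<partial>lborel) \<partial>lborel)"
   by (intro nn_integral_cong nn_integral_cmult) (use um vm in simp)
  also have "\<dots> <= (\<integral>\<^sup>+k. ennreal (decay (k :: 'a \<times> 'a \<times> 'a)) * ennreal (C * (sqrt C1 * sqrt C2 * (l2 u * l2 v))) \<partial>lborel)"
  proof (intro nn_integral_mono)
   fix k :: "'a \<times> 'a \<times> 'a"
   have "ennreal (C * decay k) * (\<integral>\<^sup>+q. ennreal (cmod (?U q k)) * ennreal (cmod (?V q k)) \<partial>lborel)
    <= ennreal (C * decay k) * ennreal (sqrt C1 * sqrt C2 * (l2 u * l2 v))" by (intro mult_left_mono CS) auto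
   also have "\<dots> = ennreal (decay k) * ennreal (C * (sqrt C1 * sqrt C2 * (l2 u * l2 v)))"
    using C(1) C1(1) C2(1) decay_pos[of k] by (simp add: ennreal_mult[symmetric] l2_nonneg algebra_simps)
   finally show "ennreal (C * decay k) * (\<integral>\<^sup>+q. ennreal (cmod (?U q k)) * ennreal (cmod (?V q k)) \<partial>lborel)
    <= ennreal (decay k) * ennreal (C * (sqrt C1 * sqrt C2 * (l2 u * l2 v)))" .
  qed
  also have "\<dots> = ennreal (M * (sqrt C1 * sqrt C2 * (l2 u * l2 v)))"
   using C(1) C1(1) C2(1) decay_mass_nonneg[where 'a="'a \<times> 'a \<times> 'a"]
   by (simp add: nn_integral_multc decay_mass M_def ennreal_mult[symmetric] l2_nonneg algebra_simps)
  finally have "cmod (LINT q|lborel. I q) <= M * (sqrt C1 * sqrt C2 * (l2 u * l2 v))"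
   using M0 C1(1) C2(1) by (subst (asm) ennreal_le_iff) (auto simp: l2_nonneg)
  moreover have "cmod (LINT q|lborel. I q) = ?N\<^sup>2 * cmod (LINT z|lborel. A z)"
   unfolding I_def sum_of_packets(2)[OF bA] by (simp add: norm_mult norm_power)
  ultimately have "cmod (LINT z|lborel. A z) <= M * (sqrt C1 * sqrt C2 * (l2 u * l2 v)) / ?N\<^sup>2"
   using N0 by (simp add: field_simps)
  also have "\<dots> = M * (sqrt C1 * sqrt C2) / ?N\<^sup>2 * l2 u * l2 v" by simp
  also have "\<dots> <= (M * (sqrt C1 * sqrt C2) / ?N\<^sup>2 + 1) * l2 u * l2 v"
   by (intro mult_right_mono l2_nonneg) auto
  finally show ?thesis unfolding A_def .
 qed
 have "M * (sqrt C1 * sqrt C2) / ?N\<^sup>2 + 1 > 0" using M0 C1(1) C2(1) by (intro add_nonneg_pos) auto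
 then show thesis using that main by blast
qed

end

section \<open>Dyadic shells\<close>

lemma symb_scaled_linear:
 fixes L :: "'c::euclidean_space => 'b::euclidean_space"
 assumes L: "bounded_linear L" and s: "\<And>p z. (p, z) \<in> \<Omega> ==> \<bar>s p\<bar> <= 1" and b: "\<And>p z. (p, z) \<in> \<Omega> ==> norm (s p *\<^sub>R L z) <= C"
 shows "symb \<Omega> (%p z. s p *\<^sub>R L z)"
 unfolding symb_iff[of \<Omega> "%p z. s p *\<^sub>R L z"]
proof (intro conjI allI ballI)
 have D: "((%z. s p *\<^sub>R L z) has_derivative (%v. s p *\<^sub>R L v)) (at z)" for p z
  by (intro derivative_intros bounded_linear_imp_has_derivative L)
 then show "(%z. s p *\<^sub>R L z) differentiable (at z)" for p z using differentiable_def by blast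
 show "\<exists>C. \<forall>p x. (p, x) \<in> \<Omega> --> norm (s p *\<^sub>R L x) <= C" using b by blast
 fix v :: 'c
 have e: "dd v (%z. s p *\<^sub>R L z) = (%z. s p *\<^sub>R L v)" for p by (rule ext, rule dd_eq[OF D])
 show "symb \<Omega> (%p. dd v (%z. s p *\<^sub>R L z))"
  unfolding e
 proof (rule symb_const[of _ _ "norm (L v)"])
  fix p z assume "(p, z) \<in> \<Omega>"
  then have "\<bar>s p\<bar> * norm (L v) <= 1 * norm (L v)" using s by (intro mult_right_mono) auto
  then show "norm (s p *\<^sub>R L v) <= norm (L v)" by simp
 qed
qed

lemma symb_ddl:
 "symb \<Omega> F ==> set bs \<subseteq> Basis ==> symb \<Omega> (%p. ddl bs (F p))"
 by (induction bs) (auto intro: symb_dd)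

lemma ddl_scale_fst:
 fixes f :: "'a::euclidean_space \<times> 'b::euclidean_space => complex"
 assumes f: "smooth f" and as: "set as \<subseteq> Basis" "set ds \<subseteq> Basis"
 shows "ddl (map inc1 as @ map inc2 ds) (%z. f (s *\<^sub>R fst z, snd z))
  = (%z. of_real (s ^ length as) * ddl (map inc1 as @ map inc2 ds) f (s *\<^sub>R fst z, snd z))"
proof -
 have T: "bounded_linear (%z::'a \<times> 'b. (s *\<^sub>R fst z, snd z))"
  by (intro bounded_linear_Pair bounded_linear_snd bounded_linear_scaleR_right[THEN bounded_linear_compose] bounded_linear_fst)
 have d: "dd b (%z. g (s *\<^sub>R fst z, snd z)) = (%z. dd (s *\<^sub>R fst b, snd b) g (s *\<^sub>R fst z, snd z))" if "smooth g" for g :: "'a \<times> 'b => complex" and b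
  using dd_compose_affine[OF T that, of b 0] by simp
 have 1: "ddl (map inc2 ds) (%z. f (s *\<^sub>R fst z, snd z)) = (%z. ddl (map inc2 ds) f (s *\<^sub>R fst z, snd z))" if "set ds \<subseteq> Basis" for ds
  using that
 proof (induction ds)
  case (Cons c ds)
  have "smooth (ddl (map inc2 ds) f)" using Cons.prems by (intro smooth_ddl f) (auto intro: Basis_inc)
  from d[OF this, of "inc2 c"] Cons show ?case by simp
 qed simp
 show ?thesis using as(1)
 proof (induction as)
  case Nil then show ?case using 1[OF as(2)] by simp
 next
  case (Cons a as)
  let ?g = "ddl (map inc1 as @ map inc2 ds) f"
  have sg: "smooth ?g" using Cons.prems as(2) by (intro smooth_ddl f) (auto intro: Basis_inc)
  have ds: "(%z. ?g (s *\<^sub>R fst z, snd z)) differentiable (at z)" for z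
   by (intro smooth_differentiable smooth_compose[OF sg] smooth_intros)
  have lin: "dd (s *\<^sub>R a, 0) ?g x = s *\<^sub>R dd (inc1 a) ?g x" for x
   using linear_cmul[OF bounded_linear.linear[OF has_derivative_bounded_linear[OF dd_has_derivative[OF smooth_differentiable[OF sg]]]], of s "inc1 a"] by simp
  have IH: "ddl (map inc1 as @ map inc2 ds) (%z. f (s *\<^sub>R fst z, snd z)) = (%z. of_real (s ^ length as) * ?g (s *\<^sub>R fst z, snd z))"
   using Cons by simp
  have "dd (inc1 a) (%z. of_real (s ^ length as) * ?g (s *\<^sub>R fst z, snd z)) z = of_real (s ^ length as) * dd (inc1 a) (%z. ?g (s *\<^sub>R fst z, snd z)) z" for z
   by (rule dd_linear[OF bounded_linear_mult_right ds])
  then have "dd (inc1 a) (%z. of_real (s ^ length as) * ?g (s *\<^sub>R fst z, snd z)) z = of_real (s ^ length (a # as)) * dd (inc1 a) ?g (s *\<^sub>R fst z, snd z)" for z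
   using d[OF sg, of "inc1 a"] lin by (simp add: scaleR_conv_of_real)
  then show ?case unfolding list.map append.simps ddl_simps(2) IH by (rule ext)
 qed
qed

text \<open>The triples consist of the dyadic index of the output variable, the dyadic index of the input
variable, and the parameter of the frequency cutoff.\<close>

definition shell_scale :: "nat \<times> nat \<times> real => real" where "shell_scale p = 2 ^ fst p"
definition shell_scale' :: "nat \<times> nat \<times> real => real" where "shell_scale' p = 2 ^ fst (snd p)"
definition eps :: "nat \<times> nat \<times> real => real" where "eps p = snd (snd p)"
definition shells :: "(nat \<times> nat \<times> real) set" where "shells = {p. 0 < eps p \<and> eps p <= 1}"

definition cut :: "'a::euclidean_space => complex" where "cut x = of_real (bump x / bump (0::'a))"

lemma shell_scale_ge_1: "shell_scale p >= 1" "shell_scale' p >= 1" by (auto simp: shell_scale_def shell_scale'_def)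

locale fio_setup = fio_phase \<Phi> for \<Phi> :: "'a::euclidean_space \<times> 'a => real" +
 fixes A :: "'a \<times> 'a \<times> 'a => complex"
 assumes A_smooth: "smooth A"
  and A_bound: "\<And>as ds. set as \<subseteq> Basis ==> set ds \<subseteq> Basis ==>
    \<exists>C. \<forall>x z. cmod (ddl (map inc1 as @ map inc2 ds) A (x, z)) <= C * bracket (- real (length as)) x"
  and \<Phi>_bound: "\<And>cs. set cs \<subseteq> Basis ==> cs \<noteq> [] ==> \<exists>C. \<forall>y \<xi>. \<bar>ddl (map inc2 cs) \<Phi> (y, \<xi>)\<bar> <= C * bracket 1 y"
begin

definition shell_set :: "((nat \<times> nat \<times> real) \<times> ('a \<times> 'a \<times> 'a)) set" where
 "shell_set = {(p, z). p \<in> shells \<and> 1/2 <= (1 / shell_scale p)\<^sup>2 + fst z \<bullet> fst z \<and> (1 / shell_scale p)\<^sup>2 + fst z \<bullet> fst z <= 8 \<and>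
   1/2 <= (1 / shell_scale' p)\<^sup>2 * (1 + fst (snd z) \<bullet> fst (snd z)) \<and> (1 / shell_scale' p)\<^sup>2 * (1 + fst (snd z) \<bullet> fst (snd z)) <= 8}"

definition shell_amp :: "nat \<times> nat \<times> real => 'a \<times> 'a \<times> 'a => complex" where
 "shell_amp p z = A (shell_scale p *\<^sub>R fst z, snd z) * of_real (plateau ((1 / shell_scale p)\<^sup>2 + fst z \<bullet> fst z) *
   plateau ((1 / shell_scale' p)\<^sup>2 * (1 + fst (snd z) \<bullet> fst (snd z)))) * cut (eps p *\<^sub>R snd (snd z))"

lemma norm_le_3: "x \<bullet> x <= 8 ==> norm x <= 3" for x :: 'a
 by (rule power2_le_imp_le) (auto simp: power2_norm_eq_inner)

lemma shell_set_X: "(p, z) \<in> shell_set ==> norm (fst z) <= 3"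
proof (rule norm_le_3)
 assume "(p, z) \<in> shell_set"
 then have "(1 / shell_scale p)\<^sup>2 + fst z \<bullet> fst z <= 8" by (simp add: shell_set_def)
 then show "fst z \<bullet> fst z <= 8" by (smt (verit) zero_le_power2)
qed

lemma shell_set_Y: "(p, z) \<in> shell_set ==> norm ((1 / shell_scale' p) *\<^sub>R fst (snd z)) <= 3"
proof (rule norm_le_3)
 assume "(p, z) \<in> shell_set"
 then have "(1 / shell_scale' p)\<^sup>2 * (1 + fst (snd z) \<bullet> fst (snd z)) <= 8" by (simp add: shell_set_def)
 then have "(1 / shell_scale' p)\<^sup>2 * (fst (snd z) \<bullet> fst (snd z)) <= 8" by (simp add: distrib_left) (smt (verit) zero_le_power2 zero_le_divide_iff)
 then show "(1 / shell_scale' p) *\<^sub>R fst (snd z) \<bullet> (1 / shell_scale' p) *\<^sub>R fst (snd z) <= 8" by (simp add: power2_eq_square)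
qed

text \<open>This is the place where the decay of derivatives in the output variable enters: after rescaling
the shell to unit size each derivative costs a factor that the decay compensates.\<close>

lemma symb_scaled_A: "symb shell_set (%p z. A (shell_scale p *\<^sub>R fst z, snd z))"
proof (rule symb_ddlI)
 show sm: "smooth (%z. A (shell_scale p *\<^sub>R fst z, snd z))" for p by (intro smooth_compose[OF A_smooth] smooth_intros)
 fix bs :: "('a \<times> 'a \<times> 'a) list" assume bs: "set bs \<subseteq> Basis"
 obtain as ds where ad: "set as \<subseteq> Basis" "set ds \<subseteq> Basis" "mset bs = mset (map inc1 as @ map inc2 ds)"
  using Basis_list_prod[OF bs] by blast
 let ?l = "length as"
 obtain C where C: "\<And>x z. cmod (ddl (map inc1 as @ map inc2 ds) A (x, z)) <= C * bracket (- real ?l) x"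
  using A_bound[OF ad(1,2)] by blast
 have "norm (ddl bs (%z. A (shell_scale p *\<^sub>R fst z, snd z)) z) <= \<bar>C\<bar> * 2 powr (real ?l / 2)" if "(p, z) \<in> shell_set" for p z
 proof -
  let ?s = "shell_scale p"
  have s: "?s >= 1" by (rule shell_scale_ge_1)
  have "1/2 <= (1 / ?s)\<^sup>2 + fst z \<bullet> fst z" using that by (simp add: shell_set_def)
  then have "?s\<^sup>2 * (1/2) <= ?s\<^sup>2 * ((1 / ?s)\<^sup>2 + fst z \<bullet> fst z)" by (rule mult_left_mono) simp
  also have "\<dots> = 1 + (norm (?s *\<^sub>R fst z))\<^sup>2"
   unfolding power2_norm_eq_inner using s by (simp add: distrib_left power_divide power2_eq_square)
  finally have "bracket (- real ?l) (?s *\<^sub>R fst z) <= (?s\<^sup>2 * (1/2)) powr (- real ?l / 2)"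
   unfolding bracket_def using s by (intro powr_mono2') auto
  also have "\<dots> = (?s powr 2) powr (- real ?l / 2) * (1/2) powr (- real ?l / 2)"
  proof -
   have e: "?s\<^sup>2 = ?s powr 2" using s by (simp add: powr_numeral)
   show ?thesis unfolding e by (rule powr_mult)
  qed
  also have "(?s powr 2) powr (- real ?l / 2) = 1 / ?s ^ ?l"
  proof -
   have a: "2 * (- real ?l / 2) = - real ?l" by simp
   show ?thesis unfolding powr_powr a powr_minus_divide using s by (subst powr_realpow) simp_all
  qed
  also have "(1/2::real) powr (- real ?l / 2) = 2 powr (real ?l / 2)"
  proof -
   have "(1/2::real) powr (- (real ?l / 2)) = 1 / 2 powr (- (real ?l / 2))" by (simp only: powr_divide powr_one_eq_one)
   also have "\<dots> = 2 powr (real ?l / 2)" by (simp only: powr_minus_divide) simp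
   finally show ?thesis by simp
  qed
  finally have br: "bracket (- real ?l) (?s *\<^sub>R fst z) <= 1 / ?s ^ ?l * 2 powr (real ?l / 2)" .
  have "norm (ddl bs (%z. A (?s *\<^sub>R fst z, snd z)) z) = ?s ^ ?l * cmod (ddl (map inc1 as @ map inc2 ds) A (?s *\<^sub>R fst z, snd z))"
   unfolding ddl_perm[OF sm bs ad(3)] ddl_scale_fst[OF A_smooth ad(1,2)] using s by (simp add: norm_mult norm_power)
  also have "\<dots> <= ?s ^ ?l * (\<bar>C\<bar> * (1 / ?s ^ ?l * 2 powr (real ?l / 2)))"
  proof (intro mult_left_mono)
   have "cmod (ddl (map inc1 as @ map inc2 ds) A (?s *\<^sub>R fst z, snd z)) <= C * bracket (- real ?l) (?s *\<^sub>R fst z)" by (rule C)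
   also have "\<dots> <= \<bar>C\<bar> * bracket (- real ?l) (?s *\<^sub>R fst z)" by (intro mult_right_mono) (auto simp: bracket_def)
   also have "\<dots> <= \<bar>C\<bar> * (1 / ?s ^ ?l * 2 powr (real ?l / 2))" by (intro mult_left_mono br) auto
   finally show "cmod (ddl (map inc1 as @ map inc2 ds) A (?s *\<^sub>R fst z, snd z)) <= \<bar>C\<bar> * (1 / ?s ^ ?l * 2 powr (real ?l / 2))" .
  qed (use s in simp)
  also have "\<dots> = \<bar>C\<bar> * 2 powr (real ?l / 2)" using s by simp
  finally show ?thesis .
 qed
 then show "\<exists>C. \<forall>p z. (p, z) \<in> shell_set --> norm (ddl bs (%z. A (shell_scale p *\<^sub>R fst z, snd z)) z) <= C" by blast
qed

lemma inv_scale: "\<bar>1 / shell_scale p\<bar> <= 1" "\<bar>1 / shell_scale' p\<bar> <= 1"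
 using shell_scale_ge_1[of p] by (auto simp: divide_le_eq)

lemma symb_X: "symb shell_set (%p z. fst z)"
 using symb_scaled_linear[OF bounded_linear_fst, of shell_set "%_. 1" 3] shell_set_X by simp

lemma symb_plateau_compose:
 assumes "symb shell_set h" shows "symb shell_set (%p z. plateau (h p z))"
 by (rule symb_compose[OF symb_plateau]) (auto intro: symb_differentiable[OF assms] symb_dd[OF assms])

lemma symb_cut: "symb shell_set (%p z. cut (eps p *\<^sub>R snd (snd z)))"
proof -
 have "symb shell_set (%p z. bump (eps p *\<^sub>R snd (snd z)))"
 proof (rule symb_compose[OF symb_bump])
  have D: "((%z::'a \<times> 'a \<times> 'a. eps p *\<^sub>R snd (snd z)) has_derivative (%v. eps p *\<^sub>R snd (snd v))) (at z)" for p z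
   by (auto intro!: derivative_eq_intros)
  then show "(%z::'a \<times> 'a \<times> 'a. eps p *\<^sub>R snd (snd z)) differentiable (at z)" for p z using differentiable_def by blast
  fix b :: "'a \<times> 'a \<times> 'a"
  have e: "dd b (%z::'a \<times> 'a \<times> 'a. eps p *\<^sub>R snd (snd z)) = (%z. eps p *\<^sub>R snd (snd b))" for p by (rule ext, rule dd_eq[OF D])
  show "symb shell_set (%p. dd b (%z::'a \<times> 'a \<times> 'a. eps p *\<^sub>R snd (snd z)))"
   unfolding e
  proof (rule symb_const[of _ _ "norm (snd (snd b))"])
   fix p z assume "(p, z) \<in> shell_set"
   then have "\<bar>eps p\<bar> * norm (snd (snd b)) <= 1 * norm (snd (snd b))" by (intro mult_right_mono) (auto simp: shell_set_def shells_def)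
   then show "norm (eps p *\<^sub>R snd (snd b)) <= norm (snd (snd b))" by simp
  qed
 qed auto
 then have "symb shell_set (%p z. complex_of_real (bump (eps p *\<^sub>R snd (snd z)) * (1 / bump (0::'a))))"
  by (intro symb_of_real symb_mult symb_const0)
 then show ?thesis by (simp add: cut_def)
qed

lemma symb_shell_amp: "symb shell_set shell_amp"
proof -
 have 1: "symb shell_set (%p z. (1 / shell_scale p)\<^sup>2 + fst z \<bullet> fst z)"
  by (intro symb_add symb_const[of _ _ 1] bounded_bilinear.symb_prod[OF bounded_bilinear_inner] symb_X)
   (use inv_scale in \<open>simp add: abs_square_le_1 power_abs[symmetric]\<close>)
 have bl: "bounded_linear (%z::'a \<times> 'a \<times> 'a. fst (snd z))" by (intro bounded_linear_compose[OF bounded_linear_fst bounded_linear_snd])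
 have y: "symb shell_set (%p z. (1 / shell_scale' p) *\<^sub>R fst (snd z))"
  by (rule symb_scaled_linear[OF bl, where C=3]) (use inv_scale(2) shell_set_Y in auto)
 have "symb shell_set (%p z. (1 / shell_scale' p)\<^sup>2 + ((1 / shell_scale' p) *\<^sub>R fst (snd z)) \<bullet> ((1 / shell_scale' p) *\<^sub>R fst (snd z)))"
  by (intro symb_add symb_const[of _ _ 1] bounded_bilinear.symb_prod[OF bounded_bilinear_inner] y)
   (use inv_scale in \<open>simp add: abs_square_le_1 power_abs[symmetric]\<close>)
 then have 2: "symb shell_set (%p z. (1 / shell_scale' p)\<^sup>2 * (1 + fst (snd z) \<bullet> fst (snd z)))"
  by (simp add: distrib_left power2_eq_square)
 show ?thesis unfolding shell_amp_def[abs_def]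
  by (intro symb_mult symb_scaled_A symb_of_real symb_plateau_compose 1 2 symb_cut)
qed

lemma shell_amp_zero: "p \<in> shells ==> (p, z) \<notin> shell_set ==> shell_amp p z = 0"
 unfolding shell_amp_def shell_set_def by (auto simp: not_le plateau_eq_0)

lemma closed_shell_set: "closed {z. (p, z) \<in> shell_set}"
proof -
 have "closed {z::'a \<times> 'a \<times> 'a. 1/2 <= (1 / shell_scale p)\<^sup>2 + fst z \<bullet> fst z \<and> (1 / shell_scale p)\<^sup>2 + fst z \<bullet> fst z <= 8 \<and>
   1/2 <= (1 / shell_scale' p)\<^sup>2 * (1 + fst (snd z) \<bullet> fst (snd z)) \<and> (1 / shell_scale' p)\<^sup>2 * (1 + fst (snd z) \<bullet> fst (snd z)) <= 8}"
  by (intro closed_Collect_conj closed_Collect_le continuous_intros)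
 then show ?thesis by (cases "p \<in> shells") (auto simp: shell_set_def)
qed

lemma shell_amp_xi: "p \<in> shells ==> norm (snd (snd z)) > 1 / eps p ==> shell_amp p z = 0"
 unfolding shell_amp_def cut_def shells_def by (auto simp: bump_0 field_simps)

end

section \<open>Nonstationarity off the diagonal\<close>

lemma bracket_1_le: "bracket 1 y <= 1 + norm y"
proof -
 have "1 + (norm y)\<^sup>2 >= 0" by (simp add: add_nonneg_nonneg)
 then have "bracket 1 y = sqrt (1 + (norm y)\<^sup>2)" by (simp add: bracket_def powr_half_sqrt)
 also have "\<dots> <= 1 + norm y" by (rule real_le_lsqrt) (auto simp: power2_eq_square algebra_simps)
 finally show ?thesis .
qed

lemma bbs_slice:
 assumes "bbs f" shows "bbs (%y. f (x, y))"
proof -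
 obtain C R where f: "f \<in> borel_measurable borel" "\<And>z. cmod (f z) <= C" "\<And>z. norm z > R ==> f z = 0"
  using assms unfolding bbs_def by blast
 have "(%y. (x, y)) \<in> borel \<rightarrow>\<^sub>M borel" by (intro borel_measurable_continuous_onI continuous_intros)
 from measurable_compose[OF this f(1)] have m: "(%y. f (x, y)) \<in> borel_measurable borel" .
 have s: "f (x, y) = 0" if "norm y > R" for y using that norm_snd_le[of y x] by (intro f(3)) linarith
 show ?thesis unfolding bbs_def using m f(2) s by blast
qed

lemma integral_bbs_pair:
 assumes "bbs f" shows "(LINT z|lborel. f z) = (LINT x|lborel. LINT y|lborel. f (x, y))"
proof -
 have "integrable (lborel \<Otimes>\<^sub>M lborel) f" using bbs_integrable[OF assms] by (simp add: lborel_prod)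
 from lborel_pair.integral_fst'[OF this] show ?thesis by (simp add: lborel_prod)
qed

context fio_setup
begin

lemma mixed_symb:
 assumes "b \<in> Basis" "zs \<noteq> []" "set zs \<subseteq> Basis"
 shows "symb UNIV (%_::unit. dd (inc1 b) (ddl (map inc2 zs) \<Phi>))"
proof -
 obtain zs' c where zs: "zs = zs' @ [c]" using assms(2) by (metis rev_exhaust)
 have c: "c \<in> Basis" "set zs' \<subseteq> Basis" using assms(3) by (auto simp: zs)
 have s: "set (map inc2 zs') \<subseteq> (Basis :: ('a \<times> 'a) set)" using c(2) by (auto intro: Basis_inc)
 have "dd (inc1 b) (ddl (map inc2 zs) \<Phi>) = ddl (map inc2 zs') (dd (inc1 b) (dd (inc2 c) \<Phi>))"
  unfolding zs using ddl_dd[OF smooth_dd[OF fw.smooth Basis_inc(2)[OF c(1)]] s Basis_inc(1)[OF assms(1)]] by simp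
 then show ?thesis using symb_ddl[OF fw.mixed[OF assms(1) c(1)] s] by simp
qed

lemma symb_scaled_grad:
 assumes "zs \<noteq> []" "set zs \<subseteq> Basis"
 shows "symb {(p, w). norm ((1 / shell_scale' p) *\<^sub>R fst w) <= 3} (%p w. (1 / shell_scale' p) * ddl (map inc2 zs) \<Phi> w)"
proof -
 let ?O = "{(p, w::'a \<times> 'a). norm ((1 / shell_scale' p) *\<^sub>R fst w) <= 3}"
 have B: "\<exists>C. \<forall>p w. (p, w) \<in> ?O --> norm ((1 / shell_scale' p) * ddl (map inc2 zs) \<Phi> w) <= C"
  if "zs \<noteq> []" "set zs \<subseteq> Basis" for zs
 proof -
  from \<Phi>_bound[OF that(2,1)] obtain C where C: "\<And>y \<xi>. \<bar>ddl (map inc2 zs) \<Phi> (y, \<xi>)\<bar> <= C * bracket 1 y" by blast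
  have "norm ((1 / shell_scale' p) * ddl (map inc2 zs) \<Phi> w) <= \<bar>C\<bar> * 4" if w: "norm ((1 / shell_scale' p) *\<^sub>R fst w) <= 3" for p w
  proof -
   let ?s = "shell_scale' p"
   have s: "?s >= 1" by (rule shell_scale_ge_1)
   have "\<bar>ddl (map inc2 zs) \<Phi> w\<bar> <= C * bracket 1 (fst w)" using C[of "fst w" "snd w"] by simp
   also have "\<dots> <= \<bar>C\<bar> * (1 + norm (fst w))" by (intro mult_mono bracket_1_le) (auto simp: bracket_def)
   finally have "(1 / ?s) * \<bar>ddl (map inc2 zs) \<Phi> w\<bar> <= (1 / ?s) * (\<bar>C\<bar> * (1 + norm (fst w)))" using s by (intro mult_left_mono) auto
   also have "\<dots> = \<bar>C\<bar> * (1 / ?s + norm ((1 / ?s) *\<^sub>R fst w))" using s by (simp add: field_simps)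
   also have "\<dots> <= \<bar>C\<bar> * (1 + 3)" using w s by (intro mult_left_mono add_mono) auto
   finally show ?thesis using s by (simp add: abs_mult)
  qed
  then show ?thesis by blast
 qed
 have "symb_k k ?O (%p w. (1 / shell_scale' p) * ddl (map inc2 zs) \<Phi> w)" if "zs \<noteq> []" "set zs \<subseteq> Basis" for k zs
  using that
 proof (induction k arbitrary: zs)
  case 0 then show ?case using B[OF 0] by simp
 next
  case (Suc k)
  have sm: "smooth (ddl (map inc2 zs) \<Phi>)" using Suc.prems by (intro smooth_ddl fw.smooth) (auto intro: Basis_inc)
  have e: "dd b (%w. (1 / shell_scale' p) * ddl (map inc2 zs) \<Phi> w) = (%w. (1 / shell_scale' p) * dd b (ddl (map inc2 zs) \<Phi>) w)" for b p
   by (rule ext, rule dd_linear[OF bounded_linear_mult_right smooth_differentiable[OF sm]])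
  have 1: "symb_k k ?O (%p. dd b (%w. (1 / shell_scale' p) * ddl (map inc2 zs) \<Phi> w))" if b: "b \<in> Basis" for b
  proof -
   from b consider u where "u \<in> Basis" "b = inc1 u" | v where "v \<in> Basis" "b = inc2 v" by (auto simp: Basis_prod_def)
   then show ?thesis
   proof cases
    case 1
    have "symb ?O (%p w. dd (inc1 u) (ddl (map inc2 zs) \<Phi>) w)"
     using symb_compose_linear[OF mixed_symb[OF 1(1) Suc.prems] bounded_linear_ident, of ?O "%_. ()"] by simp
    moreover have "symb ?O (%p w. 1 / shell_scale' p)" by (rule symb_const[of _ _ 1]) (use inv_scale(2) in simp)
    ultimately have "symb ?O (%p w. (1 / shell_scale' p) * dd (inc1 u) (ddl (map inc2 zs) \<Phi>) w)" by (intro symb_mult)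
    then show ?thesis unfolding e by (simp add: 1(2) symb_def)
   next
    case 2
    then show ?thesis unfolding e using Suc.IH[of "v # zs"] Suc.prems by simp
   qed
  qed
  have 2: "(%w. (1 / shell_scale' p) * ddl (map inc2 zs) \<Phi> w) differentiable (at w)" for p w
   by (intro differentiable_mult differentiable_const smooth_differentiable sm)
  show ?case unfolding symb_k.simps using B[OF Suc.prems] 1 2 by blast
 qed
 then show ?thesis using assms by (simp add: symb_def)
qed

definition grad :: "'a \<times> 'a => 'a" where "grad w = (\<Sum>b\<in>Basis. dd (inc2 b) \<Phi> w *\<^sub>R b)"

lemma grad_inner: "b \<in> Basis ==> grad w \<bullet> b = dd (inc2 b) \<Phi> w"
 unfolding grad_def by (rule inner_sum_left_Basis)

lemma norm_sq_Basis: "(norm x)\<^sup>2 = (\<Sum>b\<in>Basis. (x \<bullet> b)\<^sup>2)" for x :: "'b::euclidean_space"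
 unfolding power2_norm_eq_inner euclidean_inner[of x x] by (simp add: power2_eq_square)

text \<open>The upper bound is the growth hypothesis on the phase. The lower bound is the expansion of the
gradient in the input variable, started at the origin.\<close>

lemma grad_bounds:
 obtains m C where "m > 0" "C > 0" "\<And>y \<xi>. norm (grad (y, \<xi>)) <= C * (1 + norm y)" "\<And>y \<xi>. m * norm y <= norm (grad (y, \<xi>)) + C"
proof -
 obtain \<kappa> where \<kappa>: "\<kappa> > 0" "\<And>\<xi> y \<eta>. \<kappa> * (norm (y - \<eta>))\<^sup>2 <= (\<Sum>b\<in>Basis. (dd (inc1 b) (%z. \<Phi> (swp z)) (\<xi>, y) - dd (inc1 b) (%z. \<Phi> (swp z)) (\<xi>, \<eta>))\<^sup>2)"
  using bw.expanding by blast
 have "\<exists>C. \<forall>y \<xi>. \<bar>dd (inc2 b) \<Phi> (y, \<xi>)\<bar> <= C * bracket 1 y" if "b \<in> Basis" for b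
  using \<Phi>_bound[of "[b]"] that by simp
 then obtain D where D: "\<And>b y \<xi>. b \<in> Basis ==> \<bar>dd (inc2 b) \<Phi> (y, \<xi>)\<bar> <= D b * bracket 1 y" by metis
 define C where "C = (\<Sum>b\<in>(Basis::'a set). \<bar>D b\<bar>) + 1"
 have C0: "C > 0" unfolding C_def by (intro add_nonneg_pos sum_nonneg) auto
 have up: "norm (grad (y, \<xi>)) <= C * (1 + norm y)" for y \<xi>
 proof -
  have "norm (grad (y, \<xi>)) <= (\<Sum>b\<in>Basis. \<bar>grad (y, \<xi>) \<bullet> b\<bar>)" by (rule norm_le_l1)
  also have "\<dots> <= (\<Sum>b\<in>(Basis::'a set). \<bar>D b\<bar> * (1 + norm y))"
  proof (rule sum_mono)
   fix b :: 'a assume b: "b \<in> Basis"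
   have "\<bar>grad (y, \<xi>) \<bullet> b\<bar> <= D b * bracket 1 y" using D[OF b] by (simp add: grad_inner b)
   also have "\<dots> <= \<bar>D b\<bar> * (1 + norm y)" by (intro mult_mono bracket_1_le) (auto simp: bracket_def)
   finally show "\<bar>grad (y, \<xi>) \<bullet> b\<bar> <= \<bar>D b\<bar> * (1 + norm y)" .
  qed
  also have "\<dots> <= C * (1 + norm y)" unfolding C_def sum_distrib_right[symmetric] by (intro mult_right_mono) auto
  finally show ?thesis .
 qed
 have "sqrt \<kappa> * norm y <= norm (grad (y, \<xi>)) + C" for y \<xi>
 proof -
  have "\<kappa> * (norm (y - 0))\<^sup>2 <= (norm (grad (y, \<xi>) - grad (0, \<xi>)))\<^sup>2"
   using \<kappa>(2)[of y 0 \<xi>] by (simp add: dd_swp norm_sq_Basis[of "grad (y, \<xi>) - grad (0, \<xi>)"] inner_diff_left grad_inner)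
  then have "(sqrt \<kappa> * norm y)\<^sup>2 <= (norm (grad (y, \<xi>) - grad (0, \<xi>)))\<^sup>2" using \<kappa>(1) by (simp add: power_mult_distrib)
  then have "sqrt \<kappa> * norm y <= norm (grad (y, \<xi>) - grad (0, \<xi>))" by (rule power2_le_imp_le) simp
  also have "\<dots> <= norm (grad (y, \<xi>)) + norm (grad (0, \<xi>))" by (rule norm_triangle_ineq4)
  also have "norm (grad (0, \<xi>)) <= C" using up[of 0 \<xi>] by simp
  finally show ?thesis by simp
 qed
 then show thesis using that[of "sqrt \<kappa>" C] \<kappa>(1) C0 up by simp
qed

definition full_phase :: "nat \<times> nat \<times> real => 'a \<times> 'a \<times> 'a => real" where
 "full_phase p z = (shell_scale p *\<^sub>R fst z) \<bullet> snd (snd z) + \<Phi> (snd z)"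
definition big_scale :: "nat \<times> nat \<times> real => real" where "big_scale p = max (shell_scale p) (shell_scale' p)"
definition small_scale :: "nat \<times> nat \<times> real => real" where "small_scale p = min (shell_scale p) (shell_scale' p)"

lemma smooth_full_phase: "smooth (full_phase p)"
 unfolding full_phase_def[abs_def] by (intro smooth_add smooth_compose[OF fw.smooth] smooth_intros)

lemma dd_full_phase:
 "dd (inc2 (inc2 b)) (full_phase p) z = (shell_scale p *\<^sub>R fst z) \<bullet> b + dd (inc2 b) \<Phi> (snd z)"
proof -
 have 1: "((%z::'a \<times> 'a \<times> 'a. \<Phi> (snd z)) has_derivative (%v. dd (snd v) \<Phi> (snd z))) (at z)"
  by (rule has_derivative_compose[OF _ dd_has_derivative[OF smooth_differentiable[OF fw.smooth]]]) (auto intro!: derivative_eq_intros)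
 have "(full_phase p has_derivative (%v. ((shell_scale p *\<^sub>R fst z) \<bullet> snd (snd v) + (shell_scale p *\<^sub>R fst v) \<bullet> snd (snd z)) + dd (snd v) \<Phi> (snd z))) (at z)"
  unfolding full_phase_def[abs_def] by (intro has_derivative_add 1) (auto intro!: derivative_eq_intros simp: algebra_simps)
 from dd_eq[OF this, of "inc2 (inc2 b)"] show ?thesis by simp
qed

definition xi_dirs :: "('a \<times> 'a \<times> 'a) set" where "xi_dirs = (%b. inc2 (inc2 b)) ` Basis"

definition far :: "nat => (nat \<times> nat \<times> real) set" where
 "far n = {p. 2 ^ n * shell_scale p <= shell_scale' p \<or> 2 ^ n * shell_scale' p <= shell_scale p}"

definition far_set :: "nat => ((nat \<times> nat \<times> real) \<times> ('a \<times> 'a \<times> 'a)) set" where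
 "far_set n = {(p, z). p \<in> far n \<and> (p, z) \<in> shell_set}"

text \<open>On the support the output variable and the frequency gradient of the phase have sizes comparable
to their dyadic scales. If these differ by a large factor the two terms cannot cancel, and the
gradient in frequency has the size of the larger scale.\<close>

lemma nonstationary_far:
 obtains n c where "nonstationary xi_dirs (far_set n) full_phase big_scale c"
proof -
 obtain m C where mC: "m > 0" "C > 0" "\<And>y \<xi>. norm (grad (y, \<xi>)) <= C * (1 + norm y)" "\<And>y \<xi>. m * norm y <= norm (grad (y, \<xi>)) + C"
  using grad_bounds by blast
 define W where "W = 2 + 24 / m + 8 * C / m + 16 * C"
 obtain n where n: "W < 2 ^ n" using real_arch_pow[of 2 W] by auto
 have W: "W >= 2" "W >= 24 / m" "W >= 8 * C / m" "W >= 16 * C" unfolding W_def using mC(1,2) by (auto simp: add_nonneg_nonneg)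
 define c where "c = (min (m / 4) (1 / 4))\<^sup>2"
 have low: "min (m / 4) (1 / 4) * big_scale p <= norm (shell_scale p *\<^sub>R fst z + grad (snd z))" if "(p, z) \<in> far_set n" for p z
 proof -
  let ?s = "shell_scale p" and ?s' = "shell_scale' p"
  let ?X = "norm (?s *\<^sub>R fst z)" and ?G = "norm (grad (snd z))"
  have s: "?s >= 1" "?s' >= 1" by (rule shell_scale_ge_1)+
  have sh: "(p, z) \<in> shell_set" and fa: "p \<in> far n" using that by (auto simp: far_set_def)
  have X3: "?X <= 3 * ?s" using shell_set_X[OF sh] s by (simp add: mult.commute mult_left_mono)
  have y3: "norm (fst (snd z)) <= 3 * ?s'" using shell_set_Y[OF sh] s by (simp add: field_simps)
  have gup: "?G <= C * (1 + norm (fst (snd z)))" using mC(3)[of "fst (snd z)" "snd (snd z)"] by simp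
  have glo: "m * norm (fst (snd z)) <= ?G + C" using mC(4)[of "fst (snd z)" "snd (snd z)"] by simp
  have tri: "?X - ?G <= norm (?s *\<^sub>R fst z + grad (snd z))" "?G - ?X <= norm (?s *\<^sub>R fst z + grad (snd z))"
   using norm_triangle_ineq4[of "?s *\<^sub>R fst z + grad (snd z)" "grad (snd z)"] norm_triangle_ineq4[of "?s *\<^sub>R fst z + grad (snd z)" "?s *\<^sub>R fst z"] by simp_all
  from fa consider "2 ^ n * ?s <= ?s'" | "2 ^ n * ?s' <= ?s" by (auto simp: far_def)
  then show ?thesis
  proof cases
   case 1
   have Ws: "W * ?s <= ?s'" using n 1 s mult_right_mono[of W "2 ^ n" ?s] by linarith
   have W1: "W <= ?s'" using Ws s W(1) mult_left_mono[of 1 ?s W] by linarith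
   have "1 * ?s <= W * ?s" using W(1) s by (intro mult_right_mono) auto
   then have big: "big_scale p = ?s'" using Ws by (simp add: big_scale_def max_def)
   have "1/2 <= (1 / ?s')\<^sup>2 * (1 + fst (snd z) \<bullet> fst (snd z))" using sh by (simp add: shell_set_def)
   then have "?s'\<^sup>2 <= 2 * (1 + (norm (fst (snd z)))\<^sup>2)" using s by (simp add: power2_norm_eq_inner power_divide field_simps)
   moreover have "?s'\<^sup>2 >= 2\<^sup>2" using W1 W(1) by (intro power_mono) auto
   ultimately have "(?s' / 2)\<^sup>2 <= (norm (fst (snd z)))\<^sup>2" by (simp add: power_divide)
   then have "?s' / 2 <= norm (fst (snd z))" by (rule power2_le_imp_le) simp
   then have "m * (?s' / 2) <= m * norm (fst (snd z))" using mC(1) by (intro mult_left_mono) auto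
   then have g: "m * ?s' / 2 - C <= ?G" using glo by simp
   have "24 / m * ?s <= ?s'" using Ws W(2) s mult_right_mono[of "24 / m" W ?s] by linarith
   then have x: "3 * ?s <= m * ?s' / 8" using mC(1) by (simp add: field_simps)
   have "8 * C / m <= ?s'" using W(3) W1 by linarith
   then have c: "C <= m * ?s' / 8" using mC(1) by (simp add: field_simps)
   have "m * ?s' / 4 <= ?G - ?X" using g x c X3 by linarith
   then have "m / 4 * ?s' <= norm (?s *\<^sub>R fst z + grad (snd z))" using tri by simp
   moreover have "min (m / 4) (1 / 4) * ?s' <= m / 4 * ?s'" using s by (intro mult_right_mono) auto
   ultimately show ?thesis unfolding big by linarith
  next
   case 2
   have Ws: "W * ?s' <= ?s" using n 2 s mult_right_mono[of W "2 ^ n" ?s'] by linarith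
   have W1: "W <= ?s" using Ws s W(1) mult_left_mono[of 1 ?s' W] by linarith
   have "1 * ?s' <= W * ?s'" using W(1) s by (intro mult_right_mono) auto
   then have big: "big_scale p = ?s" using Ws by (simp add: big_scale_def max_def)
   have "1/2 <= (1 / ?s)\<^sup>2 + fst z \<bullet> fst z" using sh by (simp add: shell_set_def)
   moreover have "(1 / ?s)\<^sup>2 <= (1/2)\<^sup>2" using W1 W(1) by (intro power_mono) (auto simp: field_simps)
   ultimately have "(1/2)\<^sup>2 <= (norm (fst z))\<^sup>2" by (simp add: power2_norm_eq_inner power_divide)
   then have "1/2 <= norm (fst z)" by (rule power2_le_imp_le) simp
   then have x: "?s / 2 <= ?X" using s by (simp add: mult_left_mono[of "1/2" "norm (fst z)" ?s, simplified])
   have "?G <= C * (4 * ?s')" using gup y3 s mC(2) mult_left_mono[of "1 + norm (fst (snd z))" "4 * ?s'" C] by linarith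
   moreover have "16 * C * ?s' <= ?s" using Ws W(4) s mult_right_mono[of "16 * C" W ?s'] by linarith
   ultimately have "?s / 4 <= ?X - ?G" using x by linarith
   then have "1 / 4 * ?s <= norm (?s *\<^sub>R fst z + grad (snd z))" using tri by simp
   moreover have "min (m / 4) (1 / 4) * ?s <= 1 / 4 * ?s" using s by (intro mult_right_mono) auto
   ultimately show ?thesis unfolding big by linarith
  qed
 qed
 have big1: "big_scale p >= 1" for p using shell_scale_ge_1[of p] by (simp add: big_scale_def le_max_iff_disj)
 have "nonstationary xi_dirs (far_set n) full_phase big_scale c"
 proof
  show "xi_dirs \<subseteq> Basis" unfolding xi_dirs_def by (auto intro: Basis_inc)
  show "smooth (full_phase p)" for p by (rule smooth_full_phase)
  show "1 <= big_scale p" for p by (rule big1)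
  show "c > 0" using mC(1) by (simp add: c_def)
  show "c * (big_scale p)\<^sup>2 <= (\<Sum>b\<in>xi_dirs. (dd b (full_phase p) z)\<^sup>2)" if "(p, z) \<in> far_set n" for p z
  proof -
   have inj: "inj_on (%b. inc2 (inc2 b) :: 'a \<times> 'a \<times> 'a) Basis" by (auto simp: inj_on_def)
   have "(\<Sum>b\<in>xi_dirs. (dd b (full_phase p) z)\<^sup>2) = (\<Sum>b\<in>Basis. ((shell_scale p *\<^sub>R fst z + grad (snd z)) \<bullet> b)\<^sup>2)"
    unfolding xi_dirs_def sum.reindex[OF inj] comp_def
    by (intro sum.cong refl) (simp add: dd_full_phase inner_add_left grad_inner)
   also have "\<dots> = (norm (shell_scale p *\<^sub>R fst z + grad (snd z)))\<^sup>2" by (rule norm_sq_Basis[symmetric])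
   also have "\<dots> >= (min (m / 4) (1 / 4) * big_scale p)\<^sup>2"
    using low[OF that] mC(1) big1[of p] by (intro power_mono mult_nonneg_nonneg) auto
   finally show ?thesis by (simp add: c_def power_mult_distrib)
  qed
  show "symb (far_set n) (%p z. dd b (full_phase p) z / big_scale p)" if "b \<in> xi_dirs" for b
  proof -
   obtain v where v: "v \<in> Basis" "b = inc2 (inc2 v)" using \<open>b \<in> xi_dirs\<close> by (auto simp: xi_dirs_def)
   have "symb shell_set (%p z. (1 / shell_scale' p) * ddl (map inc2 [v]) \<Phi> (snd z))"
    by (rule symb_compose_linear[OF symb_scaled_grad bounded_linear_snd, where f="%p. p"])
     (use v(1) shell_set_Y in auto)
   then have g: "symb shell_set (%p z. (1 / shell_scale' p) * dd (inc2 v) \<Phi> (snd z))" by simp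
   have x: "symb shell_set (%p z. fst z \<bullet> v)" by (rule symb_linear[OF bounded_linear_inner_left symb_X])
   have r1: "symb shell_set (%p z. shell_scale p / big_scale p)"
   proof (rule symb_const[of _ _ 1])
    show "norm (shell_scale p / big_scale p) <= 1" for p
     using shell_scale_ge_1[of p] big1[of p] by (simp add: divide_le_eq) (simp add: big_scale_def)
   qed
   have r2: "symb shell_set (%p z. shell_scale' p / big_scale p)"
   proof (rule symb_const[of _ _ 1])
    show "norm (shell_scale' p / big_scale p) <= 1" for p
     using shell_scale_ge_1[of p] big1[of p] by (simp add: divide_le_eq) (simp add: big_scale_def)
   qed
   have "symb shell_set (%p z. (shell_scale p / big_scale p) * (fst z \<bullet> v) + (shell_scale' p / big_scale p) * ((1 / shell_scale' p) * dd (inc2 v) \<Phi> (snd z)))"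
    by (intro symb_add symb_mult r1 r2 x g)
   moreover have "(shell_scale p / big_scale p) * (fst z \<bullet> v) + (shell_scale' p / big_scale p) * ((1 / shell_scale' p) * dd (inc2 v) \<Phi> (snd z))
     = dd b (full_phase p) z / big_scale p" for p z
    using shell_scale_ge_1[of p] by (simp add: v(2) dd_full_phase add_divide_distrib)
   ultimately have "symb shell_set (%p z. dd b (full_phase p) z / big_scale p)" by simp
   then show ?thesis by (rule symb_mono) (auto simp: far_set_def)
  qed
 qed
 then show thesis by (rule that)
qed

end

section \<open>Decay off the diagonal\<close>

context fio_setup
begin

lemma kern_shell:
 "kern F (shell_scale p) u v z = cis (full_phase p (fst z /\<^sub>R shell_scale p, snd z)) * F (fst z /\<^sub>R shell_scale p, snd z) * (u (fst (snd z)) * v (fst z))"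
 using shell_scale_ge_1[of p] by (simp add: kern_def full_phase_def)

lemma kern_zero:
 fixes p
 assumes H: "smooth H" "\<And>z. norm z > R ==> H z = 0" and b: "b \<in> xi_dirs" and u: "bbs u" and v: "bbs v"
 defines "E \<equiv> %z. cis (- full_phase p z) * dd b H z"
 shows kern_zero_bbs: "bbs (kern E (shell_scale p) u v)" and kern_zero_integral: "(LINT z|lborel. kern E (shell_scale p) u v z) = 0"
proof -
 obtain d where d: "d \<in> Basis" "b = inc2 (inc2 d)" using b by (auto simp: xi_dirs_def)
 have bB: "b \<in> Basis" by (auto simp: d intro: Basis_inc d)
 have o: "open {z::'a \<times> 'a \<times> 'a. norm z > R}" by (intro open_Collect_less continuous_intros)
 have dz: "dd b H z = 0" if "norm z > R" for z by (rule dd_zero_open[OF o]) (use H(2) that in auto)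
 obtain D where D: "D > 0" "\<And>z. norm (dd b H z) <= D"
  using smooth_compact_support_bounded[OF smooth_dd[OF H(1) bB] dz] by blast
 have sE: "smooth E" unfolding E_def
  by (intro smooth_mult smooth_cis smooth_dd H bB) (use smooth_diff[OF smooth_const smooth_full_phase, of 0] in simp)
 show bE: "bbs (kern E (shell_scale p) u v)"
 proof (rule bbs_kern[OF smooth_measurable[OF sE] _ _ u v])
  show "cmod (E z) <= D" for z using D(2) by (simp add: E_def norm_mult)
  show "E z = 0" if "norm (snd (snd z)) > R" for z
  proof -
   have "norm (snd (snd z)) <= norm (snd z)" "norm (snd z) <= norm z" by (simp_all add: norm_prod_def real_le_rsqrt)
   then show ?thesis using that dz[of z] by (simp add: E_def)
  qed
 qed
 have k: "kern E (shell_scale p) u v (x, y, \<xi>) = (u y * v x) * dd b H (x /\<^sub>R shell_scale p, y, \<xi>)" for x y \<xi>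
  unfolding kern_shell by (simp add: E_def cis_mult mult.assoc[symmetric])
 have "(LINT \<xi>|lborel. dd b H (x, y, \<xi>)) = 0" for x y
 proof -
  have s: "smooth (%\<xi>. H (x, y, \<xi>))" by (intro smooth_compose[OF H(1)] smooth_intros)
  have e: "dd d (%\<xi>. H (x, y, \<xi>)) \<xi> = dd b H (x, y, \<xi>)" for \<xi>
   using dd_compose_affine[of "%\<xi>. (0, 0, \<xi>)" H d "(x, y, 0)"] H(1)
   by (simp add: d(2) fun_eq_iff bounded_linear_Pair bounded_linear_zero bounded_linear_ident)
  have "(LINT \<xi>|lborel. dd d (%\<xi>. H (x, y, \<xi>)) \<xi>) = 0"
  proof (rule integral_dd_zero[OF s _ d(1), of R])
   show "H (x, y, \<xi>) = 0" if "norm \<xi> > R" for \<xi>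
    using that norm_snd_le[of \<xi> y] norm_snd_le[of "(y, \<xi>)" x] by (intro H(2)) linarith
  qed
  then show ?thesis by (simp add: e)
 qed
 then have "(LINT \<xi>|lborel. kern E (shell_scale p) u v (x, y, \<xi>)) = 0" for x y
  unfolding k by simp
 then show "(LINT z|lborel. kern E (shell_scale p) u v z) = 0"
  by (simp add: integral_bbs_pair[OF bE] integral_bbs_pair[OF bbs_slice[OF bE]])
qed

lemma kern_step:
 assumes ns: "nonstationary xi_dirs \<Omega> full_phase big_scale c" and f: "symb \<Omega> f"
  and R: "\<And>z. norm z > R ==> f p z = 0" and u: "bbs u" and v: "bbs v"
 shows "(LINT z|lborel. kern (f p) (shell_scale p) u v z)
  = of_real (1 / big_scale p) * (LINT z|lborel. kern (nonstationary.step xi_dirs full_phase big_scale f p) (shell_scale p) u v z)"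
proof -
 interpret ns: nonstationary xi_dirs \<Omega> full_phase big_scale c by (rule ns)
 have o: "open {z::'a \<times> 'a \<times> 'a. norm z > R}" by (intro open_Collect_less continuous_intros)
 have sR: "ns.step f p z = 0" if "norm z > R" for z by (rule ns.step_zero[OF o]) (use R that in auto)
 define H where "H b z = cis (full_phase p z) * ns.flow b f p z" for b z
 have sH: "smooth (H b)" if "b \<in> xi_dirs" for b unfolding H_def by (rule ns.smooth_flow[OF that f])
 have HR: "H b z = 0" if "norm z > R" for b z by (simp add: H_def ns.flow_def R that)
 define E where "E b z = cis (- full_phase p z) * dd b (H b) z" for b z
 have kz: "bbs (kern (E b) (shell_scale p) u v)" "(LINT z|lborel. kern (E b) (shell_scale p) u v z) = 0" if b: "b \<in> xi_dirs" for b
  using kern_zero[OF sH[OF b] HR b u v, where p=p] unfolding E_def by simp_all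
 have pw: "kern (f p) (shell_scale p) u v z = of_real (1 / big_scale p) * kern (ns.step f p) (shell_scale p) u v z
   - of_real (1 / big_scale p) * \<i> * (\<Sum>b\<in>xi_dirs. kern (E b) (shell_scale p) u v z)" for z
 proof -
  let ?z = "(fst z /\<^sub>R shell_scale p, snd z)" and ?w = "u (fst (snd z)) * v (fst z)"
  have "kern (f p) (shell_scale p) u v z = (cis (full_phase p ?z) * f p ?z) * ?w" by (simp add: kern_shell)
  also have "\<dots> = (of_real (1 / big_scale p) * (cis (full_phase p ?z) * ns.step f p ?z)
   - of_real (1 / big_scale p) * \<i> * (\<Sum>b\<in>xi_dirs. dd b (H b) ?z)) * ?w"
   unfolding H_def by (subst ns.step_identity[OF f]) (rule refl)
  also have "\<dots> = of_real (1 / big_scale p) * kern (ns.step f p) (shell_scale p) u v z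
   - of_real (1 / big_scale p) * \<i> * (\<Sum>b\<in>xi_dirs. dd b (H b) ?z * ?w)"
   by (simp only: kern_shell left_diff_distrib sum_distrib_right mult.assoc)
  also have "(\<Sum>b\<in>xi_dirs. dd b (H b) ?z * ?w) = (\<Sum>b\<in>xi_dirs. kern (E b) (shell_scale p) u v z)"
   by (intro sum.cong refl) (simp add: kern_shell E_def mult.assoc[symmetric] cis_mult)
  finally show ?thesis .
 qed
 have bs: "bbs (kern (ns.step f p) (shell_scale p) u v)"
 proof -
  have sm: "smooth (ns.step f p)" by (rule symb_smooth[OF ns.symb_step[OF f]])
  obtain D where D: "D > 0" "\<And>z. norm (ns.step f p z) <= D" using smooth_compact_support_bounded[OF sm sR] by blast
  show ?thesis
  proof (rule bbs_kern[OF smooth_measurable[OF sm] D(2) _ u v])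
   show "ns.step f p z = 0" if "norm (snd (snd z)) > R" for z
   proof -
    have "norm (snd (snd z)) <= norm (snd z)" "norm (snd z) <= norm z" by (simp_all add: norm_prod_def real_le_rsqrt)
    then show ?thesis using that sR[of z] by simp
   qed
  qed
 qed
 have i: "integrable lborel (%z. of_real (1 / big_scale p) * \<i> * (\<Sum>b\<in>xi_dirs. kern (E b) (shell_scale p) u v z))"
  by (intro integrable_mult_right Bochner_Integration.integrable_sum bbs_integrable kz(1))
 have "(LINT z|lborel. kern (f p) (shell_scale p) u v z)
  = (LINT z|lborel. of_real (1 / big_scale p) * kern (ns.step f p) (shell_scale p) u v z)
   - (LINT z|lborel. of_real (1 / big_scale p) * \<i> * (\<Sum>b\<in>xi_dirs. kern (E b) (shell_scale p) u v z))"
  unfolding pw by (intro Bochner_Integration.integral_diff integrable_mult_right bbs_integrable bs i)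
 also have "(LINT z|lborel. of_real (1 / big_scale p) * \<i> * (\<Sum>b\<in>xi_dirs. kern (E b) (shell_scale p) u v z))
   = of_real (1 / big_scale p) * \<i> * (\<Sum>b\<in>xi_dirs. LINT z|lborel. kern (E b) (shell_scale p) u v z)"
  by (simp only: integral_mult_right_zero Bochner_Integration.integral_sum[OF bbs_integrable[OF kz(1)]])
 also have "(\<Sum>b\<in>xi_dirs. LINT z|lborel. kern (E b) (shell_scale p) u v z) = 0"
  by (rule sum.neutral) (use kz(2) in blast)
 finally show ?thesis by simp
qed

lemma shell_amp_support:
 assumes p: "p \<in> shells" and z: "norm z > 3 + 3 * shell_scale' p + 1 / eps p"
 shows "shell_amp p z = 0"
proof (rule ccontr)
 assume nz: "shell_amp p z \<noteq> 0"
 then have sh: "(p, z) \<in> shell_set" using shell_amp_zero[OF p] by blast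
 have "norm (snd (snd z)) <= 1 / eps p" using nz shell_amp_xi[OF p, of z] by (meson not_le)
 moreover have "norm (fst z) <= 3" by (rule shell_set_X[OF sh])
 moreover have "norm (fst (snd z)) <= 3 * shell_scale' p"
  using shell_set_Y[OF sh] shell_scale_ge_1[of p] by (simp add: field_simps)
 moreover have "norm z <= norm (fst z) + (norm (fst (snd z)) + norm (snd (snd z)))"
  using norm_Pair_le[of "fst z" "snd z"] norm_Pair_le[of "fst (snd z)" "snd (snd z)"] by simp
 ultimately show False using z by linarith
qed

text \<open>Near the diagonal the block estimate suffices, since the ratio of the scales is bounded below
there. Away from it, integration by parts in frequency produces any power of the larger scale, and
the resulting amplitude obeys the block estimate again.\<close>

theorem shell_decay:
 obtains K where "K > 0" "\<And>p u v. p \<in> shells ==> bbs u ==> bbs v ==>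
  cmod (LINT z|lborel. kern (shell_amp p) (shell_scale p) u v z) <= K * (small_scale p / big_scale p) ^ M * l2 u * l2 v"
proof -
 obtain n c where ns: "nonstationary xi_dirs (far_set n) full_phase big_scale c" using nonstationary_far by blast
 interpret ns: nonstationary xi_dirs "far_set n" full_phase big_scale c by (rule ns)
 have sg: "small_scale p >= 1" "big_scale p >= 1" for p
  using shell_scale_ge_1[of p] by (auto simp: small_scale_def big_scale_def le_max_iff_disj)
 have F: "symb (shells \<times> UNIV) shell_amp" by (rule symb_extend[OF symb_shell_amp closed_shell_set shell_amp_zero])
 obtain K0 where K0: "K0 > 0" "\<And>p \<rho> u v. p \<in> shells ==> bbs u ==> bbs v ==> cmod (LINT z|lborel. kern (shell_amp p) \<rho> u v z) <= K0 * l2 u * l2 v"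
 proof (rule block_estimate[OF F, of 3])
  show "shell_amp p z = 0" if "p \<in> shells" "norm (fst z) > 3" for p z
   using shell_set_X[of p z] shell_amp_zero[OF that(1), of z] that(2) by force
  show "\<exists>S. \<forall>z. norm (snd (snd z)) > S --> shell_amp p z = 0" if "p \<in> shells" for p using shell_amp_xi[OF that] by blast
 qed (rule that)
 have fa: "symb (far_set n) shell_amp" by (rule symb_mono[OF symb_shell_amp]) (auto simp: far_set_def)
 have cl: "closed {z. (p, z) \<in> far_set n}" for p
  using closed_shell_set[of p] by (cases "p \<in> far n") (auto simp: far_set_def)
 let ?G = "(ns.step ^^ M) shell_amp"
 have Gz: "?G p z = 0" if "p \<in> far n \<inter> shells" "(p, z) \<notin> far_set n" for p z
  by (rule ns.stepN_zero[where S="- {z. (p, z) \<in> far_set n}"])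
   (use cl[of p] that shell_amp_zero[of p] in \<open>auto simp: far_set_def\<close>)
 have G: "symb ((far n \<inter> shells) \<times> UNIV) ?G" by (rule symb_extend[OF ns.symb_stepN[OF fa] cl Gz])
 obtain K1 where K1: "K1 > 0" "\<And>p \<rho> u v. p \<in> far n \<inter> shells ==> bbs u ==> bbs v ==> cmod (LINT z|lborel. kern (?G p) \<rho> u v z) <= K1 * l2 u * l2 v"
 proof (rule block_estimate[OF G, of 3])
  show "?G p z = 0" if "p \<in> far n \<inter> shells" "norm (fst z) > 3" for p z
   using shell_set_X[of p z] Gz[OF that(1), of z] that(2) by (force simp: far_set_def)
  show "\<exists>S. \<forall>z. norm (snd (snd z)) > S --> ?G p z = 0" if p: "p \<in> far n \<inter> shells" for p
  proof (intro exI allI impI)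
   fix z :: "'a \<times> 'a \<times> 'a" assume z: "norm (snd (snd z)) > 1 / eps p"
   have "open {z::'a \<times> 'a \<times> 'a. norm (snd (snd z)) > 1 / eps p}" by (intro open_Collect_less continuous_intros)
   then show "?G p z = 0" by (rule ns.stepN_zero) (use z p shell_amp_xi in auto)
  qed
 qed (rule that)
 have iter: "(LINT z|lborel. kern (shell_amp p) (shell_scale p) u v z)
   = of_real (1 / big_scale p) ^ N * (LINT z|lborel. kern ((ns.step ^^ N) shell_amp p) (shell_scale p) u v z)"
  if p: "p \<in> shells" and u: "bbs u" and v: "bbs v" for p u v N
 proof (induction N)
  case (Suc N)
  have o: "open {z::'a \<times> 'a \<times> 'a. norm z > 3 + 3 * shell_scale' p + 1 / eps p}" by (intro open_Collect_less continuous_intros)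
  have "(ns.step ^^ N) shell_amp p z = 0" if "norm z > 3 + 3 * shell_scale' p + 1 / eps p" for z
   by (rule ns.stepN_zero[OF o]) (use shell_amp_support[OF p] that in auto)
  from kern_step[OF ns ns.symb_stepN[OF fa] this u v] show ?case unfolding Suc by simp
 qed simp
 show thesis
 proof (rule that[of "max K1 (K0 * (2 ^ n) ^ M)"])
  show "max K1 (K0 * (2 ^ n) ^ M) > 0" using K1(1) by (simp add: less_max_iff_disj)
  fix p and u v :: "'a => complex" assume p: "p \<in> shells" and u: "bbs u" and v: "bbs v"
  let ?Q = "cmod (LINT z|lborel. kern (shell_amp p) (shell_scale p) u v z)"
  let ?K = "max K1 (K0 * (2 ^ n) ^ M)"
  have r0: "0 <= small_scale p / big_scale p" using sg[of p] by simp
  show "?Q <= ?K * (small_scale p / big_scale p) ^ M * l2 u * l2 v"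
  proof (cases "p \<in> far n")
   case True
   have "?Q = (1 / big_scale p) ^ M * cmod (LINT z|lborel. kern (?G p) (shell_scale p) u v z)"
    unfolding iter[OF p u v, of M] using sg[of p] by (simp add: norm_mult norm_power norm_divide)
   also have "\<dots> <= (1 / big_scale p) ^ M * (K1 * l2 u * l2 v)"
    using K1(2)[OF _ u v] True p sg[of p] by (intro mult_left_mono) auto
   also have "\<dots> <= (small_scale p / big_scale p) ^ M * (K1 * l2 u * l2 v)"
    using sg[of p] K1(1) by (intro mult_right_mono power_mono divide_right_mono) (auto simp: l2_nonneg)
   also have "\<dots> = K1 * ((small_scale p / big_scale p) ^ M * l2 u * l2 v)" by simp
   also have "\<dots> <= ?K * ((small_scale p / big_scale p) ^ M * l2 u * l2 v)"
    using r0 by (intro mult_right_mono mult_nonneg_nonneg l2_nonneg zero_le_power) auto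
   finally show ?thesis by (simp add: mult.assoc)
  next
   case False
   then have "big_scale p <= 2 ^ n * small_scale p"
    unfolding far_def big_scale_def small_scale_def by (auto simp: max_def min_def not_le)
   then have "1 <= 2 ^ n * (small_scale p / big_scale p)" using sg[of p] by (simp add: field_simps)
   then have "1 <= (2 ^ n * (small_scale p / big_scale p)) ^ M" by (rule one_le_power)
   then have "K0 * l2 u * l2 v * 1 <= K0 * l2 u * l2 v * (2 ^ n * (small_scale p / big_scale p)) ^ M"
    using K0(1) by (intro mult_left_mono mult_nonneg_nonneg l2_nonneg) auto
   then have "K0 * l2 u * l2 v <= K0 * l2 u * l2 v * ((2 ^ n) ^ M * (small_scale p / big_scale p) ^ M)"
    by (simp only: power_mult_distrib mult_1_right)
   also have "\<dots> = K0 * (2 ^ n) ^ M * ((small_scale p / big_scale p) ^ M * l2 u * l2 v)" by (simp only: ac_simps)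
   finally have "?Q <= K0 * (2 ^ n) ^ M * ((small_scale p / big_scale p) ^ M * l2 u * l2 v)"
    using K0(2)[OF p u v, of "shell_scale p"] by linarith
   also have "\<dots> <= ?K * ((small_scale p / big_scale p) ^ M * l2 u * l2 v)"
    using r0 by (intro mult_right_mono mult_nonneg_nonneg l2_nonneg zero_le_power) auto
   finally show ?thesis by (simp add: mult.assoc)
  qed
 qed
qed

end

section \<open>Weighted bound for the regularized form\<close>

lemma bbs_l2_integrable: assumes "bbs g" shows "integrable lborel (%x. (cmod (g x))\<^sup>2)"
proof -
 obtain C R where g: "g \<in> borel_measurable borel" "\<And>x. cmod (g x) <= C" "\<And>x. norm x > R ==> g x = 0"
  using assms unfolding bbs_def by blast
 show ?thesis by (rule integrable_bounded_support[of _ "C\<^sup>2" R]) (use g in \<open>auto intro!: power_mono\<close>)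
qed

lemma l2_sq: "(l2 g)\<^sup>2 = (LINT x|lborel. (cmod (g x))\<^sup>2)" by (simp add: l2_def)

lemma l2_dominated:
 assumes f: "bbs f" and g: "bbs g" and c: "c >= 0" and le: "\<And>x. cmod (f x) <= c * cmod (g x)"
 shows "l2 f <= c * l2 g"
proof (rule power2_le_imp_le)
 have "(l2 f)\<^sup>2 <= (LINT x|lborel. c\<^sup>2 * (cmod (g x))\<^sup>2)"
  unfolding l2_sq
 proof (intro integral_mono integrable_mult_right bbs_l2_integrable f g)
  show "(cmod (f x))\<^sup>2 <= c\<^sup>2 * (cmod (g x))\<^sup>2" for x
   using power_mono[OF le[of x], of 2] by (simp add: power_mult_distrib)
 qed
 then show "(l2 f)\<^sup>2 <= (c * l2 g)\<^sup>2" by (simp add: power_mult_distrib l2_sq)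
qed (simp add: c l2_nonneg)

lemma bbs_continuous_mult:
 fixes f :: "'a::euclidean_space => complex"
 assumes f: "continuous_on UNIV f" and g: "bbs g" shows "bbs (%x. f x * g x)"
proof -
 obtain C R where gC: "g \<in> borel_measurable borel" "\<And>x. cmod (g x) <= C" "\<And>x. norm x > R ==> g x = 0"
  using g unfolding bbs_def by blast
 have "compact (f ` cball 0 R)" by (intro compact_continuous_image continuous_on_subset[OF f]) auto
 then obtain D where D: "\<And>x. norm x <= R ==> cmod (f x) <= D"
  unfolding compact_eq_bounded_closed bounded_iff by (metis imageI mem_cball_0)
 have b: "cmod (f x * g x) <= \<bar>D\<bar> * \<bar>C\<bar>" for x
 proof (cases "norm x <= R")
  case True
  have "cmod (f x) * cmod (g x) <= \<bar>D\<bar> * \<bar>C\<bar>"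
   using D[OF True] gC(2)[of x] by (intro mult_mono) auto
  then show ?thesis by (simp add: norm_mult)
 qed (simp add: gC(3))
 have m: "(%x. f x * g x) \<in> borel_measurable borel"
  using borel_measurable_continuous_onI[OF f] gC(1) by (intro borel_measurable_times)
 show ?thesis unfolding bbs_def using m b gC(3) by (metis mult_zero_right)
qed

lemma continuous_bracket: "continuous_on UNIV (%x. complex_of_real (bracket m x))"
proof -
 have "1 + (norm x)\<^sup>2 \<noteq> 0" for x :: 'a by (smt (verit) zero_le_power2)
 then show ?thesis unfolding bracket_def by (intro continuous_intros) auto
qed

lemma bbs_bracket: "bbs u ==> bbs (%x. of_real (bracket m x) * u x)"
 by (rule bbs_continuous_mult[OF continuous_bracket])

definition ring :: "nat => 'a::euclidean_space set" where
 "ring k = {x. 4 ^ k <= 1 + x \<bullet> x \<and> 1 + x \<bullet> x < 4 ^ Suc k}"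

lemma ring_borel: "(ring k :: 'a::euclidean_space set) \<in> sets borel"
proof -
 have e: "(ring k :: 'a set) = {x::'a. 4 ^ k <= 1 + x \<bullet> x} \<inter> {x. 1 + x \<bullet> x < 4 ^ Suc k}" by (auto simp: ring_def)
 have c: "closed {x::'a. 4 ^ k <= 1 + x \<bullet> x}" by (intro closed_Collect_le continuous_intros)
 have o: "open {x::'a. 1 + x \<bullet> x < 4 ^ Suc k}" by (intro open_Collect_less continuous_intros)
 show ?thesis unfolding e by (intro sets.Int borel_closed borel_open c o)
qed

lemma ring_sum: "(\<Sum>k<J. indicator (ring k) x) = (if 1 + x \<bullet> x < 4 ^ J then 1 else (0::real))"
proof (induction J)
 case (Suc J)
 have "(4::real) ^ J <= 4 ^ Suc J" by simp
 then have "1 + x \<bullet> x < 4 ^ J ==> 1 + x \<bullet> x < 4 ^ Suc J" by linarith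
 then show ?case unfolding sum.lessThan_Suc Suc by (auto simp: ring_def indicator_def)
qed (simp add: not_less)

text \<open>Only finitely many rings meet the support, so no convergence question arises.\<close>

lemma ring_decompose:
 assumes "bbs u" obtains J where "\<And>K x. J <= K ==> u x = (\<Sum>k<K. u x * indicator (ring k) x)"
proof -
 obtain R where R: "\<And>x. norm x > R ==> u x = 0" using assms unfolding bbs_def by blast
 obtain J where J: "1 + R\<^sup>2 < 4 ^ J" using real_arch_pow[of 4 "1 + R\<^sup>2"] by auto
 have "u x = (\<Sum>k<K. u x * indicator (ring k) x)" if K: "J <= K" for K x
 proof (cases "norm x > R")
  case False
  have "x \<bullet> x <= R\<^sup>2" using power_mono[of "norm x" R 2] False by (simp add: power2_norm_eq_inner)
  moreover have "(4::real) ^ J <= 4 ^ K" using K by simp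
  ultimately have "1 + x \<bullet> x < 4 ^ K" using J by linarith
  then have 1: "(\<Sum>k<K. indicator (ring k) x) = (1::real)" by (simp add: ring_sum)
  have "(\<Sum>k<K. u x * indicator (ring k) x) = (\<Sum>k<K. u x * of_real (indicator (ring k) x))"
   by (intro sum.cong refl) (simp add: indicator_def)
  also have "\<dots> = u x * of_real (\<Sum>k<K. indicator (ring k) x)" by (simp only: sum_distrib_left of_real_sum)
  finally show ?thesis by (simp add: 1)
 qed (simp add: R)
 then show thesis by (rule that)
qed

lemma ring_l2_sum:
 assumes g: "bbs g" shows "(\<Sum>k<J. (l2 (%x. g x * indicator (ring k) x))\<^sup>2) <= (l2 g)\<^sup>2"
proof -
 have b: "bbs (%x. g x * indicator (ring k) x)" for k by (rule bbs_indicator[OF g ring_borel])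
 have "(\<Sum>k<J. (l2 (%x. g x * indicator (ring k) x))\<^sup>2) = (LINT x|lborel. (\<Sum>k<J. (cmod (g x * indicator (ring k) x))\<^sup>2))"
  unfolding l2_sq by (rule Bochner_Integration.integral_sum[symmetric]) (rule bbs_l2_integrable[OF b])
 also have "\<dots> <= (LINT x|lborel. (cmod (g x))\<^sup>2)"
 proof (intro integral_mono Bochner_Integration.integrable_sum bbs_l2_integrable b g)
  fix x
  have "(\<Sum>k<J. (cmod (g x * indicator (ring k) x))\<^sup>2) = (\<Sum>k<J. (cmod (g x))\<^sup>2 * indicator (ring k) x)"
   by (intro sum.cong refl) (simp add: norm_mult indicator_def)
  also have "\<dots> = (cmod (g x))\<^sup>2 * (\<Sum>k<J. indicator (ring k) x)" by (simp only: sum_distrib_left)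
  finally show "(\<Sum>k<J. (cmod (g x * indicator (ring k) x))\<^sup>2) <= (cmod (g x))\<^sup>2" by (simp add: ring_sum)
 qed
 finally show ?thesis by (simp only: l2_sq)
qed

lemma ring_bracket:
 assumes "x \<in> ring k" shows "1 <= 2 powr \<bar>m\<bar> * (2 ^ k) powr (- m) * bracket m x"
proof -
 let ?t = "1 + x \<bullet> x"
 have t: "4 ^ k <= ?t" "?t < 4 ^ Suc k" using assms by (auto simp: ring_def)
 have p2: "(4::real) ^ j = (2 ^ j) powr 2" for j
 proof -
  have "(4::real) ^ j = (2\<^sup>2) ^ j" by simp
  also have "\<dots> = (2 ^ j)\<^sup>2" by (simp only: power_mult[symmetric] mult.commute)
  finally show ?thesis by (simp add: powr_numeral)
 qed
 have e: "(((2::real) ^ j) powr 2) powr (m / 2) = (2 ^ j) powr m" for j unfolding powr_powr by simp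
 have br: "bracket m x = ?t powr (m / 2)" by (simp add: bracket_def power2_norm_eq_inner)
 have "(2 ^ k) powr m <= 2 powr \<bar>m\<bar> * bracket m x"
 proof (cases "m >= 0")
  case True
  have "(2 ^ k) powr m <= bracket m x" unfolding br e[symmetric] p2[symmetric] using t(1) True by (intro powr_mono2) auto
  moreover have "1 * bracket m x <= 2 powr \<bar>m\<bar> * bracket m x"
   by (intro mult_right_mono ge_one_powr_ge_zero) (auto simp: bracket_def)
  ultimately show ?thesis by linarith
 next
  case False
  have t0: "0 < ?t" by (smt (verit) inner_ge_zero)
  have "(2 ^ Suc k) powr m <= bracket m x" unfolding br e[symmetric] p2[symmetric] using t(2) False t0 by (intro powr_mono2') auto
  then have "2 powr (- m) * (2 ^ Suc k) powr m <= 2 powr (- m) * bracket m x" by (intro mult_left_mono) auto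
  moreover have "(2 ^ Suc k) powr m = 2 powr m * (2 ^ k) powr m" unfolding power_Suc by (rule powr_mult)
  moreover have "2 powr (- m) * (2 powr m * (2 ^ k) powr m) = (2 ^ k) powr m"
   by (simp only: mult.assoc[symmetric] powr_add[symmetric]) simp
  ultimately have "(2 ^ k) powr m <= 2 powr (- m) * bracket m x" by (simp only:)
  then show ?thesis using False by simp
 qed
 then have "(2 ^ k) powr (- m) * (2 ^ k) powr m <= (2 ^ k) powr (- m) * (2 powr \<bar>m\<bar> * bracket m x)" by (intro mult_left_mono) auto
 then show ?thesis by (simp only: powr_add[symmetric]) (simp add: mult_ac)
qed

lemma ring_l2:
 fixes u :: "'a::euclidean_space => complex"
 assumes u: "bbs u"
 shows "l2 (%x. u x * indicator (ring k) x) <= 2 powr \<bar>m\<bar> * (2 ^ k) powr (- m) * l2 (%x. of_real (bracket m x) * u x * indicator (ring k) x)"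
proof (rule l2_dominated)
 show "bbs (%x. u x * indicator (ring k) x)" "bbs (%x. of_real (bracket m x) * u x * indicator (ring k) x)"
  by (intro bbs_indicator bbs_bracket u ring_borel)+
 fix x :: 'a
 show "cmod (u x * indicator (ring k) x) <= 2 powr \<bar>m\<bar> * (2 ^ k) powr (- m) * cmod (of_real (bracket m x) * u x * indicator (ring k) x)"
 proof (cases "x \<in> ring k")
  case True
  have b: "\<bar>bracket m x\<bar> = bracket m x" by (simp add: bracket_def)
  have "1 * cmod (u x) <= 2 powr \<bar>m\<bar> * (2 ^ k) powr (- m) * bracket m x * cmod (u x)"
   by (intro mult_right_mono ring_bracket True) simp
  then show ?thesis using True by (simp add: norm_mult b mult.assoc)
 qed simp
qed simp

definition proximity :: "nat => nat => real" where "proximity j k = min (2 ^ j) (2 ^ k) / max (2 ^ j) (2 ^ k)"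

lemma proximity_nonneg: "proximity j k >= 0" unfolding proximity_def by (intro divide_nonneg_nonneg) (auto simp: le_max_iff_disj)
lemma proximity_commute: "proximity j k = proximity k j" by (simp add: proximity_def min.commute max.commute)

lemma proximity_sum: "(\<Sum>j<J. proximity j k) <= 3"
proof -
 have "(\<Sum>j<J. proximity j k) <= (if J <= k then 2 ^ J / 2 ^ k else 3 - 2 * 2 ^ k / 2 ^ J)"
 proof (induction J)
  case (Suc J)
  consider "J < k" | "J = k" | "J > k" by linarith
  then show ?case
  proof cases
   case 1
   then have "(2::real) ^ J < 2 ^ k" by simp
   then have "proximity J k = 2 ^ J / 2 ^ k" by (simp add: proximity_def min_def max_def)
   then show ?thesis using 1 Suc by (simp add: field_simps)
  next
   case 2
   then show ?thesis using Suc by (simp add: proximity_def)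
  next
   case 3
   then have "(2::real) ^ k < 2 ^ J" by simp
   then have "proximity J k = 2 ^ k / 2 ^ J" by (simp add: proximity_def min_def max_def)
   then show ?thesis using 3 Suc by (simp add: field_simps)
  qed
 qed simp
 also have "\<dots> <= 3"
 proof (cases "J <= k")
  case True
  then have "(2::real) ^ J <= 2 ^ k" by simp
  then have "(2::real) ^ J / 2 ^ k <= 1" by (simp only: divide_le_eq_1_pos zero_less_power zero_less_numeral)
  then show ?thesis using True by (simp only: if_True)
 qed simp
 finally show ?thesis .
qed

text \<open>One power of the ratio is kept for summation; the others absorb the quotient of the weights,
whatever its exponent.\<close>

lemma proximity_power:
 assumes N: "\<bar>m\<bar> <= real N"
 shows "proximity j k ^ Suc N * ((2 ^ k) powr (- m) * (2 ^ j) powr m) <= proximity j k"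
proof -
 have aux: "(q / r) ^ Suc N * (q powr (- l) * r powr l) <= q / r" if q: "0 < q" "q <= r" and l: "\<bar>l\<bar> <= real N" for q r l :: real
 proof -
  have "q powr (- l) * r powr l = (r / q) powr l" using q by (simp add: powr_divide powr_minus_divide)
  also have "\<dots> <= (r / q) powr real N" using q l by (intro powr_mono) auto
  also have "\<dots> = (r / q) ^ N" using q by (intro powr_realpow) simp
  finally have "(q / r) ^ Suc N * (q powr (- l) * r powr l) <= (q / r) ^ Suc N * (r / q) ^ N" using q by (intro mult_left_mono) auto
  also have "\<dots> = (q / r) * ((q / r) * (r / q)) ^ N" by (simp only: power_mult_distrib power_Suc mult.assoc)
  also have "\<dots> = q / r" using q by simp
  finally show ?thesis .
 qed
 show ?thesis
 proof (cases "k <= j")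
  case True
  then have le: "(2::real) ^ k <= 2 ^ j" by simp
  then have "proximity j k = 2 ^ k / 2 ^ j" by (simp add: proximity_def min_def max_def)
  then show ?thesis using aux[of "2 ^ k" "2 ^ j" m] le N by simp
 next
  case False
  then have le: "(2::real) ^ j < 2 ^ k" by simp
  then have "proximity j k = 2 ^ j / 2 ^ k" by (simp add: proximity_def min_def max_def)
  then show ?thesis using aux[of "2 ^ j" "2 ^ k" "- m"] le N by (simp add: mult.commute)
 qed
qed

text \<open>The rows and columns of the proximity matrix are summable, so it acts on square-summable
sequences.\<close>

lemma proximity_bilinear:
 assumes a: "\<And>k. a k >= 0" "(\<Sum>k<J. (a k)\<^sup>2) <= X\<^sup>2" and b: "\<And>k. b k >= 0" "(\<Sum>k<J. (b k)\<^sup>2) <= Y\<^sup>2" and XY: "X >= 0" "Y >= 0"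
 shows "(\<Sum>j<J. \<Sum>k<J. proximity j k * (a k * b j)) <= 3 * X * Y"
proof (rule power2_le_imp_le)
 let ?P = "{..<J} \<times> {..<J}"
 have "(\<Sum>j<J. \<Sum>k<J. proximity j k * (a k * b j)) = (\<Sum>p\<in>?P. (sqrt (proximity (fst p) (snd p)) * a (snd p)) * (sqrt (proximity (fst p) (snd p)) * b (fst p)))"
  unfolding sum.cartesian_product by (intro sum.cong refl) (auto simp: proximity_nonneg algebra_simps)
 then have "(\<Sum>j<J. \<Sum>k<J. proximity j k * (a k * b j))\<^sup>2 <=
   (\<Sum>p\<in>?P. (sqrt (proximity (fst p) (snd p)) * a (snd p))\<^sup>2) * (\<Sum>p\<in>?P. (sqrt (proximity (fst p) (snd p)) * b (fst p))\<^sup>2)"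
  by (simp only: Cauchy_Schwarz_ineq_sum)
 also have "\<dots> <= (3 * X\<^sup>2) * (3 * Y\<^sup>2)"
 proof (intro mult_mono sum_nonneg)
  have "(\<Sum>p\<in>?P. (sqrt (proximity (fst p) (snd p)) * a (snd p))\<^sup>2) = (\<Sum>j<J. \<Sum>k<J. proximity j k * (a k)\<^sup>2)"
   unfolding sum.cartesian_product by (intro sum.cong refl) (auto simp: proximity_nonneg power_mult_distrib)
  also have "\<dots> = (\<Sum>k<J. (\<Sum>j<J. proximity j k) * (a k)\<^sup>2)" by (subst sum.swap) (simp only: sum_distrib_right)
  also have "\<dots> <= (\<Sum>k<J. 3 * (a k)\<^sup>2)" by (intro sum_mono mult_right_mono proximity_sum) auto
  also have "\<dots> = 3 * (\<Sum>k<J. (a k)\<^sup>2)" by (simp only: sum_distrib_left)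
  finally show "(\<Sum>p\<in>?P. (sqrt (proximity (fst p) (snd p)) * a (snd p))\<^sup>2) <= 3 * X\<^sup>2" using a(2) by linarith
  have "(\<Sum>p\<in>?P. (sqrt (proximity (fst p) (snd p)) * b (fst p))\<^sup>2) = (\<Sum>j<J. \<Sum>k<J. proximity j k * (b j)\<^sup>2)"
   unfolding sum.cartesian_product by (intro sum.cong refl) (auto simp: proximity_nonneg power_mult_distrib)
  also have "\<dots> = (\<Sum>j<J. (\<Sum>k<J. proximity k j) * (b j)\<^sup>2)" by (simp only: sum_distrib_right proximity_commute)
  also have "\<dots> <= (\<Sum>k<J. 3 * (b k)\<^sup>2)" by (intro sum_mono mult_right_mono proximity_sum) auto
  also have "\<dots> = 3 * (\<Sum>k<J. (b k)\<^sup>2)" by (simp only: sum_distrib_left)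
  finally show "(\<Sum>p\<in>?P. (sqrt (proximity (fst p) (snd p)) * b (fst p))\<^sup>2) <= 3 * Y\<^sup>2" using b(2) by linarith
 qed auto
 finally show "(\<Sum>j<J. \<Sum>k<J. proximity j k * (a k * b j))\<^sup>2 <= (3 * X * Y)\<^sup>2" by (simp add: power_mult_distrib algebra_simps)
qed (use XY in simp)

context fio_setup
begin

definition amp_eps :: "real => 'a \<times> 'a \<times> 'a => complex" where
 "amp_eps \<epsilon> z = A z * cut (\<epsilon> *\<^sub>R snd (snd z))"

lemma kern_block:
 fixes u v
 assumes \<epsilon>: "0 < \<epsilon>" "\<epsilon> <= 1"
 defines "p \<equiv> %j k. (j::nat, k::nat, \<epsilon>)"
 shows "kern (amp_eps \<epsilon>) 1 (%x. u x * indicator (ring k) x) (%x. v x * indicator (ring j) x)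
  = kern (shell_amp (p j k)) (shell_scale (p j k)) (%x. u x * indicator (ring k) x) (%x. v x * indicator (ring j) x)"
proof (rule ext)
 fix z :: "'a \<times> 'a \<times> 'a"
 obtain x y \<xi> where z: "z = (x, y, \<xi>)" by (metis surj_pair)
 have sq: "(1 / 2 ^ i)\<^sup>2 * (1 + w \<bullet> w) = (1 + w \<bullet> w) / 4 ^ i" for i and w :: 'a
 proof -
  have "(4::real) ^ i = (2\<^sup>2) ^ i" by simp
  also have "\<dots> = (2 ^ i)\<^sup>2" by (simp only: power_mult[symmetric] mult.commute)
  finally show ?thesis by (simp add: power_divide)
 qed
 have pl: "plateau ((1 / 2 ^ i)\<^sup>2 * (1 + w \<bullet> w)) = 1" if "w \<in> ring i" for w :: 'a and i
  unfolding sq using that by (intro plateau_eq_1) (auto simp: ring_def field_simps)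
 show "kern (amp_eps \<epsilon>) 1 (%x. u x * indicator (ring k) x) (%x. v x * indicator (ring j) x) z
  = kern (shell_amp (p j k)) (shell_scale (p j k)) (%x. u x * indicator (ring k) x) (%x. v x * indicator (ring j) x) z"
 proof (cases "x \<in> ring j \<and> y \<in> ring k")
  case True
  have X: "(1 / 2 ^ j)\<^sup>2 + (x /\<^sub>R 2 ^ j) \<bullet> (x /\<^sub>R 2 ^ j) = (1 / 2 ^ j)\<^sup>2 * (1 + x \<bullet> x)"
   by (simp add: power2_eq_square divide_simps distrib_left)
  show ?thesis
   unfolding kern_def z fst_conv snd_conv shell_amp_def amp_eps_def p_def shell_scale_def shell_scale'_def eps_def X
   using True by (simp add: pl del: inverse_eq_divide)
 qed (auto simp: kern_def z)
qed

lemma shell_amp_bbs_kern: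
 assumes p: "p \<in> shells" and u: "bbs u" and v: "bbs v"
 shows "bbs (kern (shell_amp p) \<rho> u v)"
proof -
 have sm: "smooth (shell_amp p)" by (rule symb_smooth[OF symb_shell_amp])
 obtain D where "\<And>z. norm (shell_amp p z) <= D" using smooth_compact_support_bounded[OF sm shell_amp_support[OF p]] by blast
 from bbs_kern[OF smooth_measurable[OF sm] this shell_amp_xi[OF p] u v] show ?thesis .
qed

text \<open>On each ring the weight is comparable to a power of the dyadic scale. The decay in the ratio of
the scales therefore makes the weighted estimate a matter of summing a nearly diagonal matrix, for
every exponent of the weight.\<close>

theorem weighted_bound:
 obtains K where "K > 0" "\<And>\<epsilon> u v. 0 < \<epsilon> ==> \<epsilon> <= 1 ==> bbs u ==> bbs v ==>
  cmod (LINT z|lborel. kern (amp_eps \<epsilon>) 1 u v z)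
   <= K * l2 (%x. of_real (bracket m x) * u x) * l2 (%x. of_real (bracket (- m) x) * v x)"
proof -
 obtain N where N: "\<bar>m\<bar> <= real N" using real_arch_simple by blast
 obtain K where K: "K > 0" "\<And>p u v. p \<in> shells ==> bbs u ==> bbs v ==>
  cmod (LINT z|lborel. kern (shell_amp p) (shell_scale p) u v z) <= K * (small_scale p / big_scale p) ^ Suc N * l2 u * l2 v"
  using shell_decay[where M="Suc N"] by blast
 define c where "c = K * (2 powr \<bar>m\<bar>)\<^sup>2"
 have c0: "c > 0" using K(1) by (simp add: c_def)
 show thesis
 proof (rule that[of "3 * c"])
  show "3 * c > 0" using c0 by simp
  fix \<epsilon> :: real and u v :: "'a => complex" assume \<epsilon>: "0 < \<epsilon>" "\<epsilon> <= 1" and u: "bbs u" and v: "bbs v"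
  define uu where "uu = (%k x. u x * indicator (ring k) x)"
  define vv where "vv = (%k x. v x * indicator (ring k) x)"
  define a where "a = (%k. l2 (%x. of_real (bracket m x) * u x * indicator (ring k) x))"
  define b where "b = (%k. l2 (%x. of_real (bracket (- m) x) * v x * indicator (ring k) x))"
  have bu: "bbs (uu k)" and bv: "bbs (vv k)" for k unfolding uu_def vv_def by (intro bbs_indicator u v ring_borel)+
  have ps: "(j, k, \<epsilon>) \<in> shells" for j k using \<epsilon> by (simp add: shells_def eps_def)
  obtain J1 where J1: "\<And>K x. J1 <= K ==> u x = (\<Sum>k<K. u x * indicator (ring k) x)" using ring_decompose[OF u] by blast
  obtain J2 where J2: "\<And>K x. J2 <= K ==> v x = (\<Sum>k<K. v x * indicator (ring k) x)" using ring_decompose[OF v] by blast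
  define J where "J = max J1 J2"
  have us: "u x = (\<Sum>k<J. uu k x)" and vs: "v x = (\<Sum>k<J. vv k x)" for x
   unfolding uu_def vv_def using J1[of J x] J2[of J x] by (simp_all add: J_def)
  have kb: "kern (amp_eps \<epsilon>) 1 (uu k) (vv j) = kern (shell_amp (j, k, \<epsilon>)) (shell_scale (j, k, \<epsilon>)) (uu k) (vv j)" for j k
   unfolding uu_def vv_def by (rule kern_block[OF \<epsilon>])
  have i: "integrable lborel (kern (amp_eps \<epsilon>) 1 (uu k) (vv j))" for j k
   unfolding kb by (rule bbs_integrable[OF shell_amp_bbs_kern[OF ps bu bv]])
  have sum: "kern (amp_eps \<epsilon>) 1 u v z = (\<Sum>j<J. \<Sum>k<J. kern (amp_eps \<epsilon>) 1 (uu k) (vv j) z)" for z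
  proof -
   have "kern (amp_eps \<epsilon>) 1 u v z = cis (fst z \<bullet> snd (snd z) + \<Phi> (snd z)) * amp_eps \<epsilon> (fst z /\<^sub>R 1, snd z) * ((\<Sum>k<J. uu k (fst (snd z))) * (\<Sum>j<J. vv j (fst z)))"
    unfolding kern_def us[of "fst (snd z)"] vs[of "fst z"] by (rule refl)
   also have "\<dots> = (\<Sum>j<J. \<Sum>k<J. kern (amp_eps \<epsilon>) 1 (uu k) (vv j) z)"
    unfolding kern_def sum_distrib_left sum_distrib_right by (rule refl)
   finally show ?thesis .
  qed
  have "cmod (LINT z|lborel. kern (amp_eps \<epsilon>) 1 u v z) = cmod (\<Sum>j<J. \<Sum>k<J. LINT z|lborel. kern (amp_eps \<epsilon>) 1 (uu k) (vv j) z)"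
   unfolding sum by (simp only: Bochner_Integration.integral_sum Bochner_Integration.integrable_sum i)
  also have "\<dots> <= (\<Sum>j<J. \<Sum>k<J. cmod (LINT z|lborel. kern (amp_eps \<epsilon>) 1 (uu k) (vv j) z))"
   by (intro order_trans[OF norm_sum] sum_mono norm_sum)
  also have "\<dots> <= (\<Sum>j<J. \<Sum>k<J. c * (proximity j k * (a k * b j)))"
  proof (intro sum_mono)
   fix j k
   have pr: "small_scale (j, k, \<epsilon>) / big_scale (j, k, \<epsilon>) = proximity j k"
    by (simp add: small_scale_def big_scale_def shell_scale_def shell_scale'_def proximity_def)
   have "cmod (LINT z|lborel. kern (amp_eps \<epsilon>) 1 (uu k) (vv j) z) <= K * proximity j k ^ Suc N * l2 (uu k) * l2 (vv j)"
    unfolding kb pr[symmetric] by (rule K(2)[OF ps bu bv])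
   also have "\<dots> = K * proximity j k ^ Suc N * (l2 (uu k) * l2 (vv j))" by (simp only: mult.assoc)
   also have "\<dots> <= K * proximity j k ^ Suc N * ((2 powr \<bar>m\<bar> * (2 ^ k) powr (- m) * a k) * (2 powr \<bar>m\<bar> * (2 ^ j) powr m * b j))"
    using ring_l2[OF u, of k m] ring_l2[OF v, of j "- m"] K(1)
    by (intro mult_left_mono mult_mono) (auto simp: uu_def vv_def a_def b_def l2_nonneg proximity_nonneg)
   also have "\<dots> = c * ((proximity j k ^ Suc N * ((2 ^ k) powr (- m) * (2 ^ j) powr m)) * (a k * b j))"
    unfolding c_def power2_eq_square by (simp only: ac_simps)
   also have "\<dots> <= c * (proximity j k * (a k * b j))"
    using c0 by (intro mult_left_mono mult_right_mono proximity_power N) (auto simp: a_def b_def l2_nonneg)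
   finally show "cmod (LINT z|lborel. kern (amp_eps \<epsilon>) 1 (uu k) (vv j) z) <= c * (proximity j k * (a k * b j))" .
  qed
  also have "\<dots> = c * (\<Sum>j<J. \<Sum>k<J. proximity j k * (a k * b j))" by (simp only: sum_distrib_left)
  also have "\<dots> <= c * (3 * l2 (%x. of_real (bracket m x) * u x) * l2 (%x. of_real (bracket (- m) x) * v x))"
   using c0 ring_l2_sum[OF bbs_bracket[OF u]] ring_l2_sum[OF bbs_bracket[OF v]]
   by (intro mult_left_mono proximity_bilinear) (auto simp: a_def b_def l2_nonneg)
  finally show "cmod (LINT z|lborel. kern (amp_eps \<epsilon>) 1 u v z)
   <= 3 * c * l2 (%x. of_real (bracket m x) * u x) * l2 (%x. of_real (bracket (- m) x) * v x)" by (simp only: ac_simps)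
 qed
qed

end

section \<open>Convergence of the oscillatory integral\<close>

context fio_setup
begin

lemma A_bounded: obtains C where "C > 0" "\<And>z. cmod (A z) <= C"
proof -
 obtain C where C: "\<And>x z. cmod (A (x, z)) <= C * bracket 0 x" using A_bound[of "[]" "[]"] by auto
 have p: "1 + (norm x)\<^sup>2 \<noteq> 0" for x :: 'a by (smt (verit) zero_le_power2)
 have "cmod (A z) <= \<bar>C\<bar> + 1" for z using C[of "fst z" "snd z"] p[of "fst z"] by (simp add: bracket_def)
 then show thesis by (intro that[of "\<bar>C\<bar> + 1"]) auto
qed

lemma symb_A_slice: "symb UNIV (%_::unit. %z. A (x, z))"
proof (rule symb_ddlI)
 show sm: "smooth (%z. A (x, z))" by (intro smooth_compose[OF A_smooth] smooth_intros)
 fix bs :: "('a \<times> 'a) list" assume bs: "set bs \<subseteq> Basis"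
 obtain C where "\<And>x z. cmod (ddl (map inc1 [] @ map inc2 bs) A (x, z)) <= C * bracket (- real (length ([]::'a list))) x"
  using A_bound[OF _ bs, of "[]"] by auto
 then have "norm (ddl bs (%z. A (x, z)) z) <= C * bracket 0 x" for z
  using ddl_slice2[OF A_smooth bs, of x z] by simp
 then show "\<exists>C. \<forall>p z. (p, z) \<in> UNIV --> norm (ddl bs (%z. A (x, z)) z) <= C" by blast
qed

definition inner_int :: "('a => complex) => 'a => 'a => complex" where
 "inner_int u x \<xi> = (LINT y|lborel. cis (\<Phi> (y, \<xi>)) * (A (x, y, \<xi>) * u y))"

text \<open>For fixed output variable the input integral is nonstationary in the input variable once the
frequency is large, because the gradient expands away from zero frequency on the compact support.\<close>

lemma inner_int_decay:
 assumes u: "smooth u" and R: "\<And>y. norm y > R ==> u y = 0"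
 obtains C where "C >= 0" "\<And>\<xi>. cmod (inner_int u x \<xi>) <= C * decay \<xi>"
proof -
 obtain \<kappa> where \<kappa>: "\<kappa> > 0" "\<And>y \<zeta> \<eta>. \<kappa> * (norm (\<zeta> - \<eta>))\<^sup>2 <= (\<Sum>b\<in>Basis. (dd (inc1 b) \<Phi> (y, \<zeta>) - dd (inc1 b) \<Phi> (y, \<eta>))\<^sup>2)"
  using fw.expanding by blast
 have cont: "continuous_on UNIV (dd (inc1 b) \<Phi>)" if "b \<in> Basis" for b
  by (intro smooth_continuous smooth_dd fw.smooth Basis_inc that)
 define g where "g = (%y. \<Sum>b\<in>Basis. (dd (inc1 b) \<Phi> (y, 0))\<^sup>2)"
 have p0: "continuous_on UNIV (%y::'a. (y, 0::'a))" by (intro continuous_intros)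
 have "continuous_on UNIV (%y. dd (inc1 b) \<Phi> (y, 0))" if "b \<in> Basis" for b
  by (rule continuous_on_compose2[OF cont[OF that] p0]) simp
 then have "continuous_on UNIV g" unfolding g_def by (intro continuous_on_sum continuous_on_power)
 then have "continuous_on (cball 0 R) g" by (rule continuous_on_subset) simp
 then have "compact (g ` cball 0 R)" by (rule compact_continuous_image) simp
 then have "bounded (g ` cball 0 R)" by (rule compact_imp_bounded)
 then obtain D where "\<forall>z\<in>g ` cball 0 R. norm z <= D" unfolding bounded_iff by blast
 then have D: "\<bar>g y\<bar> <= D" if "norm y <= R" for y using that by simp
 define R0 where "R0 = 1 + sqrt (4 * \<bar>D\<bar> / \<kappa>)"
 have R0: "R0 >= 1" using \<kappa>(1) by (simp add: R0_def)
 have R0D: "4 * D <= \<kappa> * s\<^sup>2" if "s >= R0" for s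
 proof -
  have "sqrt (4 * \<bar>D\<bar> / \<kappa>) <= s" using that by (simp add: R0_def)
  moreover have q: "0 <= 4 * \<bar>D\<bar> / \<kappa>" using \<kappa>(1) by simp
  ultimately have "(sqrt (4 * \<bar>D\<bar> / \<kappa>))\<^sup>2 <= s\<^sup>2" by (intro power_mono) auto
  then have "4 * \<bar>D\<bar> / \<kappa> <= s\<^sup>2" using q by (simp only: real_sqrt_pow2)
  then show ?thesis using \<kappa>(1) by (simp add: field_simps)
 qed
 define \<Omega> where "\<Omega> = {(\<xi>::'a, y::'a). R0 <= norm \<xi> \<and> norm y <= R}"
 have dt: "dd b (%y. \<Phi> (y, \<xi>)) y = dd (inc1 b) \<Phi> (y, \<xi>)" for b \<xi> y
  using dd_compose_affine[of "%y. (y, 0)" \<Phi> b "(0, \<xi>)"] fw.smooth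
  by (simp add: fun_eq_iff bounded_linear_Pair bounded_linear_zero bounded_linear_ident)
 have ns: "nonstationary Basis \<Omega> (%\<xi> y. \<Phi> (y, \<xi>)) (%\<xi>. 1 + norm \<xi>) (\<kappa> / 16)"
 proof
  show "smooth (%y. \<Phi> (y, \<xi>))" for \<xi> by (intro smooth_compose[OF fw.smooth] smooth_intros)
  show "1 <= 1 + norm \<xi>" for \<xi> :: 'a by simp
  show "symb \<Omega> (%\<xi> y. dd b (%y. \<Phi> (y, \<xi>)) y / (1 + norm \<xi>))" if b: "b \<in> Basis" for b
  proof -
   let ?f = "dd (inc1 b) \<Phi>"
   have sf: "smooth ?f" by (intro smooth_dd fw.smooth Basis_inc b)
   have "symb UNIV (%p y. (?f (fst p + y, fst (snd p)) - ?f (fst p + y, snd (snd p))) / (1 + norm (fst (snd p) - snd (snd p))))"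
   proof (rule symb_difference_quotient[OF sf])
    show "symb UNIV (%_::unit. dd (inc2 c) ?f)" if c: "c \<in> Basis" for c
     using fw.mixed[OF b c] clairaut[OF fw.smooth Basis_inc(1)[OF b] Basis_inc(2)[OF c]] by simp
   qed
   from symb_reparam[OF this, of "%\<xi>. (0, \<xi>, 0)"]
   have 1: "symb UNIV (%\<xi> y. (?f (y, \<xi>) - ?f (y, 0)) / (1 + norm \<xi>))" by simp
   have "symb (UNIV \<times> cball 0 R) (%\<xi>::'a. %y. (1 / (1 + norm \<xi>)) *\<^sub>R ?f (y, 0))"
    by (intro symb_smooth_compact smooth_compose[OF sf] smooth_intros) (auto simp: divide_le_eq_1 add_pos_nonneg)
   then have 2: "symb \<Omega> (%\<xi> y. (1 / (1 + norm \<xi>)) *\<^sub>R ?f (y, 0))" by (rule symb_mono) (auto simp: \<Omega>_def)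
   have "symb \<Omega> (%\<xi> y. (?f (y, \<xi>) - ?f (y, 0)) / (1 + norm \<xi>) + (1 / (1 + norm \<xi>)) *\<^sub>R ?f (y, 0))"
    by (rule symb_add[OF symb_mono[OF 1] 2]) simp
   moreover have "(?f (y, \<xi>) - ?f (y, 0)) / (1 + norm \<xi>) + (1 / (1 + norm \<xi>)) *\<^sub>R ?f (y, 0) = ?f (y, \<xi>) / (1 + norm \<xi>)" for y \<xi>
    by (simp add: diff_divide_distrib)
   ultimately show ?thesis by (simp only: dt)
  qed
  show "\<kappa> / 16 > 0" using \<kappa>(1) by simp
  show "\<kappa> / 16 * (1 + norm \<xi>)\<^sup>2 <= (\<Sum>b\<in>Basis. (dd b (%y. \<Phi> (y, \<xi>)) y)\<^sup>2)" if "(\<xi>, y) \<in> \<Omega>" for \<xi> y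
  proof -
   have h: "R0 <= norm \<xi>" "norm y <= R" using that by (auto simp: \<Omega>_def)
   have "\<kappa> * (norm \<xi>)\<^sup>2 <= (\<Sum>b\<in>Basis. (dd (inc1 b) \<Phi> (y, \<xi>) - dd (inc1 b) \<Phi> (y, 0))\<^sup>2)" using \<kappa>(2)[of \<xi> 0 y] by simp
   also have "\<dots> <= (\<Sum>b\<in>Basis. 2 * (dd (inc1 b) \<Phi> (y, \<xi>))\<^sup>2 + 2 * (dd (inc1 b) \<Phi> (y, 0))\<^sup>2)"
   proof (rule sum_mono)
    fix b :: 'a
    have "(p - q)\<^sup>2 <= 2 * p\<^sup>2 + 2 * q\<^sup>2" for p q :: real
     using zero_le_power2[of "p + q"] by (simp add: power2_sum power2_diff)
    then show "(dd (inc1 b) \<Phi> (y, \<xi>) - dd (inc1 b) \<Phi> (y, 0))\<^sup>2 <= 2 * (dd (inc1 b) \<Phi> (y, \<xi>))\<^sup>2 + 2 * (dd (inc1 b) \<Phi> (y, 0))\<^sup>2" .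
   qed
   also have "\<dots> = 2 * (\<Sum>b\<in>Basis. (dd (inc1 b) \<Phi> (y, \<xi>))\<^sup>2) + 2 * g y" by (simp only: sum.distrib sum_distrib_left g_def)
   finally have "\<kappa> * (norm \<xi>)\<^sup>2 <= 2 * (\<Sum>b\<in>Basis. (dd (inc1 b) \<Phi> (y, \<xi>))\<^sup>2) + 2 * D" using D[OF h(2)] by linarith
   then have a: "\<kappa> * (norm \<xi>)\<^sup>2 <= 4 * (\<Sum>b\<in>Basis. (dd (inc1 b) \<Phi> (y, \<xi>))\<^sup>2)" using R0D[OF h(1)] by linarith
   have "(1 + norm \<xi>)\<^sup>2 <= (2 * norm \<xi>)\<^sup>2" using h(1) R0 by (intro power_mono) auto
   then have "\<kappa> / 16 * (1 + norm \<xi>)\<^sup>2 <= \<kappa> / 16 * (4 * (norm \<xi>)\<^sup>2)" using \<kappa>(1) by (intro mult_left_mono) (auto simp: power_mult_distrib)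
   then show ?thesis using a unfolding dt by simp
  qed
 qed simp
 interpret ns: nonstationary Basis \<Omega> "%\<xi> y. \<Phi> (y, \<xi>)" "%\<xi>. 1 + norm \<xi>" "\<kappa> / 16" by (rule ns)
 have "bounded_linear (%y::'a. (y, 0::'a))" by (intro bounded_linear_Pair bounded_linear_zero bounded_linear_ident)
 from symb_compose_affine[OF symb_A_slice[of x] this, where f="%_. ()" and a="%\<xi>. (0, \<xi>)" and \<Omega>=\<Omega>]
 have "symb \<Omega> (%\<xi> y. A (x, y, \<xi>))" by simp
 then have f: "symb \<Omega> (%\<xi> y. A (x, y, \<xi>) * u y)"
  by (intro symb_mult symb_mono[OF symb_compact_support[OF u R]]) auto
 have cl: "closed {y. (\<xi>, y) \<in> \<Omega>}" for \<xi>
  by (cases "R0 <= norm \<xi>") (auto simp: \<Omega>_def intro!: closed_Collect_le continuous_intros)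
 obtain C1 where C1: "C1 >= 0" "\<And>\<xi>. \<xi> \<in> {\<xi>. R0 <= norm \<xi>} ==>
   norm (LINT y|lborel. cis (\<Phi> (y, \<xi>)) * (A (x, y, \<xi>) * u y)) <= C1 / (1 + norm \<xi>) ^ (DIM('a) + 1)"
  by (rule ns.nonstationary_decay[OF f cl, of "{\<xi>. R0 <= norm \<xi>}" R "DIM('a) + 1"])
   (auto simp: \<Omega>_def not_le R)
 obtain CA where CA: "CA > 0" "\<And>z. cmod (A z) <= CA" using A_bounded by blast
 have bu: "bbs u" by (rule bbs_const_smooth[OF u R])
 have iu: "integrable lborel (%y. CA * cmod (u y))" using bbs_integrable[OF bu] by (intro integrable_mult_right integrable_norm)
 define I where "I = (LINT y|lborel. CA * cmod (u y))"
 have I0: "I >= 0" unfolding I_def using CA(1) by (intro Bochner_Integration.integral_nonneg) auto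
 have "cmod (inner_int u x \<xi>) <= I" for \<xi>
  unfolding inner_int_def I_def
 proof (rule order_trans[OF integral_norm_bound])
  show "(LINT y|lborel. cmod (cis (\<Phi> (y, \<xi>)) * (A (x, y, \<xi>) * u y))) <= (LINT y|lborel. CA * cmod (u y))"
   by (rule integral_mono'[OF iu]) (auto simp: norm_mult intro!: mult_right_mono mult_nonneg_nonneg less_imp_le[OF CA(1)] CA(2))
 qed
 moreover have "I <= I * (1 + R0) ^ (DIM('a) + 1) * decay \<xi>" if "norm \<xi> < R0" for \<xi> :: 'a
 proof -
  have "(1 + norm \<xi>) ^ (DIM('a) + 1) <= (1 + R0) ^ (DIM('a) + 1)" using that by (intro power_mono) auto
  moreover have "0 < (1 + norm \<xi>) ^ (DIM('a) + 1)" by (intro zero_less_power add_pos_nonneg) auto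
  ultimately have "1 <= (1 + R0) ^ (DIM('a) + 1) * decay \<xi>"
   unfolding decay_def mult_1_right times_divide_eq_right by (simp only: le_divide_eq_1_pos)
  then have "I * 1 <= I * ((1 + R0) ^ (DIM('a) + 1) * decay \<xi>)" using I0 by (intro mult_left_mono)
  then show ?thesis by (simp only: mult_1_right mult.assoc)
 qed
 ultimately have small: "cmod (inner_int u x \<xi>) <= I * (1 + R0) ^ (DIM('a) + 1) * decay \<xi>" if "norm \<xi> < R0" for \<xi>
  using that order_trans by blast
 show thesis
 proof (rule that[of "max C1 (I * (1 + R0) ^ (DIM('a) + 1))"])
  show "max C1 (I * (1 + R0) ^ (DIM('a) + 1)) >= 0" using C1(1) by (simp add: le_max_iff_disj)
  fix \<xi> :: 'a
  show "cmod (inner_int u x \<xi>) <= max C1 (I * (1 + R0) ^ (DIM('a) + 1)) * decay \<xi>"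
  proof (cases "R0 <= norm \<xi>")
   case True
   then have "cmod (inner_int u x \<xi>) <= C1 * decay \<xi>" using C1(2)[of \<xi>] by (simp add: inner_int_def decay_def)
   also have "\<dots> <= max C1 (I * (1 + R0) ^ (DIM('a) + 1)) * decay \<xi>"
    by (intro mult_right_mono) (auto simp: less_imp_le decay_pos)
   finally show ?thesis .
  next
   case False
   then have "cmod (inner_int u x \<xi>) <= I * (1 + R0) ^ (DIM('a) + 1) * decay \<xi>" using small by simp
   also have "\<dots> <= max C1 (I * (1 + R0) ^ (DIM('a) + 1)) * decay \<xi>"
    by (intro mult_right_mono) (auto simp: less_imp_le decay_pos)
   finally show ?thesis .
  qed
 qed
qed

definition integrand :: "('a => complex) => 'a => 'a => 'a => complex" where
 "integrand u x y \<xi> = exp (\<i> * of_real (x \<bullet> \<xi> + \<Phi> (y, \<xi>))) * A (x, y, \<xi>) * u y"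

definition osc :: "('a => complex) => 'a => complex" where
 "osc u x = (LINT \<xi>|lborel. cis (x \<bullet> \<xi>) * inner_int u x \<xi>)"

lemma integrand_cis: "integrand u x y \<xi> = cis (x \<bullet> \<xi>) * (cis (\<Phi> (y, \<xi>)) * (A (x, y, \<xi>) * u y))"
proof -
 have "exp (\<i> * of_real (x \<bullet> \<xi> + \<Phi> (y, \<xi>))) = cis (x \<bullet> \<xi>) * cis (\<Phi> (y, \<xi>))"
  unfolding cis_mult by (simp add: cis_conv_exp)
 then show ?thesis unfolding integrand_def by (simp only: mult.assoc)
qed

lemma A_measurable [measurable (raw)]:
 "f \<in> borel_measurable M ==> g \<in> borel_measurable M ==> h \<in> borel_measurable M ==> (%z. A (f z, g z, h z)) \<in> borel_measurable M"
 by (rule measurable_compose[OF _ smooth_measurable[OF A_smooth]]) (intro borel_measurable_Pair)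

lemma Phi_measurable [measurable (raw)]:
 "f \<in> borel_measurable M ==> g \<in> borel_measurable M ==> (%z. \<Phi> (f z, g z)) \<in> borel_measurable M"
 by (rule measurable_compose[OF _ smooth_measurable[OF fw.smooth]]) (intro borel_measurable_Pair)

lemma inner_int_measurable:
 assumes [measurable]: "u \<in> borel_measurable borel" "f \<in> borel_measurable M" "g \<in> borel_measurable M"
 shows "(%z. inner_int u (f z) (g z)) \<in> borel_measurable M"
 unfolding inner_int_def by (intro lborel.borel_measurable_lebesgue_integral) measurable

lemma osc_measurable:
 assumes [measurable]: "u \<in> borel_measurable borel"
 shows "osc u \<in> borel_measurable borel"
proof -
 have [measurable]: "(%z. inner_int u (fst z) (snd z)) \<in> borel_measurable (borel \<Otimes>\<^sub>M lborel)"
  by (rule inner_int_measurable[OF assms]) measurable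
 have "(%(x, \<xi>). cis (x \<bullet> \<xi>) * inner_int u x \<xi>) \<in> borel_measurable (borel \<Otimes>\<^sub>M lborel)"
  unfolding case_prod_beta by measurable
 then show ?thesis unfolding osc_def[abs_def] by (rule lborel.borel_measurable_lebesgue_integral)
qed

lemma osc_integrand_measurable:
 assumes "u \<in> borel_measurable borel"
 shows "(%\<xi>. cis (x \<bullet> \<xi>) * inner_int u x \<xi>) \<in> borel_measurable borel"
 by (intro borel_measurable_times inner_int_measurable assms cis_measurable) measurable

lemma osc_integrable:
 assumes u: "smooth u" and R: "\<And>y. norm y > R ==> u y = 0"
 shows "integrable lborel (%\<xi>. cis (x \<bullet> \<xi>) * inner_int u x \<xi>)"
proof -
 obtain C where C: "C >= 0" "\<And>\<xi>. cmod (inner_int u x \<xi>) <= C * decay \<xi>" using inner_int_decay[OF u R] by blast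
 show ?thesis
 proof (rule Bochner_Integration.integrable_bound)
  show "integrable lborel (%\<xi>::'a. C * decay \<xi>)" by (intro integrable_mult_right integrable_decay)
  show "AE \<xi> in lborel. norm (cis (x \<bullet> \<xi>) * inner_int u x \<xi>) <= norm (C * decay \<xi>)"
   using C by (auto simp: norm_mult intro!: order_trans[OF C(2)])
 qed (simp add: osc_integrand_measurable smooth_measurable[OF u])
qed

text \<open>The decay of the inner integral turns the regularized double integral into an integral with an
integrable majorant, so the limit does not depend on the cutoff.\<close>

lemma osc_integral:
 assumes u: "test_function u"
 shows "has_osc_integral (integrand u x) (osc u x)"
 unfolding has_osc_integral_def
proof (intro allI impI conjI)
 obtain R where su: "smooth u" and R: "\<And>y. norm y > R ==> u y = 0" using u unfolding test_function_iff by blast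
 note mu [measurable] = smooth_measurable[OF su]
 fix \<rho> :: "'a => complex" assume "test_function \<rho> \<and> \<rho> 0 = 1"
 then obtain R' where s\<rho>: "smooth \<rho>" and R': "\<And>y. norm y > R' ==> \<rho> y = 0" and one: "\<rho> 0 = 1" unfolding test_function_iff by blast
 note m\<rho> [measurable] = smooth_measurable[OF s\<rho>]
 show int: "integrable lborel (%(y, \<xi>). \<rho> (\<epsilon> *\<^sub>R \<xi>) * integrand u x y \<xi>)" if \<epsilon>: "\<epsilon> > 0" for \<epsilon> :: real
 proof (rule integrable_compact_support[where R="\<bar>R\<bar> + \<bar>R'\<bar> / \<epsilon>"])
  show "continuous_on UNIV (%(y, \<xi>). \<rho> (\<epsilon> *\<^sub>R \<xi>) * integrand u x y \<xi>)"
   unfolding integrand_def case_prod_beta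
   by (intro continuous_intros continuous_on_compose2[OF smooth_continuous[OF s\<rho>]] continuous_on_compose2[OF smooth_continuous[OF su]]
     continuous_on_compose2[OF smooth_continuous[OF A_smooth]] continuous_on_compose2[OF smooth_continuous[OF fw.smooth]]) auto
  fix z :: "'a \<times> 'a" assume z: "norm z > \<bar>R\<bar> + \<bar>R'\<bar> / \<epsilon>"
  obtain y \<xi> where yz: "z = (y, \<xi>)" by fastforce
  have "norm z <= norm y + norm \<xi>" unfolding yz by (rule norm_Pair_le)
  then consider "norm y > R" | "norm \<xi> > \<bar>R'\<bar> / \<epsilon>" using z by linarith
  then show "(case z of (y, \<xi>) => \<rho> (\<epsilon> *\<^sub>R \<xi>) * integrand u x y \<xi>) = 0"
  proof cases
   case 2
   then have "\<bar>R'\<bar> < norm (\<epsilon> *\<^sub>R \<xi>)" using \<epsilon> by (simp add: field_simps)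
   then have "R' < norm (\<epsilon> *\<^sub>R \<xi>)" by linarith
   then show ?thesis by (simp add: yz R')
  qed (simp add: yz R integrand_def)
 qed
 have iter: "(LINT (y, \<xi>)|lborel. \<rho> (\<epsilon> *\<^sub>R \<xi>) * integrand u x y \<xi>) = (LINT \<xi>|lborel. \<rho> (\<epsilon> *\<^sub>R \<xi>) * (cis (x \<bullet> \<xi>) * inner_int u x \<xi>))" if "\<epsilon> > 0" for \<epsilon> :: real
 proof -
  have "integrable (lborel \<Otimes>\<^sub>M lborel) (%(y, \<xi>). \<rho> (\<epsilon> *\<^sub>R \<xi>) * integrand u x y \<xi>)" using int[OF that] by (simp add: lborel_prod)
  from lborel_pair.integral_snd[OF this]
  have "(LINT (y, \<xi>)|lborel. \<rho> (\<epsilon> *\<^sub>R \<xi>) * integrand u x y \<xi>) = (LINT \<xi>|lborel. LINT y|lborel. \<rho> (\<epsilon> *\<^sub>R \<xi>) * integrand u x y \<xi>)"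
   by (simp add: lborel_prod)
  then show ?thesis unfolding integrand_cis inner_int_def integral_mult_right_zero .
 qed
 obtain D where D: "\<And>y. norm (\<rho> y) <= D" using smooth_compact_support_bounded[OF s\<rho> R'] by blast
 have osc_m: "(%\<xi>. cis (x \<bullet> \<xi>) * inner_int u x \<xi>) \<in> borel_measurable borel" by (rule osc_integrand_measurable[OF mu])
 have osc_i: "integrable lborel (%\<xi>. cis (x \<bullet> \<xi>) * inner_int u x \<xi>)" by (rule osc_integrable[OF su R])
 show "((%\<epsilon>. LINT (y, \<xi>)|lborel. \<rho> (\<epsilon> *\<^sub>R \<xi>) * integrand u x y \<xi>) \<longlongrightarrow> osc u x) (at_right 0)"
  unfolding tendsto_at_iff_sequentially comp_def
 proof (intro allI impI)
  fix X :: "nat => real" assume X: "\<forall>i. X i \<in> {0<..} - {0}" "X \<longlonglongrightarrow> 0"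
  have e: "(LINT (y, \<xi>)|lborel. \<rho> (X i *\<^sub>R \<xi>) * integrand u x y \<xi>) = (LINT \<xi>|lborel. \<rho> (X i *\<^sub>R \<xi>) * (cis (x \<bullet> \<xi>) * inner_int u x \<xi>))" for i
   using X(1) by (intro iter) simp
  show "(%i. LINT (y, \<xi>)|lborel. \<rho> (X i *\<^sub>R \<xi>) * integrand u x y \<xi>) \<longlonglongrightarrow> osc u x"
   unfolding e osc_def
  proof (rule integral_dominated_convergence[where w="%\<xi>. D * norm (cis (x \<bullet> \<xi>) * inner_int u x \<xi>)"])
   show "integrable lborel (%\<xi>. D * norm (cis (x \<bullet> \<xi>) * inner_int u x \<xi>))" by (intro integrable_mult_right integrable_norm osc_i)
   have "(%i. \<rho> (X i *\<^sub>R \<xi>) * (cis (x \<bullet> \<xi>) * inner_int u x \<xi>)) \<longlonglongrightarrow> 1 * (cis (x \<bullet> \<xi>) * inner_int u x \<xi>)" for \<xi>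
   proof (intro tendsto_mult tendsto_const)
    have "(%i. X i *\<^sub>R \<xi>) \<longlonglongrightarrow> 0 *\<^sub>R \<xi>" by (intro tendsto_intros X)
    then have "(%i. \<rho> (X i *\<^sub>R \<xi>)) \<longlonglongrightarrow> \<rho> (0 *\<^sub>R \<xi>)"
     by (rule continuous_on_tendsto_compose[OF smooth_continuous[OF s\<rho>, of UNIV]]) auto
    then show "(%i. \<rho> (X i *\<^sub>R \<xi>)) \<longlonglongrightarrow> 1" by (simp add: one)
   qed
   then show "AE \<xi> in lborel. (%i. \<rho> (X i *\<^sub>R \<xi>) * (cis (x \<bullet> \<xi>) * inner_int u x \<xi>)) \<longlonglongrightarrow> cis (x \<bullet> \<xi>) * inner_int u x \<xi>" by simp
   show "AE \<xi> in lborel. norm (\<rho> (X i *\<^sub>R \<xi>) * (cis (x \<bullet> \<xi>) * inner_int u x \<xi>)) <= D * norm (cis (x \<bullet> \<xi>) * inner_int u x \<xi>)" for i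
    unfolding norm_mult[of "\<rho> _"] by (intro AE_I2 mult_right_mono D) simp
  qed (use osc_m in \<open>auto intro!: borel_measurable_times measurable_compose[OF _ m\<rho>]\<close>)
 qed
qed

end

lemma has_osc_integral_unique:
 fixes F :: "'a::euclidean_space => 'b::euclidean_space => complex"
 assumes "has_osc_integral F L" "has_osc_integral F L'" shows "L = L'"
proof -
 define \<rho> where "\<rho> = (%x::'b. complex_of_real (bump x / bump (0::'b)))"
 have "bump (0::'b) \<noteq> 0" by (simp add: bump_0)
 then have \<rho>: "test_function \<rho> \<and> \<rho> 0 = 1" using test_function_bump[where 'a='b] by (simp add: \<rho>_def)
 have "((%\<epsilon>. LINT (y, \<xi>)|lborel. \<rho> (\<epsilon> *\<^sub>R \<xi>) * F y \<xi>) \<longlongrightarrow> L) (at_right 0)"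
  "((%\<epsilon>. LINT (y, \<xi>)|lborel. \<rho> (\<epsilon> *\<^sub>R \<xi>) * F y \<xi>) \<longlongrightarrow> L') (at_right 0)"
  using assms \<rho> unfolding has_osc_integral_def by blast+
 then show ?thesis by (rule tendsto_unique[OF trivial_limit_at_right_real])
qed

section \<open>Weighted bound on test functions\<close>

lemma bracket_measurable [measurable]: "bracket m \<in> borel_measurable borel"
 unfolding bracket_def[abs_def] by measurable

lemma bracket_pos: "bracket m x > 0"
proof -
 have "1 + (norm x)\<^sup>2 \<noteq> 0" by (smt (verit) zero_le_power2)
 then show ?thesis by (simp add: bracket_def)
qed

lemma bracket_minus: "bracket (- m) x * bracket m x = 1"
proof -
 have "1 + (norm x)\<^sup>2 \<noteq> 0" by (smt (verit) zero_le_power2)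
 then show ?thesis by (simp add: bracket_def powr_add[symmetric])
qed

lemma test_function_bbs: "test_function u ==> bbs u"
 unfolding test_function_iff using bbs_const_smooth by blast

lemma cut_test: "test_function (cut :: 'a::euclidean_space => complex)" "cut (0::'a) = 1"
proof -
 show "test_function (cut :: 'a => complex)" unfolding cut_def[abs_def] by (rule test_function_bump)
 have "bump (0::'a) \<noteq> 0" by (simp add: bump_0)
 then show "cut (0::'a) = 1" by (simp add: cut_def)
qed

lemma bbs_cut: assumes "\<epsilon> > 0" shows "bbs (%\<xi>. cut (\<epsilon> *\<^sub>R \<xi>))"
proof (rule bbs_const_smooth[of _ "1 / \<epsilon>"])
 have "smooth (cut :: 'a => complex)" using cut_test(1) unfolding test_function_def by blast
 then show "smooth (%\<xi>::'a. cut (\<epsilon> *\<^sub>R \<xi>))" by (rule smooth_compose) (intro smooth_intros)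
 show "cut (\<epsilon> *\<^sub>R \<xi>) = 0" if "norm \<xi> > 1 / \<epsilon>" for \<xi> :: 'a
  using that assms by (simp add: cut_def bump_0 field_simps)
qed

context fio_setup
begin

definition reg :: "real => ('a => complex) => 'a => complex" where
 "reg \<epsilon> u x = (LINT (y, \<xi>)|lborel. cut (\<epsilon> *\<^sub>R \<xi>) * integrand u x y \<xi>)"

lemma reg_tendsto:
 assumes "test_function u" shows "((%\<epsilon>. reg \<epsilon> u x) \<longlongrightarrow> osc u x) (at_right 0)"
 using osc_integral[OF assms, of x] cut_test[where 'a='a] unfolding has_osc_integral_def reg_def by blast

lemma kern_amp_eps: "kern (amp_eps \<epsilon>) 1 u v (x, w) = v x * (cut (\<epsilon> *\<^sub>R snd w) * integrand u x (fst w) (snd w))"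
 unfolding kern_def amp_eps_def integrand_cis fst_conv snd_conv cis_mult[symmetric] by simp

lemma bbs_kern_amp_eps:
 assumes \<epsilon>: "\<epsilon> > 0" and u: "bbs u" and v: "bbs v" shows "bbs (kern (amp_eps \<epsilon>) 1 u v)"
proof -
 obtain CA where CA: "CA > 0" "\<And>z. cmod (A z) <= CA" using A_bounded by blast
 obtain D S where D: "\<And>\<xi>::'a. cmod (cut (\<epsilon> *\<^sub>R \<xi>)) <= D" and S: "\<And>\<xi>::'a. norm \<xi> > S ==> cut (\<epsilon> *\<^sub>R \<xi>) = 0"
  using bbs_cut[OF \<epsilon>, where 'a='a] unfolding bbs_def by blast
 have "(%z. cut (\<epsilon> *\<^sub>R snd (snd z))) \<in> borel_measurable (borel :: ('a \<times> 'a \<times> 'a) measure)"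
  by (rule measurable_compose[OF _ bbs_measurable[OF bbs_cut[OF \<epsilon>]]]) (intro borel_measurable_continuous_onI continuous_intros)
 then have m: "amp_eps \<epsilon> \<in> borel_measurable borel"
  unfolding amp_eps_def[abs_def] by (rule borel_measurable_times[OF smooth_measurable[OF A_smooth]])
 show ?thesis
 proof (rule bbs_kern[OF m _ _ u v])
  show "cmod (amp_eps \<epsilon> z) <= CA * D" for z
   unfolding amp_eps_def norm_mult using CA D[of "snd (snd z)"] by (intro mult_mono) auto
  show "amp_eps \<epsilon> z = 0" if "norm (snd (snd z)) > S" for z using S[OF that] by (simp add: amp_eps_def)
 qed
qed

lemma reg_pairing:
 assumes \<epsilon>: "\<epsilon> > 0" and u: "bbs u" and v: "bbs v"
 shows "(LINT z|lborel. kern (amp_eps \<epsilon>) 1 u v z) = (LINT x|lborel. v x * reg \<epsilon> u x)"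
 unfolding integral_bbs_pair[OF bbs_kern_amp_eps[OF assms]] kern_amp_eps reg_def case_prod_beta
 by (simp only: integral_mult_right_zero)

lemma reg_measurable:
 assumes [measurable]: "u \<in> borel_measurable borel" and \<epsilon>: "\<epsilon> > 0"
 shows "reg \<epsilon> u \<in> borel_measurable borel"
proof -
 have [measurable]: "(cut :: 'a => complex) \<in> borel_measurable borel" using bbs_measurable[OF test_function_bbs[OF cut_test(1)]] .
 have [measurable]: "(%z. fst z) \<in> borel_measurable (borel :: ('a \<times> 'a \<times> 'a) measure)"
  "(%z. fst (snd z)) \<in> borel_measurable (borel :: ('a \<times> 'a \<times> 'a) measure)"
  "(%z. snd (snd z)) \<in> borel_measurable (borel :: ('a \<times> 'a \<times> 'a) measure)"
  by (intro borel_measurable_continuous_onI continuous_intros)+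
 have m: "(%z. cut (\<epsilon> *\<^sub>R snd (snd z)) * integrand u (fst z) (fst (snd z)) (snd (snd z))) \<in> borel_measurable borel"
  unfolding integrand_cis by measurable
 have "sets (borel \<Otimes>\<^sub>M (lborel :: ('a \<times> 'a) measure)) = sets (borel :: ('a \<times> 'a \<times> 'a) measure)"
 proof -
  have "sets (borel \<Otimes>\<^sub>M (lborel :: ('a \<times> 'a) measure)) = sets ((borel :: 'a measure) \<Otimes>\<^sub>M (borel :: ('a \<times> 'a) measure))"
   by (intro sets_pair_measure_cong) simp_all
  then show ?thesis by (simp only: borel_prod)
 qed
 then have "(%z. cut (\<epsilon> *\<^sub>R snd (snd z)) * integrand u (fst z) (fst (snd z)) (snd (snd z))) \<in> borel_measurable (borel \<Otimes>\<^sub>M lborel)"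
  using m by (subst measurable_cong_sets[OF _ refl]) 
 then show ?thesis unfolding reg_def[abs_def] case_prod_beta
  by (intro lborel.borel_measurable_lebesgue_integral) (simp add: case_prod_beta)
qed

lemma reg_bounded:
 assumes u: "bbs u" and \<epsilon>: "\<epsilon> > 0" obtains D where "\<And>x. cmod (reg \<epsilon> u x) <= D"
proof -
 obtain CA where CA: "CA > 0" "\<And>z. cmod (A z) <= CA" using A_bounded by blast
 let ?g = "%(y::'a, \<xi>::'a). u y * cut (\<epsilon> *\<^sub>R \<xi>)"
 have i: "integrable lborel (%w. CA * cmod (?g w))"
  by (intro integrable_mult_right integrable_norm bbs_integrable bbs_pair u bbs_cut \<epsilon>)
 have "cmod (reg \<epsilon> u x) <= (LINT w|lborel. CA * cmod (?g w))" for x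
  unfolding reg_def
 proof (rule order_trans[OF integral_norm_bound], rule integral_mono'[OF i])
  fix w :: "'a \<times> 'a"
  have "cmod (u (fst w)) * cmod (cut (\<epsilon> *\<^sub>R snd w)) * cmod (A (x, fst w, snd w)) <= cmod (u (fst w)) * cmod (cut (\<epsilon> *\<^sub>R snd w)) * CA"
   by (intro mult_left_mono CA) simp
  then show "cmod (case w of (y, \<xi>) => cut (\<epsilon> *\<^sub>R \<xi>) * integrand u x y \<xi>) <= CA * cmod (?g w)"
   unfolding integrand_cis case_prod_beta by (simp add: norm_mult mult_ac)
  show "0 <= CA * cmod (?g w)" using CA(1) by simp
 qed
 then show thesis by (rule that)
qed

text \<open>The form is tested against the weighted conjugate of the regularized operator itself, truncated to
a ball; this bounds the weighted mass by its own square root.\<close>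

lemma reg_weighted_bound:
 obtains K where "K > 0" "\<And>\<epsilon> u R. 0 < \<epsilon> ==> \<epsilon> <= 1 ==> bbs u ==>
  (nn_sq (%x. of_real (bracket m x) * (reg \<epsilon> u x * indicator (cball 0 R) x)))
   <= ennreal ((K * l2 (%x. of_real (bracket m x) * u x))\<^sup>2)"
proof -
 obtain K where K: "K > 0" "\<And>\<epsilon> u v. 0 < \<epsilon> ==> \<epsilon> <= 1 ==> bbs u ==> bbs v ==>
  cmod (LINT z|lborel. kern (amp_eps \<epsilon>) 1 u v z)
   <= K * l2 (%x. of_real (bracket m x) * u x) * l2 (%x. of_real (bracket (- m) x) * v x)"
  using weighted_bound[of m] by blast
 show thesis
 proof (rule that[OF K(1)])
  fix \<epsilon> :: real and u :: "'a => complex" and R assume \<epsilon>: "0 < \<epsilon>" "\<epsilon> <= 1" and u: "bbs u"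
  let ?b = "%x. complex_of_real (bracket m x)"
  let ?U = "l2 (%x. ?b x * u x)"
  obtain D where D: "\<And>x. cmod (reg \<epsilon> u x) <= D" using reg_bounded[OF u \<epsilon>(1)] by blast
  define h where "h = (%x. reg \<epsilon> u x * indicator (cball 0 R) x)"
  have h: "bbs h" unfolding h_def
   by (rule bbs_bounded_indicator[OF reg_measurable[OF bbs_measurable[OF u] \<epsilon>(1)] D])
  define g where "g = (%x. ?b x * h x)"
  have g: "bbs g" unfolding g_def by (rule bbs_bracket[OF h])
  define v where "v = (%x. ?b x * (?b x * cnj (h x)))"
  have v: "bbs v" unfolding v_def by (intro bbs_bracket bbs_cnj h)
  have "v x * reg \<epsilon> u x = of_real ((cmod (g x))\<^sup>2)" for x
   unfolding complex_norm_square v_def g_def h_def by (cases "norm x <= R") (simp_all add: mult_ac)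
  then have 1: "(LINT z|lborel. kern (amp_eps \<epsilon>) 1 u v z) = of_real ((l2 g)\<^sup>2)"
   unfolding reg_pairing[OF \<epsilon>(1) u v] l2_sq by (simp only: integral_complex_of_real)
  have "cmod (of_real (bracket (- m) x) * v x) = cmod (g x)" for x
  proof -
   have "of_real (bracket (- m) x) * v x = of_real (bracket (- m) x * bracket m x) * (?b x * cnj (h x))" by (simp add: v_def)
   then show ?thesis by (simp add: bracket_minus g_def norm_mult)
  qed
  then have 2: "l2 (%x. of_real (bracket (- m) x) * v x) = l2 g" by (simp add: l2_def)
  have "(l2 g)\<^sup>2 <= K * ?U * l2 g" using K(2)[OF \<epsilon> u v] unfolding 1 2 by (simp add: norm_power l2_nonneg)
  then have "l2 g <= K * ?U"
   by (cases "l2 g = 0") (use l2_nonneg[of g] K(1) l2_nonneg[of "%x. ?b x * u x"] in \<open>auto simp: power2_eq_square\<close>)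
  then have "ennreal ((l2 g)\<^sup>2) <= ennreal ((K * ?U)\<^sup>2)" by (intro ennreal_leI power_mono l2_nonneg)
  then show "(nn_sq (%x. ?b x * (reg \<epsilon> u x * indicator (cball 0 R) x))) <= ennreal ((K * ?U)\<^sup>2)"
   using nn_l2[OF g] by (simp only: g_def h_def)
 qed
qed

text \<open>The regularization and the truncation are removed together by Fatou's lemma.\<close>

theorem osc_weighted_bound:
 obtains K where "K > 0" "\<And>u. test_function u ==>
  (nn_sq (%x. of_real (bracket m x) * osc u x)) <= ennreal ((K * l2 (%x. of_real (bracket m x) * u x))\<^sup>2)"
proof -
 obtain K where K: "K > 0" "\<And>\<epsilon> u R. 0 < \<epsilon> ==> \<epsilon> <= 1 ==> bbs u ==>
  (nn_sq (%x. of_real (bracket m x) * (reg \<epsilon> u x * indicator (cball 0 R) x)))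
   <= ennreal ((K * l2 (%x. of_real (bracket m x) * u x))\<^sup>2)"
  using reg_weighted_bound[of m] by blast
 show thesis
 proof (rule that[OF K(1)])
  fix u :: "'a => complex" assume u: "test_function u"
  have bu: "bbs u" by (rule test_function_bbs[OF u])
  define X where "X n = inverse (real (Suc n))" for n
  have X: "0 < X n" "X n <= 1" for n by (auto simp: X_def inverse_le_1_iff)
  have Xr: "filterlim X (at_right 0) sequentially"
   unfolding X_def[abs_def] by (rule tendsto_imp_filterlim_at_right[OF LIMSEQ_inverse_real_of_nat]) simp
  define F where "F n x = ennreal ((cmod (of_real (bracket m x) * (reg (X n) u x * indicator (cball 0 (real n)) x)))\<^sup>2)" for n x
  have Fm: "F n \<in> borel_measurable lborel" for n
  proof -
   have [measurable]: "reg (X n) u \<in> borel_measurable borel" by (rule reg_measurable[OF bbs_measurable[OF bu] X(1)])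
   have [measurable]: "(indicator (cball 0 (real n)) :: 'a => complex) \<in> borel_measurable borel" by (rule borel_measurable_indicator) simp
   show ?thesis unfolding F_def[abs_def] by measurable
  qed
  have Fl: "(%n. F n x) \<longlonglongrightarrow> ennreal ((cmod (of_real (bracket m x) * osc u x))\<^sup>2)" for x
  proof -
   have r: "(%n. reg (X n) u x) \<longlonglongrightarrow> osc u x" by (rule filterlim_compose[OF reg_tendsto[OF u] Xr])
   have "eventually (%n. norm x <= real n) sequentially" by (rule eventually_sequentiallyI[of "nat \<lceil>norm x\<rceil>"]) linarith
   then have "eventually (%n. (indicator (cball 0 (real n)) x :: complex) = 1) sequentially" by (rule eventually_mono) (simp add: indicator_def)
   then have "(%n. indicator (cball 0 (real n)) x :: complex) \<longlonglongrightarrow> 1" by (rule tendsto_eventually)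
   then have "(%n. (cmod (of_real (bracket m x) * (reg (X n) u x * indicator (cball 0 (real n)) x)))\<^sup>2) \<longlonglongrightarrow> (cmod (of_real (bracket m x) * (osc u x * 1)))\<^sup>2"
    by (intro tendsto_intros r)
   then show ?thesis unfolding F_def by (intro tendsto_ennrealI) simp
  qed
  have "(nn_sq (%x. of_real (bracket m x) * osc u x)) = (\<integral>\<^sup>+x. liminf (%n. F n x) \<partial>lborel)"
   by (intro nn_integral_cong) (simp add: lim_imp_Liminf[OF trivial_limit_sequentially Fl])
  also have "\<dots> <= liminf (%n. integral\<^sup>N lborel (F n))" by (rule nn_integral_liminf[OF Fm])
  also have "\<dots> <= ennreal ((K * l2 (%x. of_real (bracket m x) * u x))\<^sup>2)"
   unfolding F_def by (rule Liminf_le[OF trivial_limit_sequentially]) (simp add: K(2)[OF X bu])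
  finally show "(nn_sq (%x. of_real (bracket m x) * osc u x)) <= ennreal ((K * l2 (%x. of_real (bracket m x) * u x))\<^sup>2)" .
 qed
qed

lemma osc_linear:
 assumes u: "test_function u" and v: "test_function v"
 shows "osc (%y. c * u y + d * v y) x = c * osc u x + d * osc v x"
proof -
 obtain R where su: "smooth u" "\<And>y. norm y > R ==> u y = 0" using u unfolding test_function_iff by blast
 obtain R' where sv: "smooth v" "\<And>y. norm y > R' ==> v y = 0" using v unfolding test_function_iff by blast
 obtain CA where CA: "CA > 0" "\<And>z. cmod (A z) <= CA" using A_bounded by blast
 have i: "integrable lborel (%y. cis (\<Phi> (y, \<xi>)) * (A (x, y, \<xi>) * w y))" if w: "bbs w" for w \<xi>
 proof -
  have "(%y. cis (\<Phi> (y, \<xi>)) * A (x, y, \<xi>)) \<in> borel_measurable borel"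
   by (intro borel_measurable_times measurable_compose[OF _ cis_measurable] Phi_measurable A_measurable) simp_all
  from bbs_integrable[OF bbs_mult[OF w this, of CA]] show ?thesis by (simp add: norm_mult CA mult.assoc)
 qed
 have 1: "inner_int (%y. c * u y + d * v y) x \<xi> = c * inner_int u x \<xi> + d * inner_int v x \<xi>" for \<xi>
 proof -
  have "inner_int (%y. c * u y + d * v y) x \<xi> = (LINT y|lborel. c * (cis (\<Phi> (y, \<xi>)) * (A (x, y, \<xi>) * u y)) + d * (cis (\<Phi> (y, \<xi>)) * (A (x, y, \<xi>) * v y)))"
   unfolding inner_int_def by (intro Bochner_Integration.integral_cong refl) (simp add: algebra_simps)
  also have "\<dots> = c * inner_int u x \<xi> + d * inner_int v x \<xi>"
   unfolding inner_int_def integral_mult_right_zero[symmetric]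
   by (intro Bochner_Integration.integral_add integrable_mult_right i test_function_bbs u v)
  finally show ?thesis .
 qed
 have "osc (%y. c * u y + d * v y) x = (LINT \<xi>|lborel. c * (cis (x \<bullet> \<xi>) * inner_int u x \<xi>) + d * (cis (x \<bullet> \<xi>) * inner_int v x \<xi>))"
  unfolding osc_def 1 by (intro Bochner_Integration.integral_cong refl) (simp add: algebra_simps)
 also have "\<dots> = c * osc u x + d * osc v x"
  unfolding osc_def integral_mult_right_zero[symmetric]
  by (intro Bochner_Integration.integral_add integrable_mult_right osc_integrable[OF su] osc_integrable[OF sv])
 finally show ?thesis .
qed

end

section \<open>Density of test functions\<close>

definition wn :: "real => ('a::euclidean_space => complex) => ennreal" where
 "wn m f = (\<integral>\<^sup>+x. ennreal ((cmod (of_real (bracket m x) * f x))\<^sup>2) \<partial>lebesgue)"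

lemma bracket_lebesgue: "(%x. complex_of_real (bracket m x)) \<in> borel_measurable lebesgue"
 by (rule measurable_completion) measurable

lemma wn_integrand_measurable:
 assumes "f \<in> borel_measurable lebesgue"
 shows "(%x. ennreal ((cmod (of_real (bracket m x) * f x))\<^sup>2)) \<in> borel_measurable lebesgue"
 using borel_measurable_times[OF bracket_lebesgue assms] by measurable

lemma wn_add_le:
 assumes f: "f \<in> borel_measurable lebesgue" and g: "g \<in> borel_measurable lebesgue"
  and p: "wn m f <= ennreal p" "p >= 0" and q: "wn m g <= ennreal q" "q >= 0"
 shows "wn m (%x. f x + g x) <= ennreal (2 * p + 2 * q)"
proof -
 let ?b = "%x. complex_of_real (bracket m x)"
 have "wn m (%x. f x + g x) <= (\<integral>\<^sup>+x. 2 * ennreal ((cmod (?b x * f x))\<^sup>2) + 2 * ennreal ((cmod (?b x * g x))\<^sup>2) \<partial>lebesgue)"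
  unfolding wn_def
 proof (rule nn_integral_mono)
  fix x
  have "(cmod (?b x * (f x + g x)))\<^sup>2 <= (cmod (?b x * f x) + cmod (?b x * g x))\<^sup>2"
   unfolding distrib_left by (intro power_mono norm_triangle_ineq) simp
  also have "\<dots> <= 2 * (cmod (?b x * f x))\<^sup>2 + 2 * (cmod (?b x * g x))\<^sup>2"
   using zero_le_power2[of "cmod (?b x * f x) - cmod (?b x * g x)"] by (simp only: power2_sum power2_diff)
  finally have "ennreal ((cmod (?b x * (f x + g x)))\<^sup>2) <= ennreal (2 * (cmod (?b x * f x))\<^sup>2 + 2 * (cmod (?b x * g x))\<^sup>2)" by (rule ennreal_leI)
  also have "\<dots> = 2 * ennreal ((cmod (?b x * f x))\<^sup>2) + 2 * ennreal ((cmod (?b x * g x))\<^sup>2)" by (simp add: ennreal_plus ennreal_mult)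
  finally show "ennreal ((cmod (?b x * (f x + g x)))\<^sup>2) <= 2 * ennreal ((cmod (?b x * f x))\<^sup>2) + 2 * ennreal ((cmod (?b x * g x))\<^sup>2)" .
 qed
 also have "\<dots> = 2 * wn m f + 2 * wn m g"
  unfolding wn_def using wn_integrand_measurable[OF f, of m] wn_integrand_measurable[OF g, of m]
  by (simp add: nn_integral_add nn_integral_cmult)
 also have "\<dots> <= 2 * ennreal p + 2 * ennreal q" by (intro add_mono mult_left_mono p q) auto
 also have "\<dots> = ennreal (2 * p + 2 * q)" using p q by (simp add: ennreal_plus ennreal_mult)
 finally show ?thesis .
qed

lemma wn_scale:
 assumes f: "f \<in> borel_measurable lebesgue" shows "wn m (%x. c * f x) = ennreal ((cmod c)\<^sup>2) * wn m f"
proof -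
 have e: "ennreal ((cmod (of_real (bracket m x) * (c * f x)))\<^sup>2) = ennreal ((cmod c)\<^sup>2) * ennreal ((cmod (of_real (bracket m x) * f x))\<^sup>2)" for x
  by (simp add: norm_mult power_mult_distrib ennreal_mult[symmetric] mult_ac)
 show ?thesis unfolding wn_def e by (rule nn_integral_cmult[OF wn_integrand_measurable[OF f]])
qed

lemma wn_scale_le:
 assumes "f \<in> borel_measurable lebesgue" "wn m f <= ennreal p" "p >= 0"
 shows "wn m (%x. c * f x) <= ennreal ((cmod c)\<^sup>2 * p)"
 unfolding wn_scale[OF assms(1)] ennreal_mult[OF zero_le_power2 assms(3)] by (intro mult_left_mono assms) simp

lemma wn_minus: "wn m (%x. f x - g x) = wn m (%x. g x - f x)"
 unfolding wn_def norm_mult by (simp add: norm_minus_commute)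

lemma L2w_iff: "f \<in> L2w m \<longleftrightarrow> f \<in> borel_measurable lebesgue \<and> wn m f < \<infinity>"
proof -
 have "integrable lebesgue (%x. (cmod (of_real (bracket m x) * f x))\<^sup>2) \<longleftrightarrow> wn m f < \<infinity>" if "f \<in> borel_measurable lebesgue"
  unfolding integrable_iff_bounded wn_def using borel_measurable_times[OF bracket_lebesgue that, of m] by (simp add: borel_measurable_power borel_measurable_norm)
 then show ?thesis unfolding L2w_def by blast
qed

lemma L2w_norm_wn: "f \<in> L2w m ==> L2w_norm m f = sqrt (enn2real (wn m f))"
 unfolding L2w_norm_def wn_def
 by (subst integral_eq_nn_integral) (auto simp: L2w_def)

lemma test_function_measurable: "test_function u ==> u \<in> borel_measurable lebesgue"
 by (rule measurable_completion) (simp add: smooth_measurable test_function_def)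

lemma test_function_add: assumes "test_function u" "test_function v" shows "test_function (%x. u x + v x)"
proof -
 obtain R where R: "\<And>y. norm y > R ==> u y = 0" using assms(1) unfolding test_function_iff by blast
 obtain R' where R': "\<And>y. norm y > R' ==> v y = 0" using assms(2) unfolding test_function_iff by blast
 have "smooth (%x. u x + v x)" using assms unfolding test_function_def by (blast intro: smooth_add)
 then show ?thesis unfolding test_function_iff using R R' by (intro conjI exI[of _ "max R R'"]) auto
qed

lemma test_function_scale: assumes "test_function u" shows "test_function (%x. c * u x)"
proof -
 obtain R where R: "\<And>y. norm y > R ==> u y = 0" using assms unfolding test_function_iff by blast
 have "smooth (%x. c * u x)" using assms unfolding test_function_def by (intro smooth_linear[OF bounded_linear_mult_right]) simp
 then show ?thesis unfolding test_function_iff using R by (intro conjI exI[of _ R]) auto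
qed

definition approximable :: "real => ('a::euclidean_space => complex) => bool" where
 "approximable m f \<longleftrightarrow> f \<in> borel_measurable lebesgue \<and> (\<forall>e>0. \<exists>u. test_function u \<and> wn m (%x. f x - u x) <= ennreal e)"

lemma approximable_closed:
 assumes f: "f \<in> borel_measurable lebesgue" and a: "\<And>e. e > 0 ==> \<exists>g. approximable m g \<and> wn m (%x. f x - g x) <= ennreal e"
 shows "approximable m f"
 unfolding approximable_def
proof (intro conjI f allI impI)
 fix e :: real assume e: "e > 0"
 obtain g where g: "approximable m g" "wn m (%x. f x - g x) <= ennreal (e / 4)" using a[of "e / 4"] e by auto
 obtain u where u: "test_function u" "wn m (%x. g x - u x) <= ennreal (e / 4)" using g(1) e unfolding approximable_def by (meson divide_pos_pos zero_less_numeral)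
 have mg: "g \<in> borel_measurable lebesgue" using g(1) by (simp add: approximable_def)
 have "wn m (%x. (f x - g x) + (g x - u x)) <= ennreal (2 * (e / 4) + 2 * (e / 4))"
  using e by (intro wn_add_le g u borel_measurable_diff f mg test_function_measurable) auto
 then show "\<exists>u. test_function u \<and> wn m (%x. f x - u x) <= ennreal e" using u(1) by auto
qed

lemma approximable_add:
 assumes f: "approximable m f" and g: "approximable m g" shows "approximable m (%x. f x + g x)"
 unfolding approximable_def
proof (intro conjI allI impI)
 have m: "f \<in> borel_measurable lebesgue" "g \<in> borel_measurable lebesgue" using f g by (auto simp: approximable_def)
 then show "(%x. f x + g x) \<in> borel_measurable lebesgue" by measurable
 fix e :: real assume e: "e > 0"
 then have e4: "e / 4 > 0" by simp
 obtain u v where u: "test_function u" "wn m (%x. f x - u x) <= ennreal (e / 4)" and v: "test_function v" "wn m (%x. g x - v x) <= ennreal (e / 4)"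
  using f g e4 unfolding approximable_def by blast
 have "wn m (%x. (f x - u x) + (g x - v x)) <= ennreal (2 * (e / 4) + 2 * (e / 4))"
  using e by (intro wn_add_le u v borel_measurable_diff m test_function_measurable) auto
 moreover have "(f x - u x) + (g x - v x) = f x + g x - (u x + v x)" for x by simp
 ultimately show "\<exists>w. test_function w \<and> wn m (%x. f x + g x - w x) <= ennreal e"
  using test_function_add[OF u(1) v(1)] by auto
qed

lemma approximable_scale:
 assumes f: "approximable m f" shows "approximable m (%x. c * f x)"
 unfolding approximable_def
proof (intro conjI allI impI)
 have m: "f \<in> borel_measurable lebesgue" using f by (auto simp: approximable_def)
 then show "(%x. c * f x) \<in> borel_measurable lebesgue" by measurable
 fix e :: real assume e: "e > 0"
 let ?d = "e / (1 + (cmod c)\<^sup>2)"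
 have d: "?d > 0" using e by (simp add: add_pos_nonneg)
 obtain u where u: "test_function u" "wn m (%x. f x - u x) <= ennreal ?d" using f d unfolding approximable_def by blast
 have "wn m (%x. c * (f x - u x)) <= ennreal ((cmod c)\<^sup>2 * ?d)"
  by (intro wn_scale_le u borel_measurable_diff m test_function_measurable less_imp_le[OF d])
 also have "\<dots> <= ennreal ((1 + (cmod c)\<^sup>2) * ?d)" using d by (intro ennreal_leI mult_right_mono) auto
 also have "(1 + (cmod c)\<^sup>2) * ?d = e" by (simp add: add_nonneg_eq_0_iff)
 finally show "\<exists>w. test_function w \<and> wn m (%x. c * f x - w x) <= ennreal e"
  using test_function_scale[OF u(1), of c] by (auto simp: right_diff_distrib)
qed

lemma approximable_zero: "approximable m (%x. 0)"
proof -
 have "smooth (%x::'a. 0::complex)" by (rule smooth_const)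
 then have "test_function (%x::'a. 0::complex)" unfolding test_function_iff by simp
 then show ?thesis unfolding approximable_def by (auto intro!: exI[of _ "%x. 0"] simp: wn_def)
qed

lemma approximable_sum:
 "finite I ==> (\<And>i. i \<in> I ==> approximable m (f i)) ==> approximable m (%x. \<Sum>i\<in>I. f i x)"
 by (induction I rule: finite_induct) (auto intro: approximable_add approximable_zero)

lemma plateau_step_bounds: "0 <= plateau_step t" "plateau_step t <= 1"
proof -
 have "flat_exp 0 s >= 0" for s by (simp add: flat_exp_def)
 then show "0 <= plateau_step t" "plateau_step t <= 1" unfolding plateau_step_def
  by (auto simp: divide_le_eq_1 add_nonneg_nonneg) (smt (verit))+
qed

text \<open>Finitely many balls cover the compact set; the complementary product of their cutoffs is one minus
the wanted function.\<close>

lemma smooth_urysohn: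
 fixes K :: "'a::euclidean_space set"
 assumes K: "compact K" and U: "open U" "K \<subseteq> U"
 obtains \<psi> :: "'a => real" where "smooth \<psi>" "\<And>x. 0 <= \<psi> x" "\<And>x. \<psi> x <= 1" "\<And>x. x \<in> K ==> \<psi> x = 1" "\<And>x. x \<notin> U ==> \<psi> x = 0"
proof -
 have "\<exists>r>0. ball x (2 * r) \<subseteq> U" if "x \<in> K" for x
 proof -
  have "x \<in> U" using that U by blast
  then obtain e where "e > 0" "ball x e \<subseteq> U" using U(1) open_contains_ball by blast
  then show ?thesis by (intro exI[of _ "e / 2"]) auto
 qed
 then obtain r where r: "\<And>x. x \<in> K ==> r x > 0" "\<And>x. x \<in> K ==> ball x (2 * r x) \<subseteq> U" by metis
 have "K \<subseteq> (\<Union>x\<in>K. ball x (r x))" using r by auto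
 then obtain D where D: "D \<subseteq> K" "finite D" "K \<subseteq> (\<Union>x\<in>D. ball x (r x))"
  using compactE_image[OF K, of K "%x. ball x (r x)"] by auto
 have "\<exists>\<psi>::'a => real. smooth \<psi> \<and> (\<forall>x. 0 <= \<psi> x \<and> \<psi> x <= 1) \<and> (\<forall>x\<in>(\<Union>x\<in>D. ball x (r x)). \<psi> x = 1) \<and> (\<forall>x. x \<notin> U --> \<psi> x = 0)"
  using D(2,1)
 proof (induction D rule: finite_induct)
  case empty
  have "smooth (%x::'a. 0::real)" by (rule smooth_const)
  then show ?case by (intro exI[of _ "%x. 0"]) auto
 next
  case (insert z D)
  then obtain \<psi> :: "'a => real" where p: "smooth \<psi> \<and> (\<forall>x. 0 <= \<psi> x \<and> \<psi> x <= 1) \<and> (\<forall>x\<in>(\<Union>x\<in>D. ball x (r x)). \<psi> x = 1) \<and> (\<forall>x. x \<notin> U --> \<psi> x = 0)"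
   by blast
  then have \<psi>: "smooth \<psi>" "\<And>x. 0 <= \<psi> x" "\<And>x. \<psi> x <= 1" "\<And>x. x \<in> (\<Union>x\<in>D. ball x (r x)) ==> \<psi> x = 1" "\<And>x. x \<notin> U ==> \<psi> x = 0"
   by blast+
  have rz: "r z > 0" "ball z (2 * r z) \<subseteq> U" using insert.prems r by auto
  define b where "b x = plateau_step (2 - (1 / (r z)\<^sup>2) * ((x - z) \<bullet> (x - z)))" for x
  have sb: "smooth b" unfolding b_def[abs_def]
   by (rule smooth_compose[OF smooth_plateau_step, of "%x. 2 - (1 / (r z)\<^sup>2) * ((x - z) \<bullet> (x - z))"])
    (intro smooth_diff smooth_const smooth_mult smooth_inner smooth_id)
  have b01: "0 <= b x" "b x <= 1" for x by (simp_all add: b_def plateau_step_bounds)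
  have q: "(1 / (r z)\<^sup>2) * ((x - z) \<bullet> (x - z)) = (dist z x / r z)\<^sup>2" for x
   by (simp add: dist_norm norm_minus_commute power_divide power2_norm_eq_inner)
  have b1: "b x = 1" if "x \<in> ball z (r z)" for x
  proof -
   have "dist z x / r z <= 1" using that rz by simp
   then have "(dist z x / r z)\<^sup>2 <= 1" using rz by (intro power_le_one) auto
   then show ?thesis unfolding b_def q by (intro plateau_step) simp
  qed
  have b0: "b x = 0" if "x \<notin> U" for x
  proof -
   have "2 * r z <= dist z x" using that rz(2) by (auto simp: subset_iff not_less)
   then have "2 <= dist z x / r z" using rz by (simp add: field_simps)
   then have "2\<^sup>2 <= (dist z x / r z)\<^sup>2" by (intro power_mono) auto
   then show ?thesis unfolding b_def q by (intro plateau_step) simp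
  qed
  have f: "0 <= (1 - \<psi> x) * (1 - b x)" "(1 - \<psi> x) * (1 - b x) <= 1" for x
   using \<psi>(2,3)[of x] b01[of x] by (auto intro!: mult_le_one)
  have "smooth (%x. 1 - (1 - \<psi> x) * (1 - b x))" by (intro smooth_diff smooth_mult smooth_const \<psi>(1) sb)
  moreover have "1 - (1 - \<psi> x) * (1 - b x) = 1" if "x \<in> (\<Union>x\<in>insert z D. ball x (r x))" for x
   using that \<psi>(4)[of x] b1[of x] by auto
  moreover have "1 - (1 - \<psi> x) * (1 - b x) = 0" if "x \<notin> U" for x using \<psi>(5) b0 that by simp
  ultimately show ?case using f by (intro exI[of _ "%x. 1 - (1 - \<psi> x) * (1 - b x)"]) auto
 qed
 then show thesis using that D(3) by (metis subsetD)
qed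

text \<open>Inner and outer regularity of the measure squeeze the set between a compact and an open set whose
difference is small; the weight is bounded on the ball.\<close>

lemma approximable_indicator:
 fixes S :: "'a::euclidean_space set"
 assumes S: "S \<in> sets lebesgue" "S \<subseteq> cball 0 R" shows "approximable m (indicator S)"
 unfolding approximable_def
proof (intro conjI allI impI)
 show mS: "indicator S \<in> borel_measurable lebesgue" using S(1) by (rule borel_measurable_indicator)
 fix e :: real assume e: "e > 0"
 have "continuous_on (cball 0 (R + 1)) (%x::'a. complex_of_real (bracket m x))" by (rule continuous_on_subset[OF continuous_bracket]) simp
 then have "bounded ((%x::'a. complex_of_real (bracket m x)) ` cball 0 (R + 1))" by (intro compact_imp_bounded compact_continuous_image) auto
 then obtain B0 where B0: "\<forall>z\<in>(%x::'a. complex_of_real (bracket m x)) ` cball 0 (R + 1). norm z <= B0" unfolding bounded_iff by blast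
 define B where "B = \<bar>B0\<bar> + 1"
 have B: "B > 0" "\<And>x::'a. norm x <= R + 1 ==> cmod (of_real (bracket m x)) <= B" using B0 by (force simp: B_def)+
 define d where "d = e / (2 * B\<^sup>2)"
 have d: "d > 0" using e B by (simp add: d_def)
 obtain U where U: "open U" "S \<subseteq> U" "(U - S) \<in> lmeasurable" "emeasure lebesgue (U - S) < ennreal d" using sets_lebesgue_outer_open[OF S(1) d] by blast
 obtain K where K: "closed K" "K \<subseteq> S" "(S - K) \<in> lmeasurable" "emeasure lebesgue (S - K) < ennreal d" using sets_lebesgue_inner_closed[OF S(1) d] by blast
 have "bounded K" using K(2) S(2) bounded_subset[OF bounded_cball] by blast
 then have cK: "compact K" using K(1) by (simp add: compact_eq_bounded_closed)
 have KU: "K \<subseteq> U \<inter> ball 0 (R + 1)" using K(2) U(2) S(2) by force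
 obtain \<psi> :: "'a => real" where \<psi>: "smooth \<psi>" "\<And>x. 0 <= \<psi> x" "\<And>x. \<psi> x <= 1" "\<And>x. x \<in> K ==> \<psi> x = 1" "\<And>x. x \<notin> U \<inter> ball 0 (R + 1) ==> \<psi> x = 0"
  using smooth_urysohn[OF cK _ KU] U(1) by (metis open_Int open_ball)
 have t: "test_function (%x. complex_of_real (\<psi> x))" unfolding test_function_iff
  using \<psi>(5) by (intro conjI smooth_linear[OF bounded_linear_of_real] \<psi>(1) exI[of _ "R + 1"]) auto
 have "wn m (%x. indicator S x - of_real (\<psi> x)) <= (\<integral>\<^sup>+x. ennreal (B\<^sup>2) * indicator ((U - S) \<union> (S - K)) x \<partial>lebesgue)"
  unfolding wn_def
 proof (rule nn_integral_mono)
  fix x :: 'a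
  consider "x \<in> K" | "x \<notin> U \<inter> ball 0 (R + 1)" | "x \<in> U - K" "norm x < R + 1" by auto
  then show "ennreal ((cmod (of_real (bracket m x) * (indicator S x - of_real (\<psi> x))))\<^sup>2) <= ennreal (B\<^sup>2) * indicator ((U - S) \<union> (S - K)) x"
  proof cases
   case 1 then show ?thesis using \<psi>(4) K(2) by (auto simp: indicator_def)
  next
   case 2
   then have "x \<notin> S" using U(2) S(2) by force
   then show ?thesis using \<psi>(5)[OF 2] by simp
  next
   case 3
   have "indicator S x - of_real (\<psi> x) = complex_of_real (indicator S x - \<psi> x)" by (simp add: indicator_def)
   then have "cmod (indicator S x - of_real (\<psi> x)) = \<bar>indicator S x - \<psi> x\<bar>" by (simp only: norm_of_real)
   also have "\<dots> <= 1" using \<psi>(2,3)[of x] by (simp add: indicator_def)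
   finally have "cmod (of_real (bracket m x) * (indicator S x - of_real (\<psi> x))) <= B * 1"
    unfolding norm_mult using B 3 by (intro mult_mono) auto
   then have "(cmod (of_real (bracket m x) * (indicator S x - of_real (\<psi> x))))\<^sup>2 <= B\<^sup>2" by (intro power_mono) auto
   then show ?thesis using 3 by (auto simp: indicator_def intro: ennreal_leI)
  qed
 qed
 also have "\<dots> = ennreal (B\<^sup>2) * emeasure lebesgue ((U - S) \<union> (S - K))"
  using U(3) K(3) by (intro nn_integral_cmult_indicator sets.Un fmeasurableD)
 also have "\<dots> <= ennreal (B\<^sup>2) * (ennreal d + ennreal d)"
  using U(3,4) K(3,4) by (intro mult_left_mono order_trans[OF emeasure_subadditive] add_mono) (auto intro: fmeasurableD)
 also have "\<dots> = ennreal e"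
 proof -
  have "ennreal (B\<^sup>2) * (ennreal d + ennreal d) = ennreal (B\<^sup>2 * (d + d))" using d by (simp add: ennreal_plus[symmetric] ennreal_mult[symmetric] del: ennreal_plus)
  moreover have "B\<^sup>2 * (d + d) = e" using B by (simp add: d_def field_simps)
  ultimately show ?thesis by simp
 qed
 finally show "\<exists>u. test_function u \<and> wn m (%x. indicator S x - u x) <= ennreal e" using t by blast
qed

theorem L2w_approximable:
 assumes f: "f \<in> L2w m" shows "approximable m f"
proof (rule approximable_closed)
 show mf: "f \<in> borel_measurable lebesgue" using f by (simp add: L2w_iff)
 from borel_measurable_implies_sequence_metric[OF mf, of 0] obtain F where F: "\<And>i. simple_function lebesgue (F i)"
  "\<And>x. (%i. F i x) \<longlonglongrightarrow> f x" "\<And>i x. cmod (F i x) <= 2 * cmod (f x)" by auto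
 define G where "G i x = F i x * indicator (cball 0 (real i)) x" for i x
 have aG: "approximable m (G i)" for i
 proof -
  have sp: "space lebesgue = (UNIV :: 'a set)" by (simp only: space_completion space_lborel space_borel)
  have fin: "finite (range (F i))" using simple_functionD(1)[OF F(1), of i] by (simp only: sp)
  have "G i x = (\<Sum>y\<in>range (F i). y * indicator (F i -` {y} \<inter> cball 0 (real i)) x)" for x
  proof -
   have "F i x = (\<Sum>y\<in>range (F i). indicator (F i -` {y} \<inter> UNIV) x *\<^sub>R y)"
    using simple_function_indicator_representation_banach[OF F(1), of x i] by (simp only: sp UNIV_I)
   then have "G i x = (\<Sum>y\<in>range (F i). indicator (F i -` {y} \<inter> UNIV) x *\<^sub>R y) * indicator (cball 0 (real i)) x" by (simp only: G_def)
   also have "\<dots> = (\<Sum>y\<in>range (F i). y * indicator (F i -` {y} \<inter> cball 0 (real i)) x)"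
    unfolding sum_distrib_right by (intro sum.cong refl) (auto simp: indicator_def)
   finally show ?thesis .
  qed
  moreover have "approximable m (%x. \<Sum>y\<in>range (F i). y * indicator (F i -` {y} \<inter> cball 0 (real i)) x)"
  proof (intro approximable_sum fin approximable_scale approximable_indicator[where R="real i"])
   show "F i -` {y} \<inter> cball 0 (real i) \<in> sets lebesgue" for y
    using simple_functionD(2)[OF F(1), of i "{y}"] unfolding sp by (intro sets.Int) auto
  qed auto
  ultimately show ?thesis by presburger
 qed
 have mG: "G i \<in> borel_measurable lebesgue" for i using aG by (simp add: approximable_def)
 have "(%i. wn m (%x. f x - G i x)) \<longlonglongrightarrow> (\<integral>\<^sup>+x. 0 \<partial>(lebesgue :: 'a measure))"
  unfolding wn_def
 proof (rule nn_integral_dominated_convergence[where w="%x. 9 * ennreal ((cmod (of_real (bracket m x) * f x))\<^sup>2)"])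
  show "(%x. ennreal ((cmod (of_real (bracket m x) * (f x - G i x)))\<^sup>2)) \<in> borel_measurable lebesgue" for i
   by (intro wn_integrand_measurable borel_measurable_diff mf mG)
  show "(%x. 9 * ennreal ((cmod (of_real (bracket m x) * f x))\<^sup>2)) \<in> borel_measurable lebesgue"
   using wn_integrand_measurable[OF mf, of m] by measurable
  have "ennreal ((cmod (of_real (bracket m x) * (f x - G i x)))\<^sup>2) <= 9 * ennreal ((cmod (of_real (bracket m x) * f x))\<^sup>2)" for i x
  proof -
   have "cmod (G i x) <= 2 * cmod (f x)" using F(3)[of i x] by (simp add: G_def indicator_def)
   then have "cmod (f x - G i x) <= 3 * cmod (f x)" using norm_triangle_ineq4[of "f x" "G i x"] by linarith
   then have "cmod (of_real (bracket m x) * (f x - G i x)) <= 3 * cmod (of_real (bracket m x) * f x)"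
    unfolding norm_mult by (metis mult.left_commute mult_left_mono norm_ge_zero)
   then have "(cmod (of_real (bracket m x) * (f x - G i x)))\<^sup>2 <= (3 * cmod (of_real (bracket m x) * f x))\<^sup>2" by (intro power_mono) auto
   also have "\<dots> = 9 * (cmod (of_real (bracket m x) * f x))\<^sup>2" by (simp only: power_mult_distrib) simp
   finally have "ennreal ((cmod (of_real (bracket m x) * (f x - G i x)))\<^sup>2) <= ennreal (9 * (cmod (of_real (bracket m x) * f x))\<^sup>2)" by (rule ennreal_leI)
   then show ?thesis by (simp add: ennreal_mult)
  qed
  then show "AE x in lebesgue. ennreal ((cmod (of_real (bracket m x) * (f x - G i x)))\<^sup>2) <= 9 * ennreal ((cmod (of_real (bracket m x) * f x))\<^sup>2)" for i by simp
  have "(\<integral>\<^sup>+x. 9 * ennreal ((cmod (of_real (bracket m x) * f x))\<^sup>2) \<partial>lebesgue) = 9 * wn m f"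
   unfolding wn_def by (rule nn_integral_cmult[OF wn_integrand_measurable[OF mf]])
  then show "(\<integral>\<^sup>+x. 9 * ennreal ((cmod (of_real (bracket m x) * f x))\<^sup>2) \<partial>lebesgue) < \<infinity>"
   using f by (simp add: L2w_iff ennreal_mult_less_top)
  have "(%i. ennreal ((cmod (of_real (bracket m x) * (f x - G i x)))\<^sup>2)) \<longlonglongrightarrow> 0" for x
  proof -
   have "eventually (%n. norm x <= real n) sequentially" by (rule eventually_sequentiallyI[of "nat \<lceil>norm x\<rceil>"]) linarith
   then have "eventually (%n. (indicator (cball 0 (real n)) x :: complex) = 1) sequentially" by (rule eventually_mono) (simp add: indicator_def)
   then have "(%n. indicator (cball 0 (real n)) x :: complex) \<longlonglongrightarrow> 1" by (rule tendsto_eventually)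
   then have "(%i. (cmod (of_real (bracket m x) * (f x - G i x)))\<^sup>2) \<longlonglongrightarrow> (cmod (of_real (bracket m x) * (f x - f x * 1)))\<^sup>2"
    unfolding G_def by (intro tendsto_intros F(2))
   then have "(%i. ennreal ((cmod (of_real (bracket m x) * (f x - G i x)))\<^sup>2)) \<longlonglongrightarrow> ennreal ((cmod (of_real (bracket m x) * (f x - f x * 1)))\<^sup>2)" by (rule tendsto_ennrealI)
   then show ?thesis by simp
  qed
  then show "AE x in lebesgue. (%i. ennreal ((cmod (of_real (bracket m x) * (f x - G i x)))\<^sup>2)) \<longlonglongrightarrow> 0" by simp
 qed simp
 then have lim: "(%i. wn m (%x. f x - G i x)) \<longlonglongrightarrow> 0" by simp
 fix e :: real assume "e > 0"
 then have "0 < ennreal e" by simp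
 then have "eventually (%i. wn m (%x. f x - G i x) < ennreal e) sequentially" by (rule order_tendstoD(2)[OF lim])
 then obtain i where i: "wn m (%x. f x - G i x) < ennreal e" using eventually_happens'[OF sequentially_bot] by blast
 show "\<exists>g. approximable m g \<and> wn m (%x. f x - g x) <= ennreal e"
  by (intro exI[of _ "G i"] conjI aG less_imp_le i)
qed

section \<open>Extension by density\<close>

locale dense_operator =
 fixes T :: "('a::euclidean_space => complex) => 'a => complex" and m C :: real
 assumes C: "C >= 0"
  and meas: "\<And>u. test_function u ==> T u \<in> borel_measurable lebesgue"
  and lin: "\<And>u v c d x. test_function u ==> test_function v ==> T (%y. c * u y + d * v y) x = c * T u x + d * T v x"
  and bound: "\<And>u p. test_function u ==> p >= 0 ==> wn m u <= ennreal p ==> wn m (T u) <= ennreal (C * p)"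
begin

lemma test_comb: "test_function u ==> test_function v ==> test_function (%y. c * u y + d * v y)"
 by (intro test_function_add test_function_scale)

lemma T_diff:
 assumes f: "f \<in> borel_measurable lebesgue" and u: "test_function u" "wn m (%x. f x - u x) <= ennreal p" "p >= 0"
  and v: "test_function v" "wn m (%x. f x - v x) <= ennreal q" "q >= 0"
 shows "wn m (%x. T u x - T v x) <= ennreal (C * (2 * p + 2 * q))"
proof -
 have "wn m (%x. (u x - f x) + (f x - v x)) <= ennreal (2 * p + 2 * q)"
  using u v unfolding wn_minus[of m f u] by (intro wn_add_le borel_measurable_diff f test_function_measurable) auto
 then have "wn m (%x. 1 * u x + (-1) * v x) <= ennreal (2 * p + 2 * q)" by simp
 from bound[OF test_comb[OF u(1) v(1)] _ this]
 have "wn m (T (%x. 1 * u x + (-1) * v x)) <= ennreal (C * (2 * p + 2 * q))" using u(3) v(3) by simp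
 moreover have "T (%x. 1 * u x + (-1) * v x) = (%x. T u x - T v x)" by (rule ext, subst lin[OF u(1) v(1)]) simp
 ultimately show ?thesis by simp
qed

definition appr :: "('a => complex) => nat => 'a => complex" where
 "appr f k = (SOME u. test_function u \<and> wn m (%x. f x - u x) <= ennreal ((1 / 4) ^ k))"

definition ext :: "('a => complex) => 'a => complex" where
 "ext f x = lim (%k. T (appr f k) x)"

lemma appr:
 assumes "f \<in> L2w m" shows "test_function (appr f k)" "wn m (%x. f x - appr f k x) <= ennreal ((1 / 4) ^ k)"
proof -
 have "\<exists>u. test_function u \<and> wn m (%x. f x - u x) <= ennreal ((1 / 4) ^ k)"
  using L2w_approximable[OF assms] unfolding approximable_def by simp
 from someI_ex[OF this] show "test_function (appr f k)" "wn m (%x. f x - appr f k x) <= ennreal ((1 / 4) ^ k)"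
  unfolding appr_def by auto
qed

text \<open>Approximation at a geometric rate makes the weighted square increments summable with a growing
factor to spare, which forces convergence almost everywhere.\<close>

lemma ext_limit:
 assumes f: "f \<in> L2w m" shows "AE x in lebesgue. (%k. T (appr f k) x) \<longlonglongrightarrow> ext f x"
proof -
 have mf: "f \<in> borel_measurable lebesgue" using f by (simp add: L2w_iff)
 let ?b = "%x::'a. complex_of_real (bracket m x)"
 define d where "d k x = T (appr f (Suc k)) x - T (appr f k) x" for k x
 have md: "d k \<in> borel_measurable lebesgue" for k unfolding d_def[abs_def] by (intro borel_measurable_diff meas appr f)
 have wd: "wn m (d k) <= ennreal (C * 4 * (1 / 4) ^ k)" for k
 proof -
  have "wn m (d k) <= ennreal (C * (2 * (1 / 4) ^ Suc k + 2 * (1 / 4) ^ k))"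
   unfolding d_def[abs_def] by (intro T_diff[OF mf] appr f) auto
  also have "\<dots> <= ennreal (C * (4 * (1 / 4) ^ k))" using C by (intro ennreal_leI mult_left_mono) auto
  finally show ?thesis by (simp add: mult.assoc)
 qed
 define h where "h k x = ennreal (2 ^ k) * ennreal ((cmod (?b x * d k x))\<^sup>2)" for k x
 have mh: "h k \<in> borel_measurable lebesgue" for k unfolding h_def[abs_def] using wn_integrand_measurable[OF md, of m k] by measurable
 have ih: "integral\<^sup>N lebesgue (h k) <= ennreal (C * 4 * (1 / 2) ^ k)" for k
 proof -
  have "integral\<^sup>N lebesgue (h k) = ennreal (2 ^ k) * wn m (d k)" unfolding h_def[abs_def] wn_def by (rule nn_integral_cmult[OF wn_integrand_measurable[OF md]])
  also have "\<dots> <= ennreal (2 ^ k) * ennreal (C * 4 * (1 / 4) ^ k)" by (intro mult_left_mono wd) simp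
  also have "\<dots> = ennreal (C * 4 * (2 * (1 / 4)) ^ k)" unfolding power_mult_distrib using C by (subst ennreal_mult[symmetric]) (simp_all add: mult_ac)
  finally show ?thesis by simp
 qed
 have sm: "summable (%k. C * 4 * (1 / 2) ^ k)" by (intro summable_mult summable_geometric) simp
 have "(\<integral>\<^sup>+x. (\<Sum>k. h k x) \<partial>lebesgue) = (\<Sum>k. integral\<^sup>N lebesgue (h k))" by (rule nn_integral_suminf[OF mh])
 also have "\<dots> <= (\<Sum>k. ennreal (C * 4 * (1 / 2) ^ k))" by (intro suminf_le ih) auto
 also have "\<dots> = ennreal (\<Sum>k. C * 4 * (1 / 2) ^ k)" using C by (intro suminf_ennreal2 sm) simp
 also have "\<dots> < \<infinity>" by simp
 finally have fin: "(\<integral>\<^sup>+x. (\<Sum>k. h k x) \<partial>lebesgue) \<noteq> \<infinity>" by simp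
 have "(%x. \<Sum>k. h k x) \<in> borel_measurable lebesgue" using mh by measurable
 from nn_integral_PInf_AE[OF this fin] show ?thesis
 proof (rule AE_mp, intro AE_I2 impI)
  fix x assume "(\<Sum>k. h k x) \<noteq> \<infinity>"
  then obtain M where M: "(\<Sum>k. h k x) = ennreal M" "M >= 0" by (cases "\<Sum>k. h k x") auto
  have b: "bracket m x > 0" by (rule bracket_pos)
  have dk: "cmod (d k x) <= (sqrt M / bracket m x) * (1 / sqrt 2) ^ k" for k
  proof -
   have "h k x <= (\<Sum>k. h k x)" using sum_le_suminf[of "%k. h k x" "{k}"] by simp
   moreover have "ennreal (2 ^ k * (cmod (?b x * d k x))\<^sup>2) = h k x" unfolding h_def by (rule ennreal_mult) simp_all
   ultimately have "ennreal (2 ^ k * (cmod (?b x * d k x))\<^sup>2) <= ennreal M" by (simp only: M(1))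
   then have "2 ^ k * (cmod (?b x * d k x))\<^sup>2 <= M" using M(2) by simp
   then have "sqrt (2 ^ k * (cmod (?b x * d k x))\<^sup>2) <= sqrt M" by (rule real_sqrt_le_mono)
   moreover have "sqrt (2 ^ k * (cmod (?b x * d k x))\<^sup>2) = sqrt 2 ^ k * cmod (?b x * d k x)"
    unfolding real_sqrt_mult real_sqrt_power[of 2] real_sqrt_abs by (simp only: abs_norm_cancel)
   moreover have "cmod (?b x * d k x) = bracket m x * cmod (d k x)" using b by (simp add: norm_mult)
   ultimately have "sqrt 2 ^ k * (bracket m x * cmod (d k x)) <= sqrt M" by (simp only:)
   then show ?thesis using b by (simp add: field_simps power_divide)
  qed
  have "summable (%k. (sqrt M / bracket m x) * (1 / sqrt 2) ^ k)" by (intro summable_mult summable_geometric) simp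
  then have "summable (%k. d k x)" by (rule summable_comparison_test'[where N=0]) (rule dk)
  then have "(%n. \<Sum>k<n. d k x) \<longlonglongrightarrow> (\<Sum>k. d k x)" by (rule summable_LIMSEQ)
  then have "(%n. T (appr f n) x - T (appr f 0) x) \<longlonglongrightarrow> (\<Sum>k. d k x)" unfolding d_def sum_lessThan_telescope[of "%k. T (appr f k) x"] .
  then have "(%n. (T (appr f n) x - T (appr f 0) x) + T (appr f 0) x) \<longlonglongrightarrow> (\<Sum>k. d k x) + T (appr f 0) x" by (intro tendsto_add tendsto_const)
  then have "convergent (%n. T (appr f n) x)" by (auto simp: convergent_def)
  then show "(%k. T (appr f k) x) \<longlonglongrightarrow> ext f x" unfolding ext_def by (simp add: convergent_LIMSEQ_iff)
 qed
qed

lemma ext_measurable: "f \<in> L2w m ==> ext f \<in> borel_measurable lebesgue"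
 unfolding ext_def[abs_def] by (intro borel_measurable_lim_metric meas appr)

text \<open>This single estimate, with an arbitrary test function in place of the chosen approximants, yields
linearity, boundedness and agreement with the operator.\<close>

lemma ext_close:
 assumes f: "f \<in> L2w m" and w: "test_function w" "wn m (%x. f x - w x) <= ennreal q" and q: "q > 0"
 shows "wn m (%x. ext f x - T w x) <= ennreal (C * 4 * q)"
proof -
 have mf: "f \<in> borel_measurable lebesgue" using f by (simp add: L2w_iff)
 let ?F = "%k x. ennreal ((cmod (of_real (bracket m x) * (T (appr f k) x - T w x)))\<^sup>2)"
 have mF: "?F k \<in> borel_measurable lebesgue" for k
  by (intro wn_integrand_measurable borel_measurable_diff meas appr f w)
 have "wn m (%x. ext f x - T w x) = (\<integral>\<^sup>+x. liminf (%k. ?F k x) \<partial>lebesgue)"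
  unfolding wn_def
 proof (rule nn_integral_cong_AE, rule AE_mp[OF ext_limit[OF f]], intro AE_I2 impI)
  fix x assume "(%k. T (appr f k) x) \<longlonglongrightarrow> ext f x"
  then have "(%k. (cmod (of_real (bracket m x) * (T (appr f k) x - T w x)))\<^sup>2) \<longlonglongrightarrow> (cmod (of_real (bracket m x) * (ext f x - T w x)))\<^sup>2" by (intro tendsto_intros)
  from tendsto_ennrealI[OF this]
  show "ennreal ((cmod (of_real (bracket m x) * (ext f x - T w x)))\<^sup>2) = liminf (%k. ?F k x)"
   by (rule lim_imp_Liminf[OF trivial_limit_sequentially, symmetric])
 qed
 also have "\<dots> <= liminf (%k. integral\<^sup>N lebesgue (?F k))" by (rule nn_integral_liminf[OF mF])
 also have "\<dots> <= ennreal (C * 4 * q)"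
 proof (rule Liminf_le[OF trivial_limit_sequentially])
  have "(%k. (1 / 4 :: real) ^ k) \<longlonglongrightarrow> 0" by (rule LIMSEQ_realpow_zero) auto
  then have "eventually (%k. (1 / 4 :: real) ^ k < q) sequentially" by (rule order_tendstoD(2)[OF _ q])
  then show "eventually (%k. integral\<^sup>N lebesgue (?F k) <= ennreal (C * 4 * q)) sequentially"
  proof (rule eventually_mono)
   fix k assume k: "(1 / 4 :: real) ^ k < q"
   have "wn m (%x. T (appr f k) x - T w x) <= ennreal (C * (2 * (1 / 4) ^ k + 2 * q))" using q by (intro T_diff[OF mf] appr f w) auto
   also have "\<dots> <= ennreal (C * (4 * q))" using C k by (intro ennreal_leI mult_left_mono) auto
   finally show "integral\<^sup>N lebesgue (?F k) <= ennreal (C * 4 * q)" unfolding wn_def by (simp add: mult.assoc)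
  qed
 qed
 finally show ?thesis .
qed

lemma L2w_approx: assumes "f \<in> L2w m" "e > 0" obtains w where "test_function w" "wn m (%x. f x - w x) <= ennreal e"
 using L2w_approximable[OF assms(1)] assms(2) unfolding approximable_def by blast

lemma AE_zero:
 assumes g: "g \<in> borel_measurable lebesgue" and D: "D >= 0" "\<And>e. e > 0 ==> wn m g <= ennreal (D * e)"
 shows "AE x in lebesgue. g x = 0"
proof -
 have "wn m g <= 0 + ennreal e" if "e > 0" for e
 proof -
  have "wn m g <= ennreal (D * (e / (D + 1)))" using D that by (intro D(2)) simp
  also have "\<dots> <= ennreal e" using D(1) that by (intro ennreal_leI) (simp add: field_simps)
  finally show ?thesis by simp
 qed
 then have "wn m g <= 0" by (rule ennreal_le_epsilon)
 then have "wn m g = 0" by simp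
 then have "AE x in lebesgue. ennreal ((cmod (of_real (bracket m x) * g x))\<^sup>2) = 0"
  unfolding wn_def by (subst (asm) nn_integral_0_iff_AE[OF wn_integrand_measurable[OF g]])
 then show ?thesis
 proof (rule AE_mp, intro AE_I2 impI)
  fix x assume "ennreal ((cmod (of_real (bracket m x) * g x))\<^sup>2) = 0"
  then have "(cmod (of_real (bracket m x) * g x))\<^sup>2 <= 0" by (simp only: ennreal_eq_0_iff)
  then show "g x = 0" using bracket_pos[of m x] by simp
 qed
qed

lemma ext_agrees:
 assumes u: "test_function u" "u \<in> L2w m" shows "AE x in lebesgue. ext u x = T u x"
proof -
 have "AE x in lebesgue. ext u x - T u x = 0"
 proof (rule AE_zero[of _ "C * 4"])
  show "(%x. ext u x - T u x) \<in> borel_measurable lebesgue" by (intro borel_measurable_diff ext_measurable meas u)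
  show "wn m (%x. ext u x - T u x) <= ennreal (C * 4 * e)" if "e > 0" for e
   by (rule ext_close[OF u(2,1) _ that]) (simp add: wn_def)
 qed (use C in simp)
 then show ?thesis by (rule AE_mp) (simp add: AE_I2)
qed

lemma wn_finite: assumes "f \<in> L2w m" obtains r where "wn m f = ennreal r" "r >= 0"
 using assms by (cases "wn m f") (auto simp: L2w_iff)

lemma wn_ext:
 assumes f: "f \<in> L2w m" and r: "wn m f = ennreal r" "r >= 0" shows "wn m (ext f) <= ennreal (C * 4 * r)"
proof (rule ennreal_le_epsilon)
 have mf: "f \<in> borel_measurable lebesgue" using f by (simp add: L2w_iff)
 fix e' :: real assume e': "0 < e'"
 define e where "e = e' / (C * 12 + 1)"
 have e: "e > 0" using e' C by (simp add: e_def add_nonneg_pos)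
 obtain w where w: "test_function w" "wn m (%x. f x - w x) <= ennreal e" using L2w_approx[OF f e] by blast
 have "wn m (%x. (w x - f x) + f x) <= ennreal (2 * e + 2 * r)"
  using w e r unfolding wn_minus[of m f w] by (intro wn_add_le borel_measurable_diff mf test_function_measurable) auto
 then have "wn m (T w) <= ennreal (C * (2 * e + 2 * r))" using e r by (intro bound w) auto
 then have "wn m (%x. (ext f x - T w x) + T w x) <= ennreal (2 * (C * 4 * e) + 2 * (C * (2 * e + 2 * r)))"
  using e r C by (intro wn_add_le ext_close[OF f w e] borel_measurable_diff ext_measurable[OF f] meas[OF w(1)]) auto
 also have "2 * (C * 4 * e) + 2 * (C * (2 * e + 2 * r)) = C * 4 * r + C * 12 * e" by (simp add: algebra_simps)
 also have "ennreal (C * 4 * r + C * 12 * e) <= ennreal (C * 4 * r + e')"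
 proof (intro ennreal_leI add_left_mono)
  have "C * 12 * e <= (C * 12 + 1) * e" using e by (intro mult_right_mono) auto
  also have "\<dots> = e'" using C by (simp add: e_def add_nonneg_eq_0_iff)
  finally show "C * 12 * e <= e'" .
 qed
 also have "\<dots> = ennreal (C * 4 * r) + ennreal e'" using C r e' by (intro ennreal_plus) auto
 finally show "wn m (ext f) <= ennreal (C * 4 * r) + ennreal e'" by simp
qed

lemma ext_L2w: assumes "f \<in> L2w m" shows "ext f \<in> L2w m"
proof -
 obtain r where "wn m f = ennreal r" "r >= 0" using wn_finite[OF assms] by blast
 from wn_ext[OF assms this] have "wn m (ext f) < \<infinity>" using ennreal_less_top order_le_less_trans infinity_ennreal_def by metis
 then show ?thesis using ext_measurable[OF assms] by (simp add: L2w_iff)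
qed

lemma ext_norm: assumes "f \<in> L2w m" shows "L2w_norm m (ext f) <= sqrt (C * 4) * L2w_norm m f"
proof -
 obtain r where r: "wn m f = ennreal r" "r >= 0" using wn_finite[OF assms] by blast
 have "enn2real (wn m (ext f)) <= enn2real (ennreal (C * 4 * r))" by (rule enn2real_mono[OF wn_ext[OF assms r]]) simp
 then have "enn2real (wn m (ext f)) <= C * 4 * r" using C r by simp
 then show ?thesis unfolding L2w_norm_wn[OF assms] L2w_norm_wn[OF ext_L2w[OF assms]] real_sqrt_mult[symmetric]
  using r by (intro real_sqrt_le_mono) simp
qed

lemma L2w_comb: assumes f: "f \<in> L2w m" and g: "g \<in> L2w m" shows "(%x. c * f x + d * g x) \<in> L2w m"
proof -
 have mm: "f \<in> borel_measurable lebesgue" "g \<in> borel_measurable lebesgue" using f g by (auto simp: L2w_iff)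
 obtain r where r: "wn m f = ennreal r" "r >= 0" using wn_finite[OF f] by blast
 obtain s where s: "wn m g = ennreal s" "s >= 0" using wn_finite[OF g] by blast
 have "wn m (%x. c * f x + d * g x) <= ennreal (2 * ((cmod c)\<^sup>2 * r) + 2 * ((cmod d)\<^sup>2 * s))"
  using r s by (intro wn_add_le wn_scale_le borel_measurable_times borel_measurable_const mm) auto
 then have "wn m (%x. c * f x + d * g x) < \<infinity>" using ennreal_less_top order_le_less_trans infinity_ennreal_def by metis
 then show ?thesis unfolding L2w_iff using mm by (intro conjI borel_measurable_add borel_measurable_times borel_measurable_const)
qed

lemma ext_linear:
 assumes f: "f \<in> L2w m" and g: "g \<in> L2w m"
 shows "AE x in lebesgue. ext (%z. c * f z + d * g z) x = c * ext f x + d * ext g x"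
proof -
 let ?h = "%z. c * f z + d * g z"
 let ?P = "(cmod c)\<^sup>2 + (cmod d)\<^sup>2"
 have h: "?h \<in> L2w m" by (rule L2w_comb[OF f g])
 have mm: "f \<in> borel_measurable lebesgue" "g \<in> borel_measurable lebesgue" using f g by (auto simp: L2w_iff)
 have me: "ext f \<in> borel_measurable lebesgue" "ext g \<in> borel_measurable lebesgue" "ext ?h \<in> borel_measurable lebesgue"
  by (intro ext_measurable f g h)+
 have "AE x in lebesgue. ext ?h x - (c * ext f x + d * ext g x) = 0"
 proof (rule AE_zero[of _ "2 * (C * 4 * (2 * ?P + 1)) + 2 * (2 * (?P * (C * 4)))"])
  show "(%x. ext ?h x - (c * ext f x + d * ext g x)) \<in> borel_measurable lebesgue" using me by measurable
  show "0 <= 2 * (C * 4 * (2 * ?P + 1)) + 2 * (2 * (?P * (C * 4)))" using C by (intro add_nonneg_nonneg mult_nonneg_nonneg) auto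
  fix e :: real assume e: "e > 0"
  obtain v where v: "test_function v" "wn m (%x. f x - v x) <= ennreal e" using L2w_approx[OF f e] by blast
  obtain w where w: "test_function w" "wn m (%x. g x - w x) <= ennreal e" using L2w_approx[OF g e] by blast
  let ?t = "%x. c * v x + d * w x"
  have t: "test_function ?t" by (rule test_comb[OF v(1) w(1)])
  have "wn m (%x. c * (f x - v x) + d * (g x - w x)) <= ennreal (2 * ((cmod c)\<^sup>2 * e) + 2 * ((cmod d)\<^sup>2 * e))"
   using e v w by (intro wn_add_le wn_scale_le borel_measurable_times borel_measurable_diff borel_measurable_const mm test_function_measurable) auto
  also have "\<dots> <= ennreal ((2 * ?P + 1) * e)" using e by (intro ennreal_leI) (simp add: algebra_simps)
  finally have "wn m (%x. ?h x - ?t x) <= ennreal ((2 * ?P + 1) * e)" by (simp add: algebra_simps)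
  moreover have "(2 * ?P + 1) * e > 0" using e by (intro mult_pos_pos add_nonneg_pos) auto
  ultimately have 1: "wn m (%x. ext ?h x - T ?t x) <= ennreal (C * 4 * ((2 * ?P + 1) * e))" by (intro ext_close[OF h t])
  have 2: "wn m (%x. T v x - ext f x) <= ennreal (C * 4 * e)" using ext_close[OF f v e] by (simp add: wn_minus[of m "ext f"])
  have 3: "wn m (%x. T w x - ext g x) <= ennreal (C * 4 * e)" using ext_close[OF g w e] by (simp add: wn_minus[of m "ext g"])
  have 4: "wn m (%x. c * (T v x - ext f x) + d * (T w x - ext g x)) <= ennreal (2 * ((cmod c)\<^sup>2 * (C * 4 * e)) + 2 * ((cmod d)\<^sup>2 * (C * 4 * e)))"
   using e C by (intro wn_add_le wn_scale_le 2 3 borel_measurable_times borel_measurable_diff borel_measurable_const me meas v w) auto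
  have "wn m (%x. (ext ?h x - T ?t x) + (c * (T v x - ext f x) + d * (T w x - ext g x)))
    <= ennreal (2 * (C * 4 * ((2 * ?P + 1) * e)) + 2 * (2 * ((cmod c)\<^sup>2 * (C * 4 * e)) + 2 * ((cmod d)\<^sup>2 * (C * 4 * e))))"
   using e C by (intro wn_add_le 1 4 borel_measurable_add borel_measurable_times borel_measurable_diff borel_measurable_const me meas v w t) auto
  moreover have "(ext ?h x - T ?t x) + (c * (T v x - ext f x) + d * (T w x - ext g x)) = ext ?h x - (c * ext f x + d * ext g x)" for x
   unfolding lin[OF v(1) w(1)] by (simp add: algebra_simps)
  moreover have "2 * (C * 4 * ((2 * ?P + 1) * e)) + 2 * (2 * ((cmod c)\<^sup>2 * (C * 4 * e)) + 2 * ((cmod d)\<^sup>2 * (C * 4 * e)))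
   = (2 * (C * 4 * (2 * ?P + 1)) + 2 * (2 * (?P * (C * 4)))) * e" by (simp add: algebra_simps)
  ultimately show "wn m (%x. ext ?h x - (c * ext f x + d * ext g x)) <= ennreal ((2 * (C * 4 * (2 * ?P + 1)) + 2 * (2 * (?P * (C * 4)))) * e)"
   by (simp only:)
 qed
 then show ?thesis by (rule AE_mp) (simp add: AE_I2)
qed

end

lemma test_function_L2w: assumes "test_function (u :: 'a::euclidean_space => complex)" shows "u \<in> L2w m" "wn m u = ennreal ((l2 (%x. of_real (bracket m x) * u x))\<^sup>2)"
proof -
 have "bbs (%x. of_real (bracket m x) * u x)" by (intro bbs_bracket test_function_bbs assms)
 from nn_l2[OF this] show w: "wn m u = ennreal ((l2 (%x. of_real (bracket m x) * u x))\<^sup>2)" unfolding wn_def nn_integral_completion .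
 show "u \<in> L2w m" unfolding L2w_iff w using test_function_measurable[OF assms] by simp
qed

theorem (in dense_operator) bounded_extension: "extends_to_bounded_operator_on_L2w m T"
 unfolding extends_to_bounded_operator_on_L2w_def
 using ext_L2w ext_linear ext_norm ext_agrees[OF _ test_function_L2w(1)] by blast

section \<open>Nondegenerate phases\<close>

text \<open>The matrices with bounded entries and determinant bounded away from zero form a compact set of
invertible matrices, on which the least stretching factor attains its positive minimum.\<close>

lemma matrix_lower_bound:
 assumes C: "C > 0"
 obtains c where "c > 0" "\<And>(M::real^'n^'n) v. (\<And>i j. \<bar>M $ i $ j\<bar> <= B) ==> \<bar>det M\<bar> >= C ==> c * norm v <= norm (M *v v)"
proof -
 define S where "S = {(M::real^'n^'n, v::real^'n). (\<forall>i j. \<bar>M $ i $ j\<bar> <= B) \<and> C <= \<bar>det M\<bar> \<and> norm v = 1}"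
 have cd: "continuous_on UNIV (%p::(real^'n^'n) \<times> (real^'n). det (fst p))"
  unfolding det_def by (intro continuous_intros)
 have cl: "closed S"
 proof -
  have "S = (\<Inter>i. \<Inter>j. {p. \<bar>fst p $ i $ j\<bar> <= B}) \<inter> {p. C <= \<bar>det (fst p)\<bar>} \<inter> {p. norm (snd p) = 1}"
   unfolding S_def by auto
  moreover have "closed {p::(real^'n^'n) \<times> (real^'n). \<bar>fst p $ i $ j\<bar> <= B}" for i j
   by (intro closed_Collect_le continuous_intros)
  moreover have "closed {p::(real^'n^'n) \<times> (real^'n). C <= \<bar>det (fst p)\<bar>}"
   by (intro closed_Collect_le continuous_on_rabs cd continuous_on_const)
  moreover have "closed {p::(real^'n^'n) \<times> (real^'n). norm (snd p) = 1}"
   by (intro closed_Collect_eq continuous_intros)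
  ultimately show ?thesis by (simp only: closed_Int closed_INT ball_UNIV simp_thms)
 qed
 have "bounded S"
 proof (rule boundedI)
  fix p assume "p \<in> S"
  then have p: "\<And>i j. \<bar>fst p $ i $ j\<bar> <= B" "norm (snd p) = 1" by (auto simp: S_def)
  have "norm (fst p $ i) <= of_nat CARD('n) * B" for i
  proof -
   have "norm (fst p $ i) <= (\<Sum>j\<in>UNIV. \<bar>fst p $ i $ j\<bar>)" by (rule norm_le_l1_cart)
   also have "\<dots> <= of_nat CARD('n) * B" by (rule sum_bounded_above) (rule p(1))
   finally show ?thesis .
  qed
  note row = this
  have "norm (fst p) = L2_set (%i. norm (fst p $ i)) UNIV" by (rule norm_vec_def)
  also have "\<dots> <= (\<Sum>i\<in>UNIV. norm (fst p $ i))" by (rule L2_set_le_sum) simp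
  also have "\<dots> <= of_nat CARD('n) * (of_nat CARD('n) * B)" by (rule sum_bounded_above) (rule row)
  finally have "norm (fst p) <= of_nat CARD('n) * (of_nat CARD('n) * B)" .
  then show "norm p <= of_nat CARD('n) * (of_nat CARD('n) * B) + 1"
   using norm_Pair_le[of "fst p" "snd p"] p(2) by simp
 qed
 then have cpt: "compact S" using cl by (simp add: compact_eq_bounded_closed)
 have cf: "continuous_on S (%p. norm (fst p *v snd p))"
  unfolding matrix_vector_mult_def by (intro continuous_intros)
 have "\<exists>c>0. \<forall>p\<in>S. c <= norm (fst p *v snd p)"
 proof (cases "S = {}")
  case False
  obtain q where q: "q \<in> S" "\<And>p. p \<in> S ==> norm (fst q *v snd q) <= norm (fst p *v snd p)"
   using continuous_attains_inf[OF cpt False cf] by blast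
  have "det (fst q) \<noteq> 0" "snd q \<noteq> 0" using q(1) C by (auto simp: S_def)
  then have "invertible (fst q)" by (simp only: invertible_det_nz not_False_eq_True)
  then have "\<forall>x. fst q *v x = 0 --> x = 0" unfolding invertible_left_inverse matrix_left_invertible_ker .
  then have "norm (fst q *v snd q) > 0" using \<open>snd q \<noteq> 0\<close> by auto
  then show ?thesis using q(2) by blast
 qed (auto intro: exI[of _ 1])
 then obtain c where c: "c > 0" "\<And>p. p \<in> S ==> c <= norm (fst p *v snd p)" by blast
 show thesis
 proof (rule that[OF c(1)])
  fix M :: "real^'n^'n" and v :: "real^'n" assume M: "\<And>i j. \<bar>M $ i $ j\<bar> <= B" "\<bar>det M\<bar> >= C"
  show "c * norm v <= norm (M *v v)"
  proof (cases "v = 0")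
   case False
   have "(M, (1 / norm v) *\<^sub>R v) \<in> S" using M False by (simp add: S_def)
   from c(2)[OF this] have "c <= norm (M *v v) / norm v" by (simp add: matrix_vector_mult_scaleR)
   then show ?thesis using False by (simp add: field_simps)
  qed simp
 qed
qed

definition hess :: "((real^'n) \<times> (real^'n) => real) => (real^'n) \<times> (real^'n) => real^'n^'n" where
 "hess \<Psi> z = (\<chi> i j. dd (inc1 (axis i 1)) (dd (inc2 (axis j 1)) \<Psi>) z)"

lemma Basis_axis: "(Basis :: (real^'n) set) = range (%i. axis i 1)"
 unfolding Basis_vec_def by auto

lemma axis_in_Basis: "axis i (1::real) \<in> Basis" unfolding Basis_axis by (rule rangeI)

lemma sum_Basis_axis: "(\<Sum>b\<in>(Basis :: (real^'n) set). f b) = (\<Sum>i\<in>UNIV. f (axis i 1))"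
proof -
 have "inj (%i::'n. axis i (1::real))" by (auto simp: inj_on_def axis_eq_axis)
 from sum.reindex[OF this, of f] show ?thesis by (simp only: Basis_axis comp_def)
qed

lemma norm_sq_vec: "(norm (x :: real^'n))\<^sup>2 = (\<Sum>i\<in>UNIV. (x $ i)\<^sup>2)"
 unfolding power2_norm_eq_inner inner_vec_def by (simp add: power2_eq_square)

text \<open>For a fixed first variable the gradient in that variable is a map of the second variable whose
derivative is the mixed Hessian; the determinant condition bounds it from below and the bounded
derivatives make it Lipschitz.\<close>

lemma nondegenerate_expanding:
 fixes \<Psi> :: "(real^'n) \<times> (real^'n) => real"
 assumes s: "smooth \<Psi>" and C: "C > 0" "\<And>z. \<bar>det (hess \<Psi> z)\<bar> >= C"
  and mixed: "\<And>b c. b \<in> Basis ==> c \<in> Basis ==> symb UNIV (%_::unit. dd (inc1 b) (dd (inc2 c) \<Psi>))"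
 shows "\<exists>\<kappa>>0. \<forall>y \<zeta> \<eta>. \<kappa> * (norm (\<zeta> - \<eta>))\<^sup>2 <= (\<Sum>b\<in>Basis. (dd (inc1 b) \<Psi> (y, \<zeta>) - dd (inc1 b) \<Psi> (y, \<eta>))\<^sup>2)"
proof -
 let ?H = "%i j. dd (inc1 (axis i 1)) (dd (inc2 (axis j 1)) \<Psi>)"
 have sH: "smooth (?H i j)" for i j by (intro smooth_dd s Basis_inc axis_in_Basis)
 have "\<exists>B. \<forall>z. \<bar>?H i j z\<bar> <= B" for i j using symb_unit_bound[OF mixed[OF axis_in_Basis axis_in_Basis]] by simp
 then obtain B where B: "\<And>i j z. \<bar>?H i j z\<bar> <= B i j" by metis
 define BB where "BB = (\<Sum>i\<in>UNIV. \<Sum>j\<in>UNIV. \<bar>B i j\<bar>)"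
 have BB: "\<bar>hess \<Psi> z $ i $ j\<bar> <= BB" for z i j
 proof -
  have "\<bar>?H i j z\<bar> <= \<bar>B i j\<bar>" using B[of i j z] by linarith
  also have "\<dots> <= (\<Sum>j\<in>UNIV. \<bar>B i j\<bar>)" by (rule member_le_sum) auto
  also have "\<dots> <= BB" unfolding BB_def by (rule member_le_sum[of i UNIV "%i. \<Sum>j\<in>UNIV. \<bar>B i j\<bar>"]) (auto intro: sum_nonneg)
  finally show ?thesis by (simp add: hess_def)
 qed
 obtain c where c: "c > 0" "\<And>(M::real^'n^'n) v. (\<And>i j. \<bar>M $ i $ j\<bar> <= BB) ==> \<bar>det M\<bar> >= C ==> c * norm v <= norm (M *v v)"
  using matrix_lower_bound[OF C(1), where B=BB and 'n='n] by blast
 have "\<exists>L\<ge>0. \<forall>y \<zeta> \<eta>. \<bar>?H i j (y, \<zeta>) - ?H i j (y, \<eta>)\<bar> <= L * norm (\<zeta> - \<eta>)" for i j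
 proof -
  have "\<exists>C. \<forall>z. \<bar>dd (inc2 c) (?H i j) z\<bar> <= C" if "c \<in> Basis" for c
   using symb_unit_bound[OF symb_dd[OF mixed[OF axis_in_Basis axis_in_Basis] Basis_inc(2)[OF that]]] by simp
  from lipschitz_snd[OF sH this] show ?thesis by metis
 qed
 then obtain L where L: "\<And>i j. L i j >= 0" "\<And>i j y \<zeta> \<eta>. \<bar>?H i j (y, \<zeta>) - ?H i j (y, \<eta>)\<bar> <= L i j * norm (\<zeta> - \<eta>)" by metis
 define LL where "LL = (\<Sum>i\<in>UNIV. \<Sum>j\<in>UNIV. L i j) + 1"
 have LL: "LL > 0" unfolding LL_def by (intro add_nonneg_pos sum_nonneg L) simp
 have "c * norm (\<zeta> - \<eta>) <= norm ((\<chi> i. dd (inc1 (axis i 1)) \<Psi> (y, \<zeta>)) - (\<chi> i. dd (inc1 (axis i 1)) \<Psi> (y, \<eta>)))" for y \<zeta> \<eta>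
 proof (rule hadamard_expanding[where F="%\<xi>. \<chi> i. dd (inc1 (axis i 1)) \<Psi> (y, \<xi>)" and F'="%\<xi> v. hess \<Psi> (y, \<xi>) *v v" and L=LL])
  fix \<xi> :: "real^'n"
  show "((%\<xi>. \<chi> i. dd (inc1 (axis i 1)) \<Psi> (y, \<xi>)) has_derivative (%v. hess \<Psi> (y, \<xi>) *v v)) (at \<xi>)"
  proof (rule has_derivative_componentwise_within[THEN iffD2], intro ballI)
   fix b :: "real^'n" assume "b \<in> Basis"
   then obtain i where b: "b = axis i 1" by (auto simp: Basis_vec_def)
   let ?g = "dd (inc1 (axis i 1)) \<Psi>"
   have sg: "smooth ?g" by (intro smooth_dd s Basis_inc axis_in_Basis)
   have sgy: "smooth (%\<xi>. ?g (y, \<xi>))" by (intro smooth_compose[OF sg] smooth_intros)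
   have d: "dd (axis j 1) (%\<xi>. ?g (y, \<xi>)) \<xi> = ?H i j (y, \<xi>)" for j
    using ddl_slice2[OF sg, of "[axis j 1]" y \<xi>] dd_comm_inc[OF s axis_in_Basis axis_in_Basis] by (simp add: axis_in_Basis)
   have "dd v (%\<xi>. ?g (y, \<xi>)) \<xi> = (hess \<Psi> (y, \<xi>) *v v) $ i" for v
   proof -
    have "dd v (%\<xi>. ?g (y, \<xi>)) \<xi> = (\<Sum>c\<in>Basis. (v \<bullet> c) *\<^sub>R dd c (%\<xi>. ?g (y, \<xi>)) \<xi>)"
     by (rule dd_expand[OF smooth_differentiable[OF sgy]])
    also have "\<dots> = (\<Sum>j\<in>UNIV. ?H i j (y, \<xi>) * v $ j)" unfolding sum_Basis_axis by (simp add: d inner_axis mult.commute)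
    finally show ?thesis by (simp add: matrix_vector_mult_def hess_def)
   qed
   then have "((%\<xi>. ?g (y, \<xi>)) has_derivative (%v. (hess \<Psi> (y, \<xi>) *v v) $ i)) (at \<xi>)"
    using dd_has_derivative[OF smooth_differentiable[OF sgy], of \<xi>] by simp
   then show "((%x. (\<chi> i. dd (inc1 (axis i 1)) \<Psi> (y, x)) \<bullet> b) has_derivative (%x. (hess \<Psi> (y, \<xi>) *v x) \<bullet> b)) (at \<xi>)"
    by (simp add: b inner_axis)
  qed
  show "c * norm v <= norm (hess \<Psi> (y, \<xi>) *v v)" for v by (rule c(2)[OF BB C(2)])
 next
  fix \<xi> \<xi>' v :: "real^'n"
  have "norm (hess \<Psi> (y, \<xi>) *v v - hess \<Psi> (y, \<xi>') *v v) <= (\<Sum>i\<in>UNIV. \<bar>(hess \<Psi> (y, \<xi>) *v v - hess \<Psi> (y, \<xi>') *v v) $ i\<bar>)" by (rule norm_le_l1_cart)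
  also have "\<dots> <= (\<Sum>i\<in>UNIV. \<Sum>j\<in>UNIV. L i j * (norm (\<xi> - \<xi>') * norm v))"
  proof (rule sum_mono)
   fix i
   have eq: "(hess \<Psi> (y, \<xi>) *v v - hess \<Psi> (y, \<xi>') *v v) $ i = (\<Sum>j\<in>UNIV. (?H i j (y, \<xi>) - ?H i j (y, \<xi>')) * v $ j)"
    by (simp add: matrix_vector_mult_def hess_def sum_subtractf left_diff_distrib)
   have "\<bar>(hess \<Psi> (y, \<xi>) *v v - hess \<Psi> (y, \<xi>') *v v) $ i\<bar> <= (\<Sum>j\<in>UNIV. \<bar>(?H i j (y, \<xi>) - ?H i j (y, \<xi>')) * v $ j\<bar>)"
    unfolding eq by (rule sum_abs)
   also have "\<dots> <= (\<Sum>j\<in>UNIV. L i j * (norm (\<xi> - \<xi>') * norm v))"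
   proof (rule sum_mono)
    fix j
    have "0 <= L i j * norm (\<xi> - \<xi>')" by (intro mult_nonneg_nonneg L(1)) simp
    from mult_mono[OF L(2)[of i j y \<xi> \<xi>'] component_le_norm_cart[of v j] this]
    show "\<bar>(?H i j (y, \<xi>) - ?H i j (y, \<xi>')) * v $ j\<bar> <= L i j * (norm (\<xi> - \<xi>') * norm v)"
     unfolding abs_mult mult.assoc by simp
   qed
   finally show "\<bar>(hess \<Psi> (y, \<xi>) *v v - hess \<Psi> (y, \<xi>') *v v) $ i\<bar> <= (\<Sum>j\<in>UNIV. L i j * (norm (\<xi> - \<xi>') * norm v))" .
  qed
  also have "\<dots> = (\<Sum>i\<in>UNIV. \<Sum>j\<in>UNIV. L i j) * (norm (\<xi> - \<xi>') * norm v)" by (simp only: sum_distrib_right)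
  also have "\<dots> <= LL * (norm (\<xi> - \<xi>') * norm v)" unfolding LL_def by (intro mult_right_mono) auto
  finally show "norm (hess \<Psi> (y, \<xi>) *v v - hess \<Psi> (y, \<xi>') *v v) <= LL * norm (\<xi> - \<xi>') * norm v" by (simp only: mult.assoc)
 qed (use c LL in auto)
 then have e: "(c * norm (\<zeta> - \<eta>))\<^sup>2 <= (norm ((\<chi> i. dd (inc1 (axis i 1)) \<Psi> (y, \<zeta>)) - (\<chi> i. dd (inc1 (axis i 1)) \<Psi> (y, \<eta>))))\<^sup>2" for y \<zeta> \<eta>
  using c(1) by (intro power_mono) auto
 have "c\<^sup>2 * (norm (\<zeta> - \<eta>))\<^sup>2 <= (\<Sum>b\<in>Basis. (dd (inc1 b) \<Psi> (y, \<zeta>) - dd (inc1 b) \<Psi> (y, \<eta>))\<^sup>2)" for y \<zeta> \<eta>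
  using e[of \<zeta> \<eta> y] unfolding norm_sq_vec[of "_ - _"] power_mult_distrib sum_Basis_axis by (simp add: norm_sq_vec)
 then show ?thesis using c(1) by (intro exI[of _ "c\<^sup>2"]) auto
qed

lemma dd_swap_pair:
 fixes f :: "'a::euclidean_space \<times> 'a => real"
 assumes "smooth f" shows "dd b (%z. f (swp z)) = (%z. dd (swp b) f (swp z))"
proof -
 have "bounded_linear (%z::'a \<times> 'a. swp z)" by (intro bounded_linear_Pair bounded_linear_snd bounded_linear_fst)
 from dd_compose_affine[OF this assms, of b 0] show ?thesis by simp
qed

lemma fio_setup_from_hypotheses:
 fixes \<phi> :: "real^'n => real^'n => real" and a :: "real^'n => real^'n => real^'n => complex"
 assumes s\<phi>: "smooth (%(y, \<xi>). \<phi> y \<xi>)" and sa: "smooth (%(x, y, \<xi>). a x y \<xi>)"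
  and dt: "\<exists>C>0. \<forall>y \<xi>. \<bar>det (mixed_hessian \<phi> y \<xi>)\<bar> >= C"
  and mx: "\<forall>i j \<beta> \<gamma>. \<exists>C. \<forall>y \<xi>. \<bar>mderiv \<beta> (%y'. mderiv \<gamma> (%\<xi>'. mixed_hessian \<phi> y' \<xi>' $ i $ j) \<xi>) y\<bar> <= C"
  and ph: "\<forall>\<alpha>. mi_order \<alpha> >= 1 --> (\<exists>C. \<forall>y \<xi>. \<bar>mderiv \<alpha> (%\<xi>'. \<phi> y \<xi>') \<xi>\<bar> <= C * bracket 1 y)"
  and am: "\<forall>\<alpha> \<beta> \<gamma>. \<exists>C. \<forall>x y \<xi>. cmod (mderiv \<alpha> (%x'. mderiv \<beta> (%y'. mderiv \<gamma> (%\<xi>'. a x' y' \<xi>') \<xi>) y) x) <= C * bracket (- real (mi_order \<alpha>)) x"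
 shows "fio_setup (%(y, \<xi>). \<phi> y \<xi>) (%(x, y, \<xi>). a x y \<xi>)"
proof -
 define \<Phi> where "\<Phi> = (%(y, \<xi>). \<phi> y \<xi>)"
 define A where "A = (%(x, y, \<xi>). a x y \<xi>)"
 have s: "smooth \<Phi>" and sA: "smooth A" using s\<phi> sa by (simp_all add: \<Phi>_def A_def)
 have he: "mixed_hessian \<phi> y \<xi> = hess \<Phi> (y, \<xi>)" for y \<xi>
 proof -
  have "partial j (%\<xi>'. \<phi> y' \<xi>') \<xi> = dd (inc2 (axis j 1)) \<Phi> (y', \<xi>)" for j y' \<xi>
   using ddl_slice2[OF s, of "[axis j 1]" y' \<xi>] by (simp add: partial_eq_dd axis_in_Basis \<Phi>_def)
  moreover have "partial i (%y'. dd (inc2 (axis j 1)) \<Phi> (y', \<xi>)) y = dd (inc1 (axis i 1)) (dd (inc2 (axis j 1)) \<Phi>) (y, \<xi>)" for i j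
   using ddl_slice1[OF smooth_dd[OF s Basis_inc(2)[OF axis_in_Basis[of j]]], of "[axis i 1]" \<xi> y] by (simp add: partial_eq_dd axis_in_Basis)
  ultimately show ?thesis by (simp add: mixed_hessian_def hess_def vec_eq_iff)
 qed
 obtain C where C: "C > 0" "\<And>z. \<bar>det (hess \<Phi> z)\<bar> >= C" using dt unfolding he by (metis surj_pair)
 have mixed: "symb UNIV (%_::unit. dd (inc1 b) (dd (inc2 c) \<Phi>))" if bc: "b \<in> Basis" "c \<in> Basis" for b c
 proof (rule symb_ddlI)
  obtain i j where ij: "b = axis i 1" "c = axis j 1" using bc by (auto simp: Basis_vec_def)
  let ?H = "dd (inc1 b) (dd (inc2 c) \<Phi>)"
  show sH: "smooth ?H" by (intro smooth_dd s Basis_inc bc)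
  fix bs :: "((real^'n) \<times> (real^'n)) list" assume bs: "set bs \<subseteq> Basis"
  obtain ys zs where yz: "set ys \<subseteq> Basis" "set zs \<subseteq> Basis" "mset bs = mset (map inc1 ys @ map inc2 zs)" using Basis_list_prod[OF bs] by blast
  obtain \<beta> where \<beta>: "mset (mlist \<beta>) = mset ys" using mlist_exists[OF yz(1)] by blast
  obtain \<gamma> where \<gamma>: "mset (mlist \<gamma>) = mset zs" using mlist_exists[OF yz(2)] by blast
  obtain D where D: "\<And>y \<xi>. \<bar>mderiv \<beta> (%y'. mderiv \<gamma> (%\<xi>'. mixed_hessian \<phi> y' \<xi>' $ i $ j) \<xi>) y\<bar> <= D" using mx by blast
  have "mixed_hessian \<phi> y' \<xi>' $ i $ j = ?H (y', \<xi>')" for y' \<xi>' by (simp add: he hess_def ij)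
  then have "\<bar>ddl bs ?H (y, \<xi>)\<bar> <= D" for y \<xi>
   using D[of \<xi> y] unfolding ddl_perm[OF sH bs yz(3)] mderiv2_eq_ddl[OF sH yz(1) \<beta> yz(2) \<gamma>, symmetric] by simp
  then show "\<exists>C. \<forall>p x. (p, x) \<in> UNIV --> norm (ddl bs ?H x) <= C" by (metis real_norm_def surj_pair)
 qed
 have lin_swp: "bounded_linear (%z::(real^'n) \<times> (real^'n). swp z)" by (intro bounded_linear_Pair bounded_linear_snd bounded_linear_fst)
 let ?S = "%z. \<Phi> (swp z)"
 have sS: "smooth ?S" by (intro smooth_compose[OF s] smooth_intros)
 have swap: "dd (inc1 b) (dd (inc2 c) ?S) = (%z. dd (inc1 c) (dd (inc2 b) \<Phi>) (swp z))" if bc: "b \<in> Basis" "c \<in> Basis" for b c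
  unfolding dd_swap_pair[OF s] by (simp add: dd_swap_pair[OF smooth_dd[OF s Basis_inc(1)[OF bc(2)]]] dd_comm_inc[OF s bc(2,1)])
 have mixed': "symb UNIV (%_::unit. dd (inc1 b) (dd (inc2 c) ?S))" if bc: "b \<in> Basis" "c \<in> Basis" for b c
  unfolding swap[OF bc] by (rule symb_compose_linear[OF mixed[OF bc(2,1)] lin_swp, where f="%p. p"]) simp
 have "hess ?S z = transpose (hess \<Phi> (swp z))" for z
  by (simp add: vec_eq_iff hess_def transpose_def swap[OF axis_in_Basis axis_in_Basis])
 then have C': "\<bar>det (hess ?S z)\<bar> >= C" for z using C(2)[of "swp z"] by (simp add: det_transpose)
 have fw: "phase \<Phi>" by (unfold_locales) (rule s mixed nondegenerate_expanding[OF s C mixed] | assumption)+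
 have bw: "phase ?S" by (unfold_locales) (rule sS mixed' nondegenerate_expanding[OF sS C(1) C' mixed'] | assumption)+
 have "fio_setup \<Phi> A"
 proof (rule fio_setup.intro)
  show "fio_phase \<Phi>" by (rule fio_phase.intro[OF fw bw])
  show "fio_setup_axioms \<Phi> A"
  proof
   show "smooth A" by (rule sA)
   fix as :: "(real^'n) list" and ds :: "((real^'n) \<times> (real^'n)) list" assume as: "set as \<subseteq> Basis" and ds: "set ds \<subseteq> Basis"
   obtain bs cs where bc: "set bs \<subseteq> Basis" "set cs \<subseteq> Basis" "mset ds = mset (map inc1 bs @ map inc2 cs)" using Basis_list_prod[OF ds] by blast
   obtain \<alpha> where \<alpha>: "mset (mlist \<alpha>) = mset as" using mlist_exists[OF as] by blast
   obtain \<beta> where \<beta>: "mset (mlist \<beta>) = mset bs" using mlist_exists[OF bc(1)] by blast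
   obtain \<gamma> where \<gamma>: "mset (mlist \<gamma>) = mset cs" using mlist_exists[OF bc(2)] by blast
   have l: "mi_order \<alpha> = length as" using mset_eq_length[OF \<alpha>] by (simp add: length_mlist)
   have m: "mset (map inc1 as @ map inc2 ds) = mset (map inc1 as @ map inc2 (map inc1 bs @ map inc2 cs))"
    using arg_cong[OF bc(3), of "image_mset inc2"] by (simp add: image_mset.compositionality)
   have B: "set (map inc1 as @ map inc2 ds) \<subseteq> Basis"
    unfolding set_append set_map by (intro Un_least image_subsetI) (use as ds Basis_inc in blast)+
   obtain D where D: "\<And>x y \<xi>. cmod (mderiv \<alpha> (%x'. mderiv \<beta> (%y'. mderiv \<gamma> (%\<xi>'. a x' y' \<xi>') \<xi>) y) x) <= D * bracket (- real (mi_order \<alpha>)) x"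
    using am by blast
   have "cmod (ddl (map inc1 as @ map inc2 ds) A (x, y, \<xi>)) <= D * bracket (- real (length as)) x" for x y \<xi>
    using D[of \<xi> y x] unfolding ddl_perm[OF sA B m] mderiv3_eq_ddl[OF sA as \<alpha> bc(1) \<beta> bc(2) \<gamma>, symmetric] l by (simp add: A_def)
   then show "\<exists>C. \<forall>x z. cmod (ddl (map inc1 as @ map inc2 ds) A (x, z)) <= C * bracket (- real (length as)) x" by (metis surj_pair)
  next
   fix cs :: "(real^'n) list" assume cs: "set cs \<subseteq> Basis" "cs \<noteq> []"
   obtain \<beta> :: "'n => nat" where \<beta>: "mset (mlist \<beta>) = mset []" using mlist_exists[of "[]"] by auto
   obtain \<gamma> where \<gamma>: "mset (mlist \<gamma>) = mset cs" using mlist_exists[OF cs(1)] by blast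
   have "mi_order \<gamma> = length cs" using mset_eq_length[OF \<gamma>] by (simp add: length_mlist)
   then have "mi_order \<gamma> >= 1" using cs(2) by (simp add: Suc_le_eq)
   then obtain D where D: "\<And>y \<xi>. \<bar>mderiv \<gamma> (%\<xi>'. \<phi> y \<xi>') \<xi>\<bar> <= D * bracket 1 y" using ph by blast
   have "mderiv \<gamma> (%\<xi>'. \<phi> y \<xi>') \<xi> = ddl (map inc2 cs) \<Phi> (y, \<xi>)" for y \<xi>
    using mderiv2_eq_ddl[OF s _ \<beta> cs(1) \<gamma>, of \<xi> y] \<beta> by (simp add: mderiv_eq_ddl \<Phi>_def)
   then show "\<exists>C. \<forall>y \<xi>. \<bar>ddl (map inc2 cs) \<Phi> (y, \<xi>)\<bar> <= C * bracket 1 y" using D by metis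
  qed
 qed
 then show ?thesis by (simp add: \<Phi>_def A_def)
qed

theorem theorem1p1:
  fixes \<phi> :: "real^'n \<Rightarrow> real^'n \<Rightarrow> real"
    and a :: "real^'n \<Rightarrow> real^'n \<Rightarrow> real^'n \<Rightarrow> complex"
  assumes "smooth (\<lambda>(y, \<xi>). \<phi> y \<xi>)"
    and "smooth (\<lambda>(x, y, \<xi>). a x y \<xi>)"
    and "\<exists>C>0. \<forall>y \<xi>. \<bar>det (mixed_hessian \<phi> y \<xi>)\<bar> \<ge> C"
    and "\<forall>i j \<beta> \<gamma>. \<exists>C. \<forall>y \<xi>.
           \<bar>mderiv \<beta> (\<lambda>y'. mderiv \<gamma> (\<lambda>\<xi>'. mixed_hessian \<phi> y' \<xi>' $ i $ j) \<xi>) y\<bar> \<le> C"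
    and "\<forall>\<alpha>. mi_order \<alpha> \<ge> 1 \<longrightarrow>
           (\<exists>C. \<forall>y \<xi>. \<bar>mderiv \<alpha> (\<lambda>\<xi>'. \<phi> y \<xi>') \<xi>\<bar> \<le> C * bracket 1 y)"
    and "\<forall>\<alpha> \<beta> \<gamma>. \<exists>C. \<forall>x y \<xi>.
           cmod (mderiv \<alpha> (\<lambda>x'. mderiv \<beta> (\<lambda>y'. mderiv \<gamma> (\<lambda>\<xi>'. a x' y' \<xi>') \<xi>) y) x)
             \<le> C * bracket (- real (mi_order \<alpha>)) x"
  shows "(\<forall>u x. test_function u \<longrightarrow> (\<exists>L. has_osc_integral (fio_integrand \<phi> a u x) L)) \<and>
         (\<forall>m. extends_to_bounded_operator_on_L2w m (fio \<phi> a))"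
proof -
  interpret fio_setup "\<lambda>(y, \<xi>). \<phi> y \<xi>" "\<lambda>(x, y, \<xi>). a x y \<xi>"
    using fio_setup_from_hypotheses[OF assms] .
  have eq: "fio_integrand \<phi> a u x = integrand u x" for u x
    by (intro ext) (simp add: fio_integrand_def integrand_def)
  have osc: "has_osc_integral (fio_integrand \<phi> a u x) (osc u x)" if "test_function u" for u x
    unfolding eq by (rule osc_integral[OF that])
  have fio: "fio \<phi> a u x = osc u x" if "test_function u" for u x
    unfolding fio_def by (rule the_equality) (rule osc[OF that], rule has_osc_integral_unique[OF _ osc[OF that]])
  have "extends_to_bounded_operator_on_L2w m (fio \<phi> a)" for m
  proof -
    obtain K where K: "K > 0" "\<And>u. test_function u \<Longrightarrow>
      (\<integral>\<^sup>+x. ennreal ((cmod (of_real (bracket m x) * osc u x))\<^sup>2) \<partial>lborel) \<le> ennreal ((K * l2 (\<lambda>x. of_real (bracket m x) * u x))\<^sup>2)"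
      using osc_weighted_bound[of m] by blast
    interpret dense_operator "fio \<phi> a" m "K\<^sup>2"
    proof
      show "K\<^sup>2 \<ge> 0" by simp
      fix u :: "real^'n \<Rightarrow> complex" assume u: "test_function u"
      have fu: "fio \<phi> a u = osc u" using fio[OF u] by (intro ext)
      show "fio \<phi> a u \<in> borel_measurable lebesgue"
        unfolding fu by (rule measurable_completion) (simp add: osc_measurable bbs_measurable test_function_bbs u)
      show "fio \<phi> a (\<lambda>y. c * u y + d * v y) x = c * fio \<phi> a u x + d * fio \<phi> a v x" if v: "test_function v" for v c d x
        using osc_linear[OF u v] fio u v test_function_add[OF test_function_scale[OF u] test_function_scale[OF v]] by simp
      fix p :: real assume p: "p \<ge> 0" "wn m u \<le> ennreal p"
      let ?l = "l2 (\<lambda>x. of_real (bracket m x) * u x)"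
      have "?l\<^sup>2 \<le> p" using p unfolding test_function_L2w(2)[OF u] by simp
      then have "ennreal ((K * ?l)\<^sup>2) \<le> ennreal (K\<^sup>2 * p)" unfolding power_mult_distrib by (intro ennreal_leI mult_left_mono) auto
      then show "wn m (fio \<phi> a u) \<le> ennreal (K\<^sup>2 * p)"
        using K(2)[OF u] unfolding fu wn_def nn_integral_completion by (rule order_trans[rotated])
    qed
    show ?thesis by (rule bounded_extension)
  qed
  then show ?thesis using osc by blast
qed

end
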